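(* Let $\gamma_\pm$, $D$, $B$, $\gamma$, $f$ and $T>0$ be as in the context (two-layered background medium with flat transmission boundary $\{x_3=0\}$, $\overline D\subset\mathbb{R}^3_-$, $\overline B\subset\mathbb{R}^3_+$, and either $(\mathrm{M})_{\gamma_0,+}$ or $(\mathrm{M})_{\gamma_0,-}$ holds). Suppose that $D$ and $B$ satisfy either (a) or (b): (a) $D$ has $C^1$ boundary $\partial D$ and $B$ satisfies condition (C); (b) $D$ and $B$ both satisfy condition (C) and $B$ is convex. Let $I_\tau$ ($\tau\ge1$) be the indicator function and $l(D,B)$ the optical distance defined in the context. Then: (i) if $T<2\,l(D,B)$, then $\lim_{\tau\to\infty}e^{\tau T}I_\tau=0$; (ii) if $T>2\,l(D,B)$, then $\lim_{\tau\to\infty}e^{\tau T}I_\tau=-\infty$ if $(\mathrm{M})_{\gamma_0,+}$ holds, and $\lim_{\tau\to\infty}e^{\tau T}I_\tau=+\infty$ if $(\mathrm{M})_{\gamma_0,-}$ holds. Further, if $T>2\,l(D,B)$ and either $(\mathrm{M})_{\gamma_0,+}$ or $(\mathrm{M})_{\gamma_0,-}$ holds, then $$\lim_{\tau\to\infty}\frac1\tau\log|I_\tau|=-2\,l(D,B).$$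
   Context: Setting. $\mathbb{R}^3_\pm=\{x=(x_1,x_2,x_3)\in\mathbb{R}^3:\pm x_3>0\}$. $\gamma_+,\gamma_->0$ are constants with $\gamma_+\ne\gamma_-$. $I_3$ is the $3\times3$ unit matrix; inequalities between symmetric matrices are in the sense of quadratic forms. $\gamma_0(x)=\gamma_\pm I_3$ for $\pm x_3>0$. For a symmetric matrix-valued $\sigma\in L^\infty$, $L_\sigma u=\mathrm{div}(\sigma\nabla_xu)$. $D$ is a nonempty bounded measurable set with $\overline D\subset\mathbb{R}^3_-$ and $\mathbb{R}^3_-\setminus D$ connected. $\gamma=(\gamma_{ij})$ is a real symmetric matrix-valued function with $\gamma_{ij}\in L^\infty(\mathbb{R}^3)$, $\gamma(x)\ge c_0I_3$ for a.e. $x$ for some $c_0>0$, $\gamma(x)=\gamma_+I_3$ for $x_3>0$, $\gamma(x)=\gamma_-I_3$ in $\mathbb{R}^3_-\setminus D$. One of the following is assumed: $(\mathrm{M})_{\gamma_0,+}$: $\inf_{x\in D}\gamma(x)>\gamma_-I_3$, i.e. there is $c>0$ with $\gamma(x)-\gamma_-I_3\ge cI_3$ for a.e. $x\in D$; $(\mathrm{M})_{\gamma_0,-}$: $\sup_{x\in D}\gamma(x)<\gamma_-I_3$, i.e. there is $c>0$ with $\gamma_-I_3-\gamma(x)\ge cI_3$ for a.e. $x\in D$. $B$ is a nonempty bounded open set with $\overline B\subset\mathbb{R}^3_+$. The real-valued function $f\in L^2(\mathbb{R}^3)$ satisfies the emission condition: $\mathrm{supp} f\subset\overline B$ and there is $c_1>0$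 such that either $f(x)\ge c_1$ for $x\in B$, or $-f(x)\ge c_1$ for $x\in B$. For fixed $T>0$, $u$ is the unique weak solution of $(\partial_t^2-L_\gamma)u=0$ in $(0,T)\times\mathbb{R}^3$, $u(0,x)=0$, $\partial_tu(0,x)=f(x)$ on $\mathbb{R}^3$; that is, $u\in L^2(0,T;H^1(\mathbb{R}^3))$, $\partial_tu\in L^2(0,T;L^2(\mathbb{R}^3))$, $\partial_t^2u\in L^2(0,T;(H^1(\mathbb{R}^3))')$, with $\langle\partial_t^2u(t,\cdot),\phi\rangle+\int_{\mathbb{R}^3}\gamma\nabla_xu(t,x)\cdot\nabla_x\phi(x)\,dx=0$ for a.e. $t\in(0,T)$ and all $\phi\in H^1(\mathbb{R}^3)$, and the initial conditions hold in the usual sense. Indicator function: for $\tau\ge1$, $$I_\tau=\int_{\mathbb{R}^3}f(x)\,(w(x;\tau)-v(x;\tau))\,dx,\qquad w(x;\tau)=\int_0^Te^{-\tau t}u(t,x)\,dt,$$ where $v(\cdot;\tau)$ is the $L^2$-solution (weak solution in $H^1(\mathbb{R}^3)$) of $(L_{\gamma_0}-\tau^2)v+f=0$ in $\mathbb{R}^3$. Optical distance: for $x\in\mathbb{R}^3_-$, $y\in\mathbb{R}^3_+$ and $z'=(z_1,z_2)\in\mathbb{R}^2$, put $\tilde z'=(z_1,z_2,0)$, $l_{x,y}(z')=\frac{1}{\sqrt{\gamma_-}}|\tilde z'-x|+\frac1{\sqrt{\gamma_+}}|\tilde z'-y|$, $l(x,y)=\inf_{z'\in\mathbb{R}^2}l_{x,y}(z')$,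 and $l(D,B)=\inf_{x\in D,\,y\in B}l(x,y)$. Cones: for $x\in\mathbb{R}^3$, $h>0$, $\theta>0$, $n\in\mathbb{R}^3$ with $|n|=1$, $C(x,n,h,\theta)=\{y\in\mathbb{R}^3 : |y-x|\le h,\ (y-x)\cdot n\ge|y-x|\cos\theta\}$. A set $A\subset\mathbb{R}^3$ satisfies condition (C) if for every $x\in\partial A$ there is a cone $C(x,n,h,\theta)$ with vertex $x$ such that $C(x,n,h,\theta)\setminus\{x\}\subset A$. "$D$ has $C^1$ boundary" has the usual meaning: near each point of $\partial D$, after a rigid motion, $\partial D$ is the graph of a $C^1$ function and $D$ coincides, up to points of $\partial D$, with the region on one side of the graph.
   Formalization: In condition (C) the cone angle is required to satisfy 0 < θ ≤ π; with only θ > 0, the choice θ = 2π degenerates the cone to a segment, a null set D (a segment) would satisfy (C), and claim (ii) would fail. *)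

theory Defs
  imports "HOL-Analysis.Analysis"
begin

section \<open>Function spaces\<close>

text \<open>
  Elements of the spaces below are functions, not equivalence classes; equality of classes is
  vanishing of the (semi)norm of the difference, i.e. equality almost everywhere.
\<close>

primrec Ck :: "nat \<Rightarrow> ('a::euclidean_space \<Rightarrow> real) \<Rightarrow> bool" where
  "Ck 0 f \<longleftrightarrow> continuous_on UNIV f"
| "Ck (Suc k) f \<longleftrightarrow> (\<forall>x. f differentiable (at x)) \<and>
     (\<forall>b\<in>Basis. Ck k (\<lambda>x. frechet_derivative f (at x) b))"

definition test_functions :: "'a::euclidean_space set \<Rightarrow> ('a \<Rightarrow> real) set" where
  "test_functions S = {\<phi>. (\<forall>k. Ck k \<phi>) \<and> compact (closure {x. \<phi> x \<noteq> 0}) \<and> closure {x. \<phi> x \<noteq> 0} \<subseteq> S}"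

definition L2 :: "('a::euclidean_space \<Rightarrow> 'b::euclidean_space) set" where
  "L2 = {u. u \<in> borel_measurable lebesgue \<and> integrable lebesgue (\<lambda>x. (norm (u x))\<^sup>2)}"

definition L2_norm :: "('a::euclidean_space \<Rightarrow> 'b::euclidean_space) \<Rightarrow> real" where
  "L2_norm u = sqrt (LINT x|lebesgue. (norm (u x))\<^sup>2)"

definition weak_gradient :: "('a::euclidean_space \<Rightarrow> real) \<Rightarrow> ('a \<Rightarrow> 'a) \<Rightarrow> bool" where
  "weak_gradient u g \<longleftrightarrow> (\<forall>\<phi>\<in>test_functions UNIV. \<forall>b\<in>Basis.
     (LINT x|lebesgue. u x * frechet_derivative \<phi> (at x) b) = - (LINT x|lebesgue. (g x \<bullet> b) * \<phi> x))"

definition H1 :: "('a::euclidean_space \<Rightarrow> real) set" where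
  "H1 = {u\<in>L2. \<exists>g\<in>L2. weak_gradient u g}"

text \<open>The weak gradient; the choice is unique up to null sets for \<open>u\<close> in \<open>H1\<close>.\<close>

definition grad :: "('a::euclidean_space \<Rightarrow> real) \<Rightarrow> 'a \<Rightarrow> 'a" where
  "grad u = (SOME g. g \<in> L2 \<and> weak_gradient u g)"

definition H1_norm :: "('a::euclidean_space \<Rightarrow> real) \<Rightarrow> real" where
  "H1_norm u = sqrt ((L2_norm u)\<^sup>2 + (L2_norm (grad u))\<^sup>2)"

text \<open>The dual space of \<open>H1\<close>; values of a functional outside \<open>H1\<close> are irrelevant.\<close>

definition H1_dual :: "(('a::euclidean_space \<Rightarrow> real) \<Rightarrow> real) set" where
  "H1_dual = {F. (\<forall>\<phi>\<in>H1. \<forall>\<psi>\<in>H1. \<forall>a b. F (\<lambda>x. a * \<phi> x + b * \<psi> x) = a * F \<phi> + b * F \<psi>) \<and>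
                 (\<exists>K. \<forall>\<phi>\<in>H1. \<bar>F \<phi>\<bar> \<le> K * H1_norm \<phi>)}"

definition H1_dual_norm :: "(('a::euclidean_space \<Rightarrow> real) \<Rightarrow> real) \<Rightarrow> real" where
  "H1_dual_norm F = (SUP \<phi>\<in>{\<phi>\<in>H1. H1_norm \<phi> \<le> 1}. \<bar>F \<phi>\<bar>)"

text \<open>\<open>L2_pairing u\<close> is \<open>u\<close> regarded as a functional through the \<open>L2\<close> inner product.\<close>

definition L2_pairing :: "('a::euclidean_space \<Rightarrow> real) \<Rightarrow> ('a \<Rightarrow> real) \<Rightarrow> real" where
  "L2_pairing u \<phi> = (LINT x|lebesgue. u x * \<phi> x)"


section \<open>Functions of time with values in a function space\<close>

text \<open>
  A space of real-valued functions on \<open>'s\<close> is given by its carrier \<open>X\<close> and its (semi)norm \<open>N\<close>.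
  The following is Bochner's strong measurability: \<open>F\<close> is the limit in norm, for a.e. \<open>t\<close>, of
  measurable functions with finitely many values in \<open>X\<close>.
\<close>

definition strongly_measurable ::
  "real set \<Rightarrow> ('s \<Rightarrow> real) set \<Rightarrow> (('s \<Rightarrow> real) \<Rightarrow> real) \<Rightarrow> (real \<Rightarrow> 's \<Rightarrow> real) \<Rightarrow> bool" where
  "strongly_measurable J X N F \<longleftrightarrow> (\<exists>s :: nat \<Rightarrow> real \<Rightarrow> 's \<Rightarrow> real.
     (\<forall>n. finite (s n ` J) \<and> s n ` J \<subseteq> X \<and> (\<forall>y. {t\<in>J. s n t = y} \<in> sets lebesgue)) \<and>
     (AE t in lebesgue_on J. F t \<in> X \<and> (\<lambda>n. N (\<lambda>z. s n t z - F t z)) \<longlonglongrightarrow> 0))"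

definition bochner_L2 ::
  "real set \<Rightarrow> ('s \<Rightarrow> real) set \<Rightarrow> (('s \<Rightarrow> real) \<Rightarrow> real) \<Rightarrow> (real \<Rightarrow> 's \<Rightarrow> real) \<Rightarrow> bool" where
  "bochner_L2 J X N F \<longleftrightarrow> strongly_measurable J X N F \<and> integrable (lebesgue_on J) (\<lambda>t. (N (F t))\<^sup>2)"

text \<open>
  \<open>G\<close> is the distributional derivative of \<open>F\<close> on \<open>(0,T)\<close>, for functionals on \<open>Y\<close>: the identity
  \<open>\<integral> \<psi>' F dt = - \<integral> \<psi> G dt\<close> evaluated at each \<open>\<phi> \<in> Y\<close>.
\<close>

definition weak_time_derivative ::
  "real \<Rightarrow> 'y set \<Rightarrow> (real \<Rightarrow> 'y \<Rightarrow> real) \<Rightarrow> (real \<Rightarrow> 'y \<Rightarrow> real) \<Rightarrow> bool" where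
  "weak_time_derivative T Y F G \<longleftrightarrow> (\<forall>\<phi>\<in>Y. \<forall>\<psi>\<in>test_functions {0<..<T}.
     (LINT t|lebesgue_on {0<..<T}. deriv \<psi> t * F t \<phi>) = - (LINT t|lebesgue_on {0<..<T}. \<psi> t * G t \<phi>))"

text \<open>
  \<open>F(0) = F0\<close> in the usual sense: \<open>F\<close> agrees for a.e. \<open>t\<close> with a continuous function from \<open>[0,T]\<close>
  to \<open>X\<close> whose value at \<open>0\<close> is \<open>F0\<close>.
\<close>

definition has_initial_value ::
  "real \<Rightarrow> ('s \<Rightarrow> real) set \<Rightarrow> (('s \<Rightarrow> real) \<Rightarrow> real) \<Rightarrow> (real \<Rightarrow> 's \<Rightarrow> real) \<Rightarrow> ('s \<Rightarrow> real) \<Rightarrow> bool" where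
  "has_initial_value T X N F F0 \<longleftrightarrow> (\<exists>U :: real \<Rightarrow> 's \<Rightarrow> real.
     (\<forall>t\<in>{0..T}. U t \<in> X \<and> ((\<lambda>s. N (\<lambda>z. U s z - U t z)) \<longlongrightarrow> 0) (at t within {0..T})) \<and>
     (AE t in lebesgue_on {0<..<T}. F t \<in> X \<and> N (\<lambda>z. U t z - F t z) = 0) \<and>
     F0 \<in> X \<and> N (\<lambda>z. U 0 z - F0 z) = 0)"


section \<open>The medium\<close>

definition R3_plus :: "(real^3) set" where
  "R3_plus = {x. x $ 3 > 0}"

definition R3_minus :: "(real^3) set" where
  "R3_minus = {x. x $ 3 < 0}"

definition mat_le :: "real^'n^'n \<Rightarrow> real^'n^'n \<Rightarrow> bool" where
  "mat_le A B \<longleftrightarrow> (\<forall>\<xi>. \<xi> \<bullet> (A *v \<xi>) \<le> \<xi> \<bullet> (B *v \<xi>))"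

definition gamma0 :: "real \<Rightarrow> real \<Rightarrow> real^3 \<Rightarrow> real^3^3" where
  "gamma0 \<gamma>p \<gamma>m x = (if x $ 3 > 0 then mat \<gamma>p else mat \<gamma>m)"

definition admissible_medium ::
  "real \<Rightarrow> real \<Rightarrow> (real^3) set \<Rightarrow> (real^3 \<Rightarrow> real^3^3) \<Rightarrow> bool" where
  "admissible_medium \<gamma>p \<gamma>m D \<gamma> \<longleftrightarrow>
     (\<forall>i j. (\<lambda>x. \<gamma> x $ i $ j) \<in> borel_measurable lebesgue \<and>
            (\<exists>K. AE x in lebesgue. \<bar>\<gamma> x $ i $ j\<bar> \<le> K)) \<and>
     (AE x in lebesgue. transpose (\<gamma> x) = \<gamma> x) \<and>
     (\<exists>c0>0. AE x in lebesgue. mat_le (mat c0) (\<gamma> x)) \<and>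
     (AE x in lebesgue. x \<in> R3_plus \<longrightarrow> \<gamma> x = mat \<gamma>p) \<and>
     (AE x in lebesgue. x \<in> R3_minus - D \<longrightarrow> \<gamma> x = mat \<gamma>m)"

definition M_plus :: "real \<Rightarrow> (real^3) set \<Rightarrow> (real^3 \<Rightarrow> real^3^3) \<Rightarrow> bool" where
  "M_plus \<gamma>m D \<gamma> \<longleftrightarrow> (\<exists>c>0. AE x in lebesgue. x \<in> D \<longrightarrow> mat_le (mat c) (\<gamma> x - mat \<gamma>m))"

definition M_minus :: "real \<Rightarrow> (real^3) set \<Rightarrow> (real^3 \<Rightarrow> real^3^3) \<Rightarrow> bool" where
  "M_minus \<gamma>m D \<gamma> \<longleftrightarrow> (\<exists>c>0. AE x in lebesgue. x \<in> D \<longrightarrow> mat_le (mat c) (mat \<gamma>m - \<gamma> x))"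

text \<open>The support of an \<open>L2\<close> class: complement of the largest open set where it vanishes a.e.\<close>

definition ess_support :: "('a::euclidean_space \<Rightarrow> real) \<Rightarrow> 'a set" where
  "ess_support f = - \<Union>{U. open U \<and> (AE x in lebesgue. x \<in> U \<longrightarrow> f x = 0)}"

definition emission_condition :: "(real^3) set \<Rightarrow> (real^3 \<Rightarrow> real) \<Rightarrow> bool" where
  "emission_condition B f \<longleftrightarrow> ess_support f \<subseteq> closure B \<and>
     (\<exists>c1>0. (AE x in lebesgue. x \<in> B \<longrightarrow> f x \<ge> c1) \<or> (AE x in lebesgue. x \<in> B \<longrightarrow> - f x \<ge> c1))"


section \<open>Weak solutions and the indicator function\<close>

definition energy_form :: "(real^3 \<Rightarrow> real^3^3) \<Rightarrow> (real^3 \<Rightarrow> real) \<Rightarrow> (real^3 \<Rightarrow> real) \<Rightarrow> real" where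
  "energy_form \<sigma> u \<phi> = (LINT x|lebesgue. (\<sigma> x *v grad u x) \<bullet> grad \<phi> x)"

text \<open>
  \<open>u\<close> is a jointly measurable representative (one exists for every element of
  \<open>L\<^sup>2(0,T;L\<^sup>2)\<close>), so that the values \<open>u t x\<close> can be integrated in \<open>t\<close> for a.e. fixed \<open>x\<close>.
  The functions \<open>u'\<close> and \<open>u''\<close> are the first and second weak time derivatives of \<open>u\<close>.
\<close>

definition wave_solution ::
  "(real^3 \<Rightarrow> real^3^3) \<Rightarrow> (real^3 \<Rightarrow> real) \<Rightarrow> real \<Rightarrow> (real \<Rightarrow> real^3 \<Rightarrow> real) \<Rightarrow> bool" where
  "wave_solution \<gamma> f T u \<longleftrightarrow>
     (\<lambda>(t, x). u t x) \<in> borel_measurable (lebesgue_on ({0<..<T} \<times> UNIV)) \<and>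
     bochner_L2 {0<..<T} H1 H1_norm u \<and>
     (\<exists>u' u''.
        bochner_L2 {0<..<T} L2 L2_norm u' \<and>
        weak_time_derivative T L2 (\<lambda>t. L2_pairing (u t)) (\<lambda>t. L2_pairing (u' t)) \<and>
        bochner_L2 {0<..<T} H1_dual H1_dual_norm u'' \<and>
        weak_time_derivative T H1 (\<lambda>t. L2_pairing (u' t)) u'' \<and>
        (AE t in lebesgue_on {0<..<T}. \<forall>\<phi>\<in>H1. u'' t \<phi> + energy_form \<gamma> (u t) \<phi> = 0) \<and>
        has_initial_value T L2 L2_norm u (\<lambda>x. 0) \<and>
        has_initial_value T H1_dual H1_dual_norm (\<lambda>t. L2_pairing (u' t)) (L2_pairing f))"

definition background_solution ::
  "(real^3 \<Rightarrow> real^3^3) \<Rightarrow> (real^3 \<Rightarrow> real) \<Rightarrow> real \<Rightarrow> (real^3 \<Rightarrow> real) \<Rightarrow> bool" where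
  "background_solution \<sigma> f \<tau> v \<longleftrightarrow> v \<in> H1 \<and>
     (\<forall>\<phi>\<in>H1. - energy_form \<sigma> v \<phi> - \<tau>\<^sup>2 * (LINT x|lebesgue. v x * \<phi> x) + (LINT x|lebesgue. f x * \<phi> x) = 0)"

definition laplace_transform :: "real \<Rightarrow> (real \<Rightarrow> real^3 \<Rightarrow> real) \<Rightarrow> real \<Rightarrow> real^3 \<Rightarrow> real" where
  "laplace_transform T u \<tau> x = (LINT t|lebesgue_on {0<..<T}. exp (- \<tau> * t) * u t x)"

definition indicator_function ::
  "(real^3 \<Rightarrow> real) \<Rightarrow> real \<Rightarrow> (real \<Rightarrow> real^3 \<Rightarrow> real) \<Rightarrow> (real \<Rightarrow> real^3 \<Rightarrow> real) \<Rightarrow> real \<Rightarrow> real" where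
  "indicator_function f T u v \<tau> = (LINT x|lebesgue. f x * (laplace_transform T u \<tau> x - v \<tau> x))"


section \<open>Optical distance\<close>

definition optical_length :: "real \<Rightarrow> real \<Rightarrow> real^3 \<Rightarrow> real^3 \<Rightarrow> real^2 \<Rightarrow> real" where
  "optical_length \<gamma>p \<gamma>m x y z =
     (let z' = (vector [z $ 1, z $ 2, 0] :: real^3)
      in 1 / sqrt \<gamma>m * norm (z' - x) + 1 / sqrt \<gamma>p * norm (z' - y))"

definition optical_distance :: "real \<Rightarrow> real \<Rightarrow> real^3 \<Rightarrow> real^3 \<Rightarrow> real" where
  "optical_distance \<gamma>p \<gamma>m x y = (INF z. optical_length \<gamma>p \<gamma>m x y z)"

definition optical_set_distance :: "real \<Rightarrow> real \<Rightarrow> (real^3) set \<Rightarrow> (real^3) set \<Rightarrow> real" where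
  "optical_set_distance \<gamma>p \<gamma>m D B = (INF (x, y)\<in>D \<times> B. optical_distance \<gamma>p \<gamma>m x y)"


section \<open>Regularity of sets\<close>

definition finite_cone :: "real^3 \<Rightarrow> real^3 \<Rightarrow> real \<Rightarrow> real \<Rightarrow> (real^3) set" where
  "finite_cone x n h \<theta> = {y. norm (y - x) \<le> h \<and> (y - x) \<bullet> n \<ge> norm (y - x) * cos \<theta>}"

text \<open>
  The aperture \<open>\<theta>\<close> is an angle, so \<open>\<theta> \<le> pi\<close>; without this bound, \<open>\<theta> = 2 * pi\<close> would degenerate
  the cone to a line segment.
\<close>

definition condition_C :: "(real^3) set \<Rightarrow> bool" where
  "condition_C A \<longleftrightarrow> (\<forall>x\<in>frontier A. \<exists>n h \<theta>. norm n = 1 \<and> h > 0 \<and> 0 < \<theta> \<and> \<theta> \<le> pi \<and>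
     finite_cone x n h \<theta> - {x} \<subseteq> A)"

text \<open>
  \<open>U\<close> is a neighbourhood of \<open>p\<close>, \<open>x \<mapsto> Q *v x + b\<close> the rigid motion and \<open>g\<close> the graph function.
  A \<open>C\<^sup>1\<close> function near a point agrees there with a globally defined one, so \<open>g\<close> is
  taken to be defined on the whole plane.
\<close>

definition C1_boundary :: "(real^3) set \<Rightarrow> bool" where
  "C1_boundary D \<longleftrightarrow> (\<forall>p\<in>frontier D. \<exists>U Q b. \<exists>g :: real^2 \<Rightarrow> real.
     open U \<and> p \<in> U \<and> orthogonal_matrix Q \<and> Ck 1 g \<and>
     (let \<Phi> = (\<lambda>x. Q *v x + b);
          height = (\<lambda>x. \<Phi> x $ 3 - g (vector [\<Phi> x $ 1, \<Phi> x $ 2]))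
      in frontier D \<inter> U = {x\<in>U. height x = 0} \<and>
         (D - frontier D) \<inter> U = {x\<in>U. height x > 0}))"

end

theory Submission
	imports Defs "HOL-Computational_Algebra.Polynomial"
begin

text \<open>
	Everything reduces to the energy \<open>X = \<integral>\<^sub>D |\<nabla>v|\<^sup>2\<close> of the background solution inside \<open>D\<close>. The Laplace
	transform \<open>w\<close> of the wave solves the stationary equation with coefficient \<open>\<gamma>\<close> up to an error of size
	\<open>exp (- \<tau> T)\<close>. Testing the difference of the equations for \<open>w\<close> and \<open>v\<close> with \<open>w - v\<close> and with \<open>v\<close> bounds
	\<open>|I|\<close> by a multiple of \<open>X + exp (- \<tau> T) / \<tau>\<close>, and under the monotonicity conditions it bounds \<open>- I\<close> or \<open>I\<close>
	from below by a multiple of \<open>X\<close> minus such an error. Hence only the rate \<open>X = exp (- 2 \<tau> (l + o(1)))\<close> is needed.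
	The upper bound is Agmon's weighted energy estimate; the weights are soft minima of piecewise affine phases
	that satisfy Snell's law at the interface. For the lower bound, \<open>f\<close> may be taken nonnegative, so \<open>v \<ge> 0\<close>, and
	explicit subsolutions centred along a broken line from \<open>B\<close> to \<open>D\<close> propagate exponential lower bounds for the
	mass of \<open>v\<close> in small balls; a cutoff function inside \<open>D\<close> turns the mass into gradient energy.
\<close>

text \<open>Only the exponential rate of \<open>X\<close> is wanted, so constants, powers of
  \<open>tau\<close> and factors \<open>exp (tau eps)\<close> may be lost at every stage. This is
  why no ray expansion or Green function of the transmission problem appears, and why the passage of
  lower bounds through the interface may be wasteful: its cost is a constant times its length, and
  the length is sent to zero. Two points need care. The emission condition does not control
  \<open>f\<close> on the frontier of \<open>B\<close>, so the sign of \<open>f\<close> holds almost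
  everywhere only after condition (C) has made this frontier a null set. And the Laplace transform
  of the wave is never treated as an element of \<open>H1\<close>. A finite linear combination of
  elements of \<open>H1\<close>, built from simple functions approximating \<open>u\<close>, takes
  its place; it agrees with the transform under all functionals in play up to the size
  \<open>exp (- tau T)\<close> of the remainder that the equation carries anyway.\<close>

notation scaleR (infixr "*R" 75)
notation tendsto (infixr "--->" 55)
abbreviation seq_limit (infixr "---->" 60) where "X ----> L == (X ---> L) sequentially"
abbreviation pd where "pd f x == frechet_derivative f (at x)"
lemmas lint_cong = Bochner_Integration.integral_cong[OF refl]
lemmas lint_bound = Bochner_Integration.integrable_bound
lemmas lint_dom = integral_dominated_convergence
abbreviation LM where "LM == borel_measurable lebesgue"
abbreviation BM where "BM == borel_measurable borel"
abbreviation LI where "LI == integrable lebesgue"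
abbreviation lebesgue_integral (binder "LN " 60) where "lebesgue_integral f == integral\<^sup>L lebesgue f"
abbreviation almost_all (binder "AL " 10) where "almost_all P == eventually P (ae_filter lebesgue)"

subsection \<open>Square-integrable functions\<close>

lemma L2_measurable: "u : L2 ==> u : LM"
	by (simp add: L2_def)

lemma L2_integrable_norm: "u : L2 ==> LI (%x. (norm (u x))^2)"
	by (simp add: L2_def)

lemma L2_real_integrable_sq: "(u :: 'a::euclidean_space => real) : L2 ==> LI (%x. (u x)^2)"
	using L2_integrable_norm[of u] by simp

lemma L2_norm_nonneg [simp]: "0 <= L2_norm u"
	by (simp add: L2_norm_def)

lemma L2_norm_sq: "(L2_norm u)^2 = (LN x. (norm (u x))^2)"
	by (simp add: L2_norm_def)

lemma L2_dominated:
	assumes u: "u : L2" and w: "w : LM"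
		and le: "AL x. norm (w x) <= K * norm (u x)" and K: "0 <= K"
	shows "w : L2" and "L2_norm w <= K * L2_norm u"
proof -
	have le2: "AL x. (norm (w x))^2 <= K^2 * (norm (u x))^2"
		using le by eventually_elim (metis norm_ge_zero power_mono power_mult_distrib)
	have int: "LI (%x. K^2 * (norm (u x))^2)"
		using u by (simp add: L2_def)
	have iw: "LI (%x. (norm (w x))^2)"
	proof (rule lint_bound[OF int])
		show "(%x. (norm (w x))^2) : LM" using w by measurable
		show "AL x. norm ((norm (w x))^2) <= norm (K^2 * (norm (u x))^2)"
			using le2 by eventually_elim simp
	qed
	then show "w : L2" using w by (simp add: L2_def)
	have "(LN x. (norm (w x))^2) <= (LN x. K^2 * (norm (u x))^2)"
		by (rule integral_mono_AE[OF iw int le2])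
	then have "(L2_norm w)^2 <= (K * L2_norm u)^2"
		by (simp add: L2_norm_sq power_mult_distrib)
	then show "L2_norm w <= K * L2_norm u"
		by (rule power2_le_imp_le) (simp add: K)
qed

lemma L2_inner_integrable:
	assumes "u : L2" "v : L2"
	shows "LI (%x. u x \<bullet> v x)"
proof (rule lint_bound)
	show "LI (%x. (norm (u x))^2 + (norm (v x))^2)"
		using assms by (simp add: L2_def)
	show "(%x. u x \<bullet> v x) : LM"
		using assms[THEN L2_measurable] by measurable
	show "AL x. norm (u x \<bullet> v x) <= norm ((norm (u x))^2 + (norm (v x))^2)"
	proof (rule AE_I2)
		fix x
		have "norm (u x \<bullet> v x) <= norm (u x) * norm (v x)" by (simp add: Cauchy_Schwarz_ineq2)
		also have "... <= (norm (u x))^2 + (norm (v x))^2"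
		proof -
			have "2 * (norm (u x) * norm (v x)) <= (norm (u x))^2 + (norm (v x))^2"
				using sum_squares_bound[of "norm (u x)" "norm (v x)"] by (simp add: mult.assoc)
			moreover have "0 <= norm (u x) * norm (v x)" by simp
			ultimately show ?thesis by linarith
		qed
		finally show "norm (u x \<bullet> v x) <= norm ((norm (u x))^2 + (norm (v x))^2)" by simp
	qed
qed

lemma L2_mult_integrable:
	fixes u v :: "'a::euclidean_space => real"
	shows "u : L2 ==> v : L2 ==> LI (%x. u x * v x)"
	using L2_inner_integrable[of u v] by simp

lemma L2_add [intro]: "u : L2 ==> v : L2 ==> (%x. u x + v x) : L2"
proof -
	assume u: "u : L2" and v: "v : L2"
	have "LI (%x. (norm (u x))^2 + (norm (v x))^2 + 2 * (u x \<bullet> v x))"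
		using u v L2_inner_integrable[OF u v] by (simp add: L2_def)
	then show ?thesis
		using u[THEN L2_measurable] v[THEN L2_measurable]
		by (simp add: L2_def power2_norm_eq_inner algebra_simps inner_commute)
qed

lemma L2_scaleR [intro]: "u : L2 ==> (%x. c *R u x) : L2"
	by (rule L2_dominated(1)[of u _ "\<bar>c\<bar>"]) (auto dest: L2_measurable)

lemma L2_cmult [intro]: "u : L2 ==> (%x. c * u x :: real) : L2"
	using L2_scaleR[of u c] by simp

lemma L2_minus [intro]: "u : L2 ==> (%x. - u x) : L2"
	using L2_scaleR[of u "-1"] by simp

lemma L2_diff [intro]: "u : L2 ==> v : L2 ==> (%x. u x - v x) : L2"
	using L2_add[of u "%x. - v x"] by auto

lemma L2_zero [simp, intro]: "(%x. 0) : L2"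
	by (simp add: L2_def)

lemma L2_component [intro]: "g : L2 ==> (%x. g x \<bullet> e) : L2"
	by (rule L2_dominated(1)[of g _ "norm e"])
		(auto dest: L2_measurable intro!: AE_I2 order.trans[OF Cauchy_Schwarz_ineq2])

lemma L2_sum [intro]: "(!!i. i : A ==> u i : L2) ==> (%x. \<Sum>i\<in>A. u i x) : L2"
	by (induction A rule: infinite_finite_induct) auto

lemma L2_norm_cong:
	assumes "u : LM" "v : LM" "AL x. u x = v x"
	shows "L2_norm u = L2_norm v"
	unfolding L2_norm_def using assms
	by (intro arg_cong[where f = sqrt] integral_cong_AE) auto

text \<open>Integrating the square of \<open>s * norm (u x) - t * norm (v x)\<close> gives an
  inequality for all weights. The weights \<open>s = b\<close>, \<open>t = a\<close> yield the claim
  if both norms are positive. If one norm vanishes, its weight is free and is taken so large that a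
  positive integral is contradicted.\<close>

lemma L2_abs_integral_le:
	assumes u: "u : L2" and v: "v : L2"
	shows "(LN x. norm (u x) * norm (v x)) <= L2_norm u * L2_norm v"
proof -
	define a where "a = L2_norm u"
	define b where "b = L2_norm v"
	have nu: "(%x. norm (u x)) : L2" and nv: "(%x. norm (v x)) : L2"
		using u v by (auto simp: L2_def)
	have int: "LI (%x. norm (u x) * norm (v x))"
		by (rule L2_mult_integrable[OF nu nv])
	have key: "2 * s * t * (LN x. norm (u x) * norm (v x)) <= s^2 * a^2 + t^2 * b^2" for s t
	proof -
		have "(LN x. 2 * s * t * (norm (u x) * norm (v x)))
			<= (LN x. s^2 * (norm (u x))^2 + t^2 * (norm (v x))^2)"
		proof (rule integral_mono)
			show "LI (%x. 2 * s * t * (norm (u x) * norm (v x)))" using int by simp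
			show "LI (%x. s^2 * (norm (u x))^2 + t^2 * (norm (v x))^2)"
				using u v by (simp add: L2_def)
			fix x
			have "0 <= (s * norm (u x) - t * norm (v x))^2" by simp
			then show "2 * s * t * (norm (u x) * norm (v x)) <= s^2 * (norm (u x))^2 + t^2 * (norm (v x))^2"
				by (simp add: power2_diff power_mult_distrib algebra_simps)
		qed
		then show ?thesis
			using u v by (simp add: L2_def a_def b_def L2_norm_sq)
	qed
	let ?I = "LN x. norm (u x) * norm (v x)"
	have a0: "a >= 0" "b >= 0" by (simp_all add: a_def b_def)
	have I0: "?I >= 0" by simp
	show ?thesis
	proof (cases "a > 0 & b > 0")
		case True
		have "2 * b * a * ?I <= b^2 * a^2 + a^2 * b^2" by (rule key)
		then have "(a * b) * ?I <= (a * b) * (a * b)" by (simp add: power2_eq_square algebra_simps)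
		then show ?thesis using True by (simp add: a_def b_def)
	next
		case False
		have "?I <= 0"
		proof (rule ccontr)
			assume "\<not> ?I <= 0"
			then have pos: "?I > 0" by simp
			consider "a = 0" | "b = 0" using False a0 by fastforce
			then show False
			proof cases
				case 1
				have "2 * ((b^2 + 1) / ?I) * 1 * ?I <= ((b^2 + 1) / ?I)^2 * a^2 + 1^2 * b^2" by (rule key)
				then have "2 * (b^2 + 1) <= b^2" using 1 pos by simp
				then show False by (smt (verit) zero_le_power2)
			next
				case 2
				have "2 * 1 * ((a^2 + 1) / ?I) * ?I <= 1^2 * a^2 + ((a^2 + 1) / ?I)^2 * b^2" by (rule key)
				then have "2 * (a^2 + 1) <= a^2" using 2 pos by simp
				then show False by (smt (verit) zero_le_power2)
			qed
		qed
		then show ?thesis using mult_nonneg_nonneg[OF a0] unfolding a_def b_def by linarith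
	qed
qed

lemma L2_Cauchy_Schwarz:
	assumes u: "u : L2" and v: "v : L2"
	shows "\<bar>LN x. u x \<bullet> v x\<bar> <= L2_norm u * L2_norm v"
proof -
	have nu: "(%x. norm (u x)) : L2" and nv: "(%x. norm (v x)) : L2"
		using u v by (auto simp: L2_def)
	have "\<bar>LN x. u x \<bullet> v x\<bar> <= (LN x. \<bar>u x \<bullet> v x\<bar>)"
		using integral_norm_bound[of lebesgue "%x. u x \<bullet> v x"] by simp
	also have "... <= (LN x. norm (u x) * norm (v x))"
		using L2_inner_integrable[OF u v] L2_mult_integrable[OF nu nv]
		by (intro integral_mono) (auto simp: Cauchy_Schwarz_ineq2)
	also have "... <= L2_norm u * L2_norm v" by (rule L2_abs_integral_le[OF u v])
	finally show ?thesis .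
qed

lemma L2_Cauchy_Schwarz_real:
	fixes u v :: "'a::euclidean_space => real"
	shows "u : L2 ==> v : L2 ==> \<bar>LN x. u x * v x\<bar> <= L2_norm u * L2_norm v"
	using L2_Cauchy_Schwarz[of u v] by simp

lemma L2_norm_triangle:
	assumes u: "u : L2" and v: "v : L2"
	shows "L2_norm (%x. u x + v x) <= L2_norm u + L2_norm v"
proof -
	have "(L2_norm (%x. u x + v x))^2
			= (LN x. (norm (u x))^2 + (norm (v x))^2 + 2 * (u x \<bullet> v x))"
		unfolding L2_norm_sq
		by (intro Bochner_Integration.integral_cong)
			(auto simp: power2_norm_eq_inner algebra_simps inner_commute)
	also have "... = (L2_norm u)^2 + (L2_norm v)^2 + 2 * (LN x. u x \<bullet> v x)"
		using u v L2_inner_integrable[OF u v] by (simp add: L2_def L2_norm_sq)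
	also have "... <= (L2_norm u + L2_norm v)^2"
		using L2_Cauchy_Schwarz[OF u v] by (simp add: power2_sum abs_le_iff)
	finally show ?thesis by (rule power2_le_imp_le) simp
qed

lemma L2_norm_scaleR: "L2_norm (%x. c *R u x) = \<bar>c\<bar> * L2_norm u"
	by (simp add: L2_norm_def power_mult_distrib real_sqrt_mult)

lemma L2_norm_minus: "L2_norm (%x. - u x) = L2_norm u"
	by (simp add: L2_norm_def)

lemma L2_norm_triangle_diff:
	"u : L2 ==> v : L2 ==> L2_norm (%x. u x - v x) <= L2_norm u + L2_norm v"
	using L2_norm_triangle[of u "%x. - v x"] by (auto simp: L2_norm_minus)

subsection \<open>Translations\<close>

lemma distr_lebesgue_translation:
	"distr lebesgue lebesgue (%x. x + a) = (lebesgue :: 'a::euclidean_space measure)"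
proof -
	have "(lebesgue::'a measure) = density (distr lebesgue lebesgue (%x. a + (\<Sum>j\<in>Basis. (1 * (x \<bullet> j)) *R j))) (%_. ennreal (\<Prod>j\<in>(Basis::'a set). \<bar>1\<bar>))"
		using lebesgue_affine_euclidean[of "%_. 1" a] by simp
	then show ?thesis
		by (simp add: euclidean_representation density_1 add.commute)
qed

lemma measurable_lebesgue_translation: "(%x. x + a) : lebesgue \<rightarrow>\<^sub>M (lebesgue :: 'a::euclidean_space measure)"
proof -
	have "(%x::'a. a + (\<Sum>j\<in>Basis. (1 * (x \<bullet> j)) *R j)) : lebesgue \<rightarrow>\<^sub>M lebesgue"
		by (rule lebesgue_affine_measurable) auto
	then show ?thesis by (simp add: euclidean_representation add.commute)
qed

lemma borel_measurable_translation:
	assumes "f : LM"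
	shows "(%x::'a::euclidean_space. f (x + a)) : LM"
	using measurable_compose[OF measurable_lebesgue_translation assms] .

lemma integral_translation:
	fixes f :: "'a::euclidean_space => real"
	assumes "f : LM"
	shows "(LN x. f (x + a)) = (LN x. f x)"
	using integral_distr[OF measurable_lebesgue_translation[of a] assms]
	by (simp add: distr_lebesgue_translation)

lemma integrable_translation:
	fixes f :: "'a::euclidean_space => real"
	assumes "LI f"
	shows "LI (%x. f (x + a))"
	using integrable_distr[OF measurable_lebesgue_translation[of a], of f] assms
	by (simp add: distr_lebesgue_translation)

lemma AE_translation:
	assumes "AL x. P x"
	shows "AL x. P (x + a :: 'a::euclidean_space)"
proof -
	have "AE x in distr lebesgue lebesgue (%x. x + a). P x"
		unfolding distr_lebesgue_translation by (rule assms)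
	then show ?thesis by (rule AE_distrD[OF measurable_lebesgue_translation])
qed

lemma L2_translation:
	assumes "u : L2"
	shows "(%x. u (x + a)) : L2" and "L2_norm (%x. u (x + a)) = L2_norm u"
	using assms integrable_translation[of "%x. (norm (u x))^2" a] borel_measurable_translation[of u a]
		integral_translation[of "%x. (norm (u x))^2" a]
	by (auto simp: L2_def L2_norm_def)

text \<open>Fubini is applied on products of \<open>lborel\<close>, so Lebesgue measurable functions
  are first exchanged for Borel ones that agree almost everywhere.\<close>

lemma lebesgue_ex_borel:
	assumes "f : LM"
	obtains f' :: "'a::euclidean_space => real" where "f' : BM" "AL x. f x = f' x"
proof -
	obtain f' where "f' : borel_measurable lborel" "AE x in lborel. f x = f' x"
		using completion_ex_borel_measurable_real[OF assms] by blast
	then show ?thesis using that[of f'] AE_completion by auto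
qed

subsection \<open>Smooth functions\<close>

lemma Ck_Suc_imp: "Ck (Suc k) f ==> Ck k f"
proof (induction k arbitrary: f)
	case 0
	then show ?case
		by (simp add: continuous_at_imp_continuous_on differentiable_imp_continuous_within)
next
	case (Suc k)
	then show ?case by (metis Ck.simps(2))
qed

lemma Ck_const: "Ck k (%x. c)"
	by (induction k arbitrary: c) auto

lemma frechet_derivative_real_add:
	fixes f g :: "'a::euclidean_space => real"
	assumes "f differentiable (at x)" "g differentiable (at x)"
	shows "pd (%x. f x + g x) x b = pd f x b + pd g x b"
proof -
	have "((%x. f x + g x) has_derivative (%h. pd f x h + pd g x h)) (at x)"
		by (intro has_derivative_add assms[unfolded frechet_derivative_works])
	from frechet_derivative_at[OF this] show ?thesis by metis
qed

lemma Ck_add: "Ck k f ==> Ck k g ==> Ck k (%x. f x + g x)"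
proof (induction k arbitrary: f g)
	case 0
	then show ?case by (auto intro: continuous_on_add)
next
	case (Suc k)
	then have d: "!!x. f differentiable (at x)" "!!x. g differentiable (at x)" by auto
	then have "pd (%x. f x + g x) x b = pd f x b + pd g x b" for x b
		by (rule frechet_derivative_real_add)
	then show ?case using Suc d by auto
qed

lemma frechet_derivative_real_mult:
	fixes f g :: "'a::euclidean_space => real"
	assumes "f differentiable (at x)" "g differentiable (at x)"
	shows "pd (%x. f x * g x) x b = f x * pd g x b + pd f x b * g x"
proof -
	have "((%x. f x * g x) has_derivative (%h. f x * pd g x h + pd f x h * g x)) (at x)"
		by (intro has_derivative_mult assms[unfolded frechet_derivative_works])
	from frechet_derivative_at[OF this] show ?thesis by metis
qed

lemma Ck_mult: "Ck k f ==> Ck k g ==> Ck k (%x. f x * g x)"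
proof (induction k arbitrary: f g)
	case 0
	then show ?case by (auto intro: continuous_on_mult)
next
	case (Suc k)
	then have d: "!!x. f differentiable (at x)" "!!x. g differentiable (at x)" by auto
	have "Ck k (%x. pd (%x. f x * g x) x b)" if b: "b : Basis" for b
		unfolding frechet_derivative_real_mult[OF d]
	proof (intro Ck_add Suc.IH)
		show "Ck k f" "Ck k g" using Suc.prems by (blast intro: Ck_Suc_imp)+
		show "Ck k (%x. pd f x b)" "Ck k (%x. pd g x b)"
			using Suc.prems b by simp_all
	qed
	then show ?case using d by auto
qed

lemma Ck_prod: "(!!i. i : A ==> Ck k (f i)) ==> Ck k (%x. \<Prod>i\<in>A. f i x)"
	by (induction A rule: infinite_finite_induct) (auto intro: Ck_const Ck_mult)

text \<open>The induction on \<open>k\<close> has to run over a family closed under differentiation,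
  since the derivative of \<open>h\<close> is another member. The families used are the flat
  functions and the exponential alone.\<close>

lemma Ck_ridge:
	fixes b :: "'a::euclidean_space"
	assumes closed: "!!h. h : F ==> \<exists>h'\<in>F. \<forall>s::real. (h has_real_derivative h' s) (at s)" and h: "h : F"
	shows "Ck k (%x. h (x \<bullet> b + c))"
	using h
proof (induction k arbitrary: h)
	case 0
	then obtain h' where "!!s. (h has_real_derivative h' s) (at s)" using closed by blast
	then have "continuous_on UNIV h" by (meson DERIV_isCont continuous_at_imp_continuous_on)
	then show ?case by (auto intro!: continuous_intros intro: continuous_on_compose2)
next
	case (Suc k)
	then obtain h' where h': "h' : F" "!!s. (h has_real_derivative h' s) (at s)" using closed by blast
	have d: "((%x. h (x \<bullet> b + c)) has_derivative (%d. h' (x \<bullet> b + c) * (d \<bullet> b))) (at x)" for x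
	proof -
		have "((%x. x \<bullet> b + c) has_derivative (%d. d \<bullet> b)) (at x)"
			by (auto intro!: derivative_eq_intros)
		from has_derivative_compose[OF this h'(2)[of "x \<bullet> b + c", unfolded has_field_derivative_def]]
		show ?thesis .
	qed
	have "frechet_derivative (%x. h (x \<bullet> b + c)) (at x) = (%d. h' (x \<bullet> b + c) * (d \<bullet> b))" for x
		by (rule frechet_derivative_at[OF d, symmetric])
	then show ?case
		using d Ck_mult[OF Suc.IH[OF h'(1)] Ck_const] by (auto simp: differentiable_def)
qed

section \<open>Flat functions and smooth bumps on boxes\<close>

definition flat_exp :: "real poly => real => real" where
	"flat_exp P s = (if s > 0 then poly P (1 / s) * exp (- 1 / s) else 0)"

lemma poly_exp_tendsto_0: "((%x. poly P x * exp (- x)) ---> (0::real)) at_top"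
proof (induction P)
	case 0
	then show ?case by simp
next
	case (pCons a P)
	have "((%x. poly P x * x * exp (- x)) ---> (0::real)) at_top" for P
	proof -
		have "((%x. \<Sum>i\<le>degree P. coeff P i * (x ^ Suc i / exp x)) ---> (\<Sum>i\<le>degree P. coeff P i * 0)) at_top"
			by (intro tendsto_sum tendsto_mult tendsto_const tendsto_power_div_exp_0)
		moreover have "(\<Sum>i\<le>degree P. coeff P i * (x ^ Suc i / exp x)) = poly P x * x * exp (- x)" for x
			by (simp add: poly_altdef sum_distrib_right sum_distrib_left exp_minus divide_inverse algebra_simps)
		ultimately show ?thesis by simp
	qed
	from this[of P] have "((%x. a * (x ^ 0 / exp x) + poly P x * x * exp (- x)) ---> a * 0 + 0) at_top"
		by (intro tendsto_add tendsto_mult tendsto_const tendsto_power_div_exp_0)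
	then show ?case by (simp add: algebra_simps exp_minus divide_inverse)
qed

text \<open>With \<open>x = 1 / s\<close>, differentiation maps the polynomial \<open>P\<close> to
  \<open>x^2 (P - P')\<close>. Carrying the polynomial as a parameter is what closes the family
  under differentiation and makes \<open>Ck_ridge\<close> applicable.\<close>

lemma flat_exp_deriv: "(flat_exp P has_real_derivative flat_exp ([:0,0,1:] * (P - pderiv P)) s) (at s)"
proof -
	consider "s > 0" | "s < 0" | "s = 0" by linarith
	then show ?thesis
	proof cases
		case 1
		have "((%s. poly P (1 / s) * exp (- 1 / s)) has_real_derivative flat_exp ([:0,0,1:] * (P - pderiv P)) s) (at s)"
			using 1 unfolding flat_exp_def
			by (auto intro!: derivative_eq_intros DERIV_chain'[OF _ poly_DERIV] simp: power2_eq_square field_simps)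
		moreover have "eventually (%x. poly P (1 / x) * exp (- 1 / x) = flat_exp P x) (nhds s)"
			using eventually_nhds_in_open[of "{0<..}" s] 1 by (auto simp: flat_exp_def elim!: eventually_mono)
		ultimately show ?thesis
			by (subst DERIV_cong_ev[OF refl _ refl, of _ "%s. poly P (1 / s) * exp (- 1 / s)"]) (auto elim!: eventually_mono)
	next
		case 2
		have "eventually (%x. flat_exp P x = 0) (nhds s)"
			using eventually_nhds_in_open[of "{..<0}" s] 2 by (auto simp: flat_exp_def elim!: eventually_mono)
		then show ?thesis using 2 by (subst DERIV_cong_ev[OF refl _ refl]) (auto simp: flat_exp_def)
	next
		case 3
		have "((%h. (flat_exp P (0 + h) - flat_exp P 0) / h) ---> 0) (at 0)"
		proof (rule filterlim_split_at)
			have "\<forall>\<^sub>F h in at_left 0. (flat_exp P (0 + h) - flat_exp P 0) / h = 0"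
				unfolding eventually_at by (auto simp: flat_exp_def intro!: exI[of _ 1])
			then show "((%h. (flat_exp P (0 + h) - flat_exp P 0) / h) ---> 0) (at_left 0)"
				by (rule tendsto_eventually)
			\<comment> \<open>With \<open>x = 1 / h\<close> the right difference quotient at 0 is
			  \<open>x P(x) exp (- x)\<close>; the additional factor \<open>x\<close> is the
			  \<open>pCons 0\<close>.\<close>
			have "((%h. poly (pCons 0 P) (inverse h) * exp (- inverse h)) ---> 0) (at_right (0::real))"
				by (rule filterlim_compose[OF poly_exp_tendsto_0 filterlim_inverse_at_top_right])
			moreover have "\<forall>\<^sub>F h in at_right 0. poly (pCons 0 P) (inverse h) * exp (- inverse h) = (flat_exp P (0 + h) - flat_exp P 0) / h"
				unfolding eventually_at by (auto simp: flat_exp_def field_simps intro!: exI[of _ 1])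
			ultimately show "((%h. (flat_exp P (0 + h) - flat_exp P 0) / h) ---> 0) (at_right 0)"
				by (rule Lim_transform_eventually)
		qed
		then show ?thesis using 3 by (simp add: DERIV_def flat_exp_def)
	qed
qed

lemma Ck_flat_exp: "Ck k (%x. flat_exp P (x \<bullet> b + c))"
	by (rule Ck_ridge[of "range flat_exp"]) (use flat_exp_deriv in blast)+

lemma flat_exp_bounds: "0 <= flat_exp 1 s" "flat_exp 1 s <= 1" "s > 0 ==> flat_exp 1 s > 0" "s <= 0 ==> flat_exp 1 s = 0"
	by (auto simp: flat_exp_def)

lemma flat_exp_tendsto_1: "filterlim g at_top F ==> ((%n. flat_exp 1 (g n)) ---> 1) F"
proof -
	assume g: "filterlim g at_top F"
	have "((%n. exp (- (1 / g n))) ---> exp (- 0)) F"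
		by (intro tendsto_intros tendsto_divide_0[OF tendsto_const] filterlim_at_top_imp_at_infinity g)
	moreover have "eventually (%n. exp (- (1 / g n)) = flat_exp 1 (g n)) F"
		using filterlim_at_top_dense[THEN iffD1, OF g, rule_format, of 0] by eventually_elim (simp add: flat_exp_def)
	ultimately show ?thesis by (auto intro: Lim_transform_eventually)
qed

text \<open>The number \<open>n\<close> is the steepness: as it grows, the bumps increase to 1
  inside the open box and remain 0 outside, so they approximate its indicator boundedly by test
  functions.\<close>

definition box_bump :: "'a::euclidean_space => 'a => real => 'a => real" where
	"box_bump a b n x = (\<Prod>i\<in>Basis. flat_exp 1 (n * (x \<bullet> i - a \<bullet> i)) * flat_exp 1 (n * (b \<bullet> i - x \<bullet> i)))"

lemma box_bump_bounds: "0 <= box_bump a b n x" "box_bump a b n x <= 1"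
	unfolding box_bump_def
	by (auto intro!: prod_nonneg prod_le_1 mult_nonneg_nonneg mult_le_one flat_exp_bounds)

lemma box_bump_outside:
	assumes "n > 0" "x \<notin> box a b"
	shows "box_bump a b n x = 0"
proof -
	obtain i where i: "i : Basis" "x \<bullet> i <= a \<bullet> i \<or> b \<bullet> i <= x \<bullet> i" using assms(2) by (auto simp: mem_box not_less)
	then have "n * (x \<bullet> i - a \<bullet> i) <= 0 \<or> n * (b \<bullet> i - x \<bullet> i) <= 0"
		using assms(1) by (auto simp: mult_le_0_iff)
	then show ?thesis unfolding box_bump_def using i(1)
		by (subst prod_zero_iff) (auto intro!: bexI[of _ i] simp: flat_exp_bounds)
qed

lemma box_bump_pos: "n > 0 ==> x : box a b ==> box_bump a b n x > 0"
	unfolding box_bump_def mem_box by (intro prod_pos mult_pos_pos flat_exp_bounds) auto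

lemma box_bump_Ck: "Ck k (box_bump a b n)"
proof -
	have "Ck k (%x. \<Prod>i\<in>Basis. flat_exp 1 (x \<bullet> (n *R i) + (- n * (a \<bullet> i))) * flat_exp 1 (x \<bullet> (- n *R i) + n * (b \<bullet> i)))"
		by (intro Ck_prod Ck_mult Ck_flat_exp)
	then show ?thesis unfolding box_bump_def[abs_def] by (simp add: algebra_simps)
qed

lemma box_bump_support: "n > 0 ==> closure {x. box_bump a b n x ~= 0} <= cbox a b"
proof (rule closure_minimal)
	assume "n > 0"
	then show "{x. box_bump a b n x ~= 0} <= cbox a b"
		using box_bump_outside[of n _ a b] box_subset_cbox[of a b] by auto
qed (rule closed_cbox)

lemma test_functionsI:
	assumes "!!k. Ck k phi" "closure {x. phi x ~= 0} <= K" "compact K" "K <= S"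
	shows "phi : test_functions S"
proof -
	have "compact (closure {x. phi x ~= 0})"
		using compact_Int_closed[OF assms(3) closed_closure, of "{x. phi x ~= 0}"] assms(2)
		by (simp add: Int_absorb1)
	then show ?thesis using assms(1,2,4) by (simp add: test_functions_def)
qed

lemma box_bump_test: "n > 0 ==> box_bump a b n : test_functions UNIV"
	by (rule test_functionsI[OF box_bump_Ck box_bump_support compact_cbox]) simp_all

lemma box_bump_tendsto: "(%m. box_bump a b (real (Suc m)) x) ----> indicator (box a b) x"
proof (cases "x : box a b")
	case True
	have lin: "filterlim (%m. real (Suc m) * c) at_top sequentially" if "c > 0" for c
		by (rule filterlim_at_top_mult_tendsto_pos[OF tendsto_const that])
			(rule filterlim_compose[OF filterlim_real_sequentially filterlim_Suc])
	have "(%m. box_bump a b (real (Suc m)) x) ----> (\<Prod>i\<in>(Basis::'a set). 1 * 1)"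
		unfolding box_bump_def using True
		by (intro tendsto_prod tendsto_mult flat_exp_tendsto_1 lin) (auto simp: mem_box)
	then show ?thesis using True by simp
qed (simp add: box_bump_outside)

lemma borel_imp_lebesgue_measurable: "f : BM ==> f : LM"
	by (intro measurable_completion) simp

lemma continuous_imp_lebesgue_measurable: "continuous_on UNIV f ==> f : LM"
	by (intro borel_imp_lebesgue_measurable borel_measurable_continuous_onI)

lemma L2_norm_L2: "u : L2 ==> (%x. norm (u x)) : L2"
	by (auto simp: L2_def)

subsection \<open>The fundamental lemma of the calculus of variations\<close>

lemma fundamental_lemma_box:
	fixes u :: "'a::euclidean_space => real"
	assumes u: "u : LM"
		and int: "LI (%x. u x * indicator (box a b) x)"
		and zero: "!!phi. phi : test_functions UNIV ==> (LN x. u x * phi x) = 0"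
	shows "(LN x. u x * indicator (box a b) x) = 0"
proof -
	have "(%m. LN x. u x * box_bump a b (real (Suc m)) x) ----> (LN x. u x * indicator (box a b) x)"
	proof (rule lint_dom)
		show "LI (%x. norm (u x * indicator (box a b) x))" using int by (rule integrable_norm)
		show "AL x. (%m. u x * box_bump a b (real (Suc m)) x) ----> u x * indicator (box a b) x"
			by (intro AE_I2 tendsto_intros box_bump_tendsto)
		show "AL x. norm (u x * box_bump a b (real (Suc m)) x) <= norm (u x * indicator (box a b) x)" for m
		proof (rule AE_I2)
			fix x
			show "norm (u x * box_bump a b (real (Suc m)) x) <= norm (u x * indicator (box a b) x)"
				using box_bump_bounds[of a b "real (Suc m)" x] box_bump_outside[of "real (Suc m)" x a b]
				by (cases "x : box a b") (auto simp: abs_mult mult_left_le)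
		qed
		have "box_bump a b (real (Suc m)) : LM" for m
			using box_bump_Ck[of 0 a b "real (Suc m)"] by (simp add: continuous_imp_lebesgue_measurable del: of_nat_Suc)
		then show "(%x. u x * box_bump a b (real (Suc m)) x) : LM" for m
			using u by measurable
		show "(%x. u x * indicator (box a b) x) : LM"
			using int by (rule borel_measurable_integrable)
	qed
	moreover have "(LN x. u x * box_bump a b (real (Suc m)) x) = 0" for m
		by (rule zero[OF box_bump_test]) simp
	ultimately show ?thesis by (simp add: LIMSEQ_const_iff)
qed

text \<open>Boxes are stable under intersection and generate the Borel sets. The sets over which the
  integral vanishes are closed under disjoint unions, and under complements by \<open>total\<close>;
  hence all Borel sets are among them, and the density \<open>w\<close> is null.\<close>

lemma integrable_AE_zero_box:
	fixes w :: "'a::euclidean_space => real"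
	assumes w: "integrable lborel w" and box0: "!!a b. (LINT x:box a b|lborel. w x) = 0"
		and total: "(LINT x|lborel. w x) = 0"
	shows "AE x in lborel. w x = 0"
proof -
	have "(LINT x:A|lborel. w x) = 0" if "A : sets borel" for A
	proof -
		let ?G = "range (%(a, b). box a b) :: 'a set set"
		have "A : sigma_sets UNIV ?G" using that by (simp add: borel_eq_box)
		have "Int_stable ?G" by (auto simp: Int_stable_def box_Int_box)
		then show ?thesis
		proof (rule sigma_sets_induct_disjoint[OF _ _ \<open>A : sigma_sets UNIV ?G\<close>])
			fix A assume "A : ?G" then show "(LINT x:A|lborel. w x) = 0" using box0 by auto
		next
			show "(LINT x:{}|lborel. w x) = 0" by (simp add: set_lebesgue_integral_def)
		next
			fix A assume "A : sigma_sets UNIV ?G" and A0: "(LINT x:A|lborel. w x) = 0"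
			then have A: "A : sets lborel" by (simp add: borel_eq_box)
			have "(LINT x:UNIV - A|lborel. w x) = (LINT x|lborel. w x) - (LINT x:A|lborel. w x)"
				unfolding set_lebesgue_integral_def
				using Bochner_Integration.integral_diff[OF w integrable_mult_indicator[OF A w], symmetric]
				by (simp, intro Bochner_Integration.integral_cong) (auto simp: indicator_def)
			then show "(LINT x:UNIV - A|lborel. w x) = 0" using A0 total by simp
		next
			fix A :: "nat => 'a set"
			assume dis: "disjoint_family A" and "range A <= sigma_sets UNIV ?G" and A0: "!!i. (LINT x:A i|lborel. w x) = 0"
			then have A: "!!i. A i : sets lborel" by (auto simp: borel_eq_box)
			have "set_integrable lborel (\<Union>i. A i) w"
				unfolding set_integrable_def by (intro integrable_mult_indicator w sets.countable_UN) (use A in auto)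
			then have "(LINT x:(\<Union>i. A i)|lborel. w x) = (\<Sum>i. (LINT x:(A i)|lborel. w x))"
				using A dis by (intro lebesgue_integral_countable_add) (auto simp: disjoint_family_on_def)
			then show "(LINT x:(\<Union>i. A i)|lborel. w x) = 0" using A0 by simp
		qed auto
	qed
	then have "AE x in lborel. w x = (0::real)"
		by (intro density_unique_real[OF w]) (auto simp: set_lebesgue_integral_def)
	then show ?thesis .
qed

text \<open>As \<open>u\<close> is only locally integrable, its Borel version is cut off to the
  boxes of half-width \<open>n\<close>. The integrals over sub-boxes vanish because an intersection
  of boxes is a box.\<close>

theorem fundamental_lemma:
	fixes u :: "'a::euclidean_space => real"
	assumes u: "u : LM"
		and int: "!!a b. LI (%x. u x * indicator (box a b) x)"
		and zero: "!!phi. phi : test_functions UNIV ==> (LN x. u x * phi x) = 0"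
	shows "AL x. u x = 0"
proof -
	obtain u' where u': "u' : BM" "AL x. u x = u' x"
		using lebesgue_ex_borel[OF u] by blast
	have box0: "integrable lborel (%x. u' x * indicator (box a b) x) & (LINT x|lborel. u' x * indicator (box a b) x) = 0" for a b
	proof -
		have m: "(%x. u' x * indicator (box a b) x) : borel_measurable lborel" using u'(1) by measurable
		have m': "(%x. u' x * indicator (box a b) x) : LM"
			using m by (intro borel_imp_lebesgue_measurable) simp
		have ae: "AL x. u x * indicator (box a b) x = u' x * indicator (box a b) x"
			using u'(2) by eventually_elim simp
		have mu: "(%x. u x * indicator (box a b) x) : LM"
			using int by (rule borel_measurable_integrable)
		have "LI (%x. u' x * indicator (box a b) x)"
			using int integrable_cong_AE[OF mu m' ae] by simp
		moreover have "(LN x. u' x * indicator (box a b) x) = 0"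
			using integral_cong_AE[OF mu m' ae] fundamental_lemma_box[OF u int zero] by simp
		ultimately show ?thesis using m by (simp add: integrable_completion integral_completion)
	qed
	have "AE x in lborel. u' x * indicator (box (- real n *R One) (real n *R One)) x = 0" for n
	proof (rule integrable_AE_zero_box)
		fix a b :: 'a
		have "(LINT x:box a b|lborel. u' x * indicator (box (- real n *R One) (real n *R One)) x)
				= (LINT x|lborel. u' x * indicator (box a b \<inter> box (- real n *R One) (real n *R One)) x)"
			unfolding set_lebesgue_integral_def by (intro Bochner_Integration.integral_cong) (auto simp: indicator_def)
		then show "(LINT x:box a b|lborel. u' x * indicator (box (- real n *R One) (real n *R One)) x) = 0"
			using box0 by (simp add: box_Int_box)
	qed (use box0 in auto)
	then have "AE x in lborel. \<forall>n. u' x * indicator (box (- real n *R One) (real n *R One)) x = 0"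
		by (subst AE_all_countable) auto
	then have "AE x in lborel. u' x = 0"
	proof eventually_elim
		fix x assume *: "\<forall>n. u' x * indicator (box (- real n *R One) (real n *R One)) x = 0"
		obtain n where "norm x < real n" using reals_Archimedean2 by blast
		then have "x : box (- real n *R One) (real n *R One)"
			unfolding mem_box
		proof (intro ballI)
			fix i :: 'a assume "i : Basis"
			then have "\<bar>x \<bullet> i\<bar> <= norm x" by (rule Basis_le_norm)
			then have "\<bar>x \<bullet> i\<bar> < real n" using \<open>norm x < real n\<close> by linarith
			then show "(- real n *R One) \<bullet> i < x \<bullet> i & x \<bullet> i < (real n *R One) \<bullet> i"
				using \<open>i : Basis\<close> by (auto simp: inner_simps)
		qed
		then show "u' x = 0" using * by (metis indicator_simps(1) mult.right_neutral)
	qed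
	then have "AL x. u' x = 0" by (rule AE_completion)
	then show ?thesis using u'(2) by eventually_elim simp
qed

lemma indicator_bounded_L2: "A : sets lebesgue ==> bounded A ==> (indicator A :: 'a::euclidean_space => real) : L2"
proof -
	assume A: "A : sets lebesgue" "bounded A"
	then have "A : lmeasurable" by (simp add: bounded_set_imp_lmeasurable)
	then have "LI (indicator A :: 'a => real)"
		by (auto simp: fmeasurable_def)
	moreover have "(indicator A x :: real)^2 = indicator A x" for x by (simp add: indicator_def)
	ultimately show ?thesis using A by (simp add: L2_def)
qed

lemma L2_locally_integrable:
	fixes u :: "'a::euclidean_space => real"
	shows "u : L2 ==> LI (%x. u x * indicator (box a b) x)"
	by (rule L2_mult_integrable[OF _ indicator_bounded_L2]) auto

subsection \<open>Weak partial derivatives\<close>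

definition weak_partial :: "'a::euclidean_space => ('a => real) => ('a => real) => bool" where
	"weak_partial e u g \<longleftrightarrow> (\<forall>phi\<in>test_functions UNIV.
			(LN x. u x * pd phi x e) = - (LN x. g x * phi x))"

lemma weak_gradient_iff: "weak_gradient u g \<longleftrightarrow> (\<forall>e\<in>Basis. weak_partial e u (%x. g x \<bullet> e))"
	by (auto simp: weak_gradient_def weak_partial_def)

text \<open>The regularity shared by all explicit functions below. It tolerates kinks at the
  interface, is stable under products of bounded functions, and is exactly what dominated
  convergence of difference quotients along \<open>e\<close> needs.\<close>

definition dir_lipschitz :: "'a::euclidean_space => ('a => real) => ('a => real) => bool" where
	"dir_lipschitz e F F' \<longleftrightarrow> F : LM & F' : LM \<and>
			(\<exists>K. \<forall>x t. \<bar>F (x + t *R e) - F x\<bar> <= K * \<bar>t\<bar>) \<and>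
			(AL x. ((%t. (F (x + t *R e) - F x) / t) ---> F' x) (at 0))"

definition bounded_fun :: "('a => real) => bool" where
	"bounded_fun F \<longleftrightarrow> (\<exists>M. \<forall>x. \<bar>F x\<bar> <= M)"

definition bounded_support :: "('a::euclidean_space => real) => bool" where
	"bounded_support F \<longleftrightarrow> (\<exists>R. \<forall>x. norm x > R --> F x = 0)"

lemma bounded_funE:
	assumes "bounded_fun F" obtains M where "M > 0" "!!x. \<bar>F x\<bar> <= M"
proof -
	obtain M where M: "!!x. \<bar>F x\<bar> <= M" using assms by (auto simp: bounded_fun_def)
	have "max M 1 > 0" "!!x. \<bar>F x\<bar> <= max M 1" using M by (auto intro: max.coboundedI1)
	then show ?thesis using that by blast
qed

lemma bounded_supportE:
	assumes "bounded_support F" obtains R where "R > 0" "!!x. norm x > R ==> F x = 0"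
proof -
	obtain R where R: "!!x. norm x > R ==> F x = 0" using assms by (auto simp: bounded_support_def)
	have "max R 1 > 0" "!!x. norm x > max R 1 ==> F x = 0" using R by auto
	then show ?thesis using that by blast
qed

lemma dir_lipschitzE:
	assumes "dir_lipschitz e F F'" obtains K where "K > 0" "!!x t. \<bar>F (x + t *R e) - F x\<bar> <= K * \<bar>t\<bar>"
proof -
	obtain K where K: "!!x t. \<bar>F (x + t *R e) - F x\<bar> <= K * \<bar>t\<bar>" using assms by (auto simp: dir_lipschitz_def)
	have "\<bar>F (x + t *R e) - F x\<bar> <= max K 1 * \<bar>t\<bar>" for x t
		by (rule order.trans[OF K mult_right_mono]) auto
	then show ?thesis using that[of "max K 1"] by auto
qed

lemma integrable_cmult_indicator_cball: "LI (%x::'a::euclidean_space. c * indicator (cball a R) x :: real)"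
proof -
	have "LI (indicator (cball a R) :: 'a => real)"
		using lmeasurable_cball[of a R] by (simp only: lmeasurable_iff_integrable)
	then show ?thesis by simp
qed

lemma null_step_sequence:
	"\<exists>h :: nat => real. (\<forall>n. 0 < h n) & (\<forall>n. h n <= 1) & h ----> 0 & filterlim h (at 0) sequentially"
proof -
	let ?h = "%n. inverse (real (Suc n))"
	have "?h ----> 0" by (rule LIMSEQ_inverse_real_of_nat)
	moreover have "filterlim ?h (at 0) sequentially"
		unfolding filterlim_at using LIMSEQ_inverse_real_of_nat by (auto simp del: of_nat_Suc)
	moreover have "0 < ?h n & ?h n <= 1" for n by (simp add: field_simps)
	ultimately show ?thesis by (intro exI[of _ ?h] conjI allI) blast+
qed

lemma bounded_support_L2:
	assumes "F : LM" "bounded_fun F" "bounded_support F"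
	shows "F : L2"
proof -
	obtain M where M: "M > 0" "!!x. \<bar>F x\<bar> <= M" using bounded_funE[OF assms(2)] by blast
	obtain R where R: "R > 0" "!!x. norm x > R ==> F x = 0" using bounded_supportE[OF assms(3)] by blast
	have "(indicator (cball 0 R) :: 'a => real) : L2" by (rule indicator_bounded_L2) auto
	then show ?thesis
		by (rule L2_dominated(1)[OF _ assms(1), of _ M])
			(use M R in "auto simp: indicator_def not_le intro!: AE_I2")
qed

lemma bounded_support_integrable:
	assumes "F : LM" "bounded_fun F" "bounded_support F"
	shows "LI F"
proof -
	obtain M where M: "M > 0" "!!x. \<bar>F x\<bar> <= M" using bounded_funE[OF assms(2)] by blast
	obtain R where R: "R > 0" "!!x. norm x > R ==> F x = 0" using bounded_supportE[OF assms(3)] by blast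
	have "LI (%x. M * indicator (cball 0 R) x :: real)"
		by (rule integrable_cmult_indicator_cball)
	then show ?thesis
		by (rule lint_bound[OF _ assms(1)])
			(use M R in "auto simp: indicator_def not_le intro!: AE_I2")
qed

lemma bounded_fun_mult: "bounded_fun F ==> bounded_fun G ==> bounded_fun (%x. F x * G x)"
proof -
	assume "bounded_fun F" "bounded_fun G"
	then obtain M N where "M > 0" "!!x. \<bar>F x\<bar> <= M" "N > 0" "!!x. \<bar>G x\<bar> <= N" by (metis bounded_funE)
	then show ?thesis unfolding bounded_fun_def
		by (intro exI[of _ "M * N"]) (auto simp: abs_mult intro!: mult_mono)
qed

lemma bounded_support_mult1: "bounded_support F ==> bounded_support (%x. F x * G x)"
	and bounded_support_mult2: "bounded_support G ==> bounded_support (%x. F x * G x)"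
	unfolding bounded_support_def by auto

lemma dir_lipschitz_measurable:
	"dir_lipschitz e F F' ==> F : LM"
	"dir_lipschitz e F F' ==> F' : LM"
	by (simp_all add: dir_lipschitz_def)

lemma dir_lipschitz_mult:
	assumes F: "dir_lipschitz e F F'" "bounded_fun F" and G: "dir_lipschitz e G G'" "bounded_fun G"
	shows "dir_lipschitz e (%x. F x * G x) (%x. F x * G' x + F' x * G x)"
proof -
	obtain M where M: "M > 0" "!!x. \<bar>F x\<bar> <= M" using bounded_funE[OF F(2)] by blast
	obtain N where N: "N > 0" "!!x. \<bar>G x\<bar> <= N" using bounded_funE[OF G(2)] by blast
	obtain K where K: "K > 0" "!!x t. \<bar>F (x + t *R e) - F x\<bar> <= K * \<bar>t\<bar>" using dir_lipschitzE[OF F(1)] by blast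
	obtain L where L: "L > 0" "!!x t. \<bar>G (x + t *R e) - G x\<bar> <= L * \<bar>t\<bar>" using dir_lipschitzE[OF G(1)] by blast
	have split: "F y * G y - F x * G x = F y * (G y - G x) + (F y - F x) * G x" for x y by (simp add: algebra_simps)
	have "\<bar>F (x + t *R e) * G (x + t *R e) - F x * G x\<bar> <= (M * L + K * N) * \<bar>t\<bar>" for x t
	proof -
		have "\<bar>F (x + t *R e) * (G (x + t *R e) - G x)\<bar> <= M * (L * \<bar>t\<bar>)"
			unfolding abs_mult by (intro mult_mono M L) (use M in auto)
		moreover have "\<bar>(F (x + t *R e) - F x) * G x\<bar> <= (K * \<bar>t\<bar>) * N"
			unfolding abs_mult by (intro mult_mono N K) (use K in auto)
		ultimately show ?thesis unfolding split by (simp add: algebra_simps)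
	qed
	moreover have "AL x. ((%t. (F (x + t *R e) * G (x + t *R e) - F x * G x) / t) ---> F x * G' x + F' x * G x) (at 0)"
	proof -
		have "AL x. ((%t. (F (x + t *R e) - F x) / t) ---> F' x) (at 0)"
			and "AL x. ((%t. (G (x + t *R e) - G x) / t) ---> G' x) (at 0)"
			using F G by (auto simp: dir_lipschitz_def)
		then show ?thesis
		proof eventually_elim
			fix x assume f: "((%t. (F (x + t *R e) - F x) / t) ---> F' x) (at 0)"
				and g: "((%t. (G (x + t *R e) - G x) / t) ---> G' x) (at 0)"
			have "((%t. F (x + t *R e) - F x) ---> 0) (at 0)"
			proof (rule Lim_null_comparison[of _ "%t. K * \<bar>t\<bar>"])
				show "((%t. K * \<bar>t\<bar>) ---> 0) (at 0)" by (auto intro!: tendsto_eq_intros)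
			qed (use K in auto)
			then have fc: "((%t. F (x + t *R e)) ---> F x) (at 0)" by (simp add: LIM_zero_iff)
			have "((%t. F (x + t *R e) * ((G (x + t *R e) - G x) / t) + (F (x + t *R e) - F x) / t * G x)
					---> F x * G' x + F' x * G x) (at 0)"
				by (intro tendsto_intros f g fc)
			then show "((%t. (F (x + t *R e) * G (x + t *R e) - F x * G x) / t) ---> F x * G' x + F' x * G x) (at 0)"
				unfolding split by (simp add: add_divide_distrib)
		qed
	qed
	ultimately show ?thesis
		using F G unfolding dir_lipschitz_def by (auto intro!: borel_measurable_add borel_measurable_times)
qed

text \<open>Translation invariance makes the integral of every difference quotient zero. The
  quotients are dominated by the Lipschitz constant on a ball enlarged by \<open>norm e\<close>, as
  steps of length at most 1 are used.\<close>

lemma integral_dir_derivative_zero: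
	assumes F: "dir_lipschitz e F F'" and sup: "bounded_support F" and bd: "bounded_fun F"
	shows "(LN x. F' x) = 0"
proof -
	obtain K where K: "K > 0" "!!x t. \<bar>F (x + t *R e) - F x\<bar> <= K * \<bar>t\<bar>" using dir_lipschitzE[OF F] by blast
	obtain R where R: "R > 0" "!!x. norm x > R ==> F x = 0" using bounded_supportE[OF sup] by blast
	have mF: "F : LM" using F by (simp add: dir_lipschitz_def)
	have int: "LI F" by (rule bounded_support_integrable[OF mF bd sup])
	obtain h :: "nat => real" where h: "!!n. 0 < h n" "!!n. h n <= 1" "h ----> 0" and h0: "filterlim h (at 0) sequentially"
		using null_step_sequence by auto
	let ?Q = "%n x. (F (x + h n *R e) - F x) / h n"
	have "(%n. LN x. ?Q n x) ----> (LN x. F' x)"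
	proof (rule lint_dom)
		show "LI (%x. K * indicator (cball 0 (R + norm e)) x)"
			by (rule integrable_cmult_indicator_cball)
		show "F' : LM" using F by (simp add: dir_lipschitz_def)
		show "?Q n : LM" for n
			using borel_measurable_translation[OF mF, of "h n *R e"] mF by measurable
		have "AL x. ((%t. (F (x + t *R e) - F x) / t) ---> F' x) (at 0)"
			using F by (simp add: dir_lipschitz_def)
		then show "AL x. (%n. ?Q n x) ----> F' x"
			by eventually_elim (rule filterlim_compose[OF _ h0])
		show "AL x. norm (?Q n x) <= K * indicator (cball 0 (R + norm e)) x" for n
		proof (rule AE_I2)
			fix x
			show "norm (?Q n x) <= K * indicator (cball 0 (R + norm e)) x"
			proof (cases "norm x <= R + norm e")
				case True
				have "\<bar>F (x + h n *R e) - F x\<bar> <= K * \<bar>h n\<bar>" by (rule K)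
				then have "norm (?Q n x) <= K" using h(1)[of n] by (simp add: abs_divide divide_le_eq)
				then show ?thesis using True by simp
			next
				case False
				have "norm (h n *R e) <= norm e" using h(1,2)[of n] by (simp add: mult_left_le_one_le)
				then have "norm (x + h n *R e) > R"
					using False norm_triangle_ineq2[of x "- (h n *R e)"] by simp
				moreover have "norm x > R" using False by (smt (verit) norm_ge_zero)
				ultimately show ?thesis using R K by simp
			qed
		qed
	qed
	moreover have "(LN x. ?Q n x) = 0" for n
		using integral_translation[OF mF, of "h n *R e"] integrable_translation[OF int, of "h n *R e"] int
		by simp
	ultimately have "(%n. 0) ----> (LN x. F' x)" by (simp only:)
	then show ?thesis by (simp add: LIMSEQ_const_iff)
qed

lemma test_function_props:
	assumes "phi : test_functions UNIV" and e: "e : Basis"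
	shows "dir_lipschitz e phi (%x. pd phi x e)"
		and "bounded_fun phi" and "bounded_support phi"
		and "bounded_fun (%x. pd phi x e)"
		and "bounded_support (%x. pd phi x e)"
		and "continuous_on UNIV phi" and "continuous_on UNIV (%x. pd phi x e)"
proof -
	have Ck: "!!k. Ck k phi" and comp: "compact (closure {x. phi x ~= 0})"
		using assms by (auto simp: test_functions_def)
	have diff: "phi differentiable (at x)" for x using Ck[of "Suc 0"] by simp
	have hd: "(phi has_derivative pd phi x) (at x)" for x
		using diff[of x] by (simp add: frechet_derivative_works)
	show c: "continuous_on UNIV phi" using Ck[of 0] by simp
	show cd: "continuous_on UNIV (%x. pd phi x e)" using Ck[of "Suc 0"] e by simp
	obtain R where R: "R > 0" "!!x. x : closure {x. phi x ~= 0} ==> norm x <= R"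
		using compact_imp_bounded[OF comp] by (auto simp: bounded_pos)
	have R': "phi x = 0" if "norm x > R" for x
		using R(2)[of x] that closure_subset[of "{x. phi x ~= 0}"] by force
	then show sup: "bounded_support phi" by (auto simp: bounded_support_def)
	have D0: "pd phi x e = 0" if "norm x > R" for x
	proof -
		have "open {x::'a. norm x > R}" by (intro open_Collect_less continuous_intros)
		then have "(phi has_derivative (%h. 0)) (at x)"
			by (rule has_derivative_transform_within_open[OF has_derivative_const[of 0]]) (use that R' in auto)
		from frechet_derivative_at[OF this] show ?thesis by (metis)
	qed
	then show "bounded_support (%x. pd phi x e)" by (auto simp: bounded_support_def)
	have bd: "bounded_fun F" if "continuous_on UNIV F" "!!x. norm x > R ==> F x = 0" for F :: "'a => real"
	proof -
		have "compact (F ` cball 0 R)"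
			by (intro compact_continuous_image compact_cball continuous_on_subset[OF that(1)]) auto
		from compact_imp_bounded[OF this] obtain M where "\<forall>y\<in>F ` cball 0 R. norm y <= M"
			unfolding bounded_iff by blast
		then have M: "!!x. norm x <= R ==> \<bar>F x\<bar> <= M" by simp
		have "\<bar>F x\<bar> <= \<bar>M\<bar>" for x using that(2)[of x] M[of x] by (cases "norm x <= R") auto
		then show ?thesis by (auto simp: bounded_fun_def)
	qed
	show "bounded_fun phi" by (rule bd[OF c R'])
	show bdd: "bounded_fun (%x. pd phi x e)" by (rule bd[OF cd D0])
	obtain K where K: "K > 0" "!!x. \<bar>pd phi x e\<bar> <= K" using bounded_funE[OF bdd] by blast
	have line: "((%t. phi (x + t *R e)) has_real_derivative pd phi (x + t *R e) e) (at t)" for x t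
	proof -
		have "((%t. x + t *R e) has_derivative (%h. h *R e)) (at t)" by (auto intro!: derivative_eq_intros)
		from has_derivative_compose[OF this hd]
		have "((%t. phi (x + t *R e)) has_derivative (%h. pd phi (x + t *R e) (h *R e))) (at t)" .
		moreover have "pd phi (x + t *R e) (h *R e) = pd phi (x + t *R e) e * h" for h
			using linear_scale[OF has_derivative_linear[OF hd[of "x + t *R e"]], of h e] by simp
		ultimately show ?thesis by (simp add: has_field_derivative_def)
	qed
	have lip: "\<bar>phi (x + t *R e) - phi x\<bar> <= K * \<bar>t\<bar>" for x t
	proof -
		have "norm (phi (x + t *R e) - phi (x + 0 *R e)) <= K * norm (t - 0)"
			by (rule field_differentiable_bound[of UNIV "%t. phi (x + t *R e)"]) (use line K in auto)
		then show ?thesis by simp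
	qed
	have "((%t. (phi (x + t *R e) - phi x) / t) ---> pd phi x e) (at 0)" for x
		using line[of x 0] by (simp add: DERIV_def)
	then show "dir_lipschitz e phi (%x. pd phi x e)"
		unfolding dir_lipschitz_def using lip c cd by (auto intro!: continuous_imp_lebesgue_measurable)
qed

lemma test_function_line_integral:
	assumes "phi : test_functions UNIV" and e: "e : Basis" and t: "0 <= t"
	shows "phi (x - t *R e) - phi x = - (LINT s|lborel. indicator {0..t} s * frechet_derivative phi (at (x + s *R (- e))) e)"
proof -
	have Ck: "!!k. Ck k phi" using assms by (auto simp: test_functions_def)
	have hd: "(phi has_derivative pd phi x) (at x)" for x
		using Ck[of "Suc 0"] by (simp add: frechet_derivative_works)
	have line: "((%s. - phi (x + s *R (- e))) has_real_derivative frechet_derivative phi (at (x + s *R (- e))) e) (at s)" for s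
	proof -
		have "((%s. x + s *R (- e)) has_derivative (%h. h *R (- e))) (at s)" by (auto intro!: derivative_eq_intros)
		from has_derivative_minus[OF has_derivative_compose[OF this hd]]
		have "((%s. - phi (x + s *R (- e))) has_derivative (%h. - frechet_derivative phi (at (x + s *R (- e))) (h *R (- e)))) (at s)" .
		moreover have "- pd phi y (h *R (- e)) = pd phi y e * h" for h y
			using linear_scale[OF has_derivative_linear[OF hd[of y]], of "- h" e] by simp
		ultimately show ?thesis by (simp add: has_field_derivative_def)
	qed
	have "(LINT s|lborel. frechet_derivative phi (at (x + s *R (- e))) e * indicator {0..t} s)
			= - phi (x + t *R (- e)) - (- phi (x + 0 *R (- e)))"
	proof (rule integral_FTC_Icc_real[OF t])
		fix s show "DERIV (%s. - phi (x + s *R (- e))) s :> frechet_derivative phi (at (x + s *R (- e))) e" by (rule line)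
		have "continuous_on UNIV (%s. frechet_derivative phi (at (x + s *R (- e))) e)"
			by (rule continuous_on_compose2[OF test_function_props(7)[OF assms(1,2)]]) (auto intro!: continuous_intros)
		then show "isCont (%s. frechet_derivative phi (at (x + s *R (- e))) e) s"
			by (simp add: continuous_on_eq_continuous_at)
	qed
	then show ?thesis by (simp add: mult.commute)
qed

lemma frechet_derivative_translate:
	assumes "f differentiable (at (x + a))"
	shows "((%x. f (x + a)) has_derivative pd f (x + a)) (at x)"
		and "frechet_derivative (%x. f (x + a)) (at x) = pd f (x + a)"
proof -
	have f: "(f has_derivative pd f (x + a)) (at (x + a))"
		using assms by (simp add: frechet_derivative_works)
	have "((%x. x + a) has_derivative (%h. h)) (at x)" by (auto intro!: derivative_eq_intros)
	from has_derivative_compose[OF this f]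
	show hd: "((%x. f (x + a)) has_derivative pd f (x + a)) (at x)" .
	show "frechet_derivative (%x. f (x + a)) (at x) = pd f (x + a)"
		by (rule frechet_derivative_at[OF hd, symmetric])
qed

lemma Ck_translate: "Ck k f ==> Ck k (%x. f (x + a))"
proof (induction k arbitrary: f)
	case 0
	then show ?case by (auto intro!: continuous_intros intro: continuous_on_compose2)
next
	case (Suc k)
	then have d: "f differentiable (at x)" for x by simp
	have "Ck k (%x. pd f (x + a) b)" if "b : Basis" for b
		using Suc.IH[of "%x. pd f x b"] Suc.prems that by simp
	then show ?case
		using frechet_derivative_translate[OF d] by (auto simp: differentiable_def)
qed

lemma test_function_translate:
	assumes "phi : test_functions UNIV"
	shows "(%x. phi (x + a)) : test_functions UNIV"
proof -
	have Ck: "!!k. Ck k phi" and comp: "compact (closure {x. phi x ~= 0})"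
		using assms by (auto simp: test_functions_def)
	let ?C = "(%y. y - a) ` closure {x. phi x ~= 0}"
	have cC: "compact ?C" by (intro compact_continuous_image comp continuous_intros)
	have "{x. phi (x + a) ~= 0} <= ?C"
	proof
		fix x assume "x : {x. phi (x + a) ~= 0}"
		then have "x + a : closure {x. phi x ~= 0}" using closure_subset[of "{x. phi x ~= 0}"] by blast
		then show "x : ?C" by (intro image_eqI[of _ _ "x + a"]) auto
	qed
	then have "closure {x. phi (x + a) ~= 0} <= ?C" by (intro closure_minimal compact_imp_closed[OF cC])
	then show ?thesis using Ck cC by (intro test_functionsI[of _ ?C] Ck_translate) auto
qed

lemma weak_partial_dir_lipschitz:
	assumes F: "dir_lipschitz e F F'" "bounded_fun F" "bounded_fun F'" and e: "e : Basis"
	shows "weak_partial e F F'"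
	unfolding weak_partial_def
proof
	fix phi :: "'a => real" assume phi: "phi : test_functions UNIV"
	note p = test_function_props[OF phi e]
	let ?D = "%x. pd phi x e"
	have m: "F : LM" "F' : LM" "phi : LM" "?D : LM"
		using F(1) p(1) by (auto simp: dir_lipschitz_def)
	have i1: "LI (%x. F x * ?D x)"
		by (intro bounded_support_integrable borel_measurable_times m bounded_fun_mult F(2) p bounded_support_mult2)
	have i2: "LI (%x. F' x * phi x)"
		by (intro bounded_support_integrable borel_measurable_times m bounded_fun_mult F(3) p bounded_support_mult2)
	have "(LN x. F x * ?D x + F' x * phi x) = 0"
		by (rule integral_dir_derivative_zero[OF dir_lipschitz_mult[OF F(1,2) p(1,2)]])
			(intro bounded_support_mult2 p bounded_fun_mult F(2))+
	then show "(LN x. F x * ?D x) = - (LN x. F' x * phi x)"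
		using i1 i2 by simp
qed

subsection \<open>Translations of Sobolev functions\<close>

lemma L2_lborel:
	fixes p q :: "'a::euclidean_space => real"
	assumes "p : BM" "q : BM" "p : L2" "q : L2"
	shows "integrable lborel (%x. (p x)^2)"
		and "integrable lborel (%x. p x * q (x + a))"
		and "(LINT x|lborel. p x * q (x + a)) = (LN x. p x * q (x + a))"
		and "(LINT x|lborel. \<bar>p x * q (x + a)\<bar>) <= L2_norm p * L2_norm q"
proof -
	have m: "(%x. (p x)^2) : borel_measurable lborel" "(%x. p x * q (x + a)) : borel_measurable lborel"
		using assms(1,2) by measurable
	show "integrable lborel (%x. (p x)^2)"
		using L2_real_integrable_sq[OF assms(3)] m(1) by (simp add: integrable_completion)
	show "integrable lborel (%x. p x * q (x + a))"
		using L2_mult_integrable[OF assms(3) L2_translation(1)[OF assms(4), of a]] integrable_completion[OF m(2)] by simp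
	show "(LINT x|lborel. p x * q (x + a)) = (LN x. p x * q (x + a))"
		using m(2) by (simp add: integral_completion)
	have "(LINT x|lborel. \<bar>p x * q (x + a)\<bar>) = (LN x. norm (p x) * norm (q (x + a)))"
		using integral_completion[OF borel_measurable_abs[OF m(2)]] by (simp add: abs_mult)
	also have "... <= L2_norm p * L2_norm q"
		using L2_abs_integral_le[OF assms(3) L2_translation(1)[OF assms(4), of a]] L2_translation(2)[OF assms(4), of a] by simp
	finally show "(LINT x|lborel. \<bar>p x * q (x + a)\<bar>) <= L2_norm p * L2_norm q" .
qed

lemma integrable_indicator_Icc: "integrable lborel (%s::real. indicator {a..b} s * c :: real)"
	by (intro integrable_mult_left integrable_real_indicator) (auto simp: emeasure_lborel_Icc_eq)

lemma translation_Fubini: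
	fixes p q :: "'a::euclidean_space => real"
	assumes p: "p : BM" "p : L2" and q: "q : BM" "q : L2"
	shows "integrable lborel (%x. p x * (LINT s|lborel. indicator {0..t} s * q (x + s *R e)))"
		and "integrable lborel (%s. indicator {0..t} s * (LINT x|lborel. p x * q (x + s *R e)))"
		and "(LINT x|lborel. p x * (LINT s|lborel. indicator {0..t} s * q (x + s *R e)))
				= (LINT s|lborel. indicator {0..t} s * (LINT x|lborel. p x * q (x + s *R e)))"
proof -
	let ?f = "%(s::real) x. indicator {0..t} s * (p x * q (x + s *R e)) :: real"
	have meas: "case_prod ?f : borel_measurable (lborel \<Otimes>\<^sub>M lborel)"
	proof -
		have [measurable]: "p : borel_measurable lborel" "q : BM" using p q by auto
		show ?thesis by measurable
	qed
	have int: "integrable (lborel \<Otimes>\<^sub>M lborel) (case_prod ?f)"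
	proof (rule lborel_pair.Fubini_integrable[OF meas])
		show "AE s in lborel. integrable lborel (%x. case_prod ?f (s, x))"
			using L2_lborel(2)[OF p(1) q(1) p(2) q(2)] by (auto intro!: AE_I2 integrable_mult_right)
		have ind: "integrable lborel (%s. indicator {0..t} s * (L2_norm p * L2_norm q) :: real)"
			by (rule integrable_indicator_Icc)
		show "integrable lborel (%s. LINT x|lborel. norm (case_prod ?f (s, x)))"
		proof (rule lint_bound[OF ind])
			show "(%s. LINT x|lborel. norm (case_prod ?f (s, x))) : borel_measurable lborel"
				using meas by (intro lborel.borel_measurable_lebesgue_integral) (simp add: split_beta')
			show "AE s in lborel. norm (LINT x|lborel. norm (case_prod ?f (s, x))) <= norm (indicator {0..t} s * (L2_norm p * L2_norm q))"
				using L2_lborel(4)[OF p(1) q(1) p(2) q(2)]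
				by (auto intro!: AE_I2 simp: abs_mult indicator_def)
		qed
	qed
	show "integrable lborel (%x. p x * (LINT s|lborel. indicator {0..t} s * q (x + s *R e)))"
		using lborel_pair.integrable_snd[OF int] by (simp add: mult.left_commute)
	show "integrable lborel (%s. indicator {0..t} s * (LINT x|lborel. p x * q (x + s *R e)))"
		using lborel_pair.integrable_fst[OF int] by simp
	show "(LINT x|lborel. p x * (LINT s|lborel. indicator {0..t} s * q (x + s *R e)))
				= (LINT s|lborel. indicator {0..t} s * (LINT x|lborel. p x * q (x + s *R e)))"
	proof -
		have "(LINT x|lborel. ?f s x) = indicator {0..t} s * (LINT x|lborel. p x * q (x + s *R e))" for s by simp
		moreover have "(LINT s|lborel. ?f s x) = p x * (LINT s|lborel. indicator {0..t} s * q (x + s *R e))" for x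
			by (simp add: mult.left_commute)
		ultimately show ?thesis using lborel_pair.Fubini_integral[OF int] by simp
	qed
qed

lemma weak_partial_translated_test:
	assumes wp: "weak_partial e u g" and phi: "phi : test_functions UNIV"
		and g: "g : LM" and e: "e : Basis"
	shows "(LN x. u x * frechet_derivative phi (at (x + s *R (- e))) e) = - (LN x. phi x * g (x + s *R e))"
proof -
	have d: "phi differentiable (at x)" for x
		using phi Ck.simps(2)[of 0 phi] by (auto simp: test_functions_def)
	have "(LN x. u x * frechet_derivative phi (at (x + s *R (- e))) e) = - (LN x. g x * phi (x + s *R (- e)))"
		using wp[unfolded weak_partial_def, rule_format, OF test_function_translate[OF phi, of "s *R (- e)"]]
		by (simp add: frechet_derivative_translate(2)[OF d] del: scaleR_minus_right)
	also have "(LN x. g x * phi (x + s *R (- e))) = (LN x. g (x + s *R e) * phi (x + s *R e + s *R (- e)))"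
	proof (rule integral_translation[symmetric])
		have "phi : LM" using test_function_props(6)[OF phi e] by (rule continuous_imp_lebesgue_measurable)
		then show "(%x. g x * phi (x + s *R (- e))) : LM"
			using g borel_measurable_translation[of phi "s *R (- e)"] by measurable
	qed
	finally show ?thesis by (simp add: mult.commute)
qed

text \<open>By duality. Against a test function the shift of \<open>u\<close> is moved to the test
  function, where the fundamental theorem of calculus holds along each line; Fubini and the weak
  derivative at each \<open>s\<close> move it back to \<open>g\<close>. So
  \<open>u (x + t *R e) - u x\<close> equals almost everywhere the integral \<open>A x\<close> of
  \<open>g\<close> along the segment, and pairing with \<open>F\<close> gives the claim.\<close>

lemma weak_partial_translation:
	assumes u: "u : L2" and g: "g : L2" and wp: "weak_partial e u g" and e: "e : Basis" and t: "0 <= t" and F: "F : L2"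
	shows "integrable lborel (%s. indicator {0..t} s * (LN x. F x * g (x + s *R e)))"
		and "(LN x. F x * (u (x + t *R e) - u x))
				= (LINT s|lborel. indicator {0..t} s * (LN x. F x * g (x + s *R e)))"
proof -
	note mu = L2_measurable[OF u] note mg = L2_measurable[OF g] note mF = L2_measurable[OF F]
	obtain u' where u': "u' : BM" "AL x. u x = u' x"
		using lebesgue_ex_borel[OF mu] by blast
	obtain g' where g': "g' : BM" "AL x. g x = g' x"
		using lebesgue_ex_borel[OF mg] by blast
	obtain F' where F': "F' : BM" "AL x. F x = F' x"
		using lebesgue_ex_borel[OF mF] by blast
	have L2': "p' : L2" if "p : L2" "p' : BM" "AL x. p x = p' x" for p p' :: "'a => real"
		by (rule L2_dominated(1)[OF that(1) borel_imp_lebesgue_measurable[OF that(2)], of 1]) (use that(3) in auto)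
	note u'L = L2'[OF u u'] note g'L = L2'[OF g g'] note F'L = L2'[OF F F']
	have m': "u' : LM" "g' : LM" "F' : LM"
		using u'(1) g'(1) F'(1) by (auto intro: borel_imp_lebesgue_measurable)
	define A where "A x = (LINT s|lborel. indicator {0..t} s * g' (x + s *R e))" for x
	have mA: "A : BM"
	proof -
		have [measurable]: "g' : BM" by (rule g'(1))
		have "A : borel_measurable lborel" unfolding A_def by measurable
		then show ?thesis by simp
	qed
	have mAl: "A : LM" using mA by (rule borel_imp_lebesgue_measurable)
	have pA: "LI (%x. p x * A x) & (LN x. p x * A x) = (LINT s|lborel. indicator {0..t} s * (LN x. p x * g' (x + s *R e)))"
		if p: "p : BM" "p : L2" for p
	proof -
		have m: "(%x. p x * A x) : borel_measurable lborel" using p(1) mA by measurable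
		show ?thesis
			using translation_Fubini(1,3)[OF p g'(1) g'L, of t e] m
			unfolding A_def[symmetric] L2_lborel(3)[OF p(1) g'(1) p(2) g'L]
			by (simp add: integrable_completion integral_completion)
	qed
	have gg': "(LN x. p x * g (x + a)) = (LN x. p' x * g' (x + a))"
		if "p : LM" "p' : LM" "AL x. p x = p' x" for p p' a
	proof (rule integral_cong_AE)
		show "(%x. p x * g (x + a)) : LM" "(%x. p' x * g' (x + a)) : LM"
			using that borel_measurable_translation[OF mg, of a] borel_measurable_translation[OF m'(2), of a] by auto
		show "AL x. p x * g (x + a) = p' x * g' (x + a)"
			using that(3) AE_translation[OF g'(2), of a] by eventually_elim simp
	qed
	define W where "W x = u (x + t *R e) - u x - A x" for x
	have dL2: "(%x. u (x + t *R e) - u x) : L2" by (intro L2_diff L2_translation u)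
	have "AL x. W x = 0"
	proof (rule fundamental_lemma)
		show "W : LM"
			unfolding W_def using L2_measurable[OF dL2] mAl by measurable
		fix a b :: 'a
		have "LI (%x. indicator (box a b) x * A x)"
			using pA[of "indicator (box a b)"] indicator_bounded_L2[of "box a b"] by auto
		then have "LI (%x. (u (x + t *R e) - u x) * indicator (box a b) x - indicator (box a b) x * A x)"
			by (intro Bochner_Integration.integrable_diff L2_locally_integrable dL2)
		then show "LI (%x. W x * indicator (box a b) x)"
			unfolding W_def by (simp add: algebra_simps)
	next
		fix phi :: "'a => real" assume phi: "phi : test_functions UNIV"
		note tp = test_function_props[OF phi e]
		let ?D = "%x. pd phi x e"
		have phim: "phi : BM" "?D : BM"
			using tp(6,7) by (auto intro: borel_measurable_continuous_onI)
		have phiL: "phi : L2" "?D : L2"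
			by (intro bounded_support_L2 borel_imp_lebesgue_measurable phim tp)+
		have i1: "LI (%x. u (x + t *R e) * phi x)" "LI (%x. u x * phi x)"
			"LI (%x. u x * phi (x + (- (t *R e))))"
			by (intro L2_mult_integrable L2_translation u phiL)+
		have "(LN x. (u (x + t *R e) - u x) * phi x) = (LN x. u (x + t *R e) * phi x) - (LN x. u x * phi x)"
			using i1 by (simp add: left_diff_distrib)
		also have "(LN x. u (x + t *R e) * phi x) = (LN x. u x * phi (x + (- (t *R e))))"
			using integral_translation[OF borel_measurable_integrable[OF i1(3)], of "t *R e"] by simp
		also have "... - (LN x. u x * phi x) = (LN x. u x * (phi (x - t *R e) - phi x))"
			using i1(2,3) by (simp add: right_diff_distrib)
		also have "... = (LN x. u' x * - (LINT s|lborel. indicator {0..t} s * ?D (x + s *R (- e))))"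
		proof (rule integral_cong_AE)
			have [measurable]: "?D : BM" by (rule phim)
			have "(%x. LINT s|lborel. indicator {0..t} s * ?D (x + s *R (- e))) : borel_measurable lborel"
				by measurable
			then have "(%x. u' x * - (LINT s|lborel. indicator {0..t} s * ?D (x + s *R (- e)))) : BM"
				using u'(1) by measurable
			then show "(%x. u' x * - (LINT s|lborel. indicator {0..t} s * ?D (x + s *R (- e)))) : LM"
				by (rule borel_imp_lebesgue_measurable)
			show "(%x. u x * (phi (x - t *R e) - phi x)) : LM"
				using borel_measurable_integrable[OF i1(3)] borel_measurable_integrable[OF i1(2)] by (simp add: right_diff_distrib)
			show "AL x. u x * (phi (x - t *R e) - phi x) = u' x * - (LINT s|lborel. indicator {0..t} s * ?D (x + s *R (- e)))"
				using u'(2) unfolding test_function_line_integral[OF phi e t] by eventually_elim simp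
		qed
		also have "... = - (LINT x|lborel. u' x * (LINT s|lborel. indicator {0..t} s * ?D (x + s *R (- e))))"
		proof -
			have "integrable lborel (%x. u' x * (LINT s|lborel. indicator {0..t} s * ?D (x + s *R (- e))))"
				by (rule translation_Fubini(1)[OF u'(1) u'L phim(2) phiL(2)])
			from borel_measurable_integrable[OF this] show ?thesis
				by (simp only: mult_minus_right integral_minus) (subst integral_completion, auto)
		qed
		also have "... = - (LINT s|lborel. indicator {0..t} s * (LN x. u' x * ?D (x + s *R (- e))))"
			unfolding translation_Fubini(3)[OF u'(1) u'L phim(2) phiL(2)] L2_lborel(3)[OF u'(1) phim(2) u'L phiL(2)] ..
		also have "(%s. LN x. u' x * ?D (x + s *R (- e))) = (%s. - (LN x. phi x * g' (x + s *R e)))"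
		proof
			fix s
			have "(LN x. u' x * ?D (x + s *R (- e))) = (LN x. u x * ?D (x + s *R (- e)))"
			proof (rule integral_cong_AE)
				have "?D : LM" using phim(2) by (rule borel_imp_lebesgue_measurable)
				from borel_measurable_translation[OF this, of "s *R (- e)"]
				show "(%x. u' x * ?D (x + s *R (- e))) : LM" "(%x. u x * ?D (x + s *R (- e))) : LM"
					using m' mu by (auto intro!: borel_measurable_times)
				show "AL x. u' x * ?D (x + s *R (- e)) = u x * ?D (x + s *R (- e))"
					using u'(2) by eventually_elim simp
			qed
			also have "... = - (LN x. phi x * g (x + s *R e))"
				by (rule weak_partial_translated_test[OF wp phi mg e])
			also have "(LN x. phi x * g (x + s *R e)) = (LN x. phi x * g' (x + s *R e))"
				using L2_measurable[OF phiL(1)] by (intro gg') auto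
			finally show "(LN x. u' x * ?D (x + s *R (- e))) = - (LN x. phi x * g' (x + s *R e))" .
		qed
		also have "- (LINT s|lborel. indicator {0..t} s * - (LN x. phi x * g' (x + s *R e)))
				= (LN x. phi x * A x)"
			using pA[OF phim(1) phiL(1)] by simp
		finally have eq: "(LN x. (u (x + t *R e) - u x) * phi x) = (LN x. phi x * A x)" .
		have "(LN x. W x * phi x) = (LN x. (u (x + t *R e) - u x) * phi x - phi x * A x)"
			unfolding W_def by (intro Bochner_Integration.integral_cong) (auto simp: algebra_simps)
		also have "... = 0"
			using eq pA[OF phim(1) phiL(1)] L2_mult_integrable[OF dL2 phiL(1)] by simp
		finally show "(LN x. W x * phi x) = 0" .
	qed
	then have dA: "AL x. F x * (u (x + t *R e) - u x) = F' x * A x"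
		using F'(2) by eventually_elim (simp add: W_def)
	have "(LN x. F x * (u (x + t *R e) - u x)) = (LN x. F' x * A x)"
		using mF L2_measurable[OF dL2] m'(3) mAl by (intro integral_cong_AE borel_measurable_times dA) auto
	also have "... = (LINT s|lborel. indicator {0..t} s * (LN x. F' x * g' (x + s *R e)))"
		using pA[OF F'(1) F'L] by simp
	finally show "(LN x. F x * (u (x + t *R e) - u x))
				= (LINT s|lborel. indicator {0..t} s * (LN x. F x * g (x + s *R e)))"
		using gg'[OF mF m'(3) F'(2)] by simp
	show "integrable lborel (%s. indicator {0..t} s * (LN x. F x * g (x + s *R e)))"
		using translation_Fubini(2)[OF F'(1) F'L g'(1) g'L, of t e] gg'[OF mF m'(3) F'(2)]
		unfolding L2_lborel(3)[OF F'(1) g'(1) F'L g'L] by simp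
qed

lemma integral_Icc_bound:
	fixes c :: "real => real"
	assumes t: "0 <= t" and c: "!!s. 0 <= s ==> s <= t ==> \<bar>c s\<bar> <= C"
	shows "\<bar>LINT s|lborel. indicator {0..t} s * c s\<bar> <= t * C"
proof (cases "integrable lborel (%s. indicator {0..t} s * c s)")
	case True
	have "\<bar>LINT s|lborel. indicator {0..t} s * c s\<bar> <= (LINT s|lborel. \<bar>indicator {0..t} s * c s\<bar>)"
		using integral_norm_bound[of lborel "%s. indicator {0..t} s * c s"] by simp
	also have "... <= (LINT s|lborel. indicator {0..t} s * C)"
	proof (rule integral_mono)
		show "integrable lborel (%s. \<bar>indicator {0..t} s * c s\<bar>)" using True by (rule integrable_abs)
		show "integrable lborel (%s. indicator {0..t} s * C)"
			by (rule integrable_indicator_Icc)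
	qed (use c in "auto simp: indicator_def")
	also have "... = t * C" using t by simp
	finally show ?thesis .
next
	case False
	have "0 <= C" using c[of 0] t by simp
	then show ?thesis using False t by (simp add: not_integrable_integral_eq)
qed

text \<open>The translation formula is paired with the difference itself; Cauchy-Schwarz inside the
  \<open>s\<close>-integral leaves one factor of the norm to cancel.\<close>

lemma weak_partial_difference_norm:
	assumes u: "u : L2" and g: "g : L2" and wp: "weak_partial e u g" and e: "e : Basis" and t: "0 <= t"
	shows "L2_norm (%x. u (x + t *R e) - u x) <= t * L2_norm g"
proof -
	let ?d = "%x. u (x + t *R e) - u x"
	have d: "?d : L2" by (intro L2_diff L2_translation u)
	have "(L2_norm ?d)^2 = (LN x. ?d x * ?d x)" unfolding L2_norm_sq by (simp add: power2_eq_square)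
	also have "... = (LINT s|lborel. indicator {0..t} s * (LN x. ?d x * g (x + s *R e)))"
		by (rule weak_partial_translation(2)[OF u g wp e t d])
	also have "... <= \<bar>\<dots>\<bar>" by simp
	also have "... <= t * (L2_norm ?d * L2_norm g)"
		using L2_Cauchy_Schwarz_real[OF d L2_translation(1)[OF g]] L2_translation(2)[OF g]
		by (intro integral_Icc_bound t) auto
	finally have "L2_norm ?d * L2_norm ?d <= L2_norm ?d * (t * L2_norm g)" by (simp add: power2_eq_square algebra_simps)
	then show ?thesis
		using t mult_le_cancel_left_pos[of "L2_norm ?d"]
		by (cases "L2_norm ?d = 0") (auto simp: less_le simp del: mult_le_cancel_left_pos)
qed

text \<open>The quotient with step \<open>t\<close> is an average over \<open>s\<close> in
  \<open>[0, t]\<close> of pairings of \<open>F\<close> with shifts of \<open>g\<close>. Shifting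
  back onto \<open>F\<close>, the assumed rate for its translates bounds the error by
  \<open>t\<close> times a constant. A rate for \<open>F\<close> thus takes the place of continuity
  of translations in \<open>L2\<close>.\<close>

lemma weak_partial_difference_limit:
	assumes u: "u : L2" and g: "g : L2" and wp: "weak_partial e u g" and e: "e : Basis" and F: "F : L2"
		and K: "!!s. 0 <= s ==> s <= 1 ==> L2_norm (%x. F (x - s *R e) - F x) <= K * s"
		and h: "!!n. 0 < h n" "!!n. h n <= 1" "h ----> 0"
	shows "(%n. (LN x. F x * (u (x + h n *R e) - u x)) / h n) ----> (LN x. F x * g x)"
proof -
	have K0: "0 <= K" using order.trans[OF L2_norm_nonneg K[of 1]] by simp
	have bound: "\<bar>(LN x. F x * (u (x + t *R e) - u x)) / t - (LN x. F x * g x)\<bar> <= t * (K * L2_norm g)"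
		if t: "0 < t" "t <= 1" for t
	proof -
		let ?c = "%s. LN x. F x * g (x + s *R e)"
		let ?d = "LN x. F x * g x"
		have shift: "?c s = (LN x. F (x - s *R e) * g x)" for s
		proof -
			have "(%x. F (x - s *R e) * g x) : LM"
				using borel_measurable_translation[OF L2_measurable[OF F], of "- (s *R e)"] L2_measurable[OF g] by simp
			from integral_translation[OF this, of "s *R e"] show ?thesis by simp
		qed
		have diff: "\<bar>?c s - ?d\<bar> <= K * t * L2_norm g" if s: "0 <= s" "s <= t" for s
		proof -
			have Fs: "(%x. F (x - s *R e)) : L2" using L2_translation(1)[OF F, of "- (s *R e)"] by simp
			have "?c s - ?d = (LN x. (F (x - s *R e) - F x) * g x)"
				unfolding shift using L2_mult_integrable[OF Fs g] L2_mult_integrable[OF F g] by (simp add: left_diff_distrib)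
			also have "\<bar>\<dots>\<bar> <= L2_norm (%x. F (x - s *R e) - F x) * L2_norm g"
				by (intro L2_Cauchy_Schwarz_real L2_diff Fs F g)
			also have "... <= (K * s) * L2_norm g" using K[of s] s t by (intro mult_right_mono) auto
			also have "... <= (K * t) * L2_norm g" using s K0 by (intro mult_right_mono mult_left_mono) auto
			finally show ?thesis .
		qed
		have i0: "integrable lborel (%s. indicator {0..t} s * ?d)"
			by (rule integrable_indicator_Icc)
		have "(LN x. F x * (u (x + t *R e) - u x)) - t * ?d
				= (LINT s|lborel. indicator {0..t} s * ?c s) - (LINT s|lborel. indicator {0..t} s * ?d)"
			using weak_partial_translation(2)[OF u g wp e _ F, of t] t by simp
		also have "... = (LINT s|lborel. indicator {0..t} s * (?c s - ?d))"
			using weak_partial_translation(1)[OF u g wp e _ F, of t] t i0 by (simp add: right_diff_distrib)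
		also have "\<bar>\<dots>\<bar> <= t * (K * t * L2_norm g)"
			using t diff by (intro integral_Icc_bound) auto
		finally have "\<bar>(LN x. F x * (u (x + t *R e) - u x)) - t * ?d\<bar> / t <= (t * (K * t * L2_norm g)) / t"
			using t by (intro divide_right_mono) auto
		moreover have "(LN x. F x * (u (x + t *R e) - u x)) / t - ?d = ((LN x. F x * (u (x + t *R e) - u x)) - t * ?d) / t"
			using t by (simp add: field_simps)
		ultimately show ?thesis using t by (simp add: abs_divide algebra_simps)
	qed
	have "(%n. h n * (K * L2_norm g)) ----> 0" using tendsto_mult_left_zero[OF h(3)] by simp
	then have "(%n. (LN x. F x * (u (x + h n *R e) - u x)) / h n - (LN x. F x * g x)) ----> 0"
		by (rule Lim_null_comparison[rotated]) (use bound h in auto)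
	then show ?thesis by (simp add: LIM_zero_iff)
qed

lemma test_functions_L2:
	assumes "phi : test_functions UNIV" "e : Basis"
	shows "phi : L2" "(%x. pd phi x e) : L2"
	using test_function_props[OF assms] by (auto intro!: bounded_support_L2 continuous_imp_lebesgue_measurable)

lemma dir_lipschitz_translation_norm:
	assumes F: "dir_lipschitz e F F'" "bounded_support F"
	shows "\<exists>K\<ge>0. \<forall>s. 0 <= s & s <= 1 --> L2_norm (%x. F (x - s *R e) - F x) <= K * s"
proof -
	obtain K where K: "K > 0" "!!x t. \<bar>F (x + t *R e) - F x\<bar> <= K * \<bar>t\<bar>" using dir_lipschitzE[OF F(1)] by blast
	obtain R where R: "R > 0" "!!x. norm x > R ==> F x = 0" using bounded_supportE[OF F(2)] by blast
	let ?i = "indicator (cball 0 (R + norm e)) :: 'a => real"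
	have iL: "?i : L2" by (rule indicator_bounded_L2) auto
	have "L2_norm (%x. F (x - s *R e) - F x) <= (K * s) * L2_norm ?i" if s: "0 <= s" "s <= 1" for s
	proof (rule L2_dominated(2)[OF iL])
		show "(%x. F (x - s *R e) - F x) : LM"
			using borel_measurable_translation[OF dir_lipschitz_measurable(1)[OF F(1)], of "- (s *R e)"]
				dir_lipschitz_measurable(1)[OF F(1)] by (auto intro!: borel_measurable_diff)
		show "0 <= K * s" using K s by simp
		show "AL x. norm (F (x - s *R e) - F x) <= K * s * norm (?i x)"
		proof (rule AE_I2)
			fix x
			show "norm (F (x - s *R e) - F x) <= K * s * norm (?i x)"
			proof (cases "norm x <= R + norm e")
				case True
				then show ?thesis using K(2)[of x "- s"] s by simp
			next
				case False
				have "norm (s *R e) <= norm e" using s by (simp add: mult_left_le_one_le)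
				then have "norm (x - s *R e) > R" using False norm_triangle_ineq2[of x "s *R e"] by simp
				moreover have "norm x > R" using False norm_ge_zero[of e] by linarith
				ultimately show ?thesis using R False by simp
			qed
		qed
	qed
	then show ?thesis using K(1) by (intro exI[of _ "K * L2_norm ?i"]) (auto simp: algebra_simps)
qed

text \<open>Discrete integration by parts: translation invariance turns the quotient of
  \<open>u\<close> with step \<open>h n\<close> into minus the quotient of \<open>F\<close> with
  step \<open>- h n\<close>, and the latter converges with a uniform bound.\<close>

lemma dir_lipschitz_difference_limit:
	assumes u: "u : L2" and F: "dir_lipschitz e F F'" "bounded_support F" "bounded_fun F"
		and h: "!!n. 0 < h n" "!!n. h n <= 1" "h ----> 0"
	shows "(%n. (LN x. F x * (u (x + h n *R e) - u x)) / h n) ----> - (LN x. F' x * u x)"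
proof -
	note mF = dir_lipschitz_measurable[OF F(1)]
	have FL: "F : L2" by (rule bounded_support_L2[OF mF(1) F(3,2)])
	obtain K where K: "K > 0" "!!x t. \<bar>F (x + t *R e) - F x\<bar> <= K * \<bar>t\<bar>" using dir_lipschitzE[OF F(1)] by blast
	obtain R where R: "R > 0" "!!x. norm x > R ==> F x = 0" using bounded_supportE[OF F(2)] by blast
	let ?X = "%n. (LN x. F x * (u (x + h n *R e) - u x)) / h n"
	let ?Q = "%n x. (F (x + (- h n) *R e) - F x) / (- h n)"
	have Fn: "(%x. F (x + (- h n) *R e)) : L2" for n by (rule L2_translation(1)[OF FL])
	have Xeq: "?X n = - (LN x. ?Q n x * u x)" for n
	proof -
		have un: "(%x. u (x + h n *R e)) : L2" by (rule L2_translation(1)[OF u])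
		have "(LN x. F x * (u (x + h n *R e) - u x))
				= (LN x. F x * u (x + h n *R e)) - (LN x. F x * u x)"
			using L2_mult_integrable[OF FL un] L2_mult_integrable[OF FL u] by (simp add: right_diff_distrib)
		also have "(LN x. F x * u (x + h n *R e)) = (LN x. F (x + (- h n) *R e) * u x)"
			using integral_translation[OF borel_measurable_integrable[OF L2_mult_integrable[OF Fn[of n] u]], of "h n *R e"] by simp
		also have "... - (LN x. F x * u x) = (LN x. (F (x + (- h n) *R e) - F x) * u x)"
			using L2_mult_integrable[OF Fn[of n] u] L2_mult_integrable[OF FL u] by (simp add: left_diff_distrib)
		finally show ?thesis by simp
	qed
	have "(%n. LN x. ?Q n x * u x) ----> (LN x. F' x * u x)"
	proof (rule lint_dom)
		have "(indicator (cball 0 (R + norm e)) :: 'a => real) : L2" by (rule indicator_bounded_L2) auto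
		from L2_mult_integrable[OF this L2_norm_L2[OF u]]
		show "LI (%x. K * (indicator (cball 0 (R + norm e)) x * norm (u x)))"
			by (rule integrable_mult_right)
		show "(%x. F' x * u x) : LM" using mF(2) L2_measurable[OF u] by measurable
		show "(%x. ?Q n x * u x) : LM" for n
			using L2_measurable[OF Fn[of n]] mF(1) L2_measurable[OF u] by measurable
		have "filterlim (%n. - h n) (at 0) sequentially"
			using tendsto_minus[OF h(3)] h(1) by (auto simp: filterlim_at less_imp_neq[OF h(1), symmetric])
		note lim = this
		have "AL x. ((%t. (F (x + t *R e) - F x) / t) ---> F' x) (at 0)"
			using F(1) by (simp add: dir_lipschitz_def)
		then show "AL x. (%n. ?Q n x * u x) ----> F' x * u x"
			by eventually_elim (rule tendsto_mult[OF filterlim_compose[OF _ lim] tendsto_const])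
		show "AL x. norm (?Q n x * u x) <= K * (indicator (cball 0 (R + norm e)) x * norm (u x))" for n
		proof (rule AE_I2)
			fix x
			have "\<bar>?Q n x\<bar> <= K * indicator (cball 0 (R + norm e)) x"
			proof (cases "norm x <= R + norm e")
				case True
				have "\<bar>F (x + (- h n) *R e) - F x\<bar> <= K * \<bar>- h n\<bar>" by (rule K)
				then show ?thesis using True h(1)[of n] by (simp add: abs_divide divide_le_eq)
			next
				case False
				have "norm (h n *R e) <= norm e" using h(1,2)[of n] by (simp add: mult_left_le_one_le)
				then have "norm (x + (- h n) *R e) > R" using False norm_triangle_ineq2[of x "h n *R e"] by simp
				moreover have "norm x > R" using False norm_ge_zero[of e] by linarith
				ultimately show ?thesis using R K by simp
			qed
			from mult_right_mono[OF this, of "norm (u x)"]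
			show "norm (?Q n x * u x) <= K * (indicator (cball 0 (R + norm e)) x * norm (u x))"
				by (simp add: abs_mult mult.assoc)
		qed
	qed
	then show ?thesis unfolding Xeq by (rule tendsto_minus)
qed

text \<open>One and the same sequence of difference quotients is evaluated twice, once with the
  derivative falling on \<open>u\<close> and once with it falling on \<open>F\<close>.\<close>

lemma weak_partial_integration_by_parts:
	assumes u: "u : L2" and g: "g : L2" and wp: "weak_partial e u g" and e: "e : Basis"
		and F: "dir_lipschitz e F F'" "bounded_support F" "bounded_fun F"
	shows "(LN x. F x * g x) = - (LN x. F' x * u x)"
proof -
	have FL: "F : L2" by (rule bounded_support_L2[OF dir_lipschitz_measurable(1)[OF F(1)] F(3,2)])
	obtain C where C: "!!s. 0 <= s ==> s <= 1 ==> L2_norm (%x. F (x - s *R e) - F x) <= C * s"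
		using dir_lipschitz_translation_norm[OF F(1,2)] by auto
	obtain h :: "nat => real" where h: "!!n. 0 < h n" "!!n. h n <= 1" "h ----> 0"
		using null_step_sequence by auto
	show ?thesis
		by (rule LIMSEQ_unique[OF weak_partial_difference_limit[OF u g wp e FL C h] dir_lipschitz_difference_limit[OF u F h]])
qed

text \<open>The function \<open>F * phi\<close> need not be a test function; this is why integration
  by parts was proved against all bounded \<open>dir_lipschitz\<close> functions of bounded
  support.\<close>

lemma weak_partial_mult:
	assumes u: "u : L2" and g: "g : L2" and wp: "weak_partial e u g" and e: "e : Basis"
		and F: "dir_lipschitz e F F'" "bounded_fun F" "bounded_fun F'"
	shows "weak_partial e (%x. F x * u x) (%x. F x * g x + F' x * u x)"
	unfolding weak_partial_def
proof
	fix phi :: "'a => real" assume phi: "phi : test_functions UNIV"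
	note tp = test_function_props[OF phi e]
	note mF = dir_lipschitz_measurable[OF F(1)] note mt = dir_lipschitz_measurable[OF tp(1)]
	let ?D = "%x. pd phi x e"
	have L: "(%x. F x * phi x) : L2" "(%x. F x * ?D x) : L2" "(%x. F' x * phi x) : L2"
		by (intro bounded_support_L2 borel_measurable_times mF mt bounded_fun_mult F tp bounded_support_mult2)+
	note i = L2_mult_integrable[OF L(1) g] L2_mult_integrable[OF L(2) u] L2_mult_integrable[OF L(3) u]
	have "(LN x. (F x * phi x) * g x) = - (LN x. (F x * ?D x + F' x * phi x) * u x)"
		by (rule weak_partial_integration_by_parts[OF u g wp e dir_lipschitz_mult[OF F(1,2) tp(1,2)]])
			(intro bounded_support_mult2 bounded_fun_mult F tp)+
	then have "(LN x. (F x * ?D x) * u x) = - ((LN x. (F x * phi x) * g x) + (LN x. (F' x * phi x) * u x))"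
		using i by (simp add: distrib_right)
	also have "(LN x. (F x * phi x) * g x) + (LN x. (F' x * phi x) * u x) = (LN x. (F x * g x + F' x * u x) * phi x)"
		using i by (subst Bochner_Integration.integral_add[symmetric]) (auto intro!: Bochner_Integration.integral_cong simp: algebra_simps)
	finally show "(LN x. F x * u x * ?D x) = - (LN x. (F x * g x + F' x * u x) * phi x)"
		by (simp add: mult_ac)
qed

text \<open>The chain rule needs no approximation of \<open>u\<close> by smooth functions: by the translation estimate, the
	quadratic Taylor remainder of the difference quotient is of order \<open>h\<close> in \<open>L\<^sup>1\<close>.\<close>

lemma weak_partial_chain:
	fixes F F' :: "real => real"
	assumes u: "u : L2" and g: "g : L2" and wp: "weak_partial e u g" and e: "e : Basis"
		and F: "!!s. (F has_real_derivative F' s) (at s)" and F0: "F 0 = 0"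
		and M: "!!s. \<bar>F' s\<bar> <= M" and lip: "!!s r. \<bar>F' s - F' r\<bar> <= \<bar>s - r\<bar>"
	shows "(%x. F (u x)) : L2" and "(%x. F' (u x) * g x) : L2"
		and "weak_partial e (%x. F (u x)) (%x. F' (u x) * g x)"
proof -
	have M0: "0 <= M" using M[of 0] by linarith
	have cF: "continuous_on UNIV F" using F by (meson DERIV_isCont continuous_at_imp_continuous_on)
	have cF': "continuous_on UNIV F'"
	proof -
		have "1-lipschitz_on UNIV F'" unfolding lipschitz_on_def using lip by (auto simp: dist_real_def)
		then show ?thesis by (rule lipschitz_on_continuous_on)
	qed
	have [measurable]: "F : BM" "F' : BM"
		using cF cF' by (auto intro: borel_measurable_continuous_onI)
	have mu[measurable]: "u : LM" and mg[measurable]: "g : LM"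
		using u g by (auto intro: L2_measurable)
	have FM: "\<bar>F s\<bar> <= M * \<bar>s\<bar>" for s
	proof -
		have "norm (F s - F 0) <= M * norm (s - 0)"
			by (rule field_differentiable_bound[of UNIV F F']) (use F M in auto)
		then show ?thesis by (simp add: F0)
	qed
	have mFu: "(%x. F (u x)) : LM" and mF'u: "(%x. F' (u x)) : LM"
		by measurable
	show FL: "(%x. F (u x)) : L2"
		by (rule L2_dominated(1)[OF u mFu, of M]) (use FM M0 in auto)
	have mFg: "(%x. F' (u x) * g x) : LM" using mF'u mg by (rule borel_measurable_times)
	show FgL: "(%x. F' (u x) * g x) : L2"
		by (rule L2_dominated(1)[OF g mFg, of M]) (use M M0 in "auto simp: abs_mult intro!: AE_I2 mult_right_mono")
	have taylor: "\<bar>F b - F a - F' a * (b - a)\<bar> <= (b - a)^2" for a b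
	proof -
		have "norm ((F b - F' a * b) - (F a - F' a * a)) <= \<bar>b - a\<bar> * norm (b - a)"
		proof (rule field_differentiable_bound[of "closed_segment a b" "%s. F s - F' a * s" "%s. F' s - F' a"])
			fix s assume s: "s : closed_segment a b"
			show "((%s. F s - F' a * s) has_field_derivative F' s - F' a) (at s within closed_segment a b)"
				by (auto intro!: derivative_eq_intros has_field_derivative_at_within[OF F])
			have "\<bar>s - a\<bar> <= \<bar>b - a\<bar>" using s by (auto simp: closed_segment_eq_real_ivl split: if_splits)
			then show "norm (F' s - F' a) <= \<bar>b - a\<bar>" using lip[of s a] by simp
		qed auto
		then show ?thesis by (simp add: power2_eq_square algebra_simps)
	qed
	show "weak_partial e (%x. F (u x)) (%x. F' (u x) * g x)"
		unfolding weak_partial_def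
	proof
		fix phi :: "'a => real" assume phi: "phi : test_functions UNIV"
		note tp = test_function_props[OF phi e] note tL = test_functions_L2[OF phi e]
		let ?D = "%x. pd phi x e"
		obtain N where N: "N > 0" "!!x. \<bar>phi x\<bar> <= N" using bounded_funE[OF tp(2)] by blast
		note mphi[measurable] = L2_measurable[OF tL(1)]
		obtain h :: "nat => real" where h: "!!n. 0 < h n" "!!n. h n <= 1" "h ----> 0"
			using null_step_sequence by auto
		define P where "P x = F' (u x) * phi x" for x
		have mP: "P : LM" unfolding P_def using mF'u mphi by (rule borel_measurable_times)
		have PL: "P : L2"
			by (rule L2_dominated(1)[OF tL(1) mP, of M]) (use M M0 in "auto simp: P_def abs_mult intro!: AE_I2 mult_right_mono")
		obtain C where C0: "C >= 0" and C: "!!s. 0 <= s ==> s <= 1 ==> L2_norm (%x. phi (x - s *R e) - phi x) <= C * s"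
			using dir_lipschitz_translation_norm[OF tp(1,3)] by auto
		\<comment> \<open>The translates of \<open>P = F'(u) phi\<close> need a rate in \<open>L2\<close>
		  before difference quotients of \<open>u\<close> may be paired with it. The change of
		  \<open>F'(u)\<close> is bounded by that of \<open>u\<close>, hence by \<open>g\<close>, and the
		  change of \<open>phi\<close> by \<open>C\<close>.\<close>
		have P_trans: "L2_norm (%x. P (x - s *R e) - P x) <= (N * L2_norm g + M * C) * s" if s: "0 <= s" "s <= 1" for s
		proof -
			let ?du = "%x. u (x - s *R e) - u x" and ?dp = "%x. phi (x - s *R e) - phi x"
			let ?A = "%x. (F' (u (x - s *R e)) - F' (u x)) * phi (x - s *R e)" and ?B = "%x. F' (u x) * ?dp x"
			have tr: "(%x. u (x - s *R e)) : L2" "(%x. phi (x - s *R e)) : L2"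
				using L2_translation(1)[OF u, of "- (s *R e)"] L2_translation(1)[OF tL(1), of "- (s *R e)"] by auto
			note [measurable] = tr[THEN L2_measurable]
			have duL: "?du : L2" and dpL: "?dp : L2" by (intro L2_diff tr u tL)+
			have mA: "?A : LM" by measurable
			have mB: "?B : LM" by measurable
			have "AL x. norm (?A x) <= N * norm (?du x)"
			proof (rule AE_I2)
				fix x
				have "\<bar>F' (u (x - s *R e)) - F' (u x)\<bar> * \<bar>phi (x - s *R e)\<bar> <= \<bar>u (x - s *R e) - u x\<bar> * N"
					by (intro mult_mono lip N) auto
				then show "norm (?A x) <= N * norm (?du x)" by (simp add: abs_mult mult.commute)
			qed
			note A = L2_dominated[OF duL mA this less_imp_le[OF N(1)]]
			have "AL x. norm (?B x) <= M * norm (?dp x)"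
				using M by (auto intro!: AE_I2 mult_right_mono simp: abs_mult)
			note B = L2_dominated[OF dpL mB this M0]
			have "L2_norm ?du = L2_norm (%x. - (u (x + s *R e) - u x))"
				using L2_translation(2)[OF duL, of "s *R e"] by simp
			also have "... <= s * L2_norm g"
				unfolding L2_norm_minus by (rule weak_partial_difference_norm[OF u g wp e s(1)])
			finally have du: "L2_norm ?du <= s * L2_norm g" .
			have "L2_norm (%x. P (x - s *R e) - P x) = L2_norm (%x. ?A x + ?B x)"
				by (simp add: P_def algebra_simps)
			also have "... <= L2_norm ?A + L2_norm ?B" by (rule L2_norm_triangle[OF A(1) B(1)])
			also have "... <= N * (s * L2_norm g) + M * (C * s)"
				using A(2) B(2) mult_left_mono[OF du, of N] mult_left_mono[OF C[OF s] M0] N(1) by linarith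
			finally show ?thesis by (simp add: algebra_simps)
		qed
		have lim1: "(%n. (LN x. P x * (u (x + h n *R e) - u x)) / h n) ----> (LN x. P x * g x)"
			by (rule weak_partial_difference_limit[OF u g wp e PL P_trans h])
		have lim2: "(%n. (LN x. phi x * (F (u (x + h n *R e)) - F (u x))) / h n) ----> - (LN x. F (u x) * ?D x)"
			using dir_lipschitz_difference_limit[OF FL tp(1,3,2) h] by (simp add: mult.commute)
		have rem: "\<bar>(LN x. phi x * (F (u (x + h n *R e)) - F (u x))) / h n - (LN x. P x * (u (x + h n *R e) - u x)) / h n\<bar>
			<= N * (L2_norm g)^2 * h n" for n
		proof -
			let ?d = "%x. u (x + h n *R e) - u x"
			have dL: "?d : L2" by (intro L2_diff L2_translation u)
			have FdL: "(%x. F (u (x + h n *R e)) - F (u x)) : L2" by (intro L2_diff L2_translation(1)[OF FL] FL)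
			note i = L2_mult_integrable[OF tL(1) FdL] L2_mult_integrable[OF PL dL]
			have "\<bar>(LN x. phi x * (F (u (x + h n *R e)) - F (u x))) - (LN x. P x * ?d x)\<bar>
				= \<bar>LN x. phi x * (F (u (x + h n *R e)) - F (u x)) - P x * ?d x\<bar>" using i by simp
			also have "... <= (LN x. \<bar>phi x * (F (u (x + h n *R e)) - F (u x)) - P x * ?d x\<bar>)"
				using integral_norm_bound[of lebesgue "%x. phi x * (F (u (x + h n *R e)) - F (u x)) - P x * ?d x"] by simp
			also have "... <= (LN x. N * (?d x)^2)"
			proof (rule integral_mono)
				show "LI (%x. \<bar>phi x * (F (u (x + h n *R e)) - F (u x)) - P x * ?d x\<bar>)"
					using i by (intro integrable_abs Bochner_Integration.integrable_diff)
				show "LI (%x. N * (?d x)^2)"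
					by (intro integrable_mult_right L2_real_integrable_sq dL)
				fix x
				have "phi x * (F (u (x + h n *R e)) - F (u x)) - P x * ?d x = phi x * (F (u (x + h n *R e)) - F (u x) - F' (u x) * ?d x)"
					by (simp add: P_def algebra_simps)
				also have "\<bar>\<dots>\<bar> <= N * (?d x)^2" unfolding abs_mult by (intro mult_mono N taylor) (use N in auto)
				finally show "\<bar>phi x * (F (u (x + h n *R e)) - F (u x)) - P x * ?d x\<bar> <= N * (?d x)^2" .
			qed
			also have "... = N * (L2_norm ?d)^2" unfolding L2_norm_sq by simp
			also have "... <= N * (h n * L2_norm g)^2"
				using weak_partial_difference_norm[OF u g wp e, of "h n"] h(1)[of n] N(1)
				by (intro mult_left_mono power_mono) auto
			finally have "\<bar>(LN x. phi x * (F (u (x + h n *R e)) - F (u x))) - (LN x. P x * ?d x)\<bar> <= (N * (L2_norm g)^2 * h n) * h n"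
				by (simp add: power2_eq_square algebra_simps)
			then show ?thesis using h(1)[of n] by (simp add: diff_divide_distrib[symmetric] abs_divide pos_divide_le_eq)
		qed
		have "(%n. (LN x. phi x * (F (u (x + h n *R e)) - F (u x))) / h n - (LN x. P x * (u (x + h n *R e) - u x)) / h n) ----> 0"
		proof (rule Lim_null_comparison)
			show "(%n. N * (L2_norm g)^2 * h n) ----> 0" using tendsto_mult_right_zero[OF h(3)] by simp
		qed (use rem in auto)
		from LIMSEQ_unique[OF this tendsto_diff[OF lim2 lim1]]
		have "(LN x. F (u x) * ?D x) = - (LN x. P x * g x)" by linarith
		then show "(LN x. F (u x) * ?D x) = - (LN x. F' (u x) * g x * phi x)"
			by (simp add: P_def mult_ac)
	qed
qed

subsection \<open>The Sobolev space and its gradient\<close>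

lemma H1_D:
	assumes "u : H1"
	shows "u : L2" "grad u : L2" "weak_gradient u (grad u)"
proof -
	show "u : L2" using assms by (simp add: H1_def)
	have "\<exists>g. g : L2 & weak_gradient u g" using assms by (auto simp: H1_def)
	from someI_ex[OF this] show "grad u : L2" "weak_gradient u (grad u)" by (auto simp: grad_def)
qed

lemma weak_gradient_unique:
	fixes u :: "'a::euclidean_space => real"
	assumes g: "g : L2" "weak_gradient u g" and h: "h : L2" "weak_gradient u h"
	shows "AL x. g x = h x"
proof -
	have "AL x. (g x - h x) \<bullet> e = 0" if e: "e : Basis" for e
	proof (rule fundamental_lemma)
		have L: "(%x. (g x - h x) \<bullet> e) : L2" by (intro L2_component L2_diff g h)
		then show "(%x. (g x - h x) \<bullet> e) : LM" by (rule L2_measurable)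
		show "LI (%x. (g x - h x) \<bullet> e * indicator (box a b) x)" for a b
			using L by (rule L2_locally_integrable)
		fix phi :: "'a => real" assume phi: "phi : test_functions UNIV"
		have i: "LI (%x. (g x \<bullet> e) * phi x)" "LI (%x. (h x \<bullet> e) * phi x)"
			by (intro L2_mult_integrable L2_component g h test_functions_L2[OF phi e])+
		have "(LN x. (g x \<bullet> e) * phi x) = (LN x. (h x \<bullet> e) * phi x)"
		proof -
			have "(LN x. u x * pd phi x e) = - (LN x. (g x \<bullet> e) * phi x)"
				using g(2) phi e by (simp add: weak_gradient_def)
			moreover have "(LN x. u x * pd phi x e) = - (LN x. (h x \<bullet> e) * phi x)"
				using h(2) phi e by (simp add: weak_gradient_def)
			ultimately show ?thesis by simp
		qed
		then show "(LN x. (g x - h x) \<bullet> e * phi x) = 0"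
			using i by (simp add: inner_diff_left left_diff_distrib)
	qed
	then have "AL x. \<forall>e\<in>Basis. (g x - h x) \<bullet> e = 0"
		by (intro AE_finite_allI) auto
	then show ?thesis
		by eventually_elim (auto simp: inner_diff_left intro: euclidean_eqI)
qed

lemma H1_I:
	assumes "u : L2" "g : L2" "weak_gradient u g"
	shows "u : H1" "AL x. grad u x = g x"
proof -
	show u: "u : H1" using assms by (auto simp: H1_def)
	show "AL x. grad u x = g x"
		by (rule weak_gradient_unique[OF H1_D(2,3)[OF u] assms(2,3)])
qed

lemma H1_lincomb:
	fixes u w :: "'a::euclidean_space => real"
	assumes u: "u : H1" and w: "w : H1"
	shows "(%x. a * u x + b * w x) : H1"
		and "AL x. grad (%x. a * u x + b * w x) x = a *R grad u x + b *R grad w x"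
proof -
	note U = H1_D[OF u] and W = H1_D[OF w]
	have 1: "(%x. a * u x + b * w x) : L2" using U W by auto
	have 2: "(%x. a *R grad u x + b *R grad w x) : L2" using U W by auto
	have 3: "weak_gradient (%x. a * u x + b * w x) (%x. a *R grad u x + b *R grad w x)"
		unfolding weak_gradient_def
	proof (intro ballI)
		fix phi :: "'a => real" and e :: 'a assume phi: "phi : test_functions UNIV" and e: "e : Basis"
		note t = test_functions_L2[OF phi e]
		let ?D = "%x. pd phi x e"
		note i = L2_mult_integrable[OF U(1) t(2)] L2_mult_integrable[OF W(1) t(2)]
			L2_mult_integrable[OF L2_component[OF U(2)] t(1), of e] L2_mult_integrable[OF L2_component[OF W(2)] t(1), of e]
		have eq: "(LN x. u x * ?D x) = - (LN x. (grad u x \<bullet> e) * phi x)"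
			"(LN x. w x * ?D x) = - (LN x. (grad w x \<bullet> e) * phi x)"
			using U(3) W(3) phi e by (auto simp: weak_gradient_def)
		have "(LN x. (a * u x + b * w x) * ?D x) = a * (LN x. u x * ?D x) + b * (LN x. w x * ?D x)"
			using i by (simp add: distrib_right mult.assoc)
		also have "... = - (a * (LN x. (grad u x \<bullet> e) * phi x) + b * (LN x. (grad w x \<bullet> e) * phi x))"
			unfolding eq by simp
		also have "a * (LN x. (grad u x \<bullet> e) * phi x) + b * (LN x. (grad w x \<bullet> e) * phi x)
				= (LN x. ((a *R grad u x + b *R grad w x) \<bullet> e) * phi x)"
			using i by (simp add: inner_add_left distrib_right mult.assoc)
		finally show "(LN x. (a * u x + b * w x) * ?D x) = - (LN x. ((a *R grad u x + b *R grad w x) \<bullet> e) * phi x)" .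
	qed
	show "(%x. a * u x + b * w x) : H1"
		and "AL x. grad (%x. a * u x + b * w x) x = a *R grad u x + b *R grad w x"
		using H1_I[OF 1 2 3] by auto
qed

lemma H1_diff: "u : H1 ==> w : H1 ==> (%x. u x - w x) : H1"
	and grad_diff: "u : H1 ==> w : H1 ==> AL x. grad (%x. u x - w x) x = grad u x - grad w x"
	using H1_lincomb[of u w 1 "-1"] by auto

lemma H1_cmult: "u : H1 ==> (%x. c * u x) : H1"
	and grad_cmult: "u : H1 ==> AL x. grad (%x. c * u x) x = c *R grad u x"
	using H1_lincomb[of u u c 0] by auto

lemma H1_zero: "(%x. 0) : H1" and grad_zero: "AL x. grad (%x. 0) x = 0"
	using H1_I[of "%x. 0" "%x. 0"] by (auto simp: weak_gradient_def)

lemma bounded_fun_component: "bounded_fun (%x. norm (G x)) ==> bounded_fun (%x. G x \<bullet> e)"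
proof -
	assume "bounded_fun (%x. norm (G x))"
	then obtain M where M: "M > 0" "!!x. \<bar>norm (G x)\<bar> <= M" using bounded_funE by blast
	have "\<bar>G x \<bullet> e\<bar> <= M * norm e" for x
		using M(2)[of x] by (intro order.trans[OF Cauchy_Schwarz_ineq2] mult_right_mono) auto
	then show ?thesis by (auto simp: bounded_fun_def)
qed

lemma H1_mult:
	fixes u F :: "'a::euclidean_space => real"
	assumes u: "u : H1" and F: "!!e. e : Basis ==> dir_lipschitz e F (%x. G x \<bullet> e)" "bounded_fun F"
		and G: "G : LM" "bounded_fun (%x. norm (G x))"
	shows "(%x. F x * u x) : H1"
		and "AL x. grad (%x. F x * u x) x = F x *R grad u x + u x *R G x"
proof -
	note U = H1_D[OF u]
	note [measurable] = U(1,2)[THEN L2_measurable] G(1)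
	obtain e0 :: 'a where e0: "e0 : Basis" using nonempty_Basis by blast
	have [measurable]: "F : LM" using F(1)[OF e0] by (rule dir_lipschitz_measurable)
	obtain M where M: "M > 0" "!!x. \<bar>F x\<bar> <= M" using bounded_funE[OF F(2)] by blast
	obtain N where N: "N > 0" "!!x. \<bar>norm (G x)\<bar> <= N" using bounded_funE[OF G(2)] by blast
	have 1: "(%x. F x * u x) : L2"
		by (rule L2_dominated(1)[OF U(1), of _ M]) (use M in "auto simp: abs_mult intro!: AE_I2 mult_right_mono")
	have "(%x. F x *R grad u x) : L2"
		by (rule L2_dominated(1)[OF U(2), of _ M]) (use M in "auto simp: abs_mult intro!: AE_I2 mult_right_mono")
	moreover have "(%x. u x *R G x) : L2"
		by (rule L2_dominated(1)[OF U(1), of _ N]) (use N in "auto simp: mult.commute[of N] intro!: AE_I2 mult_left_mono")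
	ultimately have 2: "(%x. F x *R grad u x + u x *R G x) : L2" by (rule L2_add)
	have 3: "weak_gradient (%x. F x * u x) (%x. F x *R grad u x + u x *R G x)"
		unfolding weak_gradient_iff
	proof
		fix e :: 'a assume e: "e : Basis"
		have "weak_partial e (%x. F x * u x) (%x. F x * (grad u x \<bullet> e) + (G x \<bullet> e) * u x)"
			by (rule weak_partial_mult[OF U(1) L2_component[OF U(2)] _ e F(1)[OF e] F(2)])
				(use U(3) e G(2) in "auto simp: weak_gradient_iff intro: bounded_fun_component")
		then show "weak_partial e (%x. F x * u x) (%x. (F x *R grad u x + u x *R G x) \<bullet> e)"
			by (simp add: inner_add_left mult.commute)
	qed
	show "(%x. F x * u x) : H1"
		and "AL x. grad (%x. F x * u x) x = F x *R grad u x + u x *R G x"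
		using H1_I[OF 1 2 3] by auto
qed

lemma H1_chain:
	fixes u :: "'a::euclidean_space => real" and F F' :: "real => real"
	assumes u: "u : H1"
		and F: "!!s. (F has_real_derivative F' s) (at s)" "F 0 = 0"
		and M: "!!s. \<bar>F' s\<bar> <= M" and lip: "!!s r. \<bar>F' s - F' r\<bar> <= \<bar>s - r\<bar>"
	shows "(%x. F (u x)) : H1"
		and "AL x. grad (%x. F (u x)) x = F' (u x) *R grad u x"
proof -
	note U = H1_D[OF u]
	have wp: "weak_partial e u (%x. grad u x \<bullet> e)" if "e : Basis" for e
		using U(3) that by (simp add: weak_gradient_iff)
	note ch = weak_partial_chain[OF U(1) L2_component[OF U(2)] wp _ F M lip]
	obtain e0 :: 'a where e0: "e0 : Basis" using nonempty_Basis by blast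
	have 1: "(%x. F (u x)) : L2" by (rule ch(1)[OF e0 e0])
	have "continuous_on UNIV F'"
	proof -
		have "1-lipschitz_on UNIV F'" unfolding lipschitz_on_def using lip by (auto simp: dist_real_def)
		then show ?thesis by (rule lipschitz_on_continuous_on)
	qed
	then have [measurable]: "F' : BM" by (rule borel_measurable_continuous_onI)
	note [measurable] = U(1,2)[THEN L2_measurable]
	have "0 <= M" using M[of 0] by linarith
	then have 2: "(%x. F' (u x) *R grad u x) : L2"
		by (intro L2_dominated(1)[OF U(2), of _ M]) (use M in "auto simp: abs_mult intro!: AE_I2 mult_right_mono")
	have 3: "weak_gradient (%x. F (u x)) (%x. F' (u x) *R grad u x)"
		unfolding weak_gradient_iff using ch(3) by simp
	show "(%x. F (u x)) : H1" and "AL x. grad (%x. F (u x)) x = F' (u x) *R grad u x"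
		using H1_I[OF 1 2 3] by auto
qed

lemma H1_lipschitz:
	fixes F :: "'a::euclidean_space => real"
	assumes F: "!!e. e : Basis ==> dir_lipschitz e F (%x. G x \<bullet> e)" "bounded_fun F" "bounded_support F"
		and G: "G : LM" "bounded_fun (%x. norm (G x))" "bounded_support (%x. norm (G x))"
	shows "F : H1" and "AL x. grad F x = G x"
proof -
	obtain e0 :: 'a where e0: "e0 : Basis" using nonempty_Basis by blast
	have mF: "F : LM" using F(1)[OF e0] by (rule dir_lipschitz_measurable)
	have 1: "F : L2" by (rule bounded_support_L2[OF mF F(2,3)])
	have mG: "(%x. norm (G x)) : LM" using G(1) by measurable
	have 2: "G : L2"
		by (rule L2_dominated(1)[OF bounded_support_L2[OF mG G(2,3)] G(1), of 1]) auto
	have 3: "weak_gradient F G"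
		unfolding weak_gradient_iff
		using weak_partial_dir_lipschitz[OF F(1) F(2) bounded_fun_component[OF G(2)]] by auto
	show "F : H1" "AL x. grad F x = G x" using H1_I[OF 1 2 3] by auto
qed

text \<open>Each component of \<open>V\<close> is differentiated only along its own direction, so
  the sum of the \<open>dV e\<close> is the divergence. A field whose tangential components jump at
  the interface is therefore admissible as long as its normal component does not.\<close>

lemma H1_divergence:
	fixes u :: "'a::euclidean_space => real" and V :: "'a => 'a"
	assumes u: "u : H1" and V: "!!e. e : Basis ==> dir_lipschitz e (%x. V x \<bullet> e) (dV e)"
			"!!e. e : Basis ==> bounded_fun (%x. V x \<bullet> e)" "!!e. e : Basis ==> bounded_support (%x. V x \<bullet> e)"
		and dV: "!!e. e : Basis ==> dV e : L2"
	shows "(LN x. V x \<bullet> grad u x) = - (LN x. (\<Sum>e\<in>Basis. dV e x) * u x)"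
proof -
	note U = H1_D[OF u]
	have VL: "(%x. V x \<bullet> e) : L2" if "e : Basis" for e
		by (rule bounded_support_L2[OF dir_lipschitz_measurable(1)[OF V(1)[OF that]] V(2,3)[OF that]])
	have "(LN x. V x \<bullet> grad u x) = (LN x. (\<Sum>e\<in>Basis. (V x \<bullet> e) * (grad u x \<bullet> e)))"
		by (subst euclidean_inner) simp
	also have "... = (\<Sum>e\<in>Basis. LN x. (V x \<bullet> e) * (grad u x \<bullet> e))"
		by (intro Bochner_Integration.integral_sum L2_mult_integrable VL L2_component U)
	also have "... = (\<Sum>e\<in>Basis. - (LN x. dV e x * u x))"
	proof (rule sum.cong[OF refl])
		fix e :: 'a assume e: "e : Basis"
		show "(LN x. (V x \<bullet> e) * (grad u x \<bullet> e)) = - (LN x. dV e x * u x)"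
			by (rule weak_partial_integration_by_parts[OF U(1) L2_component[OF U(2)] _ e V(1)[OF e] V(3)[OF e] V(2)[OF e]])
				(use U(3) e in "simp add: weak_gradient_iff")
	qed
	also have "... = - (LN x. (\<Sum>e\<in>Basis. dV e x * u x))"
		by (subst Bochner_Integration.integral_sum) (auto intro!: L2_mult_integrable dV U simp: sum_negf)
	finally show ?thesis by (simp add: sum_distrib_right)
qed

subsection \<open>Elliptic coefficients\<close>

text \<open>Only the action on vectors is recorded, so that \<open>\<gamma>\<close>, bounded
  entrywise, and the scalar background \<open>gamma0\<close> are treated alike.\<close>

definition elliptic :: "(real^3 => real^3^3) => real => real => bool" where
	"elliptic sig c K \<longleftrightarrow> c > 0 & K >= 0 \<and>
			(\<forall>g :: real^3 => real^3. g : LM --> (%x. sig x *v g x) : LM) \<and>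
			(AL x. \<forall>xi. norm (sig x *v xi) <= K * norm xi & c * (xi \<bullet> xi) <= (sig x *v xi) \<bullet> xi \<and>
				(\<forall>eta. (sig x *v xi) \<bullet> eta = (sig x *v eta) \<bullet> xi))"

lemma elliptic_L2:
	assumes "elliptic sig c K" "g : L2"
	shows "(%x. sig x *v g x) : L2" "L2_norm (%x. sig x *v g x) <= K * L2_norm g"
proof -
	have m: "(%x. sig x *v g x) : LM" and K: "0 <= K"
		and ae: "AL x. \<forall>xi. norm (sig x *v xi) <= K * norm xi"
		using assms L2_measurable[OF assms(2)] by (auto simp: elliptic_def elim: eventually_mono)
	have "AL x. norm (sig x *v g x) <= K * norm (g x)" using ae by eventually_elim blast
	from L2_dominated[OF assms(2) m this K]
	show "(%x. sig x *v g x) : L2" "L2_norm (%x. sig x *v g x) <= K * L2_norm g" .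
qed

lemma mat_vector_mult: "(mat k :: real^'n^'n) *v x = k *R x"
	by (simp add: vec_eq_iff matrix_vector_mult_def mat_def if_distrib[of "%z. z * _"] sum.delta cong: if_cong)

lemma borel_measurable_vec_iff:
	fixes g :: "'a => real^'n"
	shows "g : borel_measurable M \<longleftrightarrow> (\<forall>i. (%x. g x $ i) : borel_measurable M)"
	by (subst borel_measurable_euclidean_space) (auto simp: Basis_vec_def inner_axis)

lemma borel_measurable_matrix_vector:
	fixes sig :: "'a => real^'n^'m"
	assumes "!!i j. (%x. sig x $ i $ j) : borel_measurable M" "g : borel_measurable M"
	shows "(%x. sig x *v g x) : borel_measurable M"
proof (subst borel_measurable_vec_iff, intro allI)
	fix i
	have "!!j. (%x. g x $ j) : borel_measurable M" using assms(2) by (simp add: borel_measurable_vec_iff[of g])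
	then show "(%x. (sig x *v g x) $ i) : borel_measurable M"
		unfolding matrix_vector_mult_def vec_lambda_beta by (intro borel_measurable_sum borel_measurable_times assms(1))
qed

lemma norm_matrix_vector_le:
	fixes A :: "real^'n^'m"
	assumes "!!i j. \<bar>A $ i $ j\<bar> <= k i j"
	shows "norm (A *v xi) <= (\<Sum>i\<in>UNIV. \<Sum>j\<in>UNIV. k i j) * norm xi"
proof -
	have "norm (A *v xi) <= (\<Sum>i\<in>UNIV. \<bar>(A *v xi) $ i\<bar>)" by (rule norm_le_l1_cart)
	also have "... <= (\<Sum>i\<in>UNIV. \<Sum>j\<in>UNIV. k i j * norm xi)"
	proof (rule sum_mono)
		fix i
		have "\<bar>(A *v xi) $ i\<bar> <= (\<Sum>j\<in>UNIV. \<bar>A $ i $ j * xi $ j\<bar>)" by (simp add: matrix_vector_mult_def sum_abs)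
		also have "... <= (\<Sum>j\<in>UNIV. k i j * norm xi)"
			unfolding abs_mult using assms by (intro sum_mono mult_mono component_le_norm_cart) (auto intro: order.trans[OF abs_ge_zero])
		finally show "\<bar>(A *v xi) $ i\<bar> <= (\<Sum>j\<in>UNIV. k i j * norm xi)" .
	qed
	finally show ?thesis by (simp add: sum_distrib_right)
qed

lemma admissible_elliptic:
	assumes "admissible_medium gp gm D \<gamma>"
	shows "\<exists>c K. elliptic \<gamma> c K"
proof -
	have m: "!!i j. (%x. \<gamma> x $ i $ j) : LM" and k0: "\<forall>i j. \<exists>K. AL x. \<bar>\<gamma> x $ i $ j\<bar> <= K"
		and sym: "AL x. transpose (\<gamma> x) = \<gamma> x" and c0: "\<exists>c0>0. AL x. mat_le (mat c0) (\<gamma> x)"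
		using assms by (auto simp: admissible_medium_def)
	obtain c where c: "c > 0" "AL x. mat_le (mat c) (\<gamma> x)" using c0 by blast
	have "\<exists>k. \<forall>i j. AL x. \<bar>\<gamma> x $ i $ j\<bar> <= k i j" using k0 by (simp only: choice_iff)
	then obtain k where k: "!!i j. AL x. \<bar>\<gamma> x $ i $ j\<bar> <= k i j" by blast
	have "AL x. \<forall>i\<in>UNIV. \<forall>j\<in>UNIV. \<bar>\<gamma> x $ i $ j\<bar> <= k i j"
		using k by (intro AE_finite_allI) auto
	then have "AL x. \<forall>xi. norm (\<gamma> x *v xi) <= \<bar>\<Sum>i\<in>UNIV. \<Sum>j\<in>UNIV. k i j\<bar> * norm xi & c * (xi \<bullet> xi) <= (\<gamma> x *v xi) \<bullet> xi \<and>
				(\<forall>eta. (\<gamma> x *v xi) \<bullet> eta = (\<gamma> x *v eta) \<bullet> xi)"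
		using sym c(2)
	proof eventually_elim
		case (elim x)
		have 1: "norm (\<gamma> x *v xi) <= \<bar>\<Sum>i\<in>UNIV. \<Sum>j\<in>UNIV. k i j\<bar> * norm xi" for xi
			by (rule order.trans[OF norm_matrix_vector_le[of "\<gamma> x" k]]) (use elim(1) in "auto intro: mult_right_mono")
		have 2: "c * (xi \<bullet> xi) <= (\<gamma> x *v xi) \<bullet> xi" for xi
			using elim(3) by (simp add: mat_le_def mat_vector_mult inner_commute)
		have 3: "(\<gamma> x *v xi) \<bullet> eta = (\<gamma> x *v eta) \<bullet> xi" for xi eta
			using dot_lmul_matrix[of xi "transpose (\<gamma> x)" eta] elim(2)
			by (metis inner_commute transpose_matrix_vector)
		show ?case using 1 2 3 by blast
	qed
	moreover have "\<forall>g :: real^3 => real^3. g : LM --> (%x. \<gamma> x *v g x) : LM"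
		using borel_measurable_matrix_vector[OF m] by blast
	ultimately have "elliptic \<gamma> c \<bar>\<Sum>i\<in>UNIV. \<Sum>j\<in>UNIV. k i j\<bar>"
		unfolding elliptic_def using c(1) by simp
	then show ?thesis by blast
qed

definition layer :: "real => real => real^3 => real" where
	"layer gp gm x = (if x $ 3 > 0 then gp else gm)"

lemma gamma0_mult: "gamma0 gp gm x *v xi = layer gp gm x *R xi"
	by (simp add: gamma0_def layer_def mat_vector_mult)

lemma layer_measurable: "layer gp gm : BM"
proof -
	have "(%x::real^3. x $ 3) : BM"
		by (intro borel_measurable_continuous_onI continuous_intros)
	then show ?thesis unfolding layer_def[abs_def] by measurable
qed

lemma layer_bounds: "gp > 0 ==> gm > 0 ==> min gp gm <= layer gp gm x & layer gp gm x <= max gp gm & 0 < layer gp gm x"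
	by (auto simp: layer_def)

lemma gamma0_elliptic:
	assumes "gp > 0" "gm > 0"
	shows "elliptic (gamma0 gp gm) (min gp gm) (max gp gm)"
proof -
	have [measurable]: "layer gp gm : LM"
		by (intro borel_imp_lebesgue_measurable layer_measurable)
	have m: "(%x. gamma0 gp gm x *v g x) : LM"
		if [measurable]: "g : LM" for g :: "real^3 => real^3"
		unfolding gamma0_mult by measurable
	have "norm (gamma0 gp gm x *v xi) <= max gp gm * norm xi & min gp gm * (xi \<bullet> xi) <= (gamma0 gp gm x *v xi) \<bullet> xi \<and>
				(\<forall>eta. (gamma0 gp gm x *v xi) \<bullet> eta = (gamma0 gp gm x *v eta) \<bullet> xi)" for x xi
		unfolding gamma0_mult using layer_bounds[OF assms, of x]
		by (auto intro!: mult_right_mono simp: inner_commute simp del: max_less_iff_conj)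
	then show ?thesis unfolding elliptic_def using assms m by (auto simp: le_max_iff_disj)
qed

lemma energy_form_cong:
	assumes sig: "elliptic sig c K" and u: "u : H1" "AL x. grad u x = g x" "g : LM"
		and w: "w : H1" "AL x. grad w x = h x" "h : LM"
	shows "energy_form sig u w = (LN x. (sig x *v g x) \<bullet> h x)"
	unfolding energy_form_def
proof (rule integral_cong_AE)
	note m = H1_D(2)[OF u(1), THEN L2_measurable] H1_D(2)[OF w(1), THEN L2_measurable]
	have "(%x. sig x *v grad u x) : LM" "(%x. sig x *v g x) : LM"
		using sig m u(3) by (auto simp: elliptic_def)
	then show "(%x. (sig x *v grad u x) \<bullet> grad w x) : LM"
		"(%x. (sig x *v g x) \<bullet> h x) : LM"
		using m w(3) by auto
	show "AL x. (sig x *v grad u x) \<bullet> grad w x = (sig x *v g x) \<bullet> h x"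
		using u(2) w(2) by eventually_elim simp
qed

lemma energy_form_integrable:
	assumes sig: "elliptic sig c K" and u: "u : H1" and w: "w : H1"
	shows "LI (%x. (sig x *v grad u x) \<bullet> grad w x)"
	using L2_inner_integrable[OF elliptic_L2(1)[OF sig H1_D(2)[OF u]] H1_D(2)[OF w]] .

lemma energy_form_bound:
	assumes sig: "elliptic sig c K" and u: "u : H1" and w: "w : H1"
	shows "\<bar>energy_form sig u w\<bar> <= K * L2_norm (grad u) * L2_norm (grad w)"
proof -
	have "\<bar>energy_form sig u w\<bar> <= L2_norm (%x. sig x *v grad u x) * L2_norm (grad w)"
		unfolding energy_form_def by (intro L2_Cauchy_Schwarz elliptic_L2[OF sig] H1_D u w)
	also have "... <= K * L2_norm (grad u) * L2_norm (grad w)"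
		by (intro mult_right_mono elliptic_L2(2)[OF sig] H1_D u) auto
	finally show ?thesis .
qed

lemma energy_form_coercive:
	assumes sig: "elliptic sig c K" and u: "u : H1"
	shows "c * (L2_norm (grad u))^2 <= energy_form sig u u"
proof -
	have "c * (L2_norm (grad u))^2 = (LN x. c * (norm (grad u x))^2)" by (simp add: L2_norm_sq)
	also have "... <= energy_form sig u u"
		unfolding energy_form_def
	proof (rule integral_mono_AE)
		show "LI (%x. c * (norm (grad u x))^2)"
			using H1_D(2)[OF u] by (simp add: L2_def)
		show "LI (%x. (sig x *v grad u x) \<bullet> grad u x)" by (rule energy_form_integrable[OF sig u u])
		have "AL x. \<forall>xi. c * (xi \<bullet> xi) <= (sig x *v xi) \<bullet> xi"
			using sig by (auto simp: elliptic_def elim: eventually_mono)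
		then show "AL x. c * (norm (grad u x))^2 <= (sig x *v grad u x) \<bullet> grad u x"
			by eventually_elim (simp add: power2_norm_eq_inner)
	qed
	finally show ?thesis .
qed

lemma energy_form_sym:
	assumes sig: "elliptic sig c K" and u: "u : H1" and w: "w : H1"
	shows "energy_form sig u w = energy_form sig w u"
	unfolding energy_form_def
proof (rule integral_cong_AE)
	show "(%x. (sig x *v grad u x) \<bullet> grad w x) : LM" "(%x. (sig x *v grad w x) \<bullet> grad u x) : LM"
		using energy_form_integrable[OF sig] u w by auto
	have "AL x. \<forall>xi eta. (sig x *v xi) \<bullet> eta = (sig x *v eta) \<bullet> xi"
		using sig by (auto simp: elliptic_def elim: eventually_mono)
	then show "AL x. (sig x *v grad u x) \<bullet> grad w x = (sig x *v grad w x) \<bullet> grad u x"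
		by eventually_elim blast
qed

lemma energy_form_lincomb_right:
	assumes sig: "elliptic sig c K" and z: "z : H1" and u: "u : H1" and w: "w : H1"
	shows "energy_form sig z (%x. a * u x + b * w x) = a * energy_form sig z u + b * energy_form sig z w"
proof -
	note m = H1_D(2)[OF u, THEN L2_measurable] H1_D(2)[OF w, THEN L2_measurable] H1_D(2)[OF z, THEN L2_measurable]
	have "energy_form sig z (%x. a * u x + b * w x) = (LN x. (sig x *v grad z x) \<bullet> (a *R grad u x + b *R grad w x))"
		using m by (intro energy_form_cong[OF sig z _ _ H1_lincomb[OF u w]]) auto
	also have "... = (LN x. a * ((sig x *v grad z x) \<bullet> grad u x) + b * ((sig x *v grad z x) \<bullet> grad w x))"
		by (simp add: inner_add_right)
	also have "... = a * energy_form sig z u + b * energy_form sig z w"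
		using energy_form_integrable[OF sig z u] energy_form_integrable[OF sig z w] by (simp add: energy_form_def)
	finally show ?thesis .
qed

lemma energy_form_lincomb_left:
	assumes sig: "elliptic sig c K" and z: "z : H1" and u: "u : H1" and w: "w : H1"
	shows "energy_form sig (%x. a * u x + b * w x) z = a * energy_form sig u z + b * energy_form sig w z"
	using energy_form_lincomb_right[OF assms] energy_form_sym[OF sig z] u w H1_lincomb(1)[OF u w] by simp

subsection \<open>Comparison of the perturbed and the background energies\<close>

lemma elliptic_AE:
	assumes "elliptic sig c K"
	shows "AL x. \<forall>xi. norm (sig x *v xi) <= K * norm xi & c * (xi \<bullet> xi) <= (sig x *v xi) \<bullet> xi \<and>
				(\<forall>eta. (sig x *v xi) \<bullet> eta = (sig x *v eta) \<bullet> xi)"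
	using assms by (simp add: elliptic_def)

lemma elliptic_AE_bound: "elliptic sig c K ==> AL x. \<forall>xi. norm (sig x *v xi) <= K * norm xi"
	by (rule eventually_mono[OF elliptic_AE]) blast+

definition tau_norm :: "real => (real^3 => real) => real" where
	"tau_norm tau phi = L2_norm (grad phi) + tau * L2_norm phi"

definition grad_energy_on :: "(real^3) set => (real^3 => real) => real" where
	"grad_energy_on D v = (LN x. indicator D x * (norm (grad v x))^2)"

lemma integrable_grad_energy:
	assumes "v : H1" "D : sets lebesgue"
	shows "LI (%x. indicator D x * (norm (grad v x))^2)"
	using integrable_mult_indicator[OF assms(2) L2_integrable_norm[OF H1_D(2)[OF assms(1)]]] by simp

lemma grad_energy_le: "v : H1 ==> D : sets lebesgue ==> grad_energy_on D v <= (L2_norm (grad v))^2"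
	unfolding grad_energy_on_def L2_norm_sq
	using integrable_grad_energy L2_integrable_norm[OF H1_D(2)]
	by (intro integral_mono) (auto simp: indicator_def)

lemma grad_energy_nonneg: "0 <= grad_energy_on D v"
	unfolding grad_energy_on_def by (intro integral_nonneg_AE) auto

text \<open>The admissibility conditions are silent on the plane \<open>x $ 3 = 0\<close>, which is
  a null set.\<close>

lemma medium_AE:
	assumes adm: "admissible_medium gp gm D \<gamma>" and D: "D <= R3_minus"
	shows "AL x. x \<notin> D --> \<gamma> x = gamma0 gp gm x"
proof -
	have "negligible {x::real^3. x \<bullet> axis 3 1 = 0}"
		using negligible_standard_hyperplane[of "axis 3 (1::real) :: real^3" 0] by (simp add: axis_in_Basis_iff)
	then have "AL x. (x::real^3) $ 3 ~= 0"
		by (auto simp: negligible_iff_null_sets eventually_ae_filter inner_axis)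
	moreover have "AL x. x : R3_plus --> \<gamma> x = mat gp" "AL x. x : R3_minus - D --> \<gamma> x = mat gm"
		using adm by (auto simp: admissible_medium_def)
	ultimately show ?thesis
		by eventually_elim (auto simp: gamma0_def R3_plus_def R3_minus_def)
qed

context
	fixes gp gm :: real and D :: "(real^3) set" and \<gamma> :: "real^3 => real^3^3"
	assumes pos: "gp > 0" "gm > 0" and adm: "admissible_medium gp gm D \<gamma>"
		and D_minus: "D <= R3_minus" and D_meas: "D : sets lebesgue"
begin

text \<open>The two coefficients differ only in \<open>D\<close>, so one Cauchy-Schwarz factor is
  the gradient of \<open>v\<close> restricted to \<open>D\<close>. This is how the energy in
  \<open>D\<close> alone comes to control the scattered part \<open>e\<close>.\<close>

lemma contrast_integral_bound:
	assumes el: "elliptic \<gamma> c K" and v: "v : H1" and e: "e : H1"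
	shows "\<bar>energy_form \<gamma> v e - energy_form (gamma0 gp gm) v e\<bar>
		<= (K + max gp gm) * sqrt (grad_energy_on D v) * L2_norm (grad e)"
proof -
	note el0 = gamma0_elliptic[OF pos]
	note i = energy_form_integrable[OF el v e] energy_form_integrable[OF el0 v e]
	note mv = L2_measurable[OF H1_D(2)[OF v]]
	define K1 where "K1 = K + max gp gm"
	have K1: "0 <= K1" using el el0 by (auto simp: K1_def elliptic_def)
	let ?vD = "%x. indicator D x *R grad v x"
	have mD: "(indicator D :: _ => real) : LM" using D_meas by (intro borel_measurable_indicator)
	have mvD: "?vD : LM" using mD mv by (intro borel_measurable_scaleR)
	have vDL: "?vD : L2"
		by (rule L2_dominated(1)[OF H1_D(2)[OF v] mvD, of 1]) (auto simp: indicator_def)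
	have nvD: "L2_norm ?vD = sqrt (grad_energy_on D v)"
		unfolding L2_norm_def grad_energy_on_def
		by (intro arg_cong[where f = sqrt] Bochner_Integration.integral_cong) (auto simp: indicator_def)
	have ae: "AL x. \<bar>(\<gamma> x *v grad v x) \<bullet> grad e x - (gamma0 gp gm x *v grad v x) \<bullet> grad e x\<bar>
			<= K1 * (norm (?vD x) * norm (grad e x))"
	proof -
		have "AL x. \<forall>xi. norm (\<gamma> x *v xi) <= K * norm xi" "AL x. \<forall>xi. norm (gamma0 gp gm x *v xi) <= max gp gm * norm xi"
			by (rule elliptic_AE_bound[OF el], rule elliptic_AE_bound[OF el0])
		then show ?thesis using medium_AE[OF adm D_minus]
		proof eventually_elim
			case (elim x)
			show ?case
			proof (cases "x : D")
				case True
				have "\<bar>(\<gamma> x *v grad v x) \<bullet> grad e x - (gamma0 gp gm x *v grad v x) \<bullet> grad e x\<bar>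
						<= \<bar>(\<gamma> x *v grad v x) \<bullet> grad e x\<bar> + \<bar>(gamma0 gp gm x *v grad v x) \<bullet> grad e x\<bar>" by linarith
				also have "... <= norm (\<gamma> x *v grad v x) * norm (grad e x) + norm (gamma0 gp gm x *v grad v x) * norm (grad e x)"
					by (intro add_mono Cauchy_Schwarz_ineq2)
				also have "... <= (K * norm (grad v x)) * norm (grad e x) + (max gp gm * norm (grad v x)) * norm (grad e x)"
					using elim(1,2) by (intro add_mono mult_right_mono) auto
				finally show ?thesis using True by (simp add: K1_def algebra_simps)
			qed (use elim(3) in simp)
		qed
	qed
	have eq: "energy_form \<gamma> v e - energy_form (gamma0 gp gm) v e = (LN x. (\<gamma> x *v grad v x) \<bullet> grad e x - (gamma0 gp gm x *v grad v x) \<bullet> grad e x)"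
		unfolding energy_form_def using i by simp
	have "\<bar>energy_form \<gamma> v e - energy_form (gamma0 gp gm) v e\<bar> <= (LN x. \<bar>(\<gamma> x *v grad v x) \<bullet> grad e x - (gamma0 gp gm x *v grad v x) \<bullet> grad e x\<bar>)"
		unfolding eq
		by (rule integral_abs_bound)
	also have "... <= (LN x. K1 * (norm (?vD x) * norm (grad e x)))"
		by (intro integral_mono_AE ae integrable_abs Bochner_Integration.integrable_diff i integrable_mult_right
				L2_mult_integrable L2_norm_L2 vDL H1_D(2)[OF e])
	also have "... <= K1 * (L2_norm ?vD * L2_norm (grad e))"
		using mult_left_mono[OF L2_abs_integral_le[OF vDL H1_D(2)[OF e]] K1] by simp
	finally show ?thesis unfolding nvD K1_def by (simp add: mult.assoc)
qed

lemma contrast_diagonal_bound: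
	assumes el: "elliptic \<gamma> c K" and v: "v : H1"
	shows "\<bar>energy_form \<gamma> v v - energy_form (gamma0 gp gm) v v\<bar> <= (K + max gp gm) * grad_energy_on D v"
proof -
	note el0 = gamma0_elliptic[OF pos]
	note i = energy_form_integrable[OF el v v] energy_form_integrable[OF el0 v v]
	have ae: "AL x. \<bar>(\<gamma> x *v grad v x) \<bullet> grad v x - (gamma0 gp gm x *v grad v x) \<bullet> grad v x\<bar>
			<= (K + max gp gm) * (indicator D x * (norm (grad v x))^2)"
	proof -
		have "AL x. \<forall>xi. norm (\<gamma> x *v xi) <= K * norm xi" "AL x. \<forall>xi. norm (gamma0 gp gm x *v xi) <= max gp gm * norm xi"
			by (rule elliptic_AE_bound[OF el], rule elliptic_AE_bound[OF el0])
		then show ?thesis using medium_AE[OF adm D_minus]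
		proof eventually_elim
			case (elim x)
			show ?case
			proof (cases "x : D")
				case True
				have "\<bar>(\<gamma> x *v grad v x) \<bullet> grad v x - (gamma0 gp gm x *v grad v x) \<bullet> grad v x\<bar>
						<= \<bar>(\<gamma> x *v grad v x) \<bullet> grad v x\<bar> + \<bar>(gamma0 gp gm x *v grad v x) \<bullet> grad v x\<bar>" by linarith
				also have "... <= norm (\<gamma> x *v grad v x) * norm (grad v x) + norm (gamma0 gp gm x *v grad v x) * norm (grad v x)"
					by (intro add_mono Cauchy_Schwarz_ineq2)
				also have "... <= (K * norm (grad v x)) * norm (grad v x) + (max gp gm * norm (grad v x)) * norm (grad v x)"
					using elim(1,2) by (intro add_mono mult_right_mono) auto
				finally show ?thesis using True by (simp add: power2_eq_square algebra_simps)
			qed (use elim(3) in simp)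
		qed
	qed
	have eq: "energy_form \<gamma> v v - energy_form (gamma0 gp gm) v v = (LN x. (\<gamma> x *v grad v x) \<bullet> grad v x - (gamma0 gp gm x *v grad v x) \<bullet> grad v x)"
		unfolding energy_form_def using i by simp
	have "\<bar>energy_form \<gamma> v v - energy_form (gamma0 gp gm) v v\<bar> <= (LN x. \<bar>(\<gamma> x *v grad v x) \<bullet> grad v x - (gamma0 gp gm x *v grad v x) \<bullet> grad v x\<bar>)"
		unfolding eq
		by (rule integral_abs_bound)
	also have "... <= (LN x. (K + max gp gm) * (indicator D x * (norm (grad v x))^2))"
		by (intro integral_mono_AE ae integrable_abs Bochner_Integration.integrable_diff i integrable_mult_right
				integrable_grad_energy v D_meas)
	finally show ?thesis by (simp add: grad_energy_on_def)
qed

lemma contrast_lower_bound_minus: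
	assumes el: "elliptic \<gamma> c K" and M: "AL x. x : D --> mat_le (mat d) (mat gm - \<gamma> x)" and v: "v : H1"
	shows "d * grad_energy_on D v <= energy_form (gamma0 gp gm) v v - energy_form \<gamma> v v"
proof -
	note el0 = gamma0_elliptic[OF pos]
	note i = energy_form_integrable[OF el v v] energy_form_integrable[OF el0 v v]
	have "d * grad_energy_on D v = (LN x. d * (indicator D x * (norm (grad v x))^2))"
		by (simp add: grad_energy_on_def)
	also have "... <= (LN x. (gamma0 gp gm x *v grad v x) \<bullet> grad v x - (\<gamma> x *v grad v x) \<bullet> grad v x)"
	proof (rule integral_mono_AE)
		show "LI (%x. d * (indicator D x * (norm (grad v x))^2))"
			by (intro integrable_mult_right integrable_grad_energy v D_meas)
		show "LI (%x. (gamma0 gp gm x *v grad v x) \<bullet> grad v x - (\<gamma> x *v grad v x) \<bullet> grad v x)" using i by simp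
		show "AL x. d * (indicator D x * (norm (grad v x))^2) <= (gamma0 gp gm x *v grad v x) \<bullet> grad v x - (\<gamma> x *v grad v x) \<bullet> grad v x"
			using M medium_AE[OF adm D_minus]
		proof eventually_elim
			case (elim x)
			show ?case
			proof (cases "x : D")
				case True
				then have "layer gp gm x = gm" using D_minus by (auto simp: layer_def R3_minus_def)
				moreover have "grad v x \<bullet> (mat d *v grad v x) <= grad v x \<bullet> ((mat gm - \<gamma> x) *v grad v x)"
					using elim(1) True by (simp add: mat_le_def)
				ultimately show ?thesis using True
					by (simp add: gamma0_mult mat_vector_mult matrix_vector_mult_diff_rdistrib inner_diff_right power2_norm_eq_inner inner_commute)
			qed (use elim(2) in simp)
		qed
	qed
	finally show ?thesis using i by (simp add: energy_form_def)
qed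

text \<open>On \<open>D\<close> the integrand equals \<open>\<gamma> \<zeta> \<cdot> \<zeta> - 2 gm eta \<cdot> \<zeta> + gm |eta|\<^sup>2\<close> with \<open>\<zeta> = xi + eta\<close>; complete the square in \<open>\<zeta>\<close>.\<close>

lemma contrast_lower_bound_plus:
	assumes el: "elliptic \<gamma> c K" and M: "AL x. x : D --> mat_le (mat d) (\<gamma> x - mat gm)" and d: "d > 0"
		and v: "v : H1" and e: "e : H1"
	shows "gm * d / (gm + d) * grad_energy_on D v
		<= energy_form \<gamma> e e + 2 * (energy_form \<gamma> v e - energy_form (gamma0 gp gm) v e) + (energy_form \<gamma> v v - energy_form (gamma0 gp gm) v v)"
proof -
	note el0 = gamma0_elliptic[OF pos]
	note i = energy_form_integrable[OF el e e] energy_form_integrable[OF el v e] energy_form_integrable[OF el0 v e]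
		energy_form_integrable[OF el v v] energy_form_integrable[OF el0 v v]
	let ?k = "gm * d / (gm + d)"
	let ?R = "%x. (\<gamma> x *v grad e x) \<bullet> grad e x + 2 * ((\<gamma> x *v grad v x) \<bullet> grad e x - (gamma0 gp gm x *v grad v x) \<bullet> grad e x)
			+ ((\<gamma> x *v grad v x) \<bullet> grad v x - (gamma0 gp gm x *v grad v x) \<bullet> grad v x)"
	have "?k * grad_energy_on D v = (LN x. ?k * (indicator D x * (norm (grad v x))^2))"
		by (simp add: grad_energy_on_def)
	also have "... <= (LN x. ?R x)"
	proof (rule integral_mono_AE)
		show "LI (%x. ?k * (indicator D x * (norm (grad v x))^2))"
			by (intro integrable_mult_right integrable_grad_energy v D_meas)
		show "LI ?R" using i by simp
		have c: "c > 0" using el by (simp add: elliptic_def)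
		have "AL x. \<forall>xi. c * (xi \<bullet> xi) <= (\<gamma> x *v xi) \<bullet> xi & (\<forall>eta. (\<gamma> x *v xi) \<bullet> eta = (\<gamma> x *v eta) \<bullet> xi)"
			by (rule eventually_mono[OF elliptic_AE[OF el]]) blast
		then show "AL x. ?k * (indicator D x * (norm (grad v x))^2) <= ?R x"
			using M medium_AE[OF adm D_minus]
		proof eventually_elim
			case (elim x)
			define xi eta \<zeta> where "xi = grad e x" and "eta = grad v x" and "\<zeta> = grad e x + grad v x"
			show ?case
			proof (cases "x : D")
				case True
				then have l: "layer gp gm x = gm" using D_minus by (auto simp: layer_def R3_minus_def)
				have "\<zeta> \<bullet> (mat d *v \<zeta>) <= \<zeta> \<bullet> ((\<gamma> x - mat gm) *v \<zeta>)"
					using elim(2) True by (simp add: mat_le_def)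
				then have 1: "(gm + d) * (\<zeta> \<bullet> \<zeta>) <= (\<gamma> x *v \<zeta>) \<bullet> \<zeta>"
					by (simp add: mat_vector_mult matrix_vector_mult_diff_rdistrib inner_diff_right inner_commute algebra_simps)
				have "?R x = (\<gamma> x *v \<zeta>) \<bullet> \<zeta> - 2 * gm * (eta \<bullet> \<zeta>) + gm * (eta \<bullet> eta)"
					using elim(1) unfolding \<zeta>_def eta_def
					by (simp add: gamma0_mult l matrix_vector_right_distrib inner_add_left inner_add_right algebra_simps)
				also have "... >= (gm + d) * (\<zeta> \<bullet> \<zeta>) - 2 * gm * (eta \<bullet> \<zeta>) + gm * (eta \<bullet> eta)" using 1 by simp
				\<comment> \<open>The constant \<open>?k\<close> is \<open>gm - gm^2 / (gm + d)\<close>: what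
				  remains of the coefficient of \<open>eta\<close> once the completed square has taken its
				  share.\<close>
				also have "(gm + d) * (\<zeta> \<bullet> \<zeta>) - 2 * gm * (eta \<bullet> \<zeta>) + gm * (eta \<bullet> eta)
						= ?k * (eta \<bullet> eta) + (gm + d) * ((\<zeta> - (gm / (gm + d)) *R eta) \<bullet> (\<zeta> - (gm / (gm + d)) *R eta))"
				proof -
					define s where "s = gm + d"
					have s: "s > 0" "d = s - gm" using pos d by (auto simp: s_def)
					show ?thesis unfolding s_def[symmetric] unfolding s(2) using s(1)
						by (simp add: inner_diff_left inner_diff_right inner_commute field_simps power2_eq_square)
				qed
				also have "... >= ?k * (eta \<bullet> eta)" using pos d by simp
				finally show ?thesis using True by (simp add: eta_def power2_norm_eq_inner)
			next
				case False
				have "0 <= c * (grad e x \<bullet> grad e x)" using c by simp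
				also have "... <= (\<gamma> x *v grad e x) \<bullet> grad e x" using elim(1) by blast
				finally show ?thesis using False elim(3) by simp
			qed
		qed
	qed
	finally show ?thesis using i by (simp add: energy_form_def)
qed

text \<open>The equation is tested with \<open>v\<close> itself. The minimum with 1 weights the
  gradient and the zero-order part equally, and the factor 2 comes from the square of a sum of two
  terms.\<close>

lemma background_tau_norm:
	assumes v: "background_solution (gamma0 gp gm) f tau v" and f: "f : L2" and tau: "tau >= 1"
	shows "tau_norm tau v <= 2 / min 1 (min gp gm) * L2_norm f / tau"
proof -
	define m where "m = min 1 (min gp gm)"
	have m: "m > 0" "m <= 1" "m <= min gp gm" using pos by (auto simp: m_def)
	have vH: "v : H1" using v by (simp add: background_solution_def)
	have eq: "energy_form (gamma0 gp gm) v v + tau^2 * (LN x. v x * v x) = (LN x. f x * v x)"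
	proof -
		have "- energy_form (gamma0 gp gm) v v - tau^2 * (LN x. v x * v x) + (LN x. f x * v x) = 0"
			using v vH by (auto simp: background_solution_def)
		then show ?thesis by linarith
	qed
	have n2: "(LN x. v x * v x) = (L2_norm v)^2" unfolding L2_norm_sq by (simp add: power2_eq_square)
	let ?g = "L2_norm (grad v)" and ?n = "L2_norm v"
	have "m * ?g^2 <= min gp gm * ?g^2" using m by (intro mult_right_mono) auto
	also have "... <= energy_form (gamma0 gp gm) v v" by (rule energy_form_coercive[OF gamma0_elliptic[OF pos] vH])
	finally have a: "m * ?g^2 <= energy_form (gamma0 gp gm) v v" .
	have "m * (tau * ?n)^2 <= (tau * ?n)^2" using m by (simp add: mult_left_le_one_le)
	then have b: "m * (?g^2 + (tau * ?n)^2) <= (LN x. f x * v x)"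
		using a eq unfolding n2 by (simp add: power_mult_distrib algebra_simps)
	have "(LN x. f x * v x) <= L2_norm f * ?n"
		using L2_Cauchy_Schwarz_real[OF f H1_D(1)[OF vH]] by linarith
	also have "... <= L2_norm f * (tau_norm tau v / tau)"
		using tau by (intro mult_left_mono) (auto simp: tau_norm_def field_simps)
	finally have c: "m * (?g^2 + (tau * ?n)^2) <= L2_norm f * tau_norm tau v / tau" using b by simp
	have "(tau_norm tau v)^2 <= 2 * (?g^2 + (tau * ?n)^2)"
		using sum_squares_bound[of ?g "tau * ?n"] by (simp add: tau_norm_def power2_sum)
	then have "m * (tau_norm tau v)^2 <= m * (2 * (?g^2 + (tau * ?n)^2))" using m by (intro mult_left_mono) auto
	with c have "m * (tau_norm tau v)^2 <= 2 * (L2_norm f * tau_norm tau v / tau)" by linarith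
	then have *: "tau_norm tau v * (m * tau_norm tau v) <= tau_norm tau v * (2 * L2_norm f / tau)" by (simp add: power2_eq_square algebra_simps)
	have "m * tau_norm tau v <= 2 * L2_norm f / tau"
	proof (cases "tau_norm tau v > 0")
		case True from mult_left_le_imp_le[OF * True] show ?thesis .
	next
		case False
		moreover have "0 <= tau_norm tau v" using tau by (simp add: tau_norm_def)
		ultimately show ?thesis using tau by simp
	qed
	then have "tau_norm tau v <= (2 * L2_norm f / tau) / m" using m(1) by (simp only: pos_le_divide_eq mult.commute)
	also have "... = 2 / m * L2_norm f / tau" by simp
	finally show ?thesis unfolding m_def .
qed

text \<open>Let \<open>e = w - v\<close>, let \<open>Q\<close> be its energy including the
  \<open>tau^2\<close> term, let \<open>P\<close> and \<open>S\<close> be the contrast forms at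
  \<open>(v, v)\<close> and \<open>(v, e)\<close>, and let \<open>rho\<close> be the residual of
  \<open>w\<close>. Testing with \<open>e\<close> and \<open>v\<close> gives
  \<open>Q = - S + rho e\<close> and \<open>I = - P - S + rho v\<close>. Eliminating
  \<open>S\<close> gives \<open>I = - P + Q + rho v - rho e\<close>, used for the upper bound and
  for negative contrast, where \<open>- P\<close> controls \<open>X\<close>. Completing with
  \<open>Q\<close> gives \<open>- I = Q + 2 S + P - rho v - rho e\<close>, used for positive
  contrast, where the first three terms are estimated together.\<close>

lemma perturbation_estimates:
	assumes el: "elliptic \<gamma> c K" and f: "f : L2"
	obtains C where "C > 0"
		"!!tau v w eps. tau >= 1 ==> background_solution (gamma0 gp gm) f tau v ==> w : H1 ==> 0 <= eps ==>
			(!!phi. phi : H1 ==> \<bar>energy_form \<gamma> w phi + tau^2 * (LN x. w x * phi x) - (LN x. f x * phi x)\<bar> <= eps * tau_norm tau phi) ==>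
			\<bar>LN x. f x * (w x - v x)\<bar> <= C * (grad_energy_on D v + eps / tau + eps^2) \<and>
			(\<forall>d>0. (AL x. x : D --> mat_le (mat d) (\<gamma> x - mat gm)) \<longrightarrow>
				gm * d / (gm + d) * grad_energy_on D v - C * (eps / tau + eps^2) <= - (LN x. f x * (w x - v x))) \<and>
			(\<forall>d. (AL x. x : D --> mat_le (mat d) (mat gm - \<gamma> x)) \<longrightarrow>
				d * grad_energy_on D v - C * (eps / tau + eps^2) <= (LN x. f x * (w x - v x)))"
proof -
	have c0: "c > 0" "K >= 0" using el by (auto simp: elliptic_def)
	define K1 where "K1 = K + max gp gm"
	define m where "m = min 1 c"
	define A where "A = 2 / m"
	define F where "F = 2 / min 1 (min gp gm) * L2_norm f"
	have m: "m > 0" "m <= 1" "m <= c" using c0 by (auto simp: m_def)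
	have K1: "K1 >= 0" using c0 pos by (simp add: K1_def)
	have A: "A > 0" using m by (simp add: A_def)
	have F: "F >= 0" using pos by (simp add: F_def)
	have nn: "0 <= A * K1^2" "0 <= A * K1 * F" using A K1 F by auto
	define C where "C = K1 + 2 * A * K1^2 + A * K1 * F + 3 * A + F + 1"
	have Cpos: "C > 0" using K1 A F nn unfolding C_def by linarith
	show ?thesis
	proof (rule that[OF Cpos], goal_cases)
		case (1 tau v w eps)
		note tau = 1(1) and v = 1(2) and w = 1(3) and eps = 1(4) and r = 1(5)
		have vH: "v : H1" using v by (simp add: background_solution_def)
		have veq: "energy_form (gamma0 gp gm) v phi + tau^2 * (LN x. v x * phi x) = (LN x. f x * phi x)" if "phi : H1" for phi
		proof -
			have "- energy_form (gamma0 gp gm) v phi - tau^2 * (LN x. v x * phi x) + (LN x. f x * phi x) = 0"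
				using v that by (auto simp: background_solution_def)
			then show ?thesis by linarith
		qed
		define e where "e = (%x. w x - v x)"
		have eH: "e : H1" unfolding e_def by (rule H1_diff[OF w vH])
		define rho where "rho phi = energy_form \<gamma> w phi + tau^2 * (LN x. w x * phi x) - (LN x. f x * phi x)" for phi
		define X where "X = grad_energy_on D v"
		define P where "P = energy_form \<gamma> v v - energy_form (gamma0 gp gm) v v"
		define S where "S = energy_form \<gamma> v e - energy_form (gamma0 gp gm) v e"
		define Q where "Q = energy_form \<gamma> e e + tau^2 * (L2_norm e)^2"
		define I where "I = (LN x. f x * (w x - v x))"
		have eeq: "energy_form \<gamma> e phi + tau^2 * (LN x. e x * phi x) = energy_form (gamma0 gp gm) v phi - energy_form \<gamma> v phi + rho phi" if phi: "phi : H1" for phi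
		proof -
			have 1: "energy_form \<gamma> e phi = energy_form \<gamma> w phi - energy_form \<gamma> v phi"
				using energy_form_lincomb_left[OF el phi w vH, of 1 "-1"] by (simp add: e_def)
			have 2: "(LN x. e x * phi x) = (LN x. w x * phi x) - (LN x. v x * phi x)"
				using L2_mult_integrable[OF H1_D(1)[OF w] H1_D(1)[OF phi]] L2_mult_integrable[OF H1_D(1)[OF vH] H1_D(1)[OF phi]]
				by (simp add: e_def left_diff_distrib)
			show ?thesis using veq[OF phi] unfolding 1 2 rho_def by (simp add: algebra_simps)
		qed
		have ee: "(LN x. e x * e x) = (L2_norm e)^2" unfolding L2_norm_sq by (simp add: power2_eq_square)
		have E1: "Q = - S + rho e" using eeq[OF eH] unfolding Q_def S_def ee by simp
		have E2: "energy_form \<gamma> e v + tau^2 * (LN x. e x * v x) = - P + rho v" using eeq[OF vH] unfolding P_def by simp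
		have E3: "I = energy_form (gamma0 gp gm) v e + tau^2 * (LN x. e x * v x)"
			using veq[OF eH] unfolding I_def e_def by (simp add: mult.commute)
		have E4: "I = - P - S + rho v"
			using E2 E3 energy_form_sym[OF el vH eH] unfolding S_def by simp
		have N0: "0 <= tau_norm tau phi" for phi using tau by (simp add: tau_norm_def)
		have rb: "\<bar>rho phi\<bar> <= eps * tau_norm tau phi" if "phi : H1" for phi using r[OF that] by (simp add: rho_def)
		have X0: "X >= 0" unfolding X_def by (rule grad_energy_nonneg)
		have Pb: "\<bar>P\<bar> <= K1 * X" unfolding P_def X_def K1_def by (rule contrast_diagonal_bound[OF el vH])
		have ge: "L2_norm (grad e) <= tau_norm tau e" using tau by (simp add: tau_norm_def)
		have "\<bar>S\<bar> <= K1 * sqrt X * L2_norm (grad e)" unfolding S_def X_def K1_def by (rule contrast_integral_bound[OF el vH eH])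
		also have "... <= K1 * sqrt X * tau_norm tau e" using K1 X0 ge by (intro mult_left_mono) auto
		finally have Sb: "\<bar>S\<bar> <= K1 * sqrt X * tau_norm tau e" .
		have "m * (L2_norm (grad e))^2 <= c * (L2_norm (grad e))^2" using m by (intro mult_right_mono) auto
		moreover have "... <= energy_form \<gamma> e e" by (rule energy_form_coercive[OF el eH])
		moreover have "m * (tau * L2_norm e)^2 <= (tau * L2_norm e)^2" using m by (simp add: mult_left_le_one_le)
		ultimately have "m * ((L2_norm (grad e))^2 + (tau * L2_norm e)^2) <= Q"
			unfolding Q_def by (simp add: power_mult_distrib algebra_simps)
		moreover have "(tau_norm tau e)^2 <= 2 * ((L2_norm (grad e))^2 + (tau * L2_norm e)^2)"
			using sum_squares_bound[of "L2_norm (grad e)" "tau * L2_norm e"] by (simp add: tau_norm_def power2_sum)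
		ultimately have NQ: "(tau_norm tau e)^2 <= A * Q"
		proof -
			assume a: "m * ((L2_norm (grad e))^2 + (tau * L2_norm e)^2) <= Q"
				and b: "(tau_norm tau e)^2 <= 2 * ((L2_norm (grad e))^2 + (tau * L2_norm e)^2)"
			have "A * (m * ((L2_norm (grad e))^2 + (tau * L2_norm e)^2)) <= A * Q"
				using a A by (intro mult_left_mono) auto
			moreover have "A * (m * z) = 2 * z" for z using m(1) by (simp add: A_def)
			ultimately show ?thesis using b by simp
		qed
		have Q0: "Q >= 0"
		proof -
			have "0 <= c * (L2_norm (grad e))^2" using c0 by simp
			then have "0 <= energy_form \<gamma> e e" using energy_form_coercive[OF el eH] by linarith
			then show ?thesis by (simp add: Q_def)
		qed
		have QN: "Q <= (K1 * sqrt X + eps) * tau_norm tau e" using E1 Sb rb[OF eH] by (simp add: algebra_simps)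
		have Nb: "tau_norm tau e <= A * (K1 * sqrt X + eps)"
		proof (cases "tau_norm tau e = 0")
			case True then show ?thesis using A K1 X0 eps by simp
		next
			case False
			have "tau_norm tau e * tau_norm tau e <= A * ((K1 * sqrt X + eps) * tau_norm tau e)"
				using NQ mult_left_mono[OF QN less_imp_le[OF A]] by (simp add: power2_eq_square)
			then have "tau_norm tau e * tau_norm tau e <= tau_norm tau e * (A * (K1 * sqrt X + eps))" by (simp add: algebra_simps)
			then show ?thesis using False N0[of e] by (simp add: less_le)
		qed
		define s where "s = sqrt X"
		have s0: "s >= 0" and sX: "s * s = X" using X0 by (auto simp: s_def)
		have vN: "tau_norm tau v <= F / tau" using background_tau_norm[OF v f tau] by (simp add: F_def)
		\<comment> \<open>Since \<open>sqrt X\<close> is itself of order \<open>1 / tau\<close>, the mixed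
		  term \<open>eps * sqrt X\<close> in the bound of \<open>rho e\<close> is absorbed into
		  \<open>eps / tau\<close>.\<close>
		have sF: "s <= F / tau"
		proof -
			have "X <= (L2_norm (grad v))^2" unfolding X_def by (rule grad_energy_le[OF vH D_meas])
			then have "s <= L2_norm (grad v)" unfolding s_def by (simp add: real_le_lsqrt)
			also have "... <= tau_norm tau v" using tau by (simp add: tau_norm_def)
			finally show ?thesis using vN by linarith
		qed
		have rv: "\<bar>rho v\<bar> <= F * (eps / tau)"
			using rb[OF vH] mult_left_mono[OF vN eps] by (simp add: algebra_simps)
		have re: "\<bar>rho e\<bar> <= A * K1 * F * (eps / tau) + A * eps^2"
		proof -
			have "\<bar>rho e\<bar> <= eps * (A * (K1 * s + eps))"
				using rb[OF eH] mult_left_mono[OF Nb eps] unfolding s_def by linarith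
			also have "... = A * K1 * eps * s + A * eps^2" by (simp add: algebra_simps power2_eq_square)
			also have "... <= A * K1 * eps * (F / tau) + A * eps^2" using sF A K1 eps by (intro add_right_mono mult_left_mono) auto
			finally show ?thesis by (simp add: algebra_simps)
		qed
		have Qb: "Q <= 2 * A * K1^2 * X + 2 * A * eps^2"
		proof -
			have "Q <= (K1 * s + eps) * (A * (K1 * s + eps))"
				using QN mult_left_mono[OF Nb, of "K1 * s + eps"] K1 s0 eps unfolding s_def by auto
			also have "... = A * (K1 * s + eps)^2" by (simp add: power2_eq_square algebra_simps)
			also have "... <= A * (2 * (K1 * s)^2 + 2 * eps^2)"
				using A sum_squares_bound[of "K1 * s" eps] by (intro mult_left_mono) (auto simp: power2_sum)
			finally show ?thesis using sX by (simp add: algebra_simps power2_eq_square)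
		qed
		have et: "0 <= eps / tau" using eps tau by simp
		have e2: "0 <= eps^2" by simp
		have small: "\<bar>rho v\<bar> + \<bar>rho e\<bar> <= C * (eps / tau + eps^2)"
		proof -
			have "F * (eps / tau) + A * K1 * F * (eps / tau) + A * eps^2 <= C * (eps / tau) + C * eps^2"
			proof -
				have "F + A * K1 * F <= C" "A <= C"
					using K1 A F nn unfolding C_def by linarith+
				from mult_right_mono[OF this(1) et] mult_right_mono[OF this(2) e2] show ?thesis by (simp add: algebra_simps)
			qed
			then show ?thesis using rv re by (simp add: algebra_simps)
		qed
		have up: "\<bar>I\<bar> <= C * (X + eps / tau + eps^2)"
		proof -
			have "I = - P + Q + rho v - rho e" using E4 E1 by simp
			then have "\<bar>I\<bar> <= K1 * X + (2 * A * K1^2 * X + 2 * A * eps^2) + F * (eps / tau) + (A * K1 * F * (eps / tau) + A * eps^2)"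
				using Pb Qb Q0 rv re by linarith
			also have "... = (K1 + 2 * A * K1^2) * X + (F + A * K1 * F) * (eps / tau) + (3 * A) * eps^2" by (simp add: algebra_simps)
			also have "... <= C * X + C * (eps / tau) + C * eps^2"
			proof -
				have "K1 + 2 * A * K1^2 <= C" "F + A * K1 * F <= C" "3 * A <= C"
					using K1 A F nn unfolding C_def by linarith+
				from mult_right_mono[OF this(1) X0] mult_right_mono[OF this(2) et] mult_right_mono[OF this(3) e2] show ?thesis by linarith
			qed
			finally show ?thesis by (simp add: algebra_simps)
		qed
		have plus: "gm * d / (gm + d) * X - C * (eps / tau + eps^2) <= - I"
			if d: "d > 0" "AL x. x : D --> mat_le (mat d) (\<gamma> x - mat gm)" for d
		proof -
			have "gm * d / (gm + d) * X <= energy_form \<gamma> e e + 2 * S + P"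
				unfolding X_def S_def P_def by (rule contrast_lower_bound_plus[OF el d(2,1) vH eH])
			also have "... <= Q + 2 * S + P" unfolding Q_def by simp
			also have "... = - I + rho v + rho e" using E4 E1 by simp
			finally show ?thesis using small by linarith
		qed
		have minus: "d * X - C * (eps / tau + eps^2) <= I"
			if d: "AL x. x : D --> mat_le (mat d) (mat gm - \<gamma> x)" for d
		proof -
			have "d * X <= - P" using contrast_lower_bound_minus[OF el d vH] unfolding X_def P_def by simp
			moreover have "I = - P + Q + rho v - rho e" using E4 E1 by simp
			ultimately show ?thesis using small Q0 by linarith
		qed
		show ?case using up plus minus unfolding I_def X_def by blast
	qed
qed

end

subsection \<open>Positivity\<close>

lemma min_sq_deriv: "((%s::real. (min s 0)^2) has_real_derivative 2 * min s 0) (at s)"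
proof -
	consider "s > 0" | "s < 0" | "s = 0" by linarith
	then show ?thesis
	proof cases
		case 1
		have "((%s::real. 0) has_real_derivative 0) (at s)" by simp
		then show ?thesis
			by (rule has_field_derivative_transform_within_open[of _ _ _ "{0<..}", THEN DERIV_cong]) (use 1 in auto)
	next
		case 2
		have "((%s::real. s^2) has_real_derivative 2 * s) (at s)" by (auto intro!: derivative_eq_intros)
		then show ?thesis
			by (rule has_field_derivative_transform_within_open[of _ _ _ "{..<0}", THEN DERIV_cong]) (use 2 in auto)
	next
		case 3
		have "((%h. ((min (0 + h) 0)^2 - (min 0 0)^2) / h) ---> 0) (at (0::real))"
		proof (rule Lim_null_comparison)
			show "((%h::real. \<bar>h\<bar>) ---> 0) (at 0)" by (auto intro!: tendsto_eq_intros)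
			show "\<forall>\<^sub>F h in at (0::real). norm (((min (0 + h) 0)^2 - (min 0 0)^2) / h) <= \<bar>h\<bar>"
				by (rule always_eventually) (auto simp: min_def power2_eq_square abs_mult)
		qed
		then show ?thesis using 3 by (simp add: DERIV_def)
	qed
qed

text \<open>A \<open>C\<^sup>1\<close> substitute for the negative part, so that the chain rule applies.\<close>

definition neg_trunc :: "real => real" where "neg_trunc s = 1 - sqrt (1 + (min s 0)^2)"
definition neg_trunc' :: "real => real" where "neg_trunc' s = - min s 0 / sqrt (1 + (min s 0)^2)"

lemma one_plus_sq_pos: "0 < 1 + (t::real)^2"
	by (rule add_pos_nonneg) auto

lemma neg_trunc_deriv: "(neg_trunc has_real_derivative neg_trunc' s) (at s)"
proof -
	have h: "((%s::real. 1 + (min s 0)^2) has_real_derivative 2 * min s 0) (at s)"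
		by (rule DERIV_cong[OF DERIV_add[OF DERIV_const min_sq_deriv]]) (rule add_0)
	have "((%s. sqrt (1 + (min s 0)^2)) has_real_derivative inverse (sqrt (1 + (min s 0)^2)) / 2 * (2 * min s 0)) (at s)"
		by (rule DERIV_chain2[OF DERIV_real_sqrt[OF one_plus_sq_pos] h])
	note D = DERIV_diff[OF DERIV_const this, of 1]
	have "0 - inverse q / 2 * (2 * t) = - t / q" for q t :: real by (simp add: inverse_eq_divide)
	from DERIV_cong[OF D this] show ?thesis unfolding neg_trunc_def[abs_def] neg_trunc'_def by assumption
qed

lemma neg_trunc_props:
	"neg_trunc 0 = 0" "0 <= neg_trunc' s" "\<bar>neg_trunc' s\<bar> <= 1" "neg_trunc s <= 0" "0 <= s * neg_trunc s"
	"s * neg_trunc s = 0 ==> 0 <= s"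
proof -
	show "neg_trunc 0 = 0" by (simp add: neg_trunc_def)
	show "0 <= neg_trunc' s" unfolding neg_trunc'_def by (rule divide_nonneg_nonneg) auto
	have "\<bar>min s 0\<bar> <= sqrt (1 + (min s 0)^2)" by (rule real_le_rsqrt) simp
	then have "\<bar>- min s 0\<bar> / sqrt (1 + (min s 0)^2) <= 1"
		using one_plus_sq_pos[of "min s 0"] by (subst pos_divide_le_eq) auto
	then show "\<bar>neg_trunc' s\<bar> <= 1" unfolding neg_trunc'_def abs_divide by simp
	show le: "neg_trunc s <= 0" by (simp add: neg_trunc_def)
	show "0 <= s * neg_trunc s"
		by (cases "s >= 0") (auto simp: neg_trunc_def min_def mult_nonpos_nonpos)
	show "0 <= s" if "s * neg_trunc s = 0"
	proof (rule ccontr)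
		assume "\<not> 0 <= s"
		then have "neg_trunc s < 0" by (simp add: neg_trunc_def)
		then show False using that \<open>\<not> 0 <= s\<close> by simp
	qed
qed

text \<open>The derivative of \<open>t / sqrt (1 + t^2)\<close> is the power \<open>-3/2\<close> of
  \<open>1 + t^2\<close>, hence at most 1, and truncation at 0 does not increase distances. The
  constant 1 is the one demanded by the chain rule.\<close>

lemma neg_trunc'_lipschitz: "\<bar>neg_trunc' s - neg_trunc' r\<bar> <= \<bar>s - r\<bar>"
proof -
	define g where "g t = t / sqrt (1 + t^2)" for t :: real
	note pos = one_plus_sq_pos
	have "(g has_real_derivative 1 / ((1 + t^2) * sqrt (1 + t^2))) (at t)" for t
	proof -
		define q where "q = sqrt (1 + t^2)"
		have q: "q > 0" "q * q = 1 + t * t" using pos[of t] by (auto simp: q_def power2_eq_square)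
		have "((%t::real. 1 + t^2) has_real_derivative 2 * t) (at t)" by (auto intro!: derivative_eq_intros)
		from DERIV_chain2[OF DERIV_real_sqrt[OF pos] this]
		have "((%t. sqrt (1 + t^2)) has_real_derivative inverse q / 2 * (2 * t)) (at t)" by (simp add: q_def)
		from DERIV_divide[OF DERIV_ident this] q(1)
		have "(g has_real_derivative (1 * q - t * (inverse q / 2 * (2 * t))) / (q * q)) (at t)"
			unfolding g_def q_def by simp
		moreover have "(1 * q - t * (inverse q / 2 * (2 * t))) / (q * q) = 1 / ((1 + t * t) * q)"
		proof -
			have "1 * q - t * (inverse q / 2 * (2 * t)) = (q * q - t * t) / q" using q(1) by (simp add: field_simps)
			then show ?thesis using q by simp
		qed
		ultimately show ?thesis by (simp add: q_def power2_eq_square)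
	qed
	moreover have "norm (1 / ((1 + t^2) * sqrt (1 + t^2))) <= 1" for t :: real
	proof -
		have "1 * 1 <= (1 + t^2) * sqrt (1 + t^2)" by (intro mult_mono) auto
		then show ?thesis using pos[of t] by simp
	qed
	ultimately have "norm (g b - g a) <= 1 * norm (b - a)" for a b
		by (intro field_differentiable_bound[of UNIV g]) auto
	from this[of "min s 0" "min r 0"]
	have "\<bar>g (min r 0) - g (min s 0)\<bar> <= \<bar>min r 0 - min s 0\<bar>" by (simp add: abs_minus_commute)
	moreover have "\<bar>min r 0 - min s 0\<bar> <= \<bar>s - r\<bar>" by (auto simp: min_def abs_if)
	moreover have "neg_trunc' s - neg_trunc' r = g (min r 0) - g (min s 0)" by (simp add: g_def neg_trunc'_def)
	ultimately show ?thesis by linarith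
qed

text \<open>The test function \<open>neg_trunc (v x)\<close> is nonpositive and vanishes where
  \<open>v\<close> is nonnegative. Its energy with \<open>v\<close> is nonnegative and its source
  term nonpositive, so the integral of \<open>v\<close> times it is at most 0 although the integrand
  is nonnegative.\<close>

lemma background_nonneg:
	assumes pos: "gp > 0" "gm > 0" and tau: "tau >= 1" and f: "f : L2" "AL x. 0 <= f x"
		and v: "background_solution (gamma0 gp gm) f tau v"
	shows "AL x. 0 <= v x"
proof -
	note el = gamma0_elliptic[OF pos]
	have vH: "v : H1" using v by (simp add: background_solution_def)
	note V = H1_D[OF vH] note [measurable] = V(1,2)[THEN L2_measurable]
	let ?phi = "%x. neg_trunc (v x)"
	note ch = H1_chain[OF vH neg_trunc_deriv neg_trunc_props(1) neg_trunc_props(3) neg_trunc'_lipschitz]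
	have cont: "continuous_on UNIV neg_trunc'" unfolding neg_trunc'_def
		using one_plus_sq_pos by (intro continuous_intros) (simp add: less_imp_neq[symmetric])
	have [measurable]: "neg_trunc' : BM" by (rule borel_measurable_continuous_onI[OF cont])
	have mg: "(%x. neg_trunc' (v x) *R grad v x) : LM" by measurable
	have "energy_form (gamma0 gp gm) v ?phi = (LN x. (gamma0 gp gm x *v grad v x) \<bullet> (neg_trunc' (v x) *R grad v x))"
		by (rule energy_form_cong[OF el vH _ _ ch mg]) (auto intro: L2_measurable V)
	also have "... >= 0"
		by (intro integral_nonneg_AE AE_I2)
			(use layer_bounds[OF pos] neg_trunc_props(2) in "auto simp: gamma0_mult less_imp_le")
	finally have 1: "energy_form (gamma0 gp gm) v ?phi >= 0" .
	have "(LN x. - (f x * ?phi x)) >= 0"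
		using f(2) neg_trunc_props(4) by (intro integral_nonneg_AE) (auto elim!: eventually_mono simp: mult_nonneg_nonpos)
	then have 2: "(LN x. f x * ?phi x) <= 0" by simp
	have "- energy_form (gamma0 gp gm) v ?phi - tau^2 * (LN x. v x * ?phi x) + (LN x. f x * ?phi x) = 0"
		using v ch(1) by (auto simp: background_solution_def)
	with 1 2 have "tau^2 * (LN x. v x * ?phi x) <= 0" by linarith
	moreover have "tau^2 > 0" using tau by simp
	ultimately have "(LN x. v x * ?phi x) <= 0" by (metis mult_pos_pos not_le)
	moreover have "0 <= (LN x. v x * ?phi x)"
		by (intro integral_nonneg_AE AE_I2 neg_trunc_props(5))
	ultimately have "(LN x. v x * ?phi x) = 0" by simp
	then have "AL x. v x * ?phi x = 0"
		using integral_nonneg_eq_0_iff_AE[OF L2_mult_integrable[OF V(1) H1_D(1)[OF ch(1)]]]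
		by (auto simp: neg_trunc_props(5))
	then show ?thesis by eventually_elim (rule neg_trunc_props(6))
qed

subsection \<open>Agmon's weighted energy estimate\<close>

text \<open>Here \<open>a\<close> stands for the gradient of \<open>v\<close>, \<open>h\<close> for
  the weight and \<open>g\<close> for its gradient. The identity says that testing with the squared
  weight times \<open>v\<close> produces the energy of \<open>z = h v\<close> minus a term without
  derivatives of \<open>v\<close>.\<close>

lemma agmon_expand:
	fixes a g :: "'a::real_inner"
	shows "(L *R a) \<bullet> (h *R (h *R a + v *R g) + (h * v) *R g) = L * ((norm (h *R a + v *R g))^2 - v^2 * (norm g)^2)"
	unfolding power2_norm_eq_inner inner_add_left inner_add_right inner_scaleR_left inner_scaleR_right
		inner_commute[of g a] by algebra

text \<open>The test function is \<open>eta^2 v\<close>, with \<open>z = eta v\<close>. The slope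
  condition on \<open>eta\<close> carries the factor \<open>1 - dlt\<close>, so a part
  \<open>dlt tau^2\<close> of the zero-order term survives and controls \<open>z\<close> and its
  gradient by \<open>eta f\<close>. Finally \<open>eta grad v = grad z - v G\<close>, where
  \<open>v G\<close> is at most \<open>tau / sqrt m\<close> times \<open>z\<close>. The constant
  depends neither on \<open>tau\<close> nor on the weight.\<close>

lemma agmon_estimate:
	assumes pos: "gp > 0" "gm > 0" and dlt: "0 < dlt" "dlt <= 1"
	obtains C where "C > 0" and "!!tau f v eta G. tau >= 1 ==> f : L2 ==> background_solution (gamma0 gp gm) f tau v ==>
			(!!e. e : Basis ==> dir_lipschitz e eta (%x. G x \<bullet> e)) ==> bounded_fun eta ==>
			G : LM ==> bounded_fun (%x. norm (G x)) ==>
			(!!x. layer gp gm x * (norm (G x))^2 <= (1 - dlt) * tau^2 * (eta x)^2) ==>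
			(%x. eta x *R grad v x) : L2 & L2_norm (%x. eta x *R grad v x) <= C * L2_norm (%x. eta x * f x)"
proof -
	note el = gamma0_elliptic[OF pos]
	define m where "m = min gp gm"
	have m: "m > 0" using pos by (simp add: m_def)
	define C where "C = 1 / sqrt (m * dlt) + 1 / (sqrt m * dlt)"
	have C: "C > 0" using m dlt by (simp add: C_def add_pos_pos)
	show ?thesis
	proof (rule that[OF C], goal_cases)
		case (1 tau f v eta G)
		note tau = 1(1) and f = 1(2) and v = 1(3) and dl = 1(4) and beta = 1(5) and mG = 1(6) and bG = 1(7) and eik = 1(8)
		have vH: "v : H1" using v by (simp add: background_solution_def)
		note V = H1_D[OF vH]
		let ?z = "%x. eta x * v x"
		let ?phi = "%x. eta x * ?z x"
		have z: "?z : H1" "AL x. grad ?z x = eta x *R grad v x + v x *R G x"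
			by (rule H1_mult[OF vH dl beta mG bG], assumption)+
		note Z = H1_D[OF z(1)]
		have p: "?phi : H1" "AL x. grad ?phi x = eta x *R grad ?z x + ?z x *R G x"
			by (rule H1_mult[OF z(1) dl beta mG bG], assumption)+
		have meta: "eta : LM"
			by (rule dir_lipschitz_measurable(1)[OF dl[of "axis 1 1"]]) (simp add: axis_in_Basis_iff)
		note ms[measurable] = V(1,2)[THEN L2_measurable] Z(1,2)[THEN L2_measurable] mG meta
		obtain M where M: "M > 0" "!!x. \<bar>eta x\<bar> <= M" using bounded_funE[OF beta] by blast
		have m1: "(%x. eta x *R grad v x) : LM" by measurable
		have L1: "(%x. eta x *R grad v x) : L2"
			by (rule L2_dominated(1)[OF V(2) m1, of M]) (use M in "auto intro!: AE_I2 mult_right_mono")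
		have mf: "(%x. eta x * f x) : LM" using meta L2_measurable[OF f] by measurable
		have Lf: "(%x. eta x * f x) : L2"
			by (rule L2_dominated(1)[OF f mf, of M]) (use M in "auto simp: abs_mult intro!: AE_I2 mult_right_mono")
		let ?N = "L2_norm (%x. eta x * f x)"
		have mP: "(%x. eta x *R grad ?z x + ?z x *R G x) : LM" by measurable
		have en: "energy_form (gamma0 gp gm) v ?phi
				= (LN x. (gamma0 gp gm x *v grad v x) \<bullet> (eta x *R grad ?z x + ?z x *R G x))"
			by (rule energy_form_cong[OF el vH _ _ p mP]) (auto intro: L2_measurable V)
		have pi: "LI (%x. (gamma0 gp gm x *v grad v x) \<bullet> (eta x *R grad ?z x + ?z x *R G x))"
		proof -
			have mv: "(%x. gamma0 gp gm x *v grad v x) : LM"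
				using el V(2) by (intro L2_measurable elliptic_L2(1))
			have m2: "(%x. (gamma0 gp gm x *v grad v x) \<bullet> (eta x *R grad ?z x + ?z x *R G x)) : LM"
				using mv mP by (rule borel_measurable_inner)
			have ae: "AL x. (gamma0 gp gm x *v grad v x) \<bullet> grad ?phi x
					= (gamma0 gp gm x *v grad v x) \<bullet> (eta x *R grad ?z x + ?z x *R G x)"
				using p(2) by eventually_elim simp
			note i = energy_form_integrable[OF el vH p(1)]
			show ?thesis using i integrable_cong_AE[OF borel_measurable_integrable[OF i] m2 ae] by simp
		qed
		let ?L = "layer gp gm"
		have lower: "m * (L2_norm (grad ?z))^2 - (1 - dlt) * tau^2 * (L2_norm ?z)^2 <= energy_form (gamma0 gp gm) v ?phi"
		proof -
			have "m * (L2_norm (grad ?z))^2 - (1 - dlt) * tau^2 * (L2_norm ?z)^2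
				= (LN x. m * (norm (grad ?z x))^2 - (1 - dlt) * tau^2 * (?z x)^2)"
				using L2_integrable_norm[OF Z(2)] L2_real_integrable_sq[OF Z(1)] by (simp add: L2_norm_sq)
			also have "... <= (LN x. (gamma0 gp gm x *v grad v x) \<bullet> (eta x *R grad ?z x + ?z x *R G x))"
			proof (rule integral_mono_AE[OF _ pi])
				show "LI (%x. m * (norm (grad ?z x))^2 - (1 - dlt) * tau^2 * (?z x)^2)"
					using L2_integrable_norm[OF Z(2)] L2_real_integrable_sq[OF Z(1)] by simp
				show "AL x. m * (norm (grad ?z x))^2 - (1 - dlt) * tau^2 * (?z x)^2
						<= (gamma0 gp gm x *v grad v x) \<bullet> (eta x *R grad ?z x + ?z x *R G x)"
					using z(2)
				proof eventually_elim
					case (elim x)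
					let ?a = "grad v x" and ?g = "G x"
					have "(gamma0 gp gm x *v ?a) \<bullet> (eta x *R grad ?z x + ?z x *R ?g)
							= ?L x * ((norm (grad ?z x))^2 - (v x)^2 * (norm ?g)^2)"
						unfolding elim gamma0_mult by (rule agmon_expand)
					also have "... = ?L x * (norm (grad ?z x))^2 - (v x)^2 * (?L x * (norm ?g)^2)" by (simp add: algebra_simps)
					also have "... >= m * (norm (grad ?z x))^2 - (v x)^2 * ((1 - dlt) * tau^2 * (eta x)^2)"
						using layer_bounds[OF pos, of x] unfolding m_def by (intro diff_mono mult_right_mono mult_left_mono eik) auto
					finally show ?case by (simp add: power_mult_distrib algebra_simps)
				qed
			qed
			finally show ?thesis using en by simp
		qed
		have "- energy_form (gamma0 gp gm) v ?phi - tau^2 * (LN x. v x * ?phi x) + (LN x. f x * ?phi x) = 0"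
			using v p(1) by (auto simp: background_solution_def)
		moreover have "(LN x. v x * ?phi x) = (L2_norm ?z)^2"
			unfolding L2_norm_sq by (intro Bochner_Integration.integral_cong) (auto simp: power2_eq_square)
		moreover have "(LN x. f x * ?phi x) = (LN x. (eta x * f x) * ?z x)"
			by (intro Bochner_Integration.integral_cong) auto
		moreover have "(LN x. (eta x * f x) * ?z x) <= ?N * L2_norm ?z"
			using L2_Cauchy_Schwarz_real[OF Lf Z(1)] by linarith
		ultimately have main: "m * (L2_norm (grad ?z))^2 + dlt * tau^2 * (L2_norm ?z)^2 <= ?N * L2_norm ?z"
			using lower by (simp add: algebra_simps)
		let ?n = "L2_norm ?z"
		have mz: "0 <= m * (L2_norm (grad ?z))^2" using m by simp
		have nz: "dlt * tau^2 * ?n <= ?N"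
		proof (cases "?n = 0")
			case False
			have "?n * (dlt * tau^2 * ?n) <= ?n * ?N" using main mz by (simp add: power2_eq_square algebra_simps)
			then show ?thesis using False by (simp add: less_le)
		qed simp
		have tau1: "tau <= tau^2" "1 <= tau^2"
			using tau mult_left_mono[of 1 tau tau] mult_mono[of 1 tau 1 tau] by (auto simp: power2_eq_square)
		have "dlt * tau * ?n <= dlt * tau^2 * ?n" using tau1 dlt by (intro mult_right_mono mult_left_mono) auto
		then have "dlt * tau * ?n <= ?N" using nz by linarith
		then have nz1: "tau * ?n <= ?N / dlt" using dlt by (simp add: pos_le_divide_eq mult_ac)
		have "dlt * 1 * ?n <= dlt * tau^2 * ?n" using tau1 dlt by (intro mult_right_mono mult_left_mono) auto
		then have "dlt * 1 * ?n <= ?N" using nz by linarith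
		then have nz2: "?n <= ?N / dlt" using dlt by (simp add: pos_le_divide_eq mult_ac)
		have gz: "L2_norm (grad ?z) <= ?N / sqrt (m * dlt)"
		proof -
			have "0 <= dlt * tau^2 * ?n^2" using dlt by simp
			then have "m * (L2_norm (grad ?z))^2 <= ?N * ?n" using main by linarith
			also have "... <= ?N * (?N / dlt)" by (intro mult_left_mono nz2) simp
			finally have "(L2_norm (grad ?z))^2 <= ?N^2 / (m * dlt)" using m dlt by (simp add: field_simps power2_eq_square)
			also have "... = (?N / sqrt (m * dlt))^2" using m dlt by (simp add: power_divide)
			finally show ?thesis by (rule power2_le_imp_le) (use m dlt in simp)
		qed
		have mvG: "(%x. v x *R G x) : LM" by measurable
		have aeG: "AL x. norm (v x *R G x) <= tau / sqrt m * norm (?z x)"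
		proof (rule AE_I2)
			fix x
			have "m * (norm (G x))^2 <= ?L x * (norm (G x))^2" using layer_bounds[OF pos, of x] by (intro mult_right_mono) (auto simp: m_def)
			also have "... <= (1 - dlt) * tau^2 * (eta x)^2" by (rule eik)
			also have "... <= 1 * tau^2 * (eta x)^2" using dlt by (intro mult_right_mono) auto
			finally have "(norm (G x))^2 <= (tau / sqrt m * \<bar>eta x\<bar>)^2" using m by (simp add: power_mult_distrib power_divide field_simps)
			then have "norm (G x) <= tau / sqrt m * \<bar>eta x\<bar>" by (rule power2_le_imp_le) (use m tau in auto)
			from mult_left_mono[OF this, of "\<bar>v x\<bar>"]
			show "norm (v x *R G x) <= tau / sqrt m * norm (?z x)" by (simp add: abs_mult mult_ac)
		qed
		have ts: "0 <= tau / sqrt m" using tau m by simp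
		note vG = L2_dominated[OF Z(1) mvG aeG ts]
		have "L2_norm (%x. eta x *R grad v x) = L2_norm (%x. grad ?z x - v x *R G x)"
			by (rule L2_norm_cong[OF m1]) (use z(2) in "measurable, eventually_elim, simp")
		also have "... <= L2_norm (grad ?z) + L2_norm (%x. v x *R G x)" by (rule L2_norm_triangle_diff[OF Z(2) vG(1)])
		also have "... <= ?N / sqrt (m * dlt) + (?N / dlt) / sqrt m"
			using gz vG(2) divide_right_mono[OF nz1, of "sqrt m"] m by (simp add: algebra_simps)
		also have "... = C * ?N" by (simp add: C_def field_simps)
		finally show ?case using L1 by blast
	qed
qed

subsection \<open>Piecewise affine phases\<close>

text \<open>A pair \<open>(a, b)\<close> stands for the phase with gradient \<open>a\<close> below and \<open>b\<close> above the interface; equality of the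
	tangential components (Snell's law) makes the phase continuous.\<close>

definition phase :: "(real^3) \<times> (real^3) => real^3 => real" where
	"phase p x = (if x $ 3 > 0 then snd p \<bullet> x else fst p \<bullet> x)"

definition phase_grad :: "(real^3) \<times> (real^3) => real^3 => real^3" where
	"phase_grad p x = (if x $ 3 > 0 then snd p else fst p)"

text \<open>Subsolutions of the eikonal equation. With inequalities in place of equalities the zero
  phase \<open>(0, 0)\<close> is included, which caps the weights below at 1.\<close>

definition eikonal_phase :: "real => real => (real^3) \<times> (real^3) => bool" where
	"eikonal_phase gp gm p \<longleftrightarrow> fst p $ 1 = snd p $ 1 & fst p $ 2 = snd p $ 2 \<and>
			gm * (norm (fst p))^2 <= 1 & gp * (norm (snd p))^2 <= 1"

lemma UNIV_3_cases: "(i::3) = 1 \<or> i = 2 \<or> i = 3" using exhaust_3 by blast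

lemma inner_3: "(x::real^3) \<bullet> y = x $ 1 * y $ 1 + x $ 2 * y $ 2 + x $ 3 * y $ 3"
	by (simp add: inner_vec_def sum_3)

lemma Basis_3E:
	assumes "e : (Basis :: (real^3) set)" obtains i where "e = axis i 1"
	using assms by (auto simp: Basis_vec_def)

lemma phase_grad_bound:
	assumes pos: "gp > 0" "gm > 0" and p: "eikonal_phase gp gm p"
	shows "norm (phase_grad p x) <= 1 / sqrt (layer gp gm x)" and "norm (fst p) <= 1 / sqrt gm" "norm (snd p) <= 1 / sqrt gp"
proof -
	have le: "norm a <= 1 / sqrt g" if "g > 0" "g * (norm a)^2 <= 1" for g and a :: "real^3"
	proof (rule power2_le_imp_le)
		show "(norm a)^2 <= (1 / sqrt g)^2" using that by (simp add: power_divide field_simps)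
		show "0 <= 1 / sqrt g" using that by simp
	qed
	show 1: "norm (fst p) <= 1 / sqrt gm" and 2: "norm (snd p) <= 1 / sqrt gp"
		using p pos by (auto simp: eikonal_phase_def intro!: le)
	show "norm (phase_grad p x) <= 1 / sqrt (layer gp gm x)"
		using 1 2 by (simp add: phase_grad_def layer_def)
qed

lemma phase_lipschitz:
	assumes pos: "gp > 0" "gm > 0" and p: "eikonal_phase gp gm p" and e: "e : Basis"
	shows "\<bar>phase p (x + t *R e) - phase p x\<bar> <= (1 / sqrt gm + 1 / sqrt gp) * \<bar>t\<bar>"
proof -
	obtain i where i: "e = axis i 1" using Basis_3E[OF e] by blast
	let ?a = "fst p" and ?b = "snd p" and ?L = "1 / sqrt gm + 1 / sqrt gp"
	have nn: "1 / sqrt gm >= 0" "1 / sqrt gp >= 0" using pos by auto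
	have a: "\<bar>?a $ j\<bar> <= ?L" and b: "\<bar>?b $ j\<bar> <= ?L" for j
		using component_le_norm_cart[of ?a j] component_le_norm_cart[of ?b j] phase_grad_bound(2,3)[OF pos p] nn by linarith+
	have tang: "?a $ 1 = ?b $ 1" "?a $ 2 = ?b $ 2" using p by (auto simp: eikonal_phase_def)
	define H where "H s = (if s > 0 then ?b $ 3 * s else ?a $ 3 * s)" for s
	have ph: "phase p y = ?a $ 1 * y $ 1 + ?a $ 2 * y $ 2 + H (y $ 3)" for y
		by (simp add: phase_def inner_3 H_def tang)
	have H1: "\<bar>H s - H r\<bar> <= ?L * \<bar>s - r\<bar>" if "r <= s" for s r
	proof -
		consider "0 < r" | "s <= 0" | "r <= 0" "0 < s" using that by linarith
		then show ?thesis
		proof cases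
			case 1
			then have "H s - H r = ?b $ 3 * (s - r)" using that by (simp add: H_def algebra_simps)
			then show ?thesis using b[of 3] by (simp add: abs_mult mult_right_mono)
		next
			case 2
			then have "H s - H r = ?a $ 3 * (s - r)" using that by (simp add: H_def algebra_simps)
			then show ?thesis using a[of 3] by (simp add: abs_mult mult_right_mono)
		next
			case 3
			then have "H s - H r = ?b $ 3 * s + ?a $ 3 * (- r)" by (simp add: H_def)
			moreover have "\<bar>?b $ 3 * s\<bar> <= ?L * s" using 3 b[of 3] by (simp add: abs_mult mult_right_mono)
			moreover have "\<bar>?a $ 3 * (- r)\<bar> <= ?L * (- r)" unfolding abs_mult using 3 a[of 3] by (intro mult_mono) auto
			ultimately have "\<bar>H s - H r\<bar> <= ?L * s + ?L * (- r)" by linarith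
			also have "... = ?L * (s - r)" by (simp only: distrib_left mult_minus_right diff_conv_add_uminus)
			also have "s - r = \<bar>s - r\<bar>" using that by simp
			finally show ?thesis .
		qed
	qed
	have H: "\<bar>H s - H r\<bar> <= ?L * \<bar>s - r\<bar>" for s r
		using H1[of r s] H1[of s r] by (cases "r <= s") (auto simp: abs_minus_commute)
	consider "i = 1" | "i = 2" | "i = 3" using UNIV_3_cases by blast
	then show ?thesis
	proof cases
		case 1
		then have "phase p (x + t *R e) - phase p x = ?a $ 1 * t" unfolding ph i by (simp add: axis_def algebra_simps)
		then show ?thesis using a[of 1] by (simp add: abs_mult mult_right_mono)
	next
		case 2
		then have "phase p (x + t *R e) - phase p x = ?a $ 2 * t" unfolding ph i by (simp add: axis_def algebra_simps)
		then show ?thesis using a[of 2] by (simp add: abs_mult mult_right_mono)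
	next
		case 3
		then have "phase p (x + t *R e) - phase p x = H (x $ 3 + t) - H (x $ 3)" unfolding ph i by (simp add: axis_def)
		then show ?thesis using H[of "x $ 3 + t" "x $ 3"] by simp
	qed
qed

lemma phase_deriv:
	assumes "x $ 3 ~= 0"
	shows "((%t. phase p (x + t *R e)) has_real_derivative phase_grad p x \<bullet> e) (at 0)"
proof -
	have lin: "((%t. phase_grad p x \<bullet> (x + t *R e)) has_real_derivative phase_grad p x \<bullet> e) (at 0)"
		by (auto intro!: derivative_eq_intros simp: inner_add_right)
	let ?S = "{t. (x + t *R e) $ 3 * x $ 3 > 0}"
	have "open ?S" by (intro open_Collect_less continuous_intros)
	moreover have "0 : ?S" using assms by (auto simp: zero_less_mult_iff)
	moreover have "phase_grad p x \<bullet> (x + t *R e) = phase p (x + t *R e)" if "t : ?S" for t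
		using that by (auto simp: phase_def phase_grad_def zero_less_mult_iff)
	ultimately show ?thesis by (rule has_field_derivative_transform_within_open[OF lin])
qed

lemma phase_measurable: "phase p : BM" "phase_grad p : BM"
proof -
	have [measurable]: "(%x::real^3. x $ 3) : BM"
		by (intro borel_measurable_continuous_onI continuous_intros)
	show "phase p : BM" unfolding phase_def[abs_def] by measurable
	show "phase_grad p : BM" unfolding phase_grad_def[abs_def] by measurable
qed

lemma AE_off_interface: "AL x. (x::real^3) $ 3 ~= 0"
proof -
	have "negligible {x::real^3. x \<bullet> axis 3 1 = 0}"
		using negligible_standard_hyperplane[of "axis 3 (1::real) :: real^3" 0] by (simp add: axis_in_Basis_iff)
	then show ?thesis by (auto simp: negligible_iff_null_sets eventually_ae_filter inner_axis)
qed

text \<open>Up to the factor \<open>card P\<close> this is the minimum over \<open>p\<close> of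
  \<open>exp (- s (phase p x - phase p x0))\<close>. Unlike the minimum it is smooth on either side
  of the interface, and its logarithmic gradient is \<open>- s\<close> times a convex combination of
  phase gradients, so the eikonal bound is inherited.\<close>

definition soft_weight :: "real => ((real^3) \<times> (real^3)) set => real^3 => real^3 => real" where
	"soft_weight s P x0 x = 1 / (\<Sum>p\<in>P. exp (s * (phase p x - phase p x0)))"

definition soft_weight_grad :: "real => ((real^3) \<times> (real^3)) set => real^3 => real^3 => real^3" where
	"soft_weight_grad s P x0 x =
			(- s * (soft_weight s P x0 x)^2) *R (\<Sum>p\<in>P. exp (s * (phase p x - phase p x0)) *R phase_grad p x)"

lemma soft_weight_props:
	assumes pos: "gp > 0" "gm > 0" and P: "finite P" "(0, 0) : P" "!!p. p : P ==> eikonal_phase gp gm p"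
		and s: "s >= 0"
	shows "0 < soft_weight s P x0 x" "soft_weight s P x0 x <= 1"
		and "layer gp gm x * (norm (soft_weight_grad s P x0 x))^2 <= s^2 * (soft_weight s P x0 x)^2"
		and "bounded_fun (soft_weight s P x0)" "bounded_fun (%x. norm (soft_weight_grad s P x0 x))"
		and "soft_weight_grad s P x0 : LM"
		and "e : Basis ==> dir_lipschitz e (soft_weight s P x0) (%x. soft_weight_grad s P x0 x \<bullet> e)"
proof -
	let ?E = "%p x. exp (s * (phase p x - phase p x0))"
	define Z where "Z x = (\<Sum>p\<in>P. ?E p x)" for x
	have eta: "soft_weight s P x0 x = 1 / Z x" for x by (simp add: soft_weight_def Z_def)
	have Z1: "1 <= Z x" for x
	proof -
		have "?E (0, 0) x <= Z x" unfolding Z_def by (rule member_le_sum) (use P in auto)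
		moreover have "phase (0, 0) y = 0" for y by (auto simp: phase_def)
		ultimately show ?thesis by simp
	qed
	have Z0: "0 < Z x" for x using Z1[of x] by linarith
	show w0: "0 < soft_weight s P x0 x" for x using Z0[of x] by (simp add: eta)
	show w1: "soft_weight s P x0 x <= 1" for x using Z1[of x] by (simp add: eta)
	have "\<bar>soft_weight s P x0 x\<bar> <= 1" for x using w0[of x] w1[of x] by simp
	then show bd: "bounded_fun (soft_weight s P x0)" by (auto simp: bounded_fun_def)
	have ng: "norm (soft_weight_grad s P x0 x) <= s * soft_weight s P x0 x / sqrt (layer gp gm x)" for x
	proof -
		have "norm (\<Sum>p\<in>P. ?E p x *R phase_grad p x) <= (\<Sum>p\<in>P. ?E p x * (1 / sqrt (layer gp gm x)))"
			by (intro sum_norm_le) (auto intro!: mult_left_mono phase_grad_bound[OF pos] P(3) simp del: times_divide_eq_right)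
		also have "... = Z x * (1 / sqrt (layer gp gm x))" by (simp only: Z_def sum_distrib_right)
		finally have "norm (soft_weight_grad s P x0 x) <= s * (soft_weight s P x0 x)^2 * (Z x * (1 / sqrt (layer gp gm x)))"
			unfolding soft_weight_grad_def using s by (simp add: abs_mult mult_left_mono del: times_divide_eq_right)
		also have "... = s * soft_weight s P x0 x / sqrt (layer gp gm x)"
			using Z0[of x] by (simp add: eta power2_eq_square)
		finally show ?thesis .
	qed
	have lp: "0 < layer gp gm x" "min gp gm <= layer gp gm x" for x using layer_bounds[OF pos] by auto
	show "layer gp gm x * (norm (soft_weight_grad s P x0 x))^2 <= s^2 * (soft_weight s P x0 x)^2" for x
	proof -
		have "(norm (soft_weight_grad s P x0 x))^2 <= (s * soft_weight s P x0 x / sqrt (layer gp gm x))^2"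
			by (intro power_mono ng) auto
		also have "... = s^2 * (soft_weight s P x0 x)^2 / layer gp gm x"
			using lp(1)[of x] by (simp add: power_divide power_mult_distrib)
		finally show ?thesis using lp(1)[of x] by (simp add: pos_le_divide_eq mult.commute)
	qed
	have "norm (soft_weight_grad s P x0 x) <= s / sqrt (min gp gm)" for x
	proof -
		have "s * soft_weight s P x0 x / sqrt (layer gp gm x) <= s * 1 / sqrt (min gp gm)"
			using lp[of x] s w0[of x] w1[of x] pos by (intro frac_le mult_left_mono) auto
		then show ?thesis using ng[of x] by simp
	qed
	then show "bounded_fun (%x. norm (soft_weight_grad s P x0 x))" by (auto simp: bounded_fun_def)
	note [measurable] = phase_measurable
	have m1: "soft_weight s P x0 : BM" unfolding soft_weight_def[abs_def] by measurable
	then have [measurable]: "soft_weight s P x0 : BM" .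
	have m2: "soft_weight_grad s P x0 : BM" unfolding soft_weight_grad_def[abs_def] by measurable
	then show mg: "soft_weight_grad s P x0 : LM" by (rule borel_imp_lebesgue_measurable)
	show "dir_lipschitz e (soft_weight s P x0) (%x. soft_weight_grad s P x0 x \<bullet> e)" if e: "e : Basis" for e
		unfolding dir_lipschitz_def
	proof (intro conjI)
		show "soft_weight s P x0 : LM" using m1 by (rule borel_imp_lebesgue_measurable)
		show "(%x. soft_weight_grad s P x0 x \<bullet> e) : LM" using mg by measurable
		let ?K = "s * (1 / sqrt gm + 1 / sqrt gp)"
		\<comment> \<open>A shift by \<open>t\<close> changes every exponential by at most one common
		  factor, so the sum changes by at most this factor, independently of the number of
		  phases.\<close>
		have Zle: "Z (x + t *R e) <= exp (?K * \<bar>t\<bar>) * Z x" for x t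
			unfolding Z_def sum_distrib_left
		proof (rule sum_mono)
			fix p assume p: "p : P"
			have "s * (phase p (x + t *R e) - phase p x) <= s * ((1 / sqrt gm + 1 / sqrt gp) * \<bar>t\<bar>)"
				using phase_lipschitz[OF pos P(3)[OF p] e, of x t] s by (intro mult_left_mono) auto
			then have "s * (phase p (x + t *R e) - phase p x0) <= ?K * \<bar>t\<bar> + s * (phase p x - phase p x0)"
				by (simp add: algebra_simps)
			then show "?E p (x + t *R e) <= exp (?K * \<bar>t\<bar>) * ?E p x" by (simp add: exp_add[symmetric])
		qed
		have K0: "?K >= 0" using s pos by simp
		have one_side: "soft_weight s P x0 x - soft_weight s P x0 (x + t *R e) <= ?K * \<bar>t\<bar>" for x t
		proof -
			have "1 - ?K * \<bar>t\<bar> <= exp (- (?K * \<bar>t\<bar>))" using exp_ge_add_one_self[of "- (?K * \<bar>t\<bar>)"] by simp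
			then have "soft_weight s P x0 x * (1 - ?K * \<bar>t\<bar>) <= soft_weight s P x0 x * exp (- (?K * \<bar>t\<bar>))"
				using w0[of x] by (intro mult_left_mono) auto
			also have "... = 1 / (exp (?K * \<bar>t\<bar>) * Z x)" by (simp add: eta exp_minus inverse_eq_divide)
			also have "... <= soft_weight s P x0 (x + t *R e)"
				unfolding eta using Zle[of x t] Z0[of "x + t *R e"] by (intro divide_left_mono mult_pos_pos Z0) auto
			finally have "soft_weight s P x0 x - soft_weight s P x0 (x + t *R e) <= soft_weight s P x0 x * (?K * \<bar>t\<bar>)" by (simp add: algebra_simps)
			also have "... <= 1 * (?K * \<bar>t\<bar>)" using w1[of x] K0 by (intro mult_right_mono) auto
			finally show ?thesis by simp
		qed
		have "\<bar>soft_weight s P x0 (x + t *R e) - soft_weight s P x0 x\<bar> <= ?K * \<bar>t\<bar>" for x t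
			using one_side[of x t] one_side[of "x + t *R e" "- t"] by (simp add: abs_le_iff)
		then show "\<exists>K. \<forall>x t. \<bar>soft_weight s P x0 (x + t *R e) - soft_weight s P x0 x\<bar> <= K * \<bar>t\<bar>" by blast
		show "AL x. ((%t. (soft_weight s P x0 (x + t *R e) - soft_weight s P x0 x) / t) ---> soft_weight_grad s P x0 x \<bullet> e) (at 0)"
			using AE_off_interface
		proof eventually_elim
			fix x :: "real^3" assume x: "x $ 3 ~= 0"
			have dE: "((%t. ?E p (x + t *R e)) has_real_derivative ?E p x * (s * (phase_grad p x \<bullet> e))) (at 0)" for p
			proof -
				have "((%t. s * (phase p (x + t *R e) - phase p x0)) has_real_derivative s * (phase_grad p x \<bullet> e)) (at 0)"
					using DERIV_cmult[OF DERIV_diff[OF phase_deriv[OF x] DERIV_const]] by simp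
				from DERIV_chain2[OF DERIV_exp this] show ?thesis by simp
			qed
			have dZ: "((%t. Z (x + t *R e)) has_real_derivative (\<Sum>p\<in>P. ?E p x * (s * (phase_grad p x \<bullet> e)))) (at 0)"
				unfolding Z_def by (rule DERIV_sum) (rule dE)
			have "((%t. 1 / Z (x + t *R e)) has_real_derivative
					(0 * Z (x + 0 *R e) - 1 * (\<Sum>p\<in>P. ?E p x * (s * (phase_grad p x \<bullet> e)))) / (Z (x + 0 *R e) * Z (x + 0 *R e))) (at 0)"
				by (rule DERIV_divide[OF DERIV_const dZ]) (use Z0[of x] in simp)
			moreover have "(0 * Z (x + 0 *R e) - 1 * (\<Sum>p\<in>P. ?E p x * (s * (phase_grad p x \<bullet> e)))) / (Z (x + 0 *R e) * Z (x + 0 *R e))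
					= soft_weight_grad s P x0 x \<bullet> e"
			proof -
				have "(\<Sum>p\<in>P. ?E p x * (s * (phase_grad p x \<bullet> e))) = s * ((\<Sum>p\<in>P. ?E p x *R phase_grad p x) \<bullet> e)"
					by (simp add: inner_sum_left sum_distrib_left mult.left_commute)
				then show ?thesis by (simp add: soft_weight_grad_def eta power2_eq_square)
			qed
			ultimately show "((%t. (soft_weight s P x0 (x + t *R e) - soft_weight s P x0 x) / t) ---> soft_weight_grad s P x0 x \<bullet> e) (at 0)"
				unfolding eta by (simp add: DERIV_def)
		qed
	qed
qed

subsection \<open>Optical distance and the upper bound\<close>

lemma axis_Basis_3: "axis i 1 : (Basis :: (real^3) set)"
	by (simp add: axis_in_Basis_iff)

definition interface_point :: "real^2 => real^3" where
	"interface_point z = vector [z $ 1, z $ 2, 0]"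

lemma interface_point_nth [simp]:
	"interface_point z $ 1 = z $ 1" "interface_point z $ 2 = z $ 2" "interface_point z $ 3 = 0"
	by (simp_all add: interface_point_def vector_3)

lemma optical_length_alt:
	"optical_length gp gm x y z = 1 / sqrt gm * norm (interface_point z - x) + 1 / sqrt gp * norm (interface_point z - y)"
	by (simp add: optical_length_def interface_point_def Let_def)

lemma interface_point_linear: "interface_point (z + t *R axis i 1) = interface_point z + t *R axis (if i = 1 then 1 else 2) 1"
	using exhaust_2[of i] by (auto simp: vec_eq_iff forall_3 axis_def interface_point_def vector_3)

lemma continuous_interface_point: "continuous_on S interface_point"
proof -
	have eq: "interface_point = (%z. (z $ 1) *R axis 1 1 + (z $ 2) *R axis 2 1)"
		by (rule ext) (auto simp: vec_eq_iff forall_3 axis_def)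
	show ?thesis unfolding eq by (intro continuous_intros)
qed

lemma norm_interface_point: "norm (interface_point z) = norm z"
	by (simp add: norm_eq_sqrt_inner inner_3 inner_vec_def sum_2)

lemma optical_length_nonneg: "gp > 0 ==> gm > 0 ==> 0 <= optical_length gp gm x y z"
	by (simp add: optical_length_alt)

lemma optical_distance_le: "gp > 0 ==> gm > 0 ==> optical_distance gp gm x y <= optical_length gp gm x y z"
	unfolding optical_distance_def by (rule cINF_lower) (auto intro!: bdd_belowI2[of _ 0] optical_length_nonneg)

lemma optical_distance_nonneg: "gp > 0 ==> gm > 0 ==> 0 <= optical_distance gp gm x y"
	unfolding optical_distance_def by (rule cINF_greatest) (auto intro!: optical_length_nonneg)

lemma optical_set_distance_le:
	assumes "gp > 0" "gm > 0" "x : D" "y : B"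
	shows "optical_set_distance gp gm D B <= optical_distance gp gm x y"
proof -
	have "bdd_below ((%(x, y). optical_distance gp gm x y) ` (D \<times> B))"
		by (rule bdd_belowI2[of _ 0]) (auto intro: optical_distance_nonneg assms)
	from cINF_lower[OF this, of "(x, y)"] show ?thesis using assms by (simp add: optical_set_distance_def)
qed

lemma optical_set_distance_nonneg:
	assumes "gp > 0" "gm > 0" "D ~= {}" "B ~= {}"
	shows "0 <= optical_set_distance gp gm D B"
	unfolding optical_set_distance_def
	by (rule cINF_greatest) (use assms in "auto intro: optical_distance_nonneg")

text \<open>For a fixed crossing point \<open>z\<close> the optical length is continuous in both end
  points, so the bound extends from \<open>D \<times> B\<close> to its closure.\<close>

lemma optical_set_distance_closure_le:
	assumes pos: "gp > 0" "gm > 0" and x: "x : closure D" and y: "y : closure B"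
	shows "optical_set_distance gp gm D B <= optical_length gp gm x y z"
proof -
	let ?S = "{q. optical_set_distance gp gm D B <= optical_length gp gm (fst q) (snd q) z}"
	have "closed ?S" unfolding optical_length_alt by (intro closed_Collect_le continuous_intros)
	moreover have "D \<times> B <= ?S"
	proof
		fix q assume "q : D \<times> B"
		then have "optical_set_distance gp gm D B <= optical_distance gp gm (fst q) (snd q)"
			by (intro optical_set_distance_le pos) auto
		also have "... <= optical_length gp gm (fst q) (snd q) z" by (rule optical_distance_le[OF pos])
		finally show "q : ?S" by simp
	qed
	ultimately have "closure (D \<times> B) <= ?S" by (simp add: closure_minimal)
	then show ?thesis using x y by (auto simp: closure_Times)
qed

lemma norm_line_deriv:
	fixes w e :: "'a::real_inner"
	assumes "w ~= 0"
	shows "((%t. norm (w + t *R e)) has_real_derivative (w \<bullet> e) / norm w) (at 0)"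
proof -
	have h: "((%t. (w + t *R e) \<bullet> (w + t *R e)) has_real_derivative 2 * (w \<bullet> e)) (at 0)"
		by (auto intro!: derivative_eq_intros simp: inner_add_left inner_add_right inner_commute)
	have p: "0 < (w + 0 *R e) \<bullet> (w + 0 *R e)" using assms by simp
	have "((%t. sqrt ((w + t *R e) \<bullet> (w + t *R e))) has_real_derivative
			inverse (sqrt ((w + 0 *R e) \<bullet> (w + 0 *R e))) / 2 * (2 * (w \<bullet> e))) (at 0)"
		by (rule DERIV_chain2[OF DERIV_real_sqrt[OF p] h])
	then show ?thesis unfolding norm_eq_sqrt_inner by (simp add: inverse_eq_divide)
qed

text \<open>At the minimising crossing point the first-order condition is Snell's law, i.e. the two ray directions define
	a continuous phase.\<close>

lemma snell_phase:
	assumes pos: "gp > 0" "gm > 0" and x: "x $ 3 < 0" and y: "y $ 3 > 0"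
	obtains p z where "eikonal_phase gp gm p" "phase p y - phase p x = optical_length gp gm x y z"
proof -
	let ?F = "optical_length gp gm x y"
	have cont: "continuous_on S ?F" for S
		unfolding optical_length_alt[abs_def] by (intro continuous_intros continuous_interface_point)
	\<comment> \<open>Beyond the radius \<open>R\<close> the leg from \<open>x\<close> alone is
	  optically longer than the whole path through 0, so a minimum over the ball is a global
	  one.\<close>
	define R where "R = norm x + sqrt gm * (?F 0 + 1)"
	have F0: "?F 0 >= 0" by (rule optical_length_nonneg[OF pos])
	have R: "R > 0" using F0 pos by (simp add: R_def add_nonneg_pos)
	have "\<exists>z\<in>cball 0 R. \<forall>z'\<in>cball 0 R. ?F z <= ?F z'"
		by (rule continuous_attains_inf) (use R cont in auto)
	then obtain z where z: "z : cball 0 R" "!!z'. z' : cball 0 R ==> ?F z <= ?F z'" by blast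
	have min: "?F z <= ?F z'" for z'
	proof (cases "z' : cball 0 R")
		case False
		have "norm z' - norm x <= norm (interface_point z' - x)"
			using norm_triangle_ineq2[of "interface_point z'" x] by (simp add: norm_interface_point)
		moreover have "sqrt gm * (?F 0 + 1) < norm z' - norm x" using False by (simp add: R_def)
		ultimately have "sqrt gm * (?F 0 + 1) <= norm (interface_point z' - x)" by linarith
		then have "?F 0 + 1 <= 1 / sqrt gm * norm (interface_point z' - x)" using pos by (simp add: field_simps)
		also have "... <= ?F z'" using pos by (simp add: optical_length_alt)
		finally have "?F 0 <= ?F z'" by simp
		moreover have "?F z <= ?F 0" using R by (intro z) simp
		ultimately show ?thesis by linarith
	qed (rule z)
	define w where "w = interface_point z"
	define nx ny where "nx = norm (w - x)" and "ny = norm (w - y)"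
	have "(w - x) $ 3 ~= 0" "(w - y) $ 3 ~= 0" using x y by (auto simp: w_def)
	then have ne: "w - x ~= 0" "w - y ~= 0" by force+
	then have n: "nx > 0" "ny > 0" by (auto simp: nx_def ny_def)
	have crit: "1 / sqrt gm * ((w - x) \<bullet> e / nx) + 1 / sqrt gp * ((w - y) \<bullet> e / ny) = 0"
		if e: "e = axis (if i = 1 then 1 else 2) 1" for e and i :: 2
	proof -
		have "((%t. 1 / sqrt gm * norm ((w - x) + t *R e) + 1 / sqrt gp * norm ((w - y) + t *R e)) has_real_derivative
				1 / sqrt gm * ((w - x) \<bullet> e / nx) + 1 / sqrt gp * ((w - y) \<bullet> e / ny)) (at 0)"
			unfolding nx_def ny_def by (intro DERIV_add DERIV_cmult norm_line_deriv ne)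
		moreover have "1 / sqrt gm * norm ((w - x) + t *R e) + 1 / sqrt gp * norm ((w - y) + t *R e) = ?F (z + t *R axis i 1)" for t
			unfolding optical_length_alt interface_point_linear e w_def by (simp add: algebra_simps)
		ultimately have "((%t. ?F (z + t *R axis i 1)) has_real_derivative
				1 / sqrt gm * ((w - x) \<bullet> e / nx) + 1 / sqrt gp * ((w - y) \<bullet> e / ny)) (at 0)" by simp
		from DERIV_local_min[OF this zero_less_one] show ?thesis using min by simp
	qed
	\<comment> \<open>\<open>a\<close> and \<open>b\<close> are the unit ray directions from
	  \<open>x\<close> to \<open>w\<close> and from \<open>w\<close> to \<open>y\<close>, scaled by the
	  slownesses of the two media. The vanishing tangential derivatives say that their first two
	  components agree.\<close>
	define a where "a = (1 / (sqrt gm * nx)) *R (w - x)"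
	define b where "b = (1 / (sqrt gp * ny)) *R (y - w)"
	have tang: "a $ j = b $ j" if "j = 1 \<or> j = 2" for j
	proof -
		define e :: "real^3" where "e = axis j 1"
		have "\<exists>i::2. e = axis (if i = 1 then 1 else 2) 1"
			using that by (auto simp: e_def intro: exI[of _ 1] exI[of _ 2])
		then have "1 / sqrt gm * ((w - x) \<bullet> e / nx) + 1 / sqrt gp * ((w - y) \<bullet> e / ny) = 0" using crit by blast
		then have "1 / sqrt gm * ((w - x) $ j / nx) = 1 / sqrt gp * ((y - w) $ j / ny)"
			by (simp add: e_def inner_axis algebra_simps diff_divide_distrib)
		then show ?thesis by (simp add: a_def b_def)
	qed
	have na: "norm a = 1 / sqrt gm" "norm b = 1 / sqrt gp"
		using n pos by (auto simp: a_def b_def nx_def ny_def norm_minus_commute abs_mult)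
	have ok: "eikonal_phase gp gm (a, b)"
		using tang pos by (auto simp: eikonal_phase_def na power_divide)
	have "a \<bullet> (w - x) = 1 / sqrt gm * nx"
	proof -
		have "a \<bullet> (w - x) = (1 / (sqrt gm * nx)) * (nx * nx)" by (simp add: a_def nx_def dot_square_norm power2_eq_square)
		then show ?thesis using n by simp
	qed
	moreover have "b \<bullet> (y - w) = 1 / sqrt gp * ny"
	proof -
		have "b \<bullet> (y - w) = (1 / (sqrt gp * ny)) * (ny * ny)" by (simp add: b_def ny_def norm_minus_commute dot_square_norm power2_eq_square)
		then show ?thesis using n by simp
	qed
	moreover have "a \<bullet> w = b \<bullet> w" using tang by (simp add: inner_3 w_def)
	ultimately have "phase (a, b) y - phase (a, b) x = ?F z"
		using x y by (simp add: phase_def optical_length_alt w_def[symmetric] nx_def ny_def inner_diff_right)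
	then show ?thesis using that[OF ok] by blast
qed

text \<open>By Lindelof's theorem the union of all open sets on which \<open>f\<close> vanishes
  almost everywhere is already a countable union, so the null sets add up to a null set.\<close>

lemma emission_outside:
	assumes "ess_support f <= closure B"
	shows "AL x. x \<notin> closure B --> f x = 0"
proof -
	let ?F = "{U. open U & (AL x. x : U --> f x = 0)}"
	obtain F' where F': "F' <= ?F" "countable F'" "\<Union>F' = \<Union>?F"
		using Lindelof[of ?F] by auto
	have "AL x. \<forall>U\<in>F'. x : U --> f x = 0"
		using F'(1,2) by (subst AE_ball_countable) auto
	then show ?thesis
	proof eventually_elim
		fix x assume *: "\<forall>U\<in>F'. x : U --> f x = 0"
		show "x \<notin> closure B --> f x = 0"
		proof
			assume "x \<notin> closure B"
			then have "x : \<Union>?F" using assms by (auto simp: ess_support_def)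
			then show "f x = 0" using * F'(3) by blast
		qed
	qed
qed

text \<open>Every point of the closure of \<open>B\<close> has a Snell phase that gains at least
  \<open>l\<close> on the way from \<open>x0\<close>; by compactness finitely many phases suffice to
  gain \<open>l - eps\<close> everywhere. The resulting weight is at most
  \<open>exp (- tau (l - 2 eps))\<close> on the support of \<open>f\<close> and at least
  \<open>exp (- tau eps) / N\<close> near \<open>x0\<close>, and Agmon's estimate compares the two.
  The three \<open>eps\<close> pay for compactness, for \<open>dlt\<close> and for the radius of the
  ball.\<close>

lemma grad_energy_local_upper:
	assumes pos: "gp > 0" "gm > 0" and D: "D : sets lebesgue" "closure D <= R3_minus" "D ~= {}"
		and B: "bounded B" "closure B <= R3_plus" "B ~= {}"
		and f: "f : L2" "ess_support f <= closure B" and x0: "x0 : closure D" and eps: "eps > 0"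
	obtains C where "C >= 0" "!!tau v. tau >= 1 ==> background_solution (gamma0 gp gm) f tau v ==>
			grad_energy_on (D \<inter> ball x0 (sqrt gm * eps)) v <= C * exp (- 2 * tau * (optical_set_distance gp gm D B - 3 * eps))"
proof -
	define l where "l = optical_set_distance gp gm D B"
	have l0: "l >= 0" unfolding l_def by (rule optical_set_distance_nonneg[OF pos D(3) B(3)])
	have x0m: "x0 $ 3 < 0" using x0 D by (auto simp: R3_minus_def)
	define U where "U p = {y::real^3. 0 < y $ 3 & l - eps < snd p \<bullet> y - phase p x0}" for p
	have "open (U p)" for p unfolding U_def by (intro open_Collect_conj open_Collect_less continuous_intros)
	moreover have "closure B <= (\<Union>p\<in>Collect (eikonal_phase gp gm). U p)"
	proof
		fix y assume y: "y : closure B"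
		then have y3: "y $ 3 > 0" using B by (auto simp: R3_plus_def)
		obtain p z where p: "eikonal_phase gp gm p" "phase p y - phase p x0 = optical_length gp gm x0 y z"
			using snell_phase[OF pos x0m y3] by blast
		have "l <= optical_length gp gm x0 y z"
			unfolding l_def by (rule optical_set_distance_closure_le[OF pos x0 y])
		then have "l - eps < snd p \<bullet> y - phase p x0" using p(2) y3 eps by (simp add: phase_def)
		then show "y : (\<Union>p\<in>Collect (eikonal_phase gp gm). U p)" using p(1) y3 by (intro UN_I[of p]) (auto simp: U_def)
	qed
	ultimately obtain P0 where P0: "P0 <= Collect (eikonal_phase gp gm)" "finite P0" "closure B <= (\<Union>p\<in>P0. U p)"
		using compactE_image[of "closure B" "Collect (eikonal_phase gp gm)" U] B(1) by (metis compact_closure)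
	define P where "P = insert (0, 0) P0"
	have P: "finite P" "(0, 0) : P" "!!p. p : P ==> eikonal_phase gp gm p"
		using P0 by (auto simp: P_def eikonal_phase_def)
	\<comment> \<open>Since \<open>dlt * l <= eps\<close>, lowering the rate from \<open>tau\<close> to
	  \<open>s = (1 - dlt) tau\<close> costs at most \<open>eps tau\<close> in the exponent.\<close>
	define dlt where "dlt = min (1/2) (eps / (l + 1))"
	have dlt: "0 < dlt" "dlt <= 1/2" "dlt * l <= eps"
	proof -
		show "0 < dlt" using eps l0 by (auto simp: dlt_def)
		show "dlt <= 1/2" unfolding dlt_def by (rule min.cobounded1)
		have "dlt * l <= eps / (l + 1) * l" using l0 by (intro mult_right_mono) (auto simp: dlt_def)
		also have "... <= eps" using l0 eps by (simp add: field_simps)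
		finally show "dlt * l <= eps" .
	qed
	have dlt1: "dlt <= 1" using dlt(2) by simp
	show ?thesis
	proof (rule agmon_estimate[OF pos dlt(1) dlt1], goal_cases)
	case (1 C)
	note C = 1(1) and agmon = 1(2)
	define N where "N = real (card P)"
	have N: "N >= 1" using P(1,2) by (simp add: N_def Suc_le_eq card_gt_0_iff) (metis One_nat_def Suc_leI card_gt_0_iff empty_iff)
	show ?thesis
	proof (rule that[of "(C * N * L2_norm f)^2"])
		fix tau v assume tau: "tau >= 1" and v: "background_solution (gamma0 gp gm) f tau v"
		have vH: "v : H1" using v by (simp add: background_solution_def)
		define s where "s = tau * (1 - dlt)"
		have s: "s >= 0" using tau dlt by (simp add: s_def)
		let ?eta = "soft_weight s P x0" and ?G = "soft_weight_grad s P x0"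
		note w = soft_weight_props[OF pos P s]
		have eik: "layer gp gm x * (norm (?G x))^2 <= (1 - dlt) * tau^2 * (?eta x)^2" for x
		proof -
			have "(1 - dlt) * (1 - dlt) <= (1 - dlt) * 1" using dlt by (intro mult_left_mono) auto
			then have "s^2 <= (1 - dlt) * tau^2"
				using mult_left_mono[of "(1 - dlt) * (1 - dlt)" "1 - dlt" "tau^2"] by (simp add: s_def power2_eq_square algebra_simps)
			then show ?thesis using order.trans[OF w(3) mult_right_mono] by simp
		qed
		have ag: "(%x. ?eta x *R grad v x) : L2" "L2_norm (%x. ?eta x *R grad v x) <= C * L2_norm (%x. ?eta x * f x)"
			using agmon[OF tau f(1) v w(7) w(4,6,5) eik] by auto
		have feta: "L2_norm (%x. ?eta x * f x) <= exp (- tau * (l - 2 * eps)) * L2_norm f"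
		proof (rule L2_dominated(2)[OF f(1)])
			have "?eta : LM"
				by (rule dir_lipschitz_measurable(1)[OF w(7)[OF _ axis_Basis_3[of 1]]])
			then show "(%x. ?eta x * f x) : LM" using L2_measurable[OF f(1)] by measurable
			show "AL x. norm (?eta x * f x) <= exp (- tau * (l - 2 * eps)) * norm (f x)"
				using emission_outside[OF f(2)]
			proof eventually_elim
				fix x assume out: "x \<notin> closure B --> f x = 0"
				show "norm (?eta x * f x) <= exp (- tau * (l - 2 * eps)) * norm (f x)"
				proof (cases "x : closure B")
					case True
					then obtain p where p: "p : P0" "x : U p" using P0(3) by blast
					have "l - eps <= phase p x - phase p x0" using p(2) by (simp add: U_def phase_def)
					then have "s * (l - eps) <= s * (phase p x - phase p x0)" using s by (rule mult_left_mono)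
					moreover have "tau * (l - 2 * eps) <= s * (l - eps)"
					proof -
						have "l - 2 * eps <= (1 - dlt) * (l - eps)"
						proof -
							have "(1 - dlt) * (l - eps) = l - eps - dlt * l + dlt * eps" by (simp add: algebra_simps)
							moreover have "0 <= dlt * eps" using dlt eps by simp
							ultimately show ?thesis using dlt(3) by linarith
						qed
						from mult_left_mono[OF this, of tau] show ?thesis using tau by (simp add: s_def mult.assoc)
					qed
					ultimately have "exp (tau * (l - 2 * eps)) <= exp (s * (phase p x - phase p x0))" by simp
					also have "... <= (\<Sum>p\<in>P. exp (s * (phase p x - phase p x0)))"
						by (rule member_le_sum) (use p P in "auto simp: P_def")
					finally have Zb: "exp (tau * (l - 2 * eps)) <= (\<Sum>p\<in>P. exp (s * (phase p x - phase p x0)))" .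
					then have "?eta x <= 1 / exp (tau * (l - 2 * eps))"
						using order.strict_trans2[OF exp_gt_zero Zb]
						unfolding soft_weight_def by (intro divide_left_mono mult_pos_pos) auto
					also have "... = exp (- tau * (l - 2 * eps))" by (simp add: exp_minus inverse_eq_divide)
					finally show ?thesis using w(1)[of x0 x] by (simp add: abs_mult mult_right_mono)
				qed (use out in simp)
			qed
		qed simp
		\<comment> \<open>Below the interface a phase has slope at most \<open>1 / sqrt gm\<close>, so it
		  rises by at most \<open>eps\<close> within the radius \<open>sqrt gm * eps\<close>;
		  \<open>N\<close> counts the phases.\<close>
		define a where "a = exp (- tau * eps) / N"
		have a: "a > 0" using N by (simp add: a_def)
		let ?S = "D \<inter> ball x0 (sqrt gm * eps)"
		have etaa: "a <= ?eta x" if x: "x : ?S" for x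
		proof -
			have x3: "x $ 3 < 0" using x D(2) closure_subset[of D] by (auto simp: R3_minus_def)
			have "exp (s * (phase p x - phase p x0)) <= exp (tau * eps)" if p: "p : P" for p
			proof -
				have "phase p x - phase p x0 = fst p \<bullet> (x - x0)" using x3 x0m by (simp add: phase_def inner_diff_right)
				also have "... <= norm (fst p) * norm (x - x0)" by (rule norm_cauchy_schwarz)
				also have "... <= 1 / sqrt gm * (sqrt gm * eps)"
					using x pos by (intro mult_mono phase_grad_bound(2)[OF pos P(3)[OF p]]) (auto simp: dist_norm norm_minus_commute less_imp_le)
				also have "... = eps" using pos by simp
				finally have "phase p x - phase p x0 <= eps" .
				then have "s * (phase p x - phase p x0) <= s * eps" using s by (rule mult_left_mono)
				also have "... <= tau * eps" using tau dlt eps by (intro mult_right_mono) (auto simp: s_def mult_left_le)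
				finally show ?thesis by simp
			qed
			then have "(\<Sum>p\<in>P. exp (s * (phase p x - phase p x0))) <= N * exp (tau * eps)"
				unfolding N_def by (intro sum_bounded_above) auto
			moreover have "0 < (\<Sum>p\<in>P. exp (s * (phase p x - phase p x0)))" using P by (intro sum_pos) auto
			ultimately have "1 / (N * exp (tau * eps)) <= ?eta x"
				unfolding soft_weight_def using N by (intro divide_left_mono mult_pos_pos) auto
			moreover have "a = 1 / (N * exp (tau * eps))" by (simp add: a_def exp_minus inverse_eq_divide)
			ultimately show ?thesis by simp
		qed
		have mS: "?S : sets lebesgue" using D(1) by (intro sets.Int) auto
		have "a^2 * grad_energy_on ?S v = (LN x. a^2 * (indicator ?S x * (norm (grad v x))^2))"
			by (simp add: grad_energy_on_def)
		also have "... <= (LN x. (norm (?eta x *R grad v x))^2)"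
		proof (rule integral_mono)
			show "LI (%x. a^2 * (indicator ?S x * (norm (grad v x))^2))"
				by (intro integrable_mult_right integrable_grad_energy vH mS)
			show "LI (%x. (norm (?eta x *R grad v x))^2)" by (rule L2_integrable_norm[OF ag(1)])
			fix x
			show "a^2 * (indicator ?S x * (norm (grad v x))^2) <= (norm (?eta x *R grad v x))^2"
			proof (cases "x : ?S")
				case True
				have "a^2 <= (?eta x)^2" using etaa[OF True] a by (intro power_mono) auto
				then show ?thesis using True by (simp add: power_mult_distrib mult_right_mono)
			qed simp
		qed
		also have "... = (L2_norm (%x. ?eta x *R grad v x))^2" by (simp only: L2_norm_sq)
		also have "... <= (C * (exp (- tau * (l - 2 * eps)) * L2_norm f))^2"
			using ag(2) mult_left_mono[OF feta less_imp_le[OF C]] by (intro power_mono) auto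
		finally have "grad_energy_on ?S v <= (C * (exp (- tau * (l - 2 * eps)) * L2_norm f))^2 / a^2"
			using a by (simp add: pos_le_divide_eq mult.commute)
		also have "... = (C * N * L2_norm f)^2 * (exp (- tau * (l - 2 * eps)) / exp (- tau * eps))^2"
			by (simp add: a_def power_mult_distrib power_divide)
		also have "exp (- tau * (l - 2 * eps)) / exp (- tau * eps) = exp (- tau * (l - 3 * eps))"
			by (simp add: exp_diff[symmetric] algebra_simps)
		also have "(exp (- tau * (l - 3 * eps)))^2 = exp (- 2 * tau * (l - 3 * eps))"
			by (simp add: power2_eq_square exp_add[symmetric])
		finally show "grad_energy_on ?S v <= (C * N * L2_norm f)^2 * exp (- 2 * tau * (optical_set_distance gp gm D B - 3 * eps))"
			by (simp add: l_def)
	qed simp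
	qed
qed

theorem grad_energy_upper:
	assumes pos: "gp > 0" "gm > 0" and D: "D : sets lebesgue" "closure D <= R3_minus" "D ~= {}" "bounded D"
		and B: "bounded B" "closure B <= R3_plus" "B ~= {}"
		and f: "f : L2" "ess_support f <= closure B" and eps: "eps > 0"
	obtains C where "C >= 0" "!!tau v. tau >= 1 ==> background_solution (gamma0 gp gm) f tau v ==>
			grad_energy_on D v <= C * exp (- 2 * tau * (optical_set_distance gp gm D B - eps))"
proof -
	let ?r = "sqrt gm * (eps / 3)" and ?l = "optical_set_distance gp gm D B"
	have r: "?r > 0" using pos eps by simp
	have "compact (closure D)" using D(4) by (simp add: compact_closure)
	moreover have "closure D <= (\<Union>x\<in>closure D. ball x ?r)" using r by auto
	ultimately obtain S where S: "S <= closure D" "finite S" "closure D <= (\<Union>x\<in>S. ball x ?r)"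
		using compactE_image[of "closure D" "closure D" "%x. ball x ?r"] by (metis open_ball)
	have "\<exists>C. \<forall>x\<in>S. C x >= 0 & (\<forall>tau v. tau >= 1 --> background_solution (gamma0 gp gm) f tau v \<longrightarrow>
			grad_energy_on (D \<inter> ball x ?r) v <= C x * exp (- 2 * tau * (?l - eps)))"
	proof (rule bchoice, rule ballI)
		fix x assume "x : S"
		then have x: "x : closure D" using S(1) by blast
		obtain C where "C >= 0" "!!tau v. tau >= 1 ==> background_solution (gamma0 gp gm) f tau v ==>
			grad_energy_on (D \<inter> ball x ?r) v <= C * exp (- 2 * tau * (?l - 3 * (eps / 3)))"
			using grad_energy_local_upper[OF pos D(1-3) B f x, of "eps / 3"] eps by (metis divide_pos_pos zero_less_numeral)
		then show "\<exists>C. C >= 0 & (\<forall>tau v. tau >= 1 --> background_solution (gamma0 gp gm) f tau v \<longrightarrow>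
			grad_energy_on (D \<inter> ball x ?r) v <= C * exp (- 2 * tau * (?l - eps)))" by auto
	qed
	then obtain C where C: "!!x. x : S ==> C x >= 0"
		"!!x tau v. x : S ==> tau >= 1 ==> background_solution (gamma0 gp gm) f tau v ==>
			grad_energy_on (D \<inter> ball x ?r) v <= C x * exp (- 2 * tau * (?l - eps))" by blast
	show ?thesis
	proof (rule that[of "sum C S"])
		show "0 <= sum C S" using C(1) by (rule sum_nonneg)
		fix tau v assume tau: "tau >= 1" and v: "background_solution (gamma0 gp gm) f tau v"
		have vH: "v : H1" using v by (simp add: background_solution_def)
		have int: "LI (%y. indicator (D \<inter> ball x ?r) y * (norm (grad v y))^2)" for x
			by (rule integrable_grad_energy[OF vH]) (use D(1) in auto)
		have "grad_energy_on D v <= (LN y. (\<Sum>x\<in>S. indicator (D \<inter> ball x ?r) y * (norm (grad v y))^2))"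
			unfolding grad_energy_on_def
		proof (rule integral_mono)
			show "LI (%x. indicator D x * (norm (grad v x))^2)" by (rule integrable_grad_energy[OF vH D(1)])
			show "LI (%y. \<Sum>x\<in>S. indicator (D \<inter> ball x ?r) y * (norm (grad v y))^2)"
				by (intro Bochner_Integration.integrable_sum int)
			fix y
			have nn: "0 <= (\<Sum>x\<in>S. indicator (D \<inter> ball x ?r) y * (norm (grad v y))^2)" by (intro sum_nonneg) auto
			show "indicator D y * (norm (grad v y))^2 <= (\<Sum>x\<in>S. indicator (D \<inter> ball x ?r) y * (norm (grad v y))^2)"
			proof (cases "y : D")
				case True
				then obtain x where x: "x : S" "y : ball x ?r" using S(3) closure_subset[of D] by blast
				have "indicator (D \<inter> ball x ?r) y * (norm (grad v y))^2 <= (\<Sum>x\<in>S. indicator (D \<inter> ball x ?r) y * (norm (grad v y))^2)"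
					by (rule member_le_sum[OF x(1)]) (use S(2) in auto)
				then show ?thesis using True x(2) by (simp add: indicator_def)
			qed (use nn in simp)
		qed
		also have "... = (\<Sum>x\<in>S. grad_energy_on (D \<inter> ball x ?r) v)"
			unfolding grad_energy_on_def by (intro Bochner_Integration.integral_sum int)
		also have "... <= (\<Sum>x\<in>S. C x * exp (- 2 * tau * (?l - eps)))" by (intro sum_mono C(2) tau v)
		finally show "grad_energy_on D v <= sum C S * exp (- 2 * tau * (?l - eps))" by (simp only: sum_distrib_right)
	qed
qed

subsection \<open>An explicit subsolution across the interface\<close>

lemma max_sq_deriv: "((%s::real. (max 0 s)^2) has_real_derivative 2 * max 0 s) (at s)"
proof -
	have "((%s::real. - s) has_real_derivative - 1) (at s)" by (auto intro!: derivative_eq_intros)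
	from DERIV_chain2[OF min_sq_deriv this]
	have "((%s::real. (min (- s) 0)^2) has_real_derivative 2 * min (- s) 0 * - 1) (at s)" .
	moreover have "(%s::real. (min (- s) 0)^2) = (%s. (max 0 s)^2)" by (rule ext) (auto simp: min_def max_def)
	ultimately have "((%s::real. (max 0 s)^2) has_real_derivative 2 * min (- s) 0 * - 1) (at s)" by (simp only:)
	then show ?thesis by (rule DERIV_cong) (auto simp: min_def max_def)
qed

definition stretch :: "real => real => real => real => real" where
	"stretch gp gm c r = (if r > 0 then c / gp * r else c / gm * r)"

text \<open>In the coordinates \<open>(x\<^sub>1, x\<^sub>2, stretch x\<^sub>3)\<close>, where the stretching factor is \<open>c / \<gamma>\<close>, the normal flux of a
	smooth function is continuous across the interface, so that smooth functions of these coordinates are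
	admissible test barriers.\<close>

definition stretched_diff :: "real => real => real => real^3 => real^3 => real^3" where
	"stretched_diff gp gm c q x =
			vector [x $ 1 - q $ 1, x $ 2 - q $ 2, stretch gp gm c (x $ 3) - stretch gp gm c (q $ 3)]"

lemma stretched_diff_nth [simp]:
	"stretched_diff gp gm c q x $ 1 = x $ 1 - q $ 1"
	"stretched_diff gp gm c q x $ 2 = x $ 2 - q $ 2"
	"stretched_diff gp gm c q x $ 3 = stretch gp gm c (x $ 3) - stretch gp gm c (q $ 3)"
	by (simp_all add: stretched_diff_def vector_3)

lemma stretch_bilipschitz:
	assumes pos: "gp > 0" "gm > 0" "c > 0"
	shows "\<bar>stretch gp gm c r - stretch gp gm c s\<bar> <= max (c / gp) (c / gm) * \<bar>r - s\<bar>"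
		and "min (c / gp) (c / gm) * \<bar>r - s\<bar> <= \<bar>stretch gp gm c r - stretch gp gm c s\<bar>"
proof -
	define A B M m where "A = c / gp" and "B = c / gm" and "M = max A B" and "m = min A B"
	have AB: "A > 0" "B > 0" "A <= M" "B <= M" "m <= A" "m <= B" using pos by (auto simp: A_def B_def M_def m_def)
	define f where "f r = (if r > 0 then A * r else B * r)" for r :: real
	have f: "stretch gp gm c = f" by (rule ext) (simp add: f_def stretch_def A_def B_def)
	have mono: "m * (r - s) <= f r - f s & f r - f s <= M * (r - s)" if "s <= r" for r s
	proof -
		consider "0 < s" | "r <= 0" | "s <= 0" "0 < r" using that by linarith
		then show ?thesis
		proof cases
			case 1
			then have "f r - f s = A * (r - s)" using that by (simp add: f_def right_diff_distrib)
			then show ?thesis using AB that by (auto intro: mult_right_mono)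
		next
			case 2
			then have "f r - f s = B * (r - s)" using that by (simp add: f_def right_diff_distrib)
			then show ?thesis using AB that by (auto intro: mult_right_mono)
		next
			case 3
			then have "f r - f s = A * r + B * (- s)" by (simp add: f_def)
			moreover have "m * r <= A * r" "A * r <= M * r" using 3 AB by (auto intro: mult_right_mono)
			moreover have "m * (- s) <= B * (- s)" "B * (- s) <= M * (- s)" by (rule mult_right_mono; use 3 AB in simp)+
			moreover have "m * (r - s) = m * r + m * (- s)" "M * (r - s) = M * r + M * (- s)" by (auto simp: algebra_simps)
			ultimately show ?thesis by linarith
		qed
	qed
	have m0: "0 <= m" using AB by (auto simp: m_def)
	have "m * \<bar>r - s\<bar> <= \<bar>f r - f s\<bar> & \<bar>f r - f s\<bar> <= M * \<bar>r - s\<bar>"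
	proof (cases "s <= r")
		case True
		then have "0 <= m * (r - s)" using m0 by simp
		then show ?thesis using mono[OF True] True by (auto simp: abs_of_nonneg)
	next
		case False
		then have "s >= r" by simp
		then have "0 <= m * (s - r)" using m0 by simp
		then show ?thesis using mono[OF \<open>s >= r\<close>] False by (auto simp: abs_minus_commute[of r] abs_minus_commute[of "f r"] abs_of_nonneg)
	qed
	then show "\<bar>stretch gp gm c r - stretch gp gm c s\<bar> <= max (c / gp) (c / gm) * \<bar>r - s\<bar>"
		and "min (c / gp) (c / gm) * \<bar>r - s\<bar> <= \<bar>stretch gp gm c r - stretch gp gm c s\<bar>"
		unfolding f M_def m_def A_def B_def by auto
qed

lemma norm3_sq: "(norm (x::real^3))^2 = (x $ 1)^2 + (x $ 2)^2 + (x $ 3)^2"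
	by (simp only: power2_norm_eq_inner inner_3) (simp only: power2_eq_square)

lemma norm_le_scaled:
	fixes x y :: "real^3"
	assumes "k >= 0" "!!i. \<bar>x $ i\<bar> <= k * \<bar>y $ i\<bar>"
	shows "norm x <= k * norm y"
proof (rule power2_le_imp_le)
	have "(x $ i)^2 <= (k * y $ i)^2" for i
		using power_mono[OF assms(2)[of i], of 2] by (simp add: power_mult_distrib)
	then show "(norm x)^2 <= (k * norm y)^2"
		unfolding power_mult_distrib norm3_sq by (simp add: distrib_left power_mult_distrib add_mono)
	show "0 <= k * norm y" using assms(1) by simp
qed

text \<open>The barrier is centred at \<open>q\<close>, decays at rate \<open>a\<close>, vanishes
  from radius \<open>R\<close> on, and is smoothed at its centre on the scale \<open>rho\<close>.
  After stretching, the normal flux coefficient has the constant value \<open>c\<close>.\<close>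

locale barrier =
	fixes gp gm c :: real and q :: "real^3" and rho R a :: real
	assumes gp: "gp > 0" and gm: "gm > 0" and c: "c > 0" and rho: "rho > 0" and R: "R > 0" and a: "a > 0"
begin

abbreviation "Y \<equiv> stretched_diff gp gm c q"
abbreviation "L \<equiv> layer gp gm"

definition "M0 = max 1 (max (c / gp) (c / gm))"
definition "m0 = min 1 (min (c / gp) (c / gm))"

lemma M0: "M0 >= 1" and m0: "m0 > 0" "m0 <= 1"
	using gp gm c by (auto simp: M0_def m0_def)

lemma Y_lipschitz: "norm (Y x - Y x') <= M0 * norm (x - x')"
proof (rule norm_le_scaled)
	show "\<bar>(Y x - Y x') $ i\<bar> <= M0 * \<bar>(x - x') $ i\<bar>" for i
	proof -
		consider "i = 1 \<or> i = 2" | "i = 3" using UNIV_3_cases by blast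
		then show ?thesis
		proof cases
			case 1
			have "1 * \<bar>(x - x') $ i\<bar> <= M0 * \<bar>(x - x') $ i\<bar>" using M0 by (intro mult_right_mono) auto
			then show ?thesis using 1 by auto
		next
			case 2
			have "\<bar>stretch gp gm c (x $ 3) - stretch gp gm c (x' $ 3)\<bar> <= max (c / gp) (c / gm) * \<bar>x $ 3 - x' $ 3\<bar>"
				by (rule stretch_bilipschitz(1)[OF gp gm c])
			also have "... <= M0 * \<bar>x $ 3 - x' $ 3\<bar>" by (intro mult_right_mono) (auto simp: M0_def)
			finally show ?thesis using 2 by simp
		qed
	qed
qed (use M0 in simp)

lemma Y_lower: "m0 * norm (x - x') <= norm (Y x - Y x')"
proof -
	have "norm (x - x') <= (1 / m0) * norm (Y x - Y x')"
	proof (rule norm_le_scaled)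
		show "\<bar>(x - x') $ i\<bar> <= 1 / m0 * \<bar>(Y x - Y x') $ i\<bar>" for i
		proof -
			have "m0 * \<bar>(x - x') $ i\<bar> <= \<bar>(Y x - Y x') $ i\<bar>"
			proof -
				consider "i = 1 \<or> i = 2" | "i = 3" using UNIV_3_cases by blast
				then show ?thesis
				proof cases
					case 1
					have "m0 * \<bar>(x - x') $ i\<bar> <= 1 * \<bar>(x - x') $ i\<bar>" using m0 by (intro mult_right_mono) auto
					then show ?thesis using 1 by auto
				next
					case 2
					have "m0 * \<bar>x $ 3 - x' $ 3\<bar> <= min (c / gp) (c / gm) * \<bar>x $ 3 - x' $ 3\<bar>"
						by (intro mult_right_mono) (auto simp: m0_def)
					also have "... <= \<bar>stretch gp gm c (x $ 3) - stretch gp gm c (x' $ 3)\<bar>"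
						by (rule stretch_bilipschitz(2)[OF gp gm c])
					finally show ?thesis using 2 by simp
				qed
			qed
			then show ?thesis using m0 by (simp add: field_simps)
		qed
	qed (use m0 in simp)
	then show ?thesis using m0 by (simp add: field_simps)
qed

lemma Y_q: "Y q = 0"
	by (simp add: vec_eq_iff forall_3)

lemma continuous_Y: "continuous_on UNIV Y"
proof -
	have "M0-lipschitz_on UNIV Y"
		unfolding lipschitz_on_def using Y_lipschitz M0 by (auto simp: dist_norm)
	then show ?thesis by (rule lipschitz_on_continuous_on)
qed

definition "S x = sqrt ((norm (Y x))^2 + rho^2)"

lemma S_ge: "rho <= S x" "norm (Y x) <= S x" "S x > 0" and S_le: "S x <= norm (Y x) + rho"
proof -
	show 1: "rho <= S x" unfolding S_def by (rule real_le_rsqrt) simp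
	show "norm (Y x) <= S x" unfolding S_def by (rule real_le_rsqrt) simp
	show "S x > 0" using 1 rho by linarith
	show "S x <= norm (Y x) + rho"
		unfolding S_def by (rule real_le_lsqrt) (use rho in "auto simp: power2_sum")
qed

lemma S_sq: "(S x)^2 = (norm (Y x))^2 + rho^2"
	by (simp add: S_def)

lemma S_lipschitz: "\<bar>S x - S x'\<bar> <= M0 * norm (x - x')"
proof -
	have "\<bar>S x - S x'\<bar> * (S x + S x') = \<bar>(S x)\<^sup>2 - (S x')^2\<bar>"
		using S_ge(3)[of x] S_ge(3)[of x'] by (simp add: power2_eq_square square_diff_square_factored abs_mult mult.commute)
	also have "... = \<bar>norm (Y x) - norm (Y x')\<bar> * (norm (Y x) + norm (Y x'))"
		unfolding S_sq by (simp add: power2_eq_square square_diff_square_factored abs_mult mult.commute)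
	also have "... <= norm (Y x - Y x') * (S x + S x')"
		by (intro mult_mono norm_triangle_ineq3 add_mono S_ge) auto
	finally have "\<bar>S x - S x'\<bar> <= norm (Y x - Y x')"
		using S_ge(3)[of x] S_ge(3)[of x'] by (simp add: mult_le_cancel_right)
	then show ?thesis using Y_lipschitz[of x x'] by linarith
qed

text \<open>The radial profile \<open>T\<close> is the cube of a truncated exponential: the cube of
  a positive part is twice continuously differentiable, so the flux of the barrier stays Lipschitz
  at the cutoff radius. \<open>U\<close> is \<open>T' / s\<close>, which turns the gradient of
  \<open>T (S x)\<close> into \<open>U (S x)\<close> times the vector \<open>Y x\<close>, up to the
  stretching factor; \<open>U'\<close> is the derivative of \<open>U\<close>.\<close>

definition "pp s = max 0 (exp (- a * s) - exp (- a * R))"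
definition "T s = pp s * (pp s)^2"
definition "U s = - 3 * a * ((pp s)^2 * exp (- a * s)) / s"
definition "U' s = 3 * a * (exp (- a * s) * pp s * (a * (2 * exp (- a * s) + pp s) / s + pp s / (s * s)))"

lemma pp_bounds: "0 <= pp s" "pp s <= exp (- a * s)" "s >= R ==> pp s = 0" "0 <= s ==> pp s <= 1" "0 <= s ==> exp (- a * s) <= 1"
proof -
	show "0 <= pp s" "pp s <= exp (- a * s)" by (auto simp: pp_def)
	show "pp s = 0" if "s >= R" using that a by (simp add: pp_def)
	show e: "exp (- a * s) <= 1" if "0 <= s" using that a by simp
	show "pp s <= 1" if "0 <= s" using e[OF that] \<open>pp s <= exp (- a * s)\<close> by linarith
qed

lemma exp_deriv: "((%s. exp (- a * s)) has_real_derivative - a * exp (- a * s)) (at s)"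
	by (auto intro!: derivative_eq_intros)

lemma pp_sq_deriv: "((%s. (pp s)^2) has_real_derivative 2 * pp s * (- a * exp (- a * s))) (at s)"
proof -
	have "((%s. exp (- a * s) - exp (- a * R)) has_real_derivative - a * exp (- a * s)) (at s)"
		by (auto intro!: derivative_eq_intros)
	from DERIV_chain2[OF max_sq_deriv this] show ?thesis unfolding pp_def .
qed

lemma T_deriv: "s > 0 ==> (T has_real_derivative s * U s) (at s)"
proof -
	assume s: "s > 0"
	have h: "((%s. exp (- a * s) - exp (- a * R)) has_real_derivative - a * exp (- a * s)) (at s)"
		by (auto intro!: derivative_eq_intros)
	have "T = (%s. (exp (- a * s) - exp (- a * R)) * (pp s)^2)"
		by (rule ext) (auto simp: T_def pp_def max_def)
	moreover have "((%s. (exp (- a * s) - exp (- a * R)) * (pp s)^2) has_real_derivative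
			- a * exp (- a * s) * (pp s)^2 + 2 * pp s * (- a * exp (- a * s)) * (exp (- a * s) - exp (- a * R))) (at s)"
		by (rule DERIV_mult[OF h pp_sq_deriv])
	moreover have "- a * exp (- a * s) * (pp s)^2 + 2 * pp s * (- a * exp (- a * s)) * (exp (- a * s) - exp (- a * R)) = s * U s"
	proof -
		have "pp s * (exp (- a * s) - exp (- a * R)) = (pp s)^2" by (auto simp: pp_def max_def power2_eq_square)
		then have *: "2 * pp s * (- a * exp (- a * s)) * (exp (- a * s) - exp (- a * R)) = 2 * (- a * exp (- a * s)) * (pp s)^2"
			by (metis mult.assoc mult.commute)
		show ?thesis unfolding * using s by (simp add: U_def)
	qed
	ultimately show ?thesis by simp
qed

lemma U_deriv: "s > 0 ==> (U has_real_derivative U' s) (at s)"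
proof -
	assume s: "s > 0"
	have "((%s. - 3 * a * ((pp s)^2 * exp (- a * s)) / s) has_real_derivative
			((- 3 * a * (2 * pp s * (- a * exp (- a * s)) * exp (- a * s) + - a * exp (- a * s) * (pp s)^2)) * s - (- 3 * a * ((pp s)^2 * exp (- a * s))) * 1) / (s * s)) (at s)"
		by (rule DERIV_divide[OF DERIV_cmult[OF DERIV_mult[OF pp_sq_deriv exp_deriv]] DERIV_ident]) (use s in simp)
	moreover have "((- 3 * a * (2 * pp s * (- a * exp (- a * s)) * exp (- a * s) + - a * exp (- a * s) * (pp s)^2)) * s - (- 3 * a * ((pp s)^2 * exp (- a * s))) * 1) / (s * s) = U' s"
		unfolding U'_def using s by (simp add: field_simps power2_eq_square)
	ultimately show ?thesis unfolding U_def[abs_def] by simp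
qed

definition "KU = 3 * a / rho"
definition "KU' = 3 * a * (3 * a / rho + 1 / (rho * rho))"

lemma U_bound: "rho <= s ==> \<bar>U s\<bar> <= KU" and U'_bound: "rho <= s ==> \<bar>U' s\<bar> <= KU'"
	and U_sign: "rho <= s ==> U s <= 0" and U'_sign: "rho <= s ==> 0 <= U' s"
	and TU_zero: "R <= s ==> T s = 0 & U s = 0 & U' s = 0" and T_bound: "0 <= T s" "rho <= s ==> T s <= 1"
proof -
	show "R <= s ==> T s = 0 & U s = 0 & U' s = 0" by (simp add: T_def U_def U'_def pp_bounds(3))
	show "0 <= T s" using pp_bounds(1)[of s] by (simp add: T_def)
	assume s: "rho <= s"
	then have s0: "s > 0" using rho by linarith
	define E p where "E = exp (- a * s)" and "p = pp s"
	have b: "0 <= p" "p <= 1" "0 < E" "E <= 1" using pp_bounds[of s] s0 by (auto simp: E_def p_def)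
	have p2: "0 <= p^2" "p^2 <= 1" using b by (auto simp: power_le_one)
	show "T s <= 1" using b p2 by (simp add: T_def p_def[symmetric] mult_le_one)
	have nn: "0 <= 3 * a * (p^2 * E) / s" using b a s0 by simp
	have U: "U s = - (3 * a * (p^2 * E) / s)" by (simp add: U_def p_def E_def)
	show "U s <= 0" using nn U by simp
	have "p^2 * E <= 1" using p2 b by (simp add: mult_le_one)
	then have "3 * a * (p^2 * E) / s <= 3 * a * 1 / rho" using a rho s by (intro frac_le mult_left_mono) auto
	then show "\<bar>U s\<bar> <= KU" using nn U by (simp add: KU_def)
	have U': "U' s = 3 * a * (E * p * (a * (2 * E + p) / s + p / (s * s)))" by (simp add: U'_def p_def E_def)
	show nn': "0 <= U' s" unfolding U' using b a s0 by simp
	have 1: "a * (2 * E + p) / s <= a * 3 / rho" using a b rho s by (intro frac_le mult_left_mono) auto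
	have 2: "p / (s * s) <= 1 / (rho * rho)" using b rho s by (intro frac_le mult_mono) auto
	have "E * p * (a * (2 * E + p) / s + p / (s * s)) <= 1 * (a * (2 * E + p) / s + p / (s * s))"
		using a b s0 by (intro mult_right_mono mult_le_one) auto
	also have "... <= 3 * a / rho + 1 / (rho * rho)" using 1 2 unfolding mult.commute[of a 3] mult_1_left by (rule add_mono)
	finally have "U' s <= KU'" unfolding U' KU'_def using a by (intro mult_left_mono) auto
	then show "\<bar>U' s\<bar> <= KU'" using nn' by simp
qed

lemma KU_nonneg: "0 <= KU" "0 <= KU'"
	using a rho by (auto simp: KU_def KU'_def)

lemma U_lipschitz: "rho <= s ==> rho <= r ==> \<bar>U s - U r\<bar> <= KU' * \<bar>s - r\<bar>"
proof -
	assume s: "rho <= s" "rho <= r"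
	have "norm (U s - U r) <= KU' * norm (s - r)"
	proof (rule field_differentiable_bound[of "{rho..}" U U'])
		fix z assume "z : {rho..}"
		then have z: "rho <= z" by simp
		then have "z > 0" using rho by linarith
		from has_field_derivative_at_within[OF U_deriv[OF this]]
		show "(U has_field_derivative U' z) (at z within {rho..})" .
		show "norm (U' z) <= KU'" using U'_bound[OF z] by simp
	qed (use s in auto)
	then show ?thesis by simp
qed

definition "KT = 3 * a"

lemma T_lipschitz: "rho <= s ==> rho <= r ==> \<bar>T s - T r\<bar> <= KT * \<bar>s - r\<bar>"
proof -
	assume s: "rho <= s" "rho <= r"
	have "norm (T s - T r) <= KT * norm (s - r)"
	proof (rule field_differentiable_bound[of "{rho..}" T "%z. z * U z"])
		fix z assume "z : {rho..}"
		then have z: "rho <= z" by simp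
		then have z0: "z > 0" using rho by linarith
		from has_field_derivative_at_within[OF T_deriv[OF z0]]
		show "(T has_field_derivative z * U z) (at z within {rho..})" .
		have "z * U z = - (3 * a * ((pp z)^2 * exp (- a * z)))" using z0 by (simp add: U_def)
		moreover have "(pp z)^2 * exp (- a * z) <= 1" "0 <= (pp z)^2 * exp (- a * z)"
			using pp_bounds[of z] z0 by (auto simp: mult_le_one power_le_one)
		ultimately show "norm (z * U z) <= KT" using a by (simp add: KT_def mult_left_le abs_mult)
	qed (use s in auto)
	then show ?thesis by simp
qed

text \<open>\<open>g\<close> is the barrier and \<open>gg\<close> its gradient; \<open>kf e\<close>
  is the derivative of the stretched coordinate along \<open>e\<close>, and \<open>dV e\<close> that
  of the flux component \<open>(L x *R gg x) \<bullet> e\<close>. Hence \<open>hh tau\<close> is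
  \<open>tau^2 g\<close> minus the divergence of the flux of \<open>g\<close>. The coefficient
  \<open>c^2 / L\<close> arises because the normal flux has coefficient \<open>c\<close> and one
  more normal derivative contributes \<open>c / L\<close>.\<close>

definition "g x = T (S x)"
definition "kf e x = (if e $ 3 = 0 then 1 else c / L x)" for e :: "real^3"
definition "gg x = U (S x) *R (vector [Y x $ 1, Y x $ 2, c / L x * Y x $ 3] :: real^3)"
definition "flux_coef e x = (if e $ 3 = 0 then L x else c\<^sup>2 / L x)" for e :: "real^3"
definition "dV e x = flux_coef e x * (U (S x) + U' (S x) / S x * (Y x \<bullet> e)^2)" for e :: "real^3"
definition "hh tau x = tau^2 * g x - (\<Sum>e\<in>Basis. dV e x)"

lemma axis3: "axis i (1::real) $ (3::3) = 0 \<longleftrightarrow> i ~= 3" by (auto simp: axis_def)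

lemma gg_component: "gg x \<bullet> axis i 1 = U (S x) * kf (axis i 1) x * (Y x \<bullet> axis i 1)"
proof -
	consider "i = 1" | "i = 2" | "i = 3" using UNIV_3_cases by blast
	then show ?thesis by cases (auto simp: gg_def kf_def inner_axis vector_3 axis3)
qed

lemma L_pos: "L x > 0" using layer_bounds[OF gp gm] by auto

lemma Y_line_deriv:
	assumes x: "x $ 3 ~= 0" and e: "e : Basis"
	shows "((%t. Y (x + t *R e) \<bullet> z) has_real_derivative kf e x * (e \<bullet> z)) (at 0)"
proof -
	obtain i where i: "e = axis i 1" using Basis_3E[OF e] by blast
	show ?thesis
	proof (cases "i = 3")
		case False
		then have "Y (x + t *R e) = Y x + t *R e" for t
			using UNIV_3_cases[of i] unfolding i by (auto simp: vec_eq_iff forall_3 axis_def)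
		moreover have "((%t. (Y x + t *R e) \<bullet> z) has_real_derivative e \<bullet> z) (at 0)"
			by (auto intro!: derivative_eq_intros simp: inner_add_left)
		ultimately show ?thesis using False by (simp add: kf_def i axis3)
	next
		case True
		have lin: "((%t. (Y x + (t * (c / L x)) *R e) \<bullet> z) has_real_derivative kf e x * (e \<bullet> z)) (at 0)"
			using True L_pos[of x] by (auto intro!: derivative_eq_intros simp: inner_add_left kf_def i axis3)
		let ?O = "{t. (x + t *R e) $ 3 * x $ 3 > 0}"
		have O: "open ?O" by (intro open_Collect_less continuous_intros)
		have z: "0 : ?O" using x by (auto simp: zero_less_mult_iff)
		have eq: "(Y x + (t * (c / L x)) *R e) \<bullet> z = Y (x + t *R e) \<bullet> z" if "t : ?O" for t
		proof -
			have "Y x + (t * (c / L x)) *R e = Y (x + t *R e)"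
			proof -
				have "0 < x $ 3 & 0 < x $ 3 + t \<or> x $ 3 < 0 & x $ 3 + t < 0"
					using that True by (simp add: i axis_def zero_less_mult_iff) blast
				then show ?thesis
					using True gp gm unfolding i
					by (auto simp: vec_eq_iff forall_3 axis_def stretch_def layer_def algebra_simps)
			qed
			then show ?thesis by simp
		qed
		show ?thesis by (rule has_field_derivative_transform_within_open[OF lin O z eq])
	qed
qed

lemma S_line_deriv:
	assumes x: "x $ 3 ~= 0" and e: "e : Basis"
	shows "((%t. S (x + t *R e)) has_real_derivative kf e x * (Y x \<bullet> e) / S x) (at 0)"
proof -
	have comp: "((%t. (Y (x + t *R e) \<bullet> b)^2) has_real_derivative 2 * (Y x \<bullet> b) * (kf e x * (e \<bullet> b))) (at 0)" for b
		using DERIV_power[OF Y_line_deriv[OF x e, of b], of 2] by (simp add: mult_ac)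
	have n: "(norm y)^2 = (\<Sum>b\<in>Basis. (y \<bullet> b)^2)" for y :: "real^3"
		unfolding power2_norm_eq_inner by (subst euclidean_inner) (simp add: power2_eq_square)
	have "((%t. (\<Sum>b\<in>Basis. (Y (x + t *R e) \<bullet> b)^2) + rho^2) has_real_derivative (\<Sum>b\<in>Basis. 2 * (Y x \<bullet> b) * (kf e x * (e \<bullet> b))) + 0) (at 0)"
		by (intro DERIV_add DERIV_sum comp DERIV_const)
	moreover have "(\<Sum>b\<in>Basis. 2 * (Y x \<bullet> b) * (kf e x * (e \<bullet> b))) + 0 = 2 * kf e x * (Y x \<bullet> e)"
		by (subst (2) euclidean_inner) (simp add: sum_distrib_left mult_ac)
	ultimately have h: "((%t. (norm (Y (x + t *R e)))^2 + rho^2) has_real_derivative 2 * kf e x * (Y x \<bullet> e)) (at 0)"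
		unfolding n by simp
	have p: "0 < (norm (Y (x + 0 *R e)))^2 + rho^2" using rho by (simp add: add_nonneg_pos)
	have "((%t. sqrt ((norm (Y (x + t *R e)))^2 + rho^2)) has_real_derivative
			inverse (sqrt ((norm (Y (x + 0 *R e)))^2 + rho^2)) / 2 * (2 * kf e x * (Y x \<bullet> e))) (at 0)"
		by (rule DERIV_chain2[OF DERIV_real_sqrt[OF p] h])
	moreover have "inverse (sqrt ((norm (Y (x + 0 *R e)))^2 + rho^2)) / 2 * (2 * kf e x * (Y x \<bullet> e)) = kf e x * (Y x \<bullet> e) / S x"
		by (simp add: S_def inverse_eq_divide)
	ultimately show ?thesis unfolding S_def by simp
qed

lemma continuous_S: "continuous_on UNIV S"
	unfolding S_def by (intro continuous_intros continuous_Y)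

lemma S_measurable: "S : BM"
	by (rule borel_measurable_continuous_onI[OF continuous_S])

lemma Y_measurable: "Y : BM"
	by (rule borel_measurable_continuous_onI[OF continuous_Y])

lemma profile_measurable: "T : BM" "U : BM" "U' : BM"
proof -
	have [measurable]: "pp : BM" unfolding pp_def[abs_def] by measurable
	show "T : BM" unfolding T_def[abs_def] by measurable
	show "U : BM" unfolding U_def[abs_def] by measurable
	show "U' : BM" unfolding U'_def[abs_def] by measurable
qed

lemma far: "norm x > norm q + R / m0 ==> R <= S x"
proof -
	assume "norm x > norm q + R / m0"
	then have "R / m0 <= norm (x - q)" using norm_triangle_ineq2[of x q] by linarith
	then have "R <= m0 * norm (x - q)" using m0 by (simp add: field_simps)
	also have "... <= norm (Y x)" using Y_lower[of x q] Y_q by simp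
	finally show ?thesis using S_ge(2)[of x] by linarith
qed

lemma supported: "(!!x. R <= S x ==> F x = 0) ==> bounded_support F"
	unfolding bounded_support_def using far by blast

lemma bounded_supported: "(!!x. R <= S x ==> F x = 0) ==> (!!x. S x < R ==> \<bar>F x\<bar> <= K) ==> bounded_fun F"
	unfolding bounded_fun_def by (rule exI[of _ "max K 0"]) (metis abs_zero le_max_iff_disj linorder_not_le order_refl)

lemma g_dir_lipschitz:
	assumes e: "e : Basis"
	shows "dir_lipschitz e g (%x. gg x \<bullet> e)"
	unfolding dir_lipschitz_def
proof (intro conjI)
	note [measurable] = S_measurable Y_measurable profile_measurable layer_measurable
	obtain i where i: "e = axis i 1" using Basis_3E[OF e] by blast
	have "g : BM" unfolding g_def[abs_def] by measurable
	then show "g : LM" by (rule borel_imp_lebesgue_measurable)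
	have "(%x. U (S x) * kf (axis i 1) x * (Y x \<bullet> axis i 1)) : BM" unfolding kf_def by measurable
	then show "(%x. gg x \<bullet> e) : LM"
		unfolding i gg_component by (rule borel_imp_lebesgue_measurable)
	have "\<bar>g (x + t *R e) - g x\<bar> <= KT * M0 * \<bar>t\<bar>" for x t
	proof -
		have "\<bar>g (x + t *R e) - g x\<bar> <= KT * \<bar>S (x + t *R e) - S x\<bar>"
			unfolding g_def by (intro T_lipschitz S_ge)
		also have "... <= KT * (M0 * norm (x + t *R e - x))" using a by (intro mult_left_mono S_lipschitz) (simp add: KT_def)
		finally show ?thesis using e by (simp add: norm_Basis mult.assoc)
	qed
	then show "\<exists>K. \<forall>x t. \<bar>g (x + t *R e) - g x\<bar> <= K * \<bar>t\<bar>" by blast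
	show "AL x. ((%t. (g (x + t *R e) - g x) / t) ---> gg x \<bullet> e) (at 0)"
		using AE_off_interface
	proof eventually_elim
		fix x :: "real^3" assume x: "x $ 3 ~= 0"
		have T': "(T has_real_derivative S (x + 0 *R e) * U (S (x + 0 *R e))) (at (S (x + 0 *R e)))" by (rule T_deriv[OF S_ge(3)])
		from DERIV_chain2[OF T' S_line_deriv[OF x e]]
		have "((%t. g (x + t *R e)) has_real_derivative gg x \<bullet> e) (at 0)"
			unfolding g_def i gg_component using S_ge(3)[of x] by (simp add: mult_ac)
		then show "((%t. (g (x + t *R e) - g x) / t) ---> gg x \<bullet> e) (at 0)"
			by (simp add: DERIV_def)
	qed
qed

lemma UY_lipschitz: "\<bar>U (S x') * (Y x' \<bullet> e) - U (S x) * (Y x \<bullet> e)\<bar> <= (KU' * M0 * R + KU * M0) * norm (x' - x)"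
	if e: "norm e = 1"
proof -
	have near: "\<bar>U (S x') * (Y x' \<bullet> e) - U (S x) * (Y x \<bullet> e)\<bar> <= (KU' * M0 * R + KU * M0) * norm (x' - x)"
		if "S x' < R" for x x'
	proof -
		have y1: "\<bar>Y x' \<bullet> e\<bar> <= R"
			using Cauchy_Schwarz_ineq2[of "Y x'" e] S_ge(2)[of x'] that e by simp
		have "\<bar>(U (S x') - U (S x)) * (Y x' \<bullet> e)\<bar> <= (KU' * (M0 * norm (x' - x))) * R"
			unfolding abs_mult
			by (intro mult_mono y1 order.trans[OF U_lipschitz] mult_left_mono S_lipschitz S_ge KU_nonneg)
				(use KU_nonneg M0 in auto)
		moreover have "\<bar>U (S x) * (Y x' \<bullet> e - Y x \<bullet> e)\<bar> <= KU * (M0 * norm (x' - x))"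
			unfolding abs_mult
		proof (intro mult_mono U_bound S_ge KU_nonneg)
			show "\<bar>Y x' \<bullet> e - Y x \<bullet> e\<bar> <= M0 * norm (x' - x)"
				using Cauchy_Schwarz_ineq2[of "Y x' - Y x" e] Y_lipschitz[of x' x] e by (simp add: inner_diff_left)
		qed auto
		moreover have "U (S x') * (Y x' \<bullet> e) - U (S x) * (Y x \<bullet> e) = (U (S x') - U (S x)) * (Y x' \<bullet> e) + U (S x) * (Y x' \<bullet> e - Y x \<bullet> e)"
			by (simp add: algebra_simps)
		ultimately show ?thesis by (simp add: algebra_simps)
	qed
	show ?thesis
	proof (cases "S x' < R")
		case False
		show ?thesis
		proof (cases "S x < R")
			case True
			from near[OF this, of x'] show ?thesis by (simp add: abs_minus_commute norm_minus_commute)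
		next
			case False
			then show ?thesis using \<open>\<not> S x' < R\<close> TU_zero[of "S x"] TU_zero[of "S x'"] KU_nonneg M0 R by simp
		qed
	qed (rule near)
qed

text \<open>The flux component along \<open>e\<close> is \<open>k U(S) (Y \<bullet> e)\<close>, with
  \<open>k = c\<close> in the normal direction and \<open>k = L\<close> in the tangential ones. A
  shift along \<open>e\<close> therefore never changes \<open>k\<close>, although \<open>L\<close>
  jumps.\<close>

lemma V_dir_lipschitz:
	assumes e: "e : Basis"
	shows "dir_lipschitz e (%x. (L x *R gg x) \<bullet> e) (dV e)"
proof -
	note [measurable] = S_measurable Y_measurable profile_measurable layer_measurable
	obtain i where i: "e = axis i 1" using Basis_3E[OF e] by blast
	have ne: "norm e = 1" using e by (rule norm_Basis)
	define k where "k x = (if i = 3 then c else L x)" for x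
	have V: "(L x *R gg x) \<bullet> e = k x * (U (S x) * (Y x \<bullet> e))" for x
		using L_pos[of x] unfolding i inner_scaleR_left gg_component by (simp add: k_def kf_def axis3)
	have kl: "k (x + t *R e) = k x" for x t
		using UNIV_3_cases[of i] by (auto simp: k_def i layer_def axis_def)
	have kw: "k x * kf e x = flux_coef e x" for x by (simp add: k_def kf_def flux_coef_def i axis3 power2_eq_square)
	have kb: "0 <= k x" "k x <= c + max gp gm" for x using c layer_bounds[OF gp gm, of x] by (auto simp: k_def)
	show ?thesis
		unfolding dir_lipschitz_def V
	proof (intro conjI)
		have "(%x. k x * (U (S x) * (Y x \<bullet> e))) : BM" unfolding k_def by measurable
		then show "(%x. k x * (U (S x) * (Y x \<bullet> e))) : LM" by (rule borel_imp_lebesgue_measurable)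
		have "dV e : BM" unfolding dV_def[abs_def] flux_coef_def by measurable
		then show "dV e : LM" by (rule borel_imp_lebesgue_measurable)
		let ?K = "(c + max gp gm) * (KU' * M0 * R + KU * M0)"
		have "\<bar>k (x + t *R e) * (U (S (x + t *R e)) * (Y (x + t *R e) \<bullet> e)) - k x * (U (S x) * (Y x \<bullet> e))\<bar> <= ?K * \<bar>t\<bar>" for x t
		proof -
			have "k (x + t *R e) * (U (S (x + t *R e)) * (Y (x + t *R e) \<bullet> e)) - k x * (U (S x) * (Y x \<bullet> e))
					= k x * (U (S (x + t *R e)) * (Y (x + t *R e) \<bullet> e) - U (S x) * (Y x \<bullet> e))"
				unfolding kl by (simp add: right_diff_distrib)
			then have "\<bar>k (x + t *R e) * (U (S (x + t *R e)) * (Y (x + t *R e) \<bullet> e)) - k x * (U (S x) * (Y x \<bullet> e))\<bar>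
					= k x * \<bar>U (S (x + t *R e)) * (Y (x + t *R e) \<bullet> e) - U (S x) * (Y x \<bullet> e)\<bar>"
				using kb(1)[of x] by (simp add: abs_mult)
			moreover have "... <= (c + max gp gm) * ((KU' * M0 * R + KU * M0) * norm (x + t *R e - x))"
				by (intro mult_mono kb UY_lipschitz ne) (use c gp in auto)
			ultimately show ?thesis using ne by (simp add: mult.assoc)
		qed
		then show "\<exists>K. \<forall>x t. \<bar>k (x + t *R e) * (U (S (x + t *R e)) * (Y (x + t *R e) \<bullet> e)) - k x * (U (S x) * (Y x \<bullet> e))\<bar> <= K * \<bar>t\<bar>" by blast
		show "AL x. ((%t. (k (x + t *R e) * (U (S (x + t *R e)) * (Y (x + t *R e) \<bullet> e)) - k x * (U (S x) * (Y x \<bullet> e))) / t) ---> dV e x) (at 0)"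
			using AE_off_interface
		proof eventually_elim
			fix x :: "real^3" assume x: "x $ 3 ~= 0"
			have U'': "(U has_real_derivative U' (S (x + 0 *R e))) (at (S (x + 0 *R e)))" by (rule U_deriv[OF S_ge(3)])
			have D: "((%t. k x * (U (S (x + t *R e)) * (Y (x + t *R e) \<bullet> e))) has_real_derivative
					k x * (U' (S (x + 0 *R e)) * (kf e x * (Y x \<bullet> e) / S x) * (Y (x + 0 *R e) \<bullet> e) + kf e x * (e \<bullet> e) * U (S (x + 0 *R e)))) (at 0)"
				by (rule DERIV_cmult[OF DERIV_mult[OF DERIV_chain2[OF U'' S_line_deriv[OF x e]] Y_line_deriv[OF x e]]])
			have ee: "e \<bullet> e = 1" using ne by (simp add: norm_eq_sqrt_inner)
			have "k x * (U' (S (x + 0 *R e)) * (kf e x * (Y x \<bullet> e) / S x) * (Y (x + 0 *R e) \<bullet> e) + kf e x * (e \<bullet> e) * U (S (x + 0 *R e))) = dV e x"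
				unfolding dV_def kw[symmetric] ee by (simp add: algebra_simps power2_eq_square)
			with D have "((%t. k x * (U (S (x + t *R e)) * (Y (x + t *R e) \<bullet> e))) has_real_derivative dV e x) (at 0)" by simp
			then show "((%t. (k (x + t *R e) * (U (S (x + t *R e)) * (Y (x + t *R e) \<bullet> e)) - k x * (U (S x) * (Y x \<bullet> e))) / t) ---> dV e x) (at 0)"
				unfolding kl by (simp add: DERIV_def)
		qed
	qed
qed

end

subsection \<open>Propagation of lower bounds\<close>

context barrier begin

definition "Wmax = 3 * (max gp gm + c^2 / min gp gm)"

lemma flux_coef_bounds: "0 <= flux_coef e x" "flux_coef e x <= max gp gm + c^2 / min gp gm"
proof -
	have L: "min gp gm <= L x" "L x <= max gp gm" "0 < L x" using layer_bounds[OF gp gm] by auto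
	define k where "k = c^2 / min gp gm"
	have 1: "c^2 / L x <= k" unfolding k_def using L gp gm by (intro divide_left_mono) auto
	have 2: "0 <= k" "0 <= c^2 / L x" "0 <= max gp gm" using gp gm L by (auto simp: k_def)
	show "0 <= flux_coef e x" using 2 L by (simp add: flux_coef_def)
	have "flux_coef e x = L x \<or> flux_coef e x = c^2 / L x" by (simp add: flux_coef_def)
	then show "flux_coef e x <= max gp gm + c^2 / min gp gm"
		unfolding k_def[symmetric] using 1 2 L by linarith
qed

lemma gg_measurable: "gg : LM"
proof (subst borel_measurable_euclidean_space, rule ballI)
	fix e :: "real^3" assume "e : Basis"
	then show "(%x. gg x \<bullet> e) : LM" by (rule dir_lipschitz_measurable(2)[OF g_dir_lipschitz])
qed

lemma kf_bounds: "0 <= kf e x" "kf e x <= 1 + c / min gp gm"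
proof -
	have L: "min gp gm <= L x" "0 < L x" using layer_bounds[OF gp gm] by auto
	have "c / L x <= c / min gp gm" using L gp gm c by (intro divide_left_mono) auto
	moreover have "0 <= c / min gp gm" "0 <= c / L x" using gp gm L c by auto
	ultimately show "0 <= kf e x" "kf e x <= 1 + c / min gp gm" unfolding kf_def by auto
qed

lemma Y_component: "e : Basis ==> S x < R ==> \<bar>Y x \<bullet> e\<bar> <= R"
	using Basis_le_norm[of e "Y x"] S_ge(2)[of x] by linarith

lemma gg_component_bound:
	assumes e: "e : Basis"
	shows "\<bar>gg x \<bullet> e\<bar> <= KU * (1 + c / min gp gm) * R"
proof -
	obtain i where i: "e = axis i 1" using Basis_3E[OF e] by blast
	have nn: "0 <= KU * (1 + c / min gp gm) * R" using KU_nonneg kf_bounds[of e x] R by (intro mult_nonneg_nonneg) auto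
	show ?thesis
	proof (cases "S x < R")
		case True
		have "\<bar>U (S x)\<bar> * \<bar>kf e x\<bar> * \<bar>Y x \<bullet> e\<bar> <= KU * (1 + c / min gp gm) * R"
			using kf_bounds[of e x] KU_nonneg by (intro mult_mono U_bound S_ge Y_component[OF e True]) auto
		then show ?thesis unfolding i gg_component abs_mult .
	next
		case False
		then have "U (S x) = 0" using TU_zero[of "S x"] by simp
		then show ?thesis using nn unfolding i gg_component by simp
	qed
qed

lemma g_H1: "g : H1" and grad_g: "AL x. grad g x = gg x"
proof -
	have bg: "bounded_fun g"
		by (rule bounded_supported[of _ 1]) (use TU_zero T_bound S_ge in "auto simp: g_def")
	have sg: "bounded_support g" by (rule supported) (use TU_zero in "auto simp: g_def")
	have "norm (gg x) <= (\<Sum>e\<in>(Basis :: (real^3) set). KU * (1 + c / min gp gm) * R)" for x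
		by (rule order.trans[OF norm_le_l1]) (intro sum_mono gg_component_bound)
	then have bgg: "bounded_fun (%x. norm (gg x))" unfolding bounded_fun_def by auto
	have sgg: "bounded_support (%x. norm (gg x))" by (rule supported) (use TU_zero in "auto simp: gg_def")
	show "g : H1" "AL x. grad g x = gg x"
		using H1_lipschitz[OF g_dir_lipschitz bg sg gg_measurable bgg sgg] by auto
qed

lemma dV_bounds:
	assumes that: "e : Basis"
	shows "bounded_fun (dV e)" "bounded_support (dV e)"
proof -
	show "bounded_support (dV e)" by (rule supported) (use TU_zero in "auto simp: dV_def")
	let ?W = "max gp gm + c^2 / min gp gm"
	show "bounded_fun (dV e)"
	proof (rule bounded_supported[of _ "?W * (KU + KU' / rho * R^2)"])
		fix x assume x: "S x < R"
		have "\<bar>U' (S x) / S x * (Y x \<bullet> e)^2\<bar> <= KU' / rho * R^2"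
			unfolding abs_mult abs_divide
		proof (intro mult_mono frac_le)
			show "\<bar>(Y x \<bullet> e)\<^sup>2\<bar> <= R^2" using power_mono[OF Y_component[OF that x], of 2] by simp
			show "rho <= \<bar>S x\<bar>" using S_ge[of x] by simp
		qed (use U'_bound[OF S_ge(1)] KU_nonneg rho in auto)
		then have "\<bar>U (S x) + U' (S x) / S x * (Y x \<bullet> e)^2\<bar> <= KU + KU' / rho * R^2"
			using U_bound[OF S_ge(1)[of x]] by linarith
		then show "\<bar>dV e x\<bar> <= ?W * (KU + KU' / rho * R^2)"
			unfolding dV_def abs_mult using flux_coef_bounds[of e x] by (intro mult_mono) auto
	qed (use TU_zero in "auto simp: dV_def")
qed

lemma dV_L2: "e : Basis ==> dV e : L2"
	using bounded_support_L2[OF dir_lipschitz_measurable(2)[OF V_dir_lipschitz] dV_bounds] by blast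

text \<open>The equation for \<open>v\<close> is tested with \<open>g\<close>, and the remaining
  derivative of \<open>v\<close> is moved to the explicit flux. As a result \<open>v\<close> enters
  undifferentiated and positivity can be exploited.\<close>

lemma barrier_identity:
	assumes f: "f : L2" and v: "background_solution (gamma0 gp gm) f tau v"
	shows "LI (%x. v x * hh tau x)" and "(LN x. f x * g x) = (LN x. v x * hh tau x)"
proof -
	have vH: "v : H1" using v by (simp add: background_solution_def)
	note V = H1_D[OF vH] and G = H1_D[OF g_H1]
	have sL: "(%x. \<Sum>e\<in>Basis. dV e x) : L2" by (intro L2_sum dV_L2)
	have hL: "hh tau : L2" unfolding hh_def[abs_def] by (intro L2_diff L2_cmult G sL)
	show "LI (%x. v x * hh tau x)" by (rule L2_mult_integrable[OF V(1) hL])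
	have bV: "bounded_fun (%x. (L x *R gg x) \<bullet> e)" if e: "e : Basis" for e
		unfolding bounded_fun_def
	proof (intro exI allI)
		fix x
		show "\<bar>(L x *R gg x) \<bullet> e\<bar> <= max gp gm * (KU * (1 + c / min gp gm) * R)"
			unfolding inner_scaleR_left abs_mult using layer_bounds[OF gp gm, of x]
			by (intro mult_mono gg_component_bound[OF e]) auto
	qed
	have sV: "bounded_support (%x. (L x *R gg x) \<bullet> e)" for e
		by (rule supported) (use TU_zero in "auto simp: gg_def")
	have "energy_form (gamma0 gp gm) v g = (LN x. (gamma0 gp gm x *v grad v x) \<bullet> gg x)"
		by (rule energy_form_cong[OF gamma0_elliptic[OF gp gm] vH _ L2_measurable[OF V(2)] g_H1 grad_g gg_measurable]) auto
	also have "... = (LN x. (L x *R gg x) \<bullet> grad v x)"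
		by (intro Bochner_Integration.integral_cong) (auto simp: gamma0_mult inner_commute)
	also have "... = - (LN x. (\<Sum>e\<in>Basis. dV e x) * v x)"
		by (rule H1_divergence[OF vH V_dir_lipschitz bV sV dV_L2])
	finally have en: "energy_form (gamma0 gp gm) v g = - (LN x. (\<Sum>e\<in>Basis. dV e x) * v x)" .
	have "- energy_form (gamma0 gp gm) v g - tau^2 * (LN x. v x * g x) + (LN x. f x * g x) = 0"
		using v g_H1 by (auto simp: background_solution_def)
	then have "(LN x. f x * g x) = tau^2 * (LN x. v x * g x) - (LN x. (\<Sum>e\<in>Basis. dV e x) * v x)"
		using en by linarith
	also have "... = (LN x. tau^2 * (v x * g x) - (\<Sum>e\<in>Basis. dV e x) * v x)"
		using L2_mult_integrable[OF V(1) G(1)] L2_mult_integrable[OF sL V(1)] by simp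
	also have "... = (LN x. v x * hh tau x)"
		by (intro Bochner_Integration.integral_cong) (auto simp: hh_def algebra_simps)
	finally show "(LN x. f x * g x) = (LN x. v x * hh tau x)" .
qed

text \<open>All three contributions are compared with the common factor
  \<open>pp^2 exp (- a S)\<close>. The cube triples the decay rate, whence \<open>9 a^2\<close> in
  the second-order term; \<open>3 a Wmax / rho\<close> bounds the first-order term, and the quotient
  of \<open>(norm (Y x))^2\<close> by \<open>(S x)^2\<close> measures what smoothing the distance
  costs near \<open>q\<close>.\<close>

lemma hh_upper:
	assumes near: "S x < R ==> a0 <= L x & a0 <= c^2 / L x" and a0: "a0 >= 0"
	shows "hh tau x <= (pp (S x))^2 * exp (- a * S x) * (tau^2 + 3 * a * Wmax / rho - 9 * a^2 * a0 * (norm (Y x))^2 / (S x)^2)"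
proof (cases "S x < R")
	case False
	then have "S x >= R" by simp
	then show ?thesis using TU_zero[of "S x"] pp_bounds(3)[of "S x"] by (simp add: hh_def g_def dV_def)
next
	case True
	define s E p where "s = S x" and "E = exp (- a * S x)" and "p = pp (S x)"
	have s: "s > 0" "rho <= s" using S_ge[of x] by (auto simp: s_def)
	have b: "0 <= p" "p <= E" "0 < E" using pp_bounds[of "S x"] by (auto simp: E_def p_def)
	have nn: "0 <= p^2 * E" using b by simp
	let ?W = "\<Sum>e\<in>(Basis :: (real^3) set). flux_coef e x"
	let ?Q = "\<Sum>e\<in>(Basis :: (real^3) set). flux_coef e x * (Y x \<bullet> e)^2"
	have sumdV: "(\<Sum>e\<in>Basis. dV e x) = U s * ?W + U' s / s * ?Q"
		by (simp add: dV_def s_def sum_distrib_left sum_distrib_right distrib_left sum.distrib mult_ac)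
	have card3: "card (Basis :: (real^3) set) = 3" by simp
	have W: "?W <= Wmax"
	proof -
		have "?W <= of_nat (card (Basis :: (real^3) set)) * (max gp gm + c^2 / min gp gm)"
			by (rule sum_bounded_above) (rule flux_coef_bounds)
		then show ?thesis unfolding card3 Wmax_def by simp
	qed
	have W0: "0 <= ?W" by (intro sum_nonneg flux_coef_bounds)
	have Q: "a0 * (norm (Y x))^2 <= ?Q"
	proof -
		have "(norm (Y x))^2 = (\<Sum>e\<in>Basis. (Y x \<bullet> e)^2)"
			unfolding power2_norm_eq_inner by (subst euclidean_inner) (simp add: power2_eq_square)
		then have "a0 * (norm (Y x))^2 = (\<Sum>e\<in>Basis. a0 * (Y x \<bullet> e)^2)" by (simp add: sum_distrib_left)
		also have "... <= ?Q" using near[OF True] by (intro sum_mono mult_right_mono) (auto simp: flux_coef_def)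
		finally show ?thesis .
	qed
	have U: "- U s = 3 * a * (p^2 * E) / s" by (simp add: U_def p_def E_def s_def)
	have U1: "- U s * ?W <= (p^2 * E) * (3 * a * Wmax / rho)"
	proof -
		have "3 * a * (p^2 * E) / s <= 3 * a * (p^2 * E) / rho" using nn a s rho by (intro divide_left_mono) auto
		then have "- U s * ?W <= 3 * a * (p^2 * E) / rho * Wmax" unfolding U using W W0 nn a rho by (intro mult_mono) auto
		then show ?thesis by (simp add: mult_ac)
	qed
	have U2: "(p^2 * E) * (9 * a^2 * a0 * (norm (Y x))^2 / s^2) <= U' s / s * ?Q"
	proof -
		\<comment> \<open>As \<open>p <= E\<close>, the factor \<open>2 E + p\<close> may be lowered to
		  \<open>3 p\<close>, which produces the common factor \<open>p^2 E\<close>.\<close>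
		have "a * (3 * p) / s + 0 <= a * (2 * E + p) / s + p / (s * s)"
			using a b s by (intro add_mono divide_right_mono mult_left_mono) auto
		then have "3 * a * (E * p * (a * (3 * p) / s)) <= U' s"
			unfolding U'_def E_def[symmetric] s_def p_def[symmetric] using a b by (intro mult_left_mono) auto
		then have "3 * a * (E * p * (a * (3 * p) / s)) / s * (a0 * (norm (Y x))^2) <= U' s / s * ?Q"
			using Q s a0 a b by (intro mult_mono divide_right_mono) (auto intro!: divide_nonneg_nonneg U'_sign)
		moreover have "3 * a * (E * p * (a * (3 * p) / s)) / s * (a0 * (norm (Y x))^2) = (p^2 * E) * (9 * a^2 * a0 * (norm (Y x))^2 / s^2)"
			by (simp add: power2_eq_square mult_ac)
		ultimately show ?thesis by simp
	qed
	have g: "g x <= p^2 * E"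
	proof -
		have "p * p^2 <= E * p^2" using b by (intro mult_right_mono) auto
		then show ?thesis by (simp add: g_def T_def p_def mult.commute)
	qed
	have "hh tau x = tau^2 * g x + (- U s * ?W) - U' s / s * ?Q" unfolding hh_def sumdV by simp
	also have "... <= tau^2 * (p^2 * E) + (p^2 * E) * (3 * a * Wmax / rho) - (p^2 * E) * (9 * a^2 * a0 * (norm (Y x))^2 / s^2)"
		using U1 U2 mult_left_mono[OF g, of "tau^2"] by simp
	also have "... = p^2 * E * (tau^2 + 3 * a * Wmax / rho - 9 * a^2 * a0 * (norm (Y x))^2 / s^2)" by (simp add: algebra_simps)
	finally show ?thesis unfolding p_def E_def s_def .
qed

text \<open>As \<open>v\<close> is nonnegative, an upper bound of \<open>hh\<close> suffices. It is
  nonpositive outside the ball about \<open>q\<close> and bounded away from zero on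
  \<open>A\<close>, so the mass of \<open>v\<close> on \<open>A\<close> and the source seen by the
  barrier must both be paid for by the mass of \<open>v\<close> near \<open>q\<close>.\<close>

lemma barrier_mass:
	assumes f: "f : L2" and v: "background_solution (gamma0 gp gm) f tau v" and v0: "AL x. 0 <= v x"
		and near: "!!x. S x < R ==> a0 <= L x & a0 <= c^2 / L x" and a0: "a0 >= 0" and dlt: "dlt >= 0"
		and outer: "!!x. r <= norm (x - q) ==> tau\<^sup>2 + 3 * a * Wmax / rho - 9 * a^2 * a0 * (norm (Y x))^2 / (S x)^2 <= - dlt * tau^2"
		and K: "tau^2 + 3 * a * Wmax / rho <= K * tau^2" "K >= 0"
		and A: "A : sets lebesgue" "!!x. x : A ==> r <= norm (x - q) & S x <= d1"
		and d1: "2 * exp (- a * R) <= exp (- a * d1)"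
	shows "(LN x. f x * g x) + dlt * tau^2 / 4 * exp (- 3 * a * d1) * (LN x. indicator A x * v x)
			<= K * tau^2 * (LN x. indicator (ball q r) x * v x)"
proof -
	have vH: "v : H1" using v by (simp add: background_solution_def)
	note V = H1_D[OF vH]
	note bi = barrier_identity[OF f v]
	define k where "k = dlt * tau^2 / 4 * exp (- 3 * a * d1)"
	have k0: "k >= 0" using dlt by (simp add: k_def)
	have bound: "hh tau x <= K * tau^2 * indicator (ball q r) x - k * indicator A x" for x
	proof -
		let ?p = "(pp (S x))^2 * exp (- a * S x)"
		have s0: "0 <= S x" using S_ge(3)[of x] by linarith
		have p01: "0 <= ?p" "?p <= 1" using pp_bounds[of "S x"] s0 by (auto simp: mult_le_one power_le_one)
		have up: "hh tau x <= ?p * (tau^2 + 3 * a * Wmax / rho - 9 * a^2 * a0 * (norm (Y x))^2 / (S x)^2)"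
			by (rule hh_upper[OF near a0])
		show ?thesis
		proof (cases "r <= norm (x - q)")
			case False
			then have xb: "x : ball q r" by (simp add: dist_norm norm_minus_commute)
			have xA: "x \<notin> A" using A(2) False by blast
			have "tau^2 + 3 * a * Wmax / rho - 9 * a^2 * a0 * (norm (Y x))^2 / (S x)^2 <= K * tau^2"
			proof -
				have "0 <= 9 * a^2 * a0 * (norm (Y x))^2 / (S x)^2" using a0 by simp
				then show ?thesis using K(1) by linarith
			qed
			from mult_left_mono[OF this p01(1)] up have "hh tau x <= ?p * (K * tau^2)" by linarith
			also have "... <= 1 * (K * tau^2)" using p01 K(2) by (intro mult_right_mono) auto
			finally show ?thesis using xb xA by simp
		next
			case True
			then have xb: "x \<notin> ball q r" by (simp add: dist_norm norm_minus_commute)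
			from mult_left_mono[OF outer[OF True] p01(1)] up
			have le: "hh tau x <= ?p * (- dlt * tau^2)" by linarith
			show ?thesis
			proof (cases "x : A")
				case False
				have "?p * (- dlt * tau^2) <= 0" using p01 dlt by (simp add: mult_nonneg_nonneg)
				then show ?thesis using le xb False by simp
			next
				case True
				then have sd: "S x <= d1" using A(2) by blast
				have e1: "exp (- a * d1) <= exp (- a * S x)" using sd a by simp
				\<comment> \<open>By \<open>d1\<close> the truncation removes at most half of the exponential on
				  \<open>A\<close>; squaring this half gives the quarter in the constant
				  \<open>k\<close>.\<close>
				then have "exp (- a * d1) / 2 <= exp (- a * S x) - exp (- a * R)" using d1 by linarith
				then have "exp (- a * d1) / 2 <= pp (S x)" unfolding pp_def by (rule max.coboundedI2)
				then have "(exp (- a * d1) / 2)^2 * exp (- a * d1) <= ?p" using e1 by (intro mult_mono power_mono) auto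
				moreover have "(exp (- a * d1) / 2)^2 * exp (- a * d1) = exp (- 3 * a * d1) / 4"
					by (simp add: power2_eq_square exp_add[symmetric] algebra_simps)
				ultimately have "exp (- 3 * a * d1) / 4 * (dlt * tau^2) <= ?p * (dlt * tau^2)" using dlt by (intro mult_right_mono) auto
				then show ?thesis using le xb True by (simp add: k_def algebra_simps)
			qed
		qed
	qed
	have iA: "LI (%x. indicator B x * v x)" if "B : sets lebesgue" "bounded B" for B
		by (rule L2_mult_integrable[OF indicator_bounded_L2[OF that] V(1)])
	have bA: "bounded A"
	proof -
		have "A <= ball 0 (norm q + d1 / m0 + 1)"
		proof
			fix x assume "x : A"
			then have "norm (Y x) <= d1" using A(2) S_ge(2)[of x] by force
			moreover have "m0 * norm (x - q) <= norm (Y x)" using Y_lower[of x q] Y_q by simp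
			ultimately have "norm (x - q) <= d1 / m0" using m0 by (simp add: pos_le_divide_eq mult.commute)
			then show "x : ball 0 (norm q + d1 / m0 + 1)" using norm_triangle_ineq2[of x q] by simp
		qed
		then show ?thesis by (rule bounded_subset[OF bounded_ball])
	qed
	note i1 = iA[of "ball q r"] and i2 = iA[OF A(1) bA]
	have "(LN x. f x * g x) <= (LN x. K * tau^2 * (indicator (ball q r) x * v x) - k * (indicator A x * v x))"
		unfolding bi(2)
	proof (rule integral_mono_AE[OF bi(1)])
		show "LI (%x. K * tau^2 * (indicator (ball q r) x * v x) - k * (indicator A x * v x))"
			using i1 i2 by simp
		show "AL x. v x * hh tau x <= K * tau^2 * (indicator (ball q r) x * v x) - k * (indicator A x * v x)"
			using v0
		proof eventually_elim
			fix x assume "0 <= v x"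
			from mult_left_mono[OF bound[of x] this]
			show "v x * hh tau x <= K * tau^2 * (indicator (ball q r) x * v x) - k * (indicator A x * v x)"
				by (simp add: algebra_simps)
		qed
	qed
	also have "... = K * tau^2 * (LN x. indicator (ball q r) x * v x) - k * (LN x. indicator A x * v x)"
		using i1 i2 by simp
	finally show ?thesis unfolding k_def by simp
qed

end

section \<open>Points at which the mass of the solution is bounded below\<close>

abbreviation mass where "mass v t p r == LN x. indicator (ball p r) x * v t x"

text \<open>The number \<open>alp\<close> plays the role of an upper bound for the optical travel
  time from the source to \<open>p\<close>. The arbitrary \<open>eps\<close> absorbs constants and
  powers of \<open>tau\<close>, and the arbitrary \<open>r\<close> makes the notion local.\<close>

definition good :: "(real => real^3 => real) => real^3 => real => bool" where
	"good v p alp \<longleftrightarrow> (\<forall>r>0. \<forall>eps>0. eventually (%tau. exp (- tau * (alp + eps)) <= (mass v tau p r)) at_top)"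

lemma goodD: "good v p alp ==> r > 0 ==> eps > 0 ==>
	eventually (%tau. exp (- tau * (alp + eps)) <= (mass v tau p r)) at_top"
	unfolding good_def by blast

locale background =
	fixes gp gm :: real and f :: "real^3 => real" and v :: "real => real^3 => real"
	assumes gp: "gp > 0" and gm: "gm > 0" and f: "f : L2" and f0: "AL x. 0 <= f x"
		and sol: "!!tau. tau >= 1 ==> background_solution (gamma0 gp gm) f tau (v tau)"
begin

lemma v_H1: "tau >= 1 ==> v tau : H1"
	using sol by (simp add: background_solution_def)

lemma v_nonneg: "tau >= 1 ==> AL x. 0 <= v tau x"
	by (rule background_nonneg[OF gp gm _ f f0 sol])

lemma mass_integrable: "tau >= 1 ==> LI (%x. indicator (ball p r) x * v tau x)"
	by (rule L2_mult_integrable[OF indicator_bounded_L2 H1_D(1)[OF v_H1]]) auto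

lemma mass_mono:
	assumes "tau >= 1" "ball p r <= ball q s"
	shows "(mass v tau p r) <= (mass v tau q s)"
proof (rule integral_mono_AE[OF mass_integrable[OF assms(1)] mass_integrable[OF assms(1)]])
	show "AL x. indicator (ball p r) x * v tau x <= indicator (ball q s) x * v tau x"
		using v_nonneg[OF assms(1)] by eventually_elim (use assms(2) in "auto simp: indicator_def")
qed

text \<open>A ball about \<open>p\<close> contains a half-sized ball about any sufficiently near
  \<open>p'\<close>, and the mass is monotone because \<open>v\<close> is nonnegative.\<close>

lemma good_limit:
	assumes "!!eps. eps > 0 ==> \<exists>p' alp'. good v p' alp' & dist p' p < eps & alp' <= alp + eps"
	shows "good v p alp"
	unfolding good_def
proof (intro allI impI)
	fix r eps :: real assume r: "r > 0" and eps: "eps > 0"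
	obtain p' alp' where p': "good v p' alp'" "dist p' p < min (r / 2) (eps / 2)" "alp' <= alp + min (r / 2) (eps / 2)"
		using assms[of "min (r / 2) (eps / 2)"] r eps by auto
	have sub: "ball p' (r / 2) <= ball p r"
	proof
		fix x assume "x : ball p' (r / 2)"
		then show "x : ball p r" using p'(2) dist_triangle[of p x p'] by (simp add: dist_commute)
	qed
	have r2: "r / 2 > 0" "eps / 2 > 0" using r eps by auto
	show "eventually (%tau. exp (- tau * (alp + eps)) <= (mass v tau p r)) at_top"
		using goodD[OF p'(1) r2] eventually_ge_at_top[of 1]
	proof eventually_elim
		case (elim tau)
		have "tau * (alp' + eps / 2) <= tau * (alp + eps)" using elim(2) p'(3) by (intro mult_left_mono) auto
		then have "exp (- tau * (alp + eps)) <= exp (- tau * (alp' + eps / 2))" by simp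
		also have "... <= (LN x. indicator (ball p' (r / 2)) x * v tau x)" by (rule elim(1))
		also have "... <= (mass v tau p r)" by (rule mass_mono[OF elim(2) sub])
		finally show ?case .
	qed
qed

text \<open>The profile decays like \<open>exp (- 3 a s)\<close>. With \<open>a = kap * tau\<close>
  and \<open>3 * kap\<close> slightly above \<open>1 / sqrt a0\<close> the barrier is a strict
  subsolution away from its centre, while its loss over the distance \<open>d\<close> stays below
  \<open>d / sqrt a0 + eps\<close> per unit of \<open>tau\<close>. All constants are fixed before
  \<open>tau\<close> and the centre \<open>q\<close>.\<close>

lemma barrier_parameters:
	assumes c: "c > 0" and a0: "a0 > 0" and R: "R > d" "d >= 0" and r: "r > 0" and eps: "eps > 0"
	obtains kap rho d1 dlt K tau0 where "kap > 0" "rho > 0" "rho <= (d1 - d) / 2" "d < d1" "d1 < R" "dlt > 0" "K > 0" "tau0 >= 1"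
		"3 * kap * d1 <= d / sqrt a0 + eps"
		"!!tau q x. tau >= tau0 ==> r <= norm (x - q) ==> tau\<^sup>2 + 3 * (kap * tau) * barrier.Wmax gp gm c / rho
				- 9 * (kap * tau)^2 * a0 * (norm (stretched_diff gp gm c q x))^2 / (barrier.S gp gm c q rho x)^2 <= - dlt * tau^2"
		"!!tau. tau >= tau0 ==> tau\<^sup>2 + 3 * (kap * tau) * barrier.Wmax gp gm c / rho <= K * tau^2"
		"!!tau. tau >= tau0 ==> 2 * exp (- (kap * tau) * R) <= exp (- (kap * tau) * d1)"
proof -
	define m0 where "m0 = barrier.m0 gp gm c"
	define W where "W = barrier.Wmax gp gm c"
	interpret B0: barrier gp gm c 0 1 1 1 by unfold_locales (use gp gm c in auto)
	have m0: "m0 > 0" using B0.m0(1) by (simp add: m0_def)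
	have W: "W >= 0" unfolding W_def B0.Wmax_def using gp gm by (auto intro!: add_nonneg_nonneg simp: le_max_iff_disj)
	define s where "s = sqrt a0"
	have s: "s > 0" "s * s = a0" using a0 by (auto simp: s_def)
	\<comment> \<open>\<open>t\<close> is the relative excess of all parameters. The bound
	  \<open>(R - d) / 2\<close> keeps \<open>d1 = d + t\<close> below \<open>R\<close>; the bound
	  \<open>s * eps / (d + 2)\<close> comes from
	  \<open>\<mu> * d1 = d + t * (d + 1 + t) <= d + t * (d + 2)\<close>.\<close>
	define t where "t = min ((R - d) / 2) (min 1 (s * eps / (d + 2)))"
	have t: "t > 0" "t <= 1" "t <= (R - d) / 2" "t * (d + 2) <= s * eps"
	proof -
		show "t > 0" using R s eps by (auto simp: t_def)
		show "t <= 1" unfolding t_def by auto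
		show "t <= (R - d) / 2" unfolding t_def by (rule min.cobounded1)
		have "t <= s * eps / (d + 2)" unfolding t_def by simp
		then show "t * (d + 2) <= s * eps" using R by (simp add: pos_le_divide_eq)
	qed
	define \<mu> where "\<mu> = 1 + t"
	define d1 where "d1 = d + t"
	define kap where "kap = \<mu> / (3 * s)"
	define dlt where "dlt = t / 2"
	define \<beta> where "\<beta> = t / \<mu>"
	have \<mu>: "\<mu> > 1" using t by (simp add: \<mu>_def)
	have \<beta>: "\<beta> > 0" "1 - \<beta> = 1 / \<mu>" using t \<mu> by (auto simp: \<beta>_def \<mu>_def field_simps)
	\<comment> \<open>Outside the ball of radius \<open>r\<close> the vector \<open>Y\<close> has norm
	  at least \<open>m0 * r\<close>, so with this \<open>rho\<close> the smoothing loses at most the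
	  factor \<open>1 - \<beta> = 1 / \<mu>\<close>. Against the \<open>\<mu>^2\<close> from
	  \<open>9 * kap^2 * a0\<close> a factor \<open>\<mu>\<close> in front of \<open>tau^2\<close>
	  survives.\<close>
	define rho where "rho = min (t / 2) (sqrt \<beta> * m0 * r)"
	have rho: "rho > 0" "rho <= t / 2" "rho <= sqrt \<beta> * m0 * r" using t \<beta> m0 r by (auto simp: rho_def)
	have kap: "kap > 0" using \<mu> s by (simp add: kap_def)
	have kap2: "9 * kap^2 * a0 = \<mu>^2"
		unfolding kap_def s(2)[symmetric] using s(1) by (simp add: power2_eq_square field_simps)
	\<comment> \<open>The first-order term is linear in \<open>tau\<close>; from \<open>tau0\<close> on
	  it is at most \<open>dlt * tau^2\<close>, half of the gain \<open>t * tau^2\<close>. The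
	  logarithm ensures that the exponential at \<open>R\<close> is at most half of that at
	  \<open>d1\<close>.\<close>
	define tau0 where "tau0 = max 1 (max (3 * kap * W / (rho * dlt)) (ln 2 / (kap * (R - d1))))"
	have dlt: "dlt > 0" using t by (simp add: dlt_def)
	have d1: "d < d1" "d1 < R" using t R by (auto simp: d1_def)
	have W1: "3 * (kap * tau) * W / rho <= dlt * tau^2" and tau1: "tau >= 1" if "tau >= tau0" for tau
	proof -
		show "tau >= 1" using that by (simp add: tau0_def)
		have "3 * kap * W / (rho * dlt) <= tau" using that by (simp add: tau0_def)
		then have "3 * kap * W / rho <= dlt * tau" using rho dlt by (simp add: field_simps)
		then have "3 * kap * W / rho * tau <= dlt * tau * tau" using \<open>tau >= 1\<close> by (intro mult_right_mono) auto
		then show "3 * (kap * tau) * W / rho <= dlt * tau^2" by (simp add: power2_eq_square mult_ac)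
	qed
	show ?thesis
	proof (rule that[of kap rho d1 dlt "1 + dlt" tau0])
		show "kap > 0" "rho > 0" "d < d1" "d1 < R" "dlt > 0" "tau0 >= 1" "1 + dlt > 0" using kap rho d1 dlt by (auto simp: tau0_def)
		show "rho <= (d1 - d) / 2" using rho(2) by (simp add: d1_def)
		show "3 * kap * d1 <= d / sqrt a0 + eps"
		proof -
			have "\<mu> * d1 = d + t * (d + 1 + t)" by (simp add: \<mu>_def d1_def algebra_simps)
			also have "... <= d + t * (d + 2)" using t by (intro add_left_mono mult_left_mono) auto
			also have "... <= d + s * eps" using t(4) by simp
			finally have "\<mu> * d1 / s <= (d + s * eps) / s" using s by (intro divide_right_mono) auto
			also have "(d + s * eps) / s = d / s + eps" using s by (simp add: add_divide_distrib)
			finally show ?thesis using s by (simp add: kap_def s_def)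
		qed
		show "tau^2 + 3 * (kap * tau) * barrier.Wmax gp gm c / rho <= (1 + dlt) * tau^2" if "tau >= tau0" for tau
			using W1[OF that] by (simp add: W_def algebra_simps)
		show "2 * exp (- (kap * tau) * R) <= exp (- (kap * tau) * d1)" if "tau >= tau0" for tau
		proof -
			have "ln 2 / (kap * (R - d1)) <= tau" using that by (simp add: tau0_def)
			then have "ln 2 <= tau * (kap * (R - d1))" using kap d1 by (simp add: pos_divide_le_eq)
			then have "ln 2 - (kap * tau) * R <= - (kap * tau) * d1" by (simp add: algebra_simps)
			then have "exp (ln 2 + - (kap * tau) * R) <= exp (- (kap * tau) * d1)" by simp
			then show ?thesis by (simp only: exp_add) simp
		qed
		show "tau^2 + 3 * (kap * tau) * barrier.Wmax gp gm c / rho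
				- 9 * (kap * tau)^2 * a0 * (norm (stretched_diff gp gm c q x))^2 / (barrier.S gp gm c q rho x)^2 <= - dlt * tau^2"
			if tau: "tau >= tau0" and x: "r <= norm (x - q)" for tau q x
		proof -
			interpret B: barrier gp gm c q rho 1 1 by unfold_locales (use gp gm c rho in auto)
			have "m0 * r <= m0 * norm (x - q)" using x m0 by (intro mult_left_mono) auto
			also have "... <= norm (B.Y x)" using B.Y_lower[of x q] B.Y_q by (simp add: m0_def)
			finally have y: "m0 * r <= norm (B.Y x)" .
			have "rho <= sqrt \<beta> * (m0 * r)" using rho(3) by (simp add: mult.assoc)
			also have "... <= sqrt \<beta> * B.S x" using y B.S_ge(2)[of x] \<beta> by (intro mult_left_mono) auto
			finally have "rho^2 <= (sqrt \<beta> * B.S x)^2" using rho(1) by (intro power_mono) auto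
			then have "rho^2 <= \<beta> * (B.S x)^2" using \<beta> by (simp add: power_mult_distrib)
			then have "(1 - \<beta>) * (B.S x)^2 <= (norm (B.Y x))^2" using B.S_sq[of x] by (simp add: algebra_simps)
			then have ratio: "1 / \<mu> <= (norm (B.Y x))^2 / (B.S x)^2"
				using B.S_ge(3)[of x] unfolding \<beta>(2) by (simp add: pos_le_divide_eq)
			have "\<mu> * tau^2 = \<mu>^2 * tau^2 * (1 / \<mu>)" using \<mu> by (simp add: power2_eq_square)
			also have "... <= \<mu>^2 * tau^2 * ((norm (B.Y x))^2 / (B.S x)^2)" using ratio by (intro mult_left_mono) auto
			also have "... = 9 * (kap * tau)^2 * a0 * (norm (B.Y x))^2 / (B.S x)^2"
				unfolding kap2[symmetric] by (simp add: power_mult_distrib)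
			finally have big: "\<mu> * tau^2 <= 9 * (kap * tau)^2 * a0 * (norm (B.Y x))^2 / (B.S x)^2" .
			have "tau^2 + dlt * tau^2 - \<mu> * tau^2 = - dlt * tau^2" by (simp add: \<mu>_def dlt_def algebra_simps)
			then show ?thesis using big W1[OF tau] unfolding W_def by linarith
		qed
	qed
qed

lemma absorb_constant:
	assumes "k > 0" "eps > 0"
	shows "eventually (%tau::real. exp (- tau * eps) <= k) at_top"
proof -
	have "eventually (%tau. - ln k / eps <= tau) at_top" by (rule eventually_ge_at_top)
	then show ?thesis
	proof eventually_elim
		fix tau assume "- ln k / eps <= tau"
		then have "- tau * eps <= ln k" using assms by (simp add: field_simps)
		then have "exp (- tau * eps) <= exp (ln k)" by simp
		then show "exp (- tau * eps) <= k" using assms by simp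
	qed
qed

text \<open>The barrier is centred at the new point \<open>q\<close>, and \<open>A\<close> is a
  small ball about the old point \<open>p\<close>. The decay \<open>exp (- 3 kap tau d1)\<close> of
  the barrier between the two is the increment of the rate. Thirds of \<open>eps\<close> pay for the
  hypothesis at \<open>p\<close>, for the excess of the parameters and for the constants.\<close>

lemma good_step:
	assumes good: "good v p alp" and c: "c > 0" and a0: "a0 > 0" and R: "norm (stretched_diff gp gm c q p) < R"
		and near: "!!x. norm (stretched_diff gp gm c q x) < R ==> a0 <= layer gp gm x & a0 <= c^2 / layer gp gm x"
	shows "good v q (alp + norm (stretched_diff gp gm c q p) / sqrt a0)"
proof (cases "p = q")
	case True
	interpret B: barrier gp gm c q 1 1 1 by unfold_locales (use gp gm c in auto)
	show ?thesis using good True B.Y_q by simp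
next
	case False
	define d where "d = norm (stretched_diff gp gm c q p)"
	define M0 where "M0 = barrier.M0 gp gm c"
	have d0: "d >= 0" by (simp add: d_def)
	have dR: "d < R" using R by (simp add: d_def)
	have pq: "norm (p - q) > 0" using False by simp
	show ?thesis
		unfolding d_def[symmetric] good_def
	proof (intro allI impI)
		fix r0 eps :: real assume r0: "r0 > 0" and eps: "eps > 0"
		define r where "r = min r0 (norm (p - q) / 2)"
		have r: "r > 0" "r <= r0" "r <= norm (p - q) / 2" using r0 pq by (auto simp: r_def)
		have eps3: "eps / 3 > 0" using eps by simp
		show "eventually (%tau. exp (- tau * (alp + d / sqrt a0 + eps)) <= (mass v tau q r0)) at_top"
		proof (rule barrier_parameters[OF c a0 dR d0 r(1) eps3], goal_cases)
			case (1 kap rho d1 dlt K tau0)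
			note par = 1(1-9) and outer = 1(10) and K = 1(11) and ex = 1(12)
			\<comment> \<open>The first bound keeps the ball about \<open>p\<close> away from the ball of
			  radius \<open>r\<close> about \<open>q\<close>, the second keeps it within
			  \<open>S <= d1\<close>, where the barrier is not yet truncated.\<close>
			define r1 where "r1 = min (norm (p - q) / 2) ((d1 - d) / (2 * M0))"
			have M0: "M0 >= 1"
			proof -
				interpret B: barrier gp gm c q 1 1 1 by unfold_locales (use gp gm c in auto)
				show ?thesis using B.M0 by (simp add: M0_def)
			qed
			have r1: "r1 > 0" "r1 <= norm (p - q) / 2" "M0 * r1 <= (d1 - d) / 2"
			proof -
				show "r1 > 0" "r1 <= norm (p - q) / 2" using pq par(4) M0 by (auto simp: r1_def)
				have "r1 <= (d1 - d) / (2 * M0)" by (simp add: r1_def)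
				then show "M0 * r1 <= (d1 - d) / 2" using M0 by (simp add: field_simps)
			qed
			have ev: "eventually (%tau::real. exp (- tau * (eps / 3)) <= dlt / (4 * K)) at_top"
				by (rule absorb_constant) (use par eps in auto)
			show ?thesis
				using goodD[OF good r1(1) eps3] ev eventually_ge_at_top[of tau0]
			proof eventually_elim
				case (elim tau)
				have tau: "tau >= 1" using elim(3) par(8) by linarith
				interpret B: barrier gp gm c q rho R "kap * tau"
					by unfold_locales (use gp gm c par tau dR d0 in auto)
				have A: "r <= norm (x - q) & B.S x <= d1" if x: "x : ball p r1" for x
				proof
					have xp: "norm (x - p) < r1" using x by (simp add: dist_norm norm_minus_commute)
					have "norm (p - q) <= norm (x - q) + norm (x - p)"
						using norm_triangle_ineq4[of "x - q" "x - p"] by simp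
					then show "r <= norm (x - q)" using r(3) r1(2) xp by linarith
					have "norm (B.Y x) <= norm (B.Y p) + norm (B.Y x - B.Y p)" by (rule norm_triangle_sub)
					also have "norm (B.Y x - B.Y p) <= M0 * norm (x - p)" unfolding M0_def by (rule B.Y_lipschitz)
					also have "... <= M0 * r1" using xp M0 by (intro mult_left_mono) auto
					finally have yb: "norm (B.Y x) <= norm (B.Y p) + M0 * r1" by simp
					have "norm (B.Y p) = d" by (simp add: d_def)
					then have "norm (B.Y x) <= d + (d1 - d) / 2" using yb r1(3) by linarith
					then have "norm (B.Y x) + rho <= d1" using par(3) by (simp add: field_simps)
					then show "B.S x <= d1" using B.S_le[of x] by linarith
				qed
				have mA: "ball p r1 : sets lebesgue" by simp
				have near': "a0 <= B.L x & a0 <= c^2 / B.L x" if "B.S x < R" for x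
					using near B.S_ge(2)[of x] that by force
				have nn: "0 <= a0" "0 <= dlt" "0 <= K" using a0 par by auto
				have bm: "(LN x. f x * B.g x) + dlt * tau^2 / 4 * exp (- 3 * (kap * tau) * d1) * (mass v tau p r1)
						<= K * tau^2 * (mass v tau q r)"
					by (rule B.barrier_mass[OF f sol[OF tau] v_nonneg[OF tau] near' nn(1,2) outer[OF elim(3)] K[OF elim(3)] nn(3) mA A ex[OF elim(3)]])
				have "0 <= (LN x. f x * B.g x)"
					using f0 by (intro integral_nonneg_AE) (auto elim!: eventually_mono simp: B.g_def B.T_bound)
				then have "dlt * tau^2 / 4 * exp (- 3 * (kap * tau) * d1) * (mass v tau p r1)
						<= K * tau^2 * (mass v tau q r)" using bm by linarith
				then have "tau^2 * (dlt / 4 * exp (- 3 * (kap * tau) * d1) * (mass v tau p r1))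
						<= tau^2 * (K * (mass v tau q r))" by (simp add: mult_ac)
				then have m1: "dlt / 4 * exp (- 3 * (kap * tau) * d1) * (mass v tau p r1)
						<= K * (mass v tau q r)" using tau by simp
				have "dlt / 4 * exp (- 3 * (kap * tau) * d1) * exp (- tau * (alp + eps / 3))
						<= dlt / 4 * exp (- 3 * (kap * tau) * d1) * (mass v tau p r1)"
					using elim(1) par(6) by (intro mult_left_mono) auto
				with m1 have m2: "dlt / (4 * K) * (exp (- 3 * (kap * tau) * d1) * exp (- tau * (alp + eps / 3)))
						<= (mass v tau q r)"
					using par(7) by (simp add: field_simps)
				have "tau * (3 * kap * d1) <= tau * (d / sqrt a0 + eps / 3)" using par(9) tau by (intro mult_left_mono) auto
				then have "exp (- tau * (d / sqrt a0 + eps / 3)) <= exp (- 3 * (kap * tau) * d1)" by (simp add: mult_ac)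
				then have "exp (- tau * (eps / 3)) * (exp (- tau * (d / sqrt a0 + eps / 3)) * exp (- tau * (alp + eps / 3)))
						<= dlt / (4 * K) * (exp (- 3 * (kap * tau) * d1) * exp (- tau * (alp + eps / 3)))"
					using elim(2) par by (intro mult_mono) auto
				moreover have "exp (- tau * (eps / 3)) * (exp (- tau * (d / sqrt a0 + eps / 3)) * exp (- tau * (alp + eps / 3))) = exp (- tau * (alp + d / sqrt a0 + eps))"
					unfolding exp_add[symmetric] by (simp add: algebra_simps)
				ultimately have "exp (- tau * (alp + d / sqrt a0 + eps)) <= (mass v tau q r)"
					using m2 by linarith
				also have "... <= (mass v tau q r0)"
					using r(2) by (intro mass_mono[OF tau]) auto
				finally show ?case .
			qed
		qed
	qed
qed

text \<open>Here the source term of \<open>barrier_mass\<close> does the work, with \<open>A\<close>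
  empty: on a ball where \<open>f >= c1\<close> the barrier is at least
  \<open>exp (- 3 kap tau d1) / 8\<close>. The exponent costs \<open>eps / 2\<close>, the constants
  \<open>eps / 4\<close> and the factor \<open>tau^2\<close> another \<open>eps / 4\<close>.\<close>

lemma good_start:
	assumes r2: "r2 > 0" and c1: "c1 > 0" "AL x. x : ball q r2 --> c1 <= f x"
	shows "good v q 0"
	unfolding good_def
proof (intro allI impI)
	fix r eps :: real assume r: "r > 0" and eps: "eps > 0"
	\<comment> \<open>The parameters will be taken with \<open>d = 0\<close>, so the rate
	  \<open>d / sqrt a0\<close> vanishes and crude constants valid in both media cost nothing.\<close>
	define c a0 where "c = (1::real)" and "a0 = min (min gp gm) (1 / max gp gm)"
	have c: "c > 0" and a0: "a0 > 0" using gp gm by (auto simp: c_def a0_def less_max_iff_disj)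
	have near: "a0 <= layer gp gm x & a0 <= c^2 / layer gp gm x" for x
	proof -
		have L: "min gp gm <= layer gp gm x" "layer gp gm x <= max gp gm" "0 < layer gp gm x" using layer_bounds[OF gp gm] by auto
		have "1 / max gp gm <= 1 / layer gp gm x" using L by (intro divide_left_mono) auto
		then show ?thesis using L(1) unfolding a0_def c_def by auto
	qed
	have eps2: "eps / 2 > 0" using eps by simp
	define M0 where "M0 = barrier.M0 gp gm c"
	show "eventually (%tau. exp (- tau * (0 + eps)) <= (mass v tau q r)) at_top"
	proof (rule barrier_parameters[OF c a0 zero_less_one order_refl r eps2], goal_cases)
		case (1 kap rho d1 dlt K tau0)
		note par = 1(1-9) and outer = 1(10) and K = 1(11) and ex = 1(12)
		have M0: "M0 >= 1"
		proof -
			interpret B: barrier gp gm c q 1 1 1 by unfold_locales (use gp gm c in auto)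
			show ?thesis using B.M0 by (simp add: M0_def)
		qed
		define r1 where "r1 = min r2 (d1 / (2 * M0))"
		have r1: "r1 > 0" "r1 <= r2" "M0 * r1 <= d1 / 2"
		proof -
			show "r1 > 0" "r1 <= r2" using r2 par(4) M0 by (auto simp: r1_def)
			have "r1 <= d1 / (2 * M0)" by (simp add: r1_def)
			then show "M0 * r1 <= d1 / 2" using M0 by (simp add: field_simps)
		qed
		define vol where "vol = measure lebesgue (ball q r1)"
		have vol: "vol > 0" unfolding vol_def using content_ball_pos[OF r1(1)] by simp
		have kpos: "c1 * vol / (8 * K) > 0" using c1 vol par by simp
		have ev: "eventually (%tau::real. exp (- tau * (eps / 4)) <= c1 * vol / (8 * K)) at_top"
			by (rule absorb_constant[OF kpos]) (use eps in auto)
		have ev2: "eventually (%tau::real. tau^2 * exp (- tau * (eps / 4)) <= 1) at_top"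
		proof -
			have "((%x. x ^ 2 / exp x) ---> (0::real)) at_top" by (rule tendsto_power_div_exp_0)
			moreover have "filterlim (%tau::real. tau * (eps / 4)) at_top at_top"
				using eps by (intro filterlim_at_top_mult_tendsto_pos[OF tendsto_const _ filterlim_ident]) auto
			ultimately have "((%tau. (tau * (eps / 4)) ^ 2 / exp (tau * (eps / 4))) ---> (0::real)) at_top"
				by (rule filterlim_compose)
			then have "eventually (%tau. (tau * (eps / 4)) ^ 2 / exp (tau * (eps / 4)) < (eps / 4)^2) at_top"
				using eps by (intro order_tendstoD) auto
			then show ?thesis
			proof eventually_elim
				case (elim tau)
				have "exp (- tau * (eps / 4)) = inverse (exp (tau * (eps / 4)))" by (simp add: exp_minus)
				then have "(tau * (eps / 4)) ^ 2 / exp (tau * (eps / 4)) = (eps / 4)^2 * (tau^2 * exp (- tau * (eps / 4)))"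
					by (simp only: power_mult_distrib divide_inverse mult_ac)
				then have "(eps / 4)^2 * (tau^2 * exp (- tau * (eps / 4))) < (eps / 4)^2 * 1" using elim by linarith
				moreover have "0 < (eps / 4)^2" using eps by simp
				ultimately show ?case using mult_less_cancel_left_pos by fastforce
			qed
		qed
		show ?thesis
			using ev ev2 eventually_ge_at_top[of tau0]
		proof eventually_elim
			case (elim tau)
			have tau: "tau >= 1" using elim(3) par(8) by linarith
			interpret B: barrier gp gm c q rho 1 "kap * tau"
				by unfold_locales (use gp gm c par tau in auto)
			have nn: "0 <= a0" "0 <= dlt" "0 <= K" using a0 par by auto
			have bm: "(LN x. f x * B.g x) + dlt * tau^2 / 4 * exp (- 3 * (kap * tau) * d1) * (LN x. indicator {} x * v tau x)
					<= K * tau^2 * (mass v tau q r)"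
				by (rule B.barrier_mass[OF f sol[OF tau] v_nonneg[OF tau] near nn(1,2) outer[OF elim(3)] K[OF elim(3)] nn(3) sets.empty_sets _ ex[OF elim(3)]]) auto
			define e where "e = exp (- 3 * (kap * tau) * d1) / 8"
			have gl: "e <= B.g x" if x: "x : ball q r1" for x
			proof -
				have xq: "norm (x - q) < r1" using x by (simp add: dist_norm norm_minus_commute)
				have "norm (B.Y x) <= M0 * norm (x - q)" using B.Y_lipschitz[of x q] B.Y_q by (simp add: M0_def)
				also have "... <= M0 * r1" using xq M0 by (intro mult_left_mono) auto
				finally have "B.S x <= d1" using r1(3) par(3) B.S_le[of x] by simp
				then have "(kap * tau) * B.S x <= (kap * tau) * d1" using less_imp_le[OF B.a] by (rule mult_left_mono)
				then have "exp (- (kap * tau) * d1) <= exp (- (kap * tau) * B.S x)" by simp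
				then have "exp (- (kap * tau) * d1) / 2 <= exp (- (kap * tau) * B.S x) - exp (- (kap * tau) * 1)" using ex[OF elim(3)] by linarith
				then have h: "exp (- (kap * tau) * d1) / 2 <= B.pp (B.S x)" unfolding B.pp_def by (rule max.coboundedI2)
				have "exp (- (kap * tau) * d1) / 2 * (exp (- (kap * tau) * d1) / 2)^2 <= B.g x"
					unfolding B.g_def B.T_def by (intro mult_mono power_mono h B.pp_bounds) auto
				moreover have "exp (- (kap * tau) * d1) / 2 * (exp (- (kap * tau) * d1) / 2)^2 = e"
					by (simp add: e_def power2_eq_square exp_add[symmetric] algebra_simps)
				ultimately show ?thesis by simp
			qed
			have e0: "e > 0" by (simp add: e_def)
			have "c1 * e * vol = (LN x. c1 * e * indicator (ball q r1) x)"
				by (simp add: vol_def)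
			also have "... <= (LN x. f x * B.g x)"
			proof (rule integral_mono_AE)
				show "LI (%x. c1 * e * indicator (ball q r1) x)"
					using lmeasurable_ball[of q r1] by (simp add: lmeasurable_iff_integrable)
				show "LI (%x. f x * B.g x)" by (rule L2_mult_integrable[OF f H1_D(1)[OF B.g_H1]])
				show "AL x. c1 * e * indicator (ball q r1) x <= f x * B.g x"
					using c1(2) f0
				proof eventually_elim
					fix x assume a: "x : ball q r2 --> c1 <= f x" "0 <= f x"
					show "c1 * e * indicator (ball q r1) x <= f x * B.g x"
					proof (cases "x : ball q r1")
						case True
						then have "c1 <= f x" using a(1) r1(2) by auto
						then have "c1 * e <= f x * B.g x" using gl[OF True] c1 e0 a(2) by (intro mult_mono) auto
						then show ?thesis using True by simp
					qed (use a(2) B.T_bound(1) in "simp add: B.g_def")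
				qed
			qed
			also have "... <= K * tau^2 * (mass v tau q r)" using bm by simp
			finally have b1: "c1 * e * vol <= K * tau^2 * (mass v tau q r)" .
			define I where "I = (mass v tau q r)"
			have b2: "c1 * vol / (8 * K) * exp (- 3 * (kap * tau) * d1) <= tau^2 * I"
				using b1 par(7) unfolding e_def I_def[symmetric] by (simp add: field_simps)
			have "tau * (3 * kap * d1) <= tau * (eps / 2)" using par(9) tau by (intro mult_left_mono) auto
			then have "exp (- tau * (eps / 2)) <= exp (- 3 * (kap * tau) * d1)" by (simp add: mult_ac)
			then have "exp (- tau * (eps / 4)) * exp (- tau * (eps / 2)) <= c1 * vol / (8 * K) * exp (- 3 * (kap * tau) * d1)"
				using elim(1) kpos by (intro mult_mono) auto
			with b2 have b3: "exp (- tau * (eps / 4)) * exp (- tau * (eps / 2)) <= tau^2 * I" by linarith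
			have I0: "0 <= I"
			proof -
				have "0 <= tau^2 * I" using b3 by (rule order.trans[rotated]) simp
				then show ?thesis using tau by (simp add: zero_le_mult_iff)
			qed
			have "exp (- tau * eps) = exp (- tau * (eps / 4)) * (exp (- tau * (eps / 4)) * exp (- tau * (eps / 2)))"
				unfolding exp_add[symmetric] by (simp add: algebra_simps)
			also have "... <= exp (- tau * (eps / 4)) * (tau^2 * I)" by (intro mult_left_mono b3) simp
			also have "... = (tau^2 * exp (- tau * (eps / 4))) * I" by simp
			also have "... <= 1 * I" using elim(2) I0 by (intro mult_right_mono) auto
			finally show ?case by (simp add: I_def)
		qed
	qed
qed

end

section \<open>Lower bounds along broken lines\<close>

context background begin

text \<open>Taking for \<open>c\<close> the conductivity at \<open>q\<close> makes the stretching
  the identity on the side of \<open>q\<close>, and the radius \<open>\<bar>q $ 3\<bar>\<close>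
  keeps the barrier off the interface. Then \<open>a0 = c\<close> is the exact conductivity and
  nothing is lost in the rate.\<close>

lemma good_small_step:
	assumes good: "good v p alp" and pq: "p $ 3 * q $ 3 > 0" and d: "norm (p - q) < \<bar>q $ 3\<bar>"
	shows "good v q (alp + norm (p - q) / sqrt (layer gp gm q))"
proof -
	define c where "c = layer gp gm q"
	have c: "c > 0" using layer_bounds[OF gp gm] by (simp add: c_def)
	have st: "stretch gp gm c r = r" if "r * q $ 3 > 0" for r
		using that gp gm by (auto simp: stretch_def c_def layer_def zero_less_mult_iff)
	have qq: "q $ 3 * q $ 3 > 0" using pq by (auto simp: zero_less_mult_iff)
	have Yp: "stretched_diff gp gm c q p = p - q"
		using st[OF pq] st[OF qq] by (simp add: vec_eq_iff forall_3)
	have near: "c <= layer gp gm x & c <= c^2 / layer gp gm x"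
		if x: "norm (stretched_diff gp gm c q x) < \<bar>q $ 3\<bar>" for x
	proof -
		have "\<bar>stretch gp gm c (x $ 3) - q $ 3\<bar> < \<bar>q $ 3\<bar>"
			using component_le_norm_cart[of "stretched_diff gp gm c q x" 3] x st[OF qq] by simp
		then have s: "0 < stretch gp gm c (x $ 3) * q $ 3"
			by (auto simp: abs_if zero_less_mult_iff split: if_splits)
		have "(0 < x $ 3 & 0 < q $ 3) \<or> (x $ 3 < 0 & q $ 3 < 0)"
		proof (cases "x $ 3 > 0")
			case True
			then have "0 < stretch gp gm c (x $ 3)" using c gp by (simp add: stretch_def)
			then show ?thesis using s True by (simp add: zero_less_mult_iff)
		next
			case False
			then have "stretch gp gm c (x $ 3) <= 0" using c gm by (simp add: stretch_def mult_nonneg_nonpos divide_nonpos_pos)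
			moreover from this s have "stretch gp gm c (x $ 3) < 0 & q $ 3 < 0" by (auto simp: zero_less_mult_iff)
			ultimately show ?thesis using False c by (cases "x $ 3 = 0") (auto simp: stretch_def)
		qed
		then have "layer gp gm x = c" by (auto simp: c_def layer_def)
		then show ?thesis using c by (simp add: power2_eq_square)
	qed
	have "good v q (alp + norm (stretched_diff gp gm c q p) / sqrt c)"
		by (rule good_step[OF good c c _ near]) (use d Yp in auto)
	then show ?thesis unfolding Yp by (simp add: c_def)
qed

text \<open>By convexity all points of the segment stay at distance at least \<open>m\<close> from
  the interface, so \<open>n\<close> equal steps shorter than \<open>m\<close> are small steps, and
  their costs add up exactly.\<close>

lemma good_segment:
	assumes good: "good v p alp" and pq: "p $ 3 * q $ 3 > 0"
	shows "good v q (alp + norm (p - q) / sqrt (layer gp gm q))"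
proof -
	define m where "m = min \<bar>p $ 3\<bar> \<bar>q $ 3\<bar>"
	define N where "N = norm (p - q)"
	define \<gamma> where "\<gamma> = layer gp gm q"
	have m: "m > 0" using pq by (auto simp: m_def zero_less_mult_iff)
	obtain n where n: "N / m < real n" using reals_Archimedean2 by blast
	have "0 <= N / m" using m by (simp add: N_def)
	then have n0: "real n > 0" using n by linarith
	have small: "N / real n < m" using n n0 m by (simp add: field_simps)
	define P where "P k = p + (real k / real n) *R (q - p)" for k :: nat
	have P3: "P k $ 3 * q $ 3 > 0 & m <= \<bar>P k $ 3\<bar>" if k: "k <= n" for k
	proof -
		define s where "s = real k / real n"
		have s: "0 <= s" "s <= 1" using k n0 by (auto simp: s_def)
		have e: "P k $ 3 = (1 - s) * p $ 3 + s * q $ 3" by (simp add: P_def s_def[symmetric] algebra_simps)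
		consider "0 < p $ 3" "0 < q $ 3" | "p $ 3 < 0" "q $ 3 < 0" using pq by (auto simp: zero_less_mult_iff)
		then show ?thesis
		proof cases
			case 1
			have "(1 - s) * m + s * m <= (1 - s) * p $ 3 + s * q $ 3"
				using s 1 by (intro add_mono mult_left_mono) (auto simp: m_def)
			then have "m <= P k $ 3" unfolding e by (simp add: algebra_simps)
			then show ?thesis using m 1 by (auto simp: zero_less_mult_iff)
		next
			case 2
			have "(1 - s) * m + s * m <= (1 - s) * (- p $ 3) + s * (- q $ 3)"
				using s 2 by (intro add_mono mult_left_mono) (auto simp: m_def)
			then have "m <= - P k $ 3" unfolding e by (simp add: algebra_simps)
			then show ?thesis using m 2 by (auto simp: zero_less_mult_iff)
		qed
	qed
	have lay: "layer gp gm (P k) = \<gamma>" if "k <= n" for k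
		using P3[OF that] by (auto simp: \<gamma>_def layer_def zero_less_mult_iff)
	have "k <= n ==> good v (P k) (alp + real k * (N / real n) / sqrt \<gamma>)" for k
	proof (induction k)
		case 0
		then show ?case using good by (simp add: P_def)
	next
		case (Suc k)
		then have k: "k <= n" by simp
		have "P k - P (Suc k) = (1 / real n) *R (p - q)"
		proof -
			have "P k - P (Suc k) = (real k / real n - real (Suc k) / real n) *R (q - p)"
				by (simp only: P_def scaleR_left_diff_distrib) simp
			also have "real k / real n - real (Suc k) / real n = - (1 / real n)"
				using n0 by (simp add: field_simps)
			finally show ?thesis by (simp add: algebra_simps)
		qed
		then have dist: "norm (P k - P (Suc k)) = N / real n" using n0 by (simp add: N_def)
		have "0 < P k $ 3 * P (Suc k) $ 3"
			using P3[OF k] P3[OF Suc.prems] by (auto simp: zero_less_mult_iff)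
		moreover have "norm (P k - P (Suc k)) < \<bar>P (Suc k) $ 3\<bar>"
			using P3[OF Suc.prems] small dist by linarith
		ultimately have "good v (P (Suc k)) (alp + real k * (N / real n) / sqrt \<gamma> + norm (P k - P (Suc k)) / sqrt (layer gp gm (P (Suc k))))"
			by (rule good_small_step[OF Suc.IH[OF k]])
		moreover have "alp + real k * (N / real n) / sqrt \<gamma> + norm (P k - P (Suc k)) / sqrt (layer gp gm (P (Suc k)))
				= alp + real (Suc k) * (N / real n) / sqrt \<gamma>"
			unfolding dist lay[OF Suc.prems] by (simp add: add_divide_distrib distrib_right)
		ultimately show ?case by (simp only:)
	qed
	from this[of n] n0 show ?thesis by (simp add: P_def N_def \<gamma>_def)
qed

text \<open>With \<open>c = 1\<close> and an \<open>a0\<close> valid in both media the barrier may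
  extend across the interface. The rate is not sharp, but it is a fixed multiple of the distance,
  which is enough for a crossing that is made short.\<close>

lemma good_crossing: "\<exists>C\<ge>0. \<forall>p q alp. good v p alp --> (\<exists>\<beta>. good v q \<beta> & \<beta> <= alp + C * norm (p - q))"
proof -
	define a0 where "a0 = min (min gp gm) (1 / max gp gm)"
	have a0: "a0 > 0" using gp gm by (auto simp: a0_def less_max_iff_disj)
	have near: "a0 <= layer gp gm x & a0 <= 1^2 / layer gp gm x" for x
	proof -
		have L: "min gp gm <= layer gp gm x" "layer gp gm x <= max gp gm" "0 < layer gp gm x" using layer_bounds[OF gp gm] by auto
		have "1 / max gp gm <= 1 / layer gp gm x" using L by (intro divide_left_mono) auto
		then show ?thesis using L(1) unfolding a0_def by auto
	qed
	define M0 where "M0 = barrier.M0 gp gm 1"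
	have M0: "M0 >= 1"
	proof -
		interpret B: barrier gp gm 1 0 1 1 1 by unfold_locales (use gp gm in auto)
		show ?thesis using B.M0 by (simp add: M0_def)
	qed
	have "\<exists>\<beta>. good v q \<beta> & \<beta> <= alp + M0 / sqrt a0 * norm (p - q)" if g: "good v p alp" for p q alp
	proof -
		interpret B: barrier gp gm 1 q 1 1 1 by unfold_locales (use gp gm in auto)
		have g1: "good v q (alp + norm (B.Y p) / sqrt a0)"
			by (rule good_step[OF g zero_less_one a0 _ near, of q "norm (B.Y p) + 1"]) simp
		have "norm (B.Y p) <= M0 * norm (p - q)" using B.Y_lipschitz[of p q] B.Y_q by (simp add: M0_def)
		then have "norm (B.Y p) / sqrt a0 <= M0 * norm (p - q) / sqrt a0" using a0 by (intro divide_right_mono) auto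
		then show ?thesis using g1 by (intro exI[of _ "alp + norm (B.Y p) / sqrt a0"]) simp
	qed
	then show ?thesis using M0 a0 by (intro exI[of _ "M0 / sqrt a0"]) auto
qed

text \<open>Both legs of the broken line are walked at their exact cost up to the points
  \<open>a\<close> and \<open>b\<close> at relative distance \<open>t\<close> from the crossing
  point. The gap \<open>a - b = t *R (y - x)\<close> is jumped at cost at most \<open>eps\<close>,
  and \<open>good_limit\<close> removes the \<open>eps\<close>.\<close>

lemma good_optical_path:
	assumes y: "good v y 0" "y $ 3 > 0" and x: "x $ 3 < 0"
	shows "good v x (optical_length gp gm x y z)"
proof (rule good_limit)
	fix eps :: real assume eps: "eps > 0"
	obtain C where C: "C >= 0" "!!p q alp. good v p alp ==> \<exists>\<beta>. good v q \<beta> & \<beta> <= alp + C * norm (p - q)"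
		using good_crossing by blast
	define w where "w = interface_point z"
	define t where "t = min (1 / 2) (eps / (C * norm (y - x) + 1))"
	have den: "C * norm (y - x) + 1 > 0" using C(1) by (simp add: add_nonneg_pos)
	have t: "0 < t" "t < 1" "C * (t * norm (y - x)) <= eps"
	proof -
		show t0: "0 < t" using eps den by (simp add: t_def)
		have "t <= 1 / 2" unfolding t_def by (rule min.cobounded1)
		then show "t < 1" by simp
		have "t <= eps / (C * norm (y - x) + 1)" unfolding t_def by (rule min.cobounded2)
		then have "t * (C * norm (y - x) + 1) <= eps" using den by (simp add: pos_le_divide_eq)
		then show "C * (t * norm (y - x)) <= eps" using t0 by (simp add: algebra_simps)
	qed
	define a where "a = w + t *R (y - w)"
	define b where "b = w + t *R (x - w)"
	have w3: "w $ 3 = 0" by (simp add: w_def)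
	have a3: "a $ 3 > 0" and b3: "b $ 3 < 0" using t x y(2) by (auto simp: a_def b_def w3 mult_pos_neg)
	have "good v a (0 + norm (y - a) / sqrt (layer gp gm a))" by (rule good_segment[OF y(1)]) (use a3 y(2) in simp)
	then have ga: "good v a (norm (y - a) / sqrt gp)" using a3 by (simp add: layer_def)
	obtain \<beta> where \<beta>: "good v b \<beta>" "\<beta> <= norm (y - a) / sqrt gp + C * norm (a - b)" using C(2)[OF ga] by blast
	have "good v x (\<beta> + norm (b - x) / sqrt (layer gp gm x))"
		by (rule good_segment[OF \<beta>(1)]) (use b3 x in "simp add: mult_neg_neg")
	then have gx: "good v x (\<beta> + norm (b - x) / sqrt gm)" using x by (simp add: layer_def)
	have "y - a = (1 - t) *R (y - w)" by (simp add: a_def algebra_simps)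
	then have "norm (y - a) <= 1 * norm (y - w)" using t by (simp only: norm_scaleR) (intro mult_right_mono; simp)
	then have na: "norm (y - a) / sqrt gp <= norm (w - y) / sqrt gp" using gp by (intro divide_right_mono) (auto simp: norm_minus_commute)
	have "b - x = (1 - t) *R (w - x)" by (simp add: b_def algebra_simps)
	then have "norm (b - x) <= 1 * norm (w - x)" using t by (simp only: norm_scaleR) (intro mult_right_mono; simp)
	then have nb: "norm (b - x) / sqrt gm <= norm (w - x) / sqrt gm" using gm by (intro divide_right_mono) auto
	have "a - b = t *R (y - x)" by (simp add: a_def b_def algebra_simps)
	then have nab: "C * norm (a - b) <= eps" using t by simp
	have "\<beta> + norm (b - x) / sqrt gm <= optical_length gp gm x y z + eps"
		using \<beta>(2) na nb nab unfolding optical_length_alt w_def[symmetric] by simp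
	then show "\<exists>p' alp'. good v p' alp' & dist p' x < eps & alp' <= optical_length gp gm x y z + eps"
		using gx eps by (intro exI[of _ x] exI[of _ "\<beta> + norm (b - x) / sqrt gm"]) simp
qed

end

section \<open>From mass to gradient energy\<close>

lemma test_function_H1:
	fixes phi :: "'a::euclidean_space => real"
	assumes phi: "phi : test_functions UNIV"
	defines "G \<equiv> %x. \<Sum>e\<in>Basis. pd phi x e *R e"
	shows "phi : H1" "AL x. grad phi x = G x" "G : L2"
proof -
	obtain e0 :: 'a where e0: "e0 : Basis" using nonempty_Basis by blast
	have 1: "phi : L2" by (rule test_functions_L2(1)[OF phi e0])
	show 2: "G : L2"
		unfolding G_def
	proof (rule L2_sum)
		fix e :: 'a assume e: "e : Basis"
		note t = test_functions_L2(2)[OF phi e]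
		show "(%x. pd phi x e *R e) : L2"
			by (rule L2_dominated(1)[OF t _ _ zero_le_one]) (use L2_measurable[OF t] e in "auto simp: norm_Basis")
	qed
	have 3: "weak_gradient phi G"
		unfolding weak_gradient_iff
	proof
		fix e :: 'a assume e: "e : Basis"
		note t = test_function_props[OF phi e]
		have "G x \<bullet> e = pd phi x e" for x
			using e by (simp add: G_def inner_sum_left inner_Basis if_distrib sum.delta cong: if_cong)
		then show "weak_partial e phi (%x. G x \<bullet> e)"
			using weak_partial_dir_lipschitz[OF t(1,2,4) e] by simp
	qed
	show "phi : H1" "AL x. grad phi x = G x" using H1_I[OF 1 2 3] by auto
qed

lemma frechet_derivative_outside:
	fixes phi :: "'a::euclidean_space => real"
	assumes "closed C" "!!y. y \<notin> C ==> phi y = 0" "x \<notin> C"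
	shows "pd phi x e = 0"
proof -
	have "open (- C)" using assms(1) by (simp add: open_Compl)
	then have "(phi has_derivative (%h. 0)) (at x)"
		by (rule has_derivative_transform_within_open[OF has_derivative_const[of 0]]) (use assms in auto)
	from frechet_derivative_at[OF this] show ?thesis by metis
qed

lemma local_bump:
	fixes q :: "'a::euclidean_space"
	assumes r: "r > 0"
	obtains phi k s where "phi : test_functions UNIV" "k > 0" "s > 0" "!!x. 0 <= phi x" "!!x. x : ball q s ==> k <= phi x"
		"!!x. x \<notin> ball q r ==> phi x = 0" "!!x e. x \<notin> ball q r ==> pd phi x e = 0"
proof -
	obtain a b where ab: "q : box a b" "cbox a b <= ball q r"
	proof -
		obtain a b where "q : box a b" "box a b <= ball q (r / 2)"
			using rational_boxes[of "r / 2" q] r by (metis half_gt_zero)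
		moreover from this have "cbox a b <= cball q (r / 2)"
		proof -
			have "cbox a b = closure (box a b)" using \<open>q : box a b\<close> by (subst closure_box) auto
			also have "... <= cball q (r / 2)" using \<open>box a b <= ball q (r / 2)\<close> ball_subset_cball by (intro closure_minimal) auto
			finally show ?thesis .
		qed
		ultimately show ?thesis using r by (intro that[of a b]) (auto simp: subset_iff)
	qed
	let ?phi = "box_bump a b 1"
	have phi: "?phi : test_functions UNIV" by (rule box_bump_test) simp
	have out: "?phi x = 0" if "x \<notin> cbox a b" for x
		using box_bump_outside[of 1 x a b] that box_subset_cbox[of a b] by auto
	obtain s where s: "s > 0" "cball q s <= box a b"
		using open_contains_cball_eq[OF open_box[of a b]] ab(1) by blast
	have "continuous_on UNIV ?phi" using box_bump_Ck[of 0 a b 1] by simp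
	then have "continuous_on (cball q s) ?phi" by (rule continuous_on_subset) simp
	then have "\<exists>x\<in>cball q s. \<forall>y\<in>cball q s. ?phi x <= ?phi y"
		using s(1) by (intro continuous_attains_inf) auto
	then obtain x0 where x0: "x0 : cball q s" "!!y. y : cball q s ==> ?phi x0 <= ?phi y" by blast
	have k: "?phi x0 > 0" by (rule box_bump_pos) (use x0(1) s(2) in auto)
	show ?thesis
	proof (rule that[OF phi k s(1)])
		show "0 <= ?phi x" for x by (rule box_bump_bounds)
		show "?phi x0 <= ?phi x" if "x : ball q s" for x using x0(2)[of x] that by simp
		show "?phi x = 0" if "x \<notin> ball q r" for x using out[of x] that ab(2) by blast
		show "pd ?phi x e = 0" if "x \<notin> ball q r" for x e
			by (rule frechet_derivative_outside[OF closed_cbox out]) (use that ab(2) in auto)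
	qed
qed

text \<open>The bump \<open>phi\<close> is supported in \<open>D\<close>, where \<open>f\<close>
  vanishes. The equation then equates \<open>tau^2\<close> times the integral of
  \<open>v phi\<close> with minus the energy form of \<open>v\<close> and \<open>phi\<close>, which
  is at most a constant times the square root of the gradient energy in \<open>D\<close>.\<close>

lemma (in background) good_energy:
	assumes good: "good v q alp" and D: "D : sets lebesgue" and r: "r > 0" "ball q r <= D"
		and fD: "AL x. x : D --> f x = 0" and eps: "eps > 0"
	shows "eventually (%tau. exp (- 2 * tau * (alp + eps)) <= grad_energy_on D (v tau)) at_top"
proof (rule local_bump[OF r(1), of q], goal_cases)
	case (1 phi k s)
	note phi = 1(1) and k = 1(2) and s = 1(3) and phi0 = 1(4) and phik = 1(5) and out = 1(6) and dout = 1(7)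
	define G where "G = (%x. \<Sum>e\<in>Basis. pd phi x e *R e)"
	have th: "phi : H1" "AL x. grad phi x = G x" "G : L2"
		using test_function_H1[OF phi] unfolding G_def by auto
	define C where "C = max gp gm * L2_norm G + 1"
	have C: "C > 0" using gp unfolding C_def by (intro add_nonneg_pos mult_nonneg_nonneg) (auto simp: le_max_iff_disj)
	have eps2: "eps / 2 > 0" using eps by simp
	have ev: "eventually (%tau::real. exp (- tau * (eps / 2)) <= k / C) at_top"
		by (rule absorb_constant) (use k C eps in auto)
	show ?thesis
		using goodD[OF good s eps2] ev eventually_ge_at_top[of 1]
	proof eventually_elim
		case (elim tau)
		note tau = elim(3)
		note V = H1_D[OF v_H1[OF tau]]
		have mL: "(%x. gamma0 gp gm x *v grad (v tau) x) : L2" by (rule elliptic_L2(1)[OF gamma0_elliptic[OF gp gm] V(2)])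
		have en: "energy_form (gamma0 gp gm) (v tau) phi = (LN x. (gamma0 gp gm x *v grad (v tau) x) \<bullet> G x)"
			by (rule energy_form_cong[OF gamma0_elliptic[OF gp gm] v_H1[OF tau] _ L2_measurable[OF V(2)] th(1,2) L2_measurable[OF th(3)]]) simp
		let ?vD = "%x. indicator D x *R grad (v tau) x"
		have mD: "(indicator D :: _ => real) : LM" using D by (intro borel_measurable_indicator)
		have mvD: "?vD : LM" using mD L2_measurable[OF V(2)] by (intro borel_measurable_scaleR)
		have vDL: "?vD : L2"
			by (rule L2_dominated(1)[OF V(2) mvD, of 1]) (auto simp: indicator_def)
		have nvD: "L2_norm ?vD = sqrt (grad_energy_on D (v tau))"
			unfolding L2_norm_def grad_energy_on_def
			by (intro arg_cong[where f = sqrt] Bochner_Integration.integral_cong) (auto simp: indicator_def)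
		have "\<bar>energy_form (gamma0 gp gm) (v tau) phi\<bar> <= (LN x. \<bar>(gamma0 gp gm x *v grad (v tau) x) \<bullet> G x\<bar>)"
			unfolding en by (rule integral_abs_bound)
		also have "... <= (LN x. max gp gm * (norm (?vD x) * norm (G x)))"
		proof (rule integral_mono)
			show "LI (%x. \<bar>(gamma0 gp gm x *v grad (v tau) x) \<bullet> G x\<bar>)"
				by (intro integrable_abs L2_inner_integrable mL th)
			show "LI (%x. max gp gm * (norm (?vD x) * norm (G x)))"
				by (rule integrable_mult_right) (rule L2_mult_integrable[OF L2_norm_L2[OF vDL] L2_norm_L2[OF th(3)]])
			fix x
			show "\<bar>(gamma0 gp gm x *v grad (v tau) x) \<bullet> G x\<bar> <= max gp gm * (norm (?vD x) * norm (G x))"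
			proof (cases "x : ball q r")
				case True
				have "\<bar>(gamma0 gp gm x *v grad (v tau) x) \<bullet> G x\<bar> = layer gp gm x * \<bar>grad (v tau) x \<bullet> G x\<bar>"
					using layer_bounds[OF gp gm, of x] by (simp add: gamma0_mult abs_mult)
				moreover have "... <= max gp gm * (norm (grad (v tau) x) * norm (G x))"
					using layer_bounds[OF gp gm, of x] by (intro mult_mono Cauchy_Schwarz_ineq2) auto
				moreover have "x : D" using True r(2) by blast
				ultimately show ?thesis by simp
			next
				case False
				then have "G x = 0" by (simp add: G_def dout)
				then show ?thesis by simp
			qed
		qed
		also have "... = max gp gm * (LN x. norm (?vD x) * norm (G x))" by simp
		also have "... <= max gp gm * (L2_norm ?vD * L2_norm G)"
			using gp by (intro mult_left_mono L2_abs_integral_le vDL th) auto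
		also have "... <= C * sqrt (grad_energy_on D (v tau))"
			unfolding nvD C_def using grad_energy_nonneg[of D "v tau"] by (simp add: algebra_simps)
		finally have eb: "\<bar>energy_form (gamma0 gp gm) (v tau) phi\<bar> <= C * sqrt (grad_energy_on D (v tau))" .
		have "(LN x. f x * phi x) = 0"
		proof (rule integral_eq_zero_AE)
			show "AL x. f x * phi x = 0"
				using fD
			proof eventually_elim
				fix x assume "x : D --> f x = 0"
				then show "f x * phi x = 0" using out[of x] r(2) by (cases "x : ball q r") auto
			qed
		qed
		moreover have "- energy_form (gamma0 gp gm) (v tau) phi - tau^2 * (LN x. v tau x * phi x) + (LN x. f x * phi x) = 0"
			using sol[OF tau] th(1) by (auto simp: background_solution_def)
		ultimately have "tau^2 * (LN x. v tau x * phi x) <= C * sqrt (grad_energy_on D (v tau))" using eb by simp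
		moreover have "k * (mass v tau q s) <= (LN x. v tau x * phi x)"
		proof -
			have "(LN x. k * (indicator (ball q s) x * v tau x)) <= (LN x. v tau x * phi x)"
			proof (rule integral_mono_AE)
				show "LI (%x. k * (indicator (ball q s) x * v tau x))"
					by (intro integrable_mult_right mass_integrable tau)
				show "LI (%x. v tau x * phi x)" by (rule L2_mult_integrable[OF V(1) H1_D(1)[OF th(1)]])
				show "AL x. k * (indicator (ball q s) x * v tau x) <= v tau x * phi x"
					using v_nonneg[OF tau]
				proof eventually_elim
					fix x assume v0: "0 <= v tau x"
					show "k * (indicator (ball q s) x * v tau x) <= v tau x * phi x"
						using mult_left_mono[OF phik v0, of x] v0 phi0[of x] by (cases "x : ball q s") (auto simp: mult.commute)
				qed
			qed
			then show ?thesis by simp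
		qed
		moreover have "0 <= (LN x. v tau x * phi x)"
			using v_nonneg[OF tau] phi0 by (intro integral_nonneg_AE) (auto elim!: eventually_mono)
		moreover have "1 <= tau^2" using tau by simp
		ultimately have "k * (mass v tau q s) <= C * sqrt (grad_energy_on D (v tau))"
			using mult_right_mono[of 1 "tau^2" "LN x. v tau x * phi x"] by linarith
		then have "k / C * (mass v tau q s) <= sqrt (grad_energy_on D (v tau))"
			using C by (simp add: pos_divide_le_eq mult.commute)
		moreover have "exp (- tau * (eps / 2)) * exp (- tau * (alp + eps / 2)) <= k / C * (mass v tau q s)"
			using elim(1,2) k C by (intro mult_mono) auto
		moreover have "exp (- tau * (eps / 2)) * exp (- tau * (alp + eps / 2)) = exp (- tau * (alp + eps))"
			unfolding exp_add[symmetric] by (simp add: algebra_simps)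
		ultimately have "exp (- tau * (alp + eps)) <= sqrt (grad_energy_on D (v tau))" by linarith
		then have "(exp (- tau * (alp + eps)))^2 <= (sqrt (grad_energy_on D (v tau)))^2" by (intro power_mono) auto
		moreover have "(exp (- tau * (alp + eps)))^2 = exp (- 2 * tau * (alp + eps))"
			unfolding power2_eq_square exp_add[symmetric] by simp
		ultimately show ?case using grad_energy_nonneg[of D "v tau"] by simp
	qed
qed

subsection \<open>Regularity of the domains\<close>

text \<open>The open set consists of the directions strictly inside the truncated cone; the segment
  from the vertex along any of them stays in the cone. The angle bounds give
  \<open>cos \<theta> < 1\<close>, so that the axis is one of them.\<close>

lemma cone_direction:
	assumes n: "norm n = 1" and h: "h > 0" and \<theta>: "0 < \<theta>" "\<theta> <= pi"
	shows "open {w::real^3. w ~= 0 & norm w < h & norm w * cos \<theta> < w \<bullet> n}" (is "open ?W")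
		and "0 < t ==> t < h ==> t *R n : {w. w ~= 0 & norm w < h & norm w * cos \<theta> < w \<bullet> n}"
		and "w : {w. w ~= 0 & norm w < h & norm w * cos \<theta> < w \<bullet> n} ==> 0 < t' ==> t' <= 1 ==> x + t' *R w : finite_cone x n h \<theta> - {x}"
proof -
	show "open ?W" by (intro open_Collect_conj open_Collect_less open_Collect_neq continuous_intros)
	have "cos \<theta> < cos 0" using \<theta> by (intro cos_monotone_0_pi) auto
	then have cos: "cos \<theta> < 1" by simp
	have "n \<bullet> n = 1" using n by (simp add: norm_eq_sqrt_inner)
	then show "0 < t ==> t < h ==> t *R n : ?W" using n cos by auto
	show "w : ?W ==> 0 < t' ==> t' <= 1 ==> x + t' *R w : finite_cone x n h \<theta> - {x}"
	proof -
		assume w: "w : ?W" and t: "0 < t'" "t' <= 1"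
		have "t' * norm w <= 1 * norm w" using t by (intro mult_right_mono) auto
		moreover have "norm w < h" using w by simp
		ultimately have "t' * norm w <= h" by linarith
		moreover have "t' * (norm w * cos \<theta>) <= t' * (w \<bullet> n)" using w t by (intro mult_left_mono) auto
		ultimately show ?thesis using w t by (simp add: finite_cone_def mult.assoc)
	qed
qed

text \<open>A short way along the axis of the cone a whole ball fits into \<open>A\<close>. Such
  balls are needed near every point of the closure, since the final test function must live inside
  \<open>D\<close> near an almost optimal end point.\<close>

lemma condition_C_interior:
	assumes C: "condition_C A" and x: "x : closure A" and rho: "rho > 0"
	shows "\<exists>q r. r > 0 & ball q r <= A & dist q x < rho"
proof (cases "x : interior A")
	case True
	then obtain r where "r > 0" "ball x r <= A" by (auto simp: mem_interior)
	then show ?thesis using rho by (intro exI[of _ x] exI[of _ r]) auto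
next
	case False
	then have "x : frontier A" using x by (simp add: frontier_def)
	then obtain n h \<theta> where c: "norm n = 1" "h > 0" "0 < \<theta>" "\<theta> <= pi" "finite_cone x n h \<theta> - {x} <= A"
		using C by (auto simp: condition_C_def)
	let ?W = "{w::real^3. w ~= 0 & norm w < h & norm w * cos \<theta> < w \<bullet> n}"
	define t where "t = min h rho / 2"
	have t: "0 < t" "t < h" "t < rho" using c(2) rho by (auto simp: t_def min_def)
	have "t *R n : ?W" by (rule cone_direction(2)[OF c(1-4) t(1,2)])
	then obtain r where r: "r > 0" "ball (t *R n) r <= ?W"
		using open_contains_ball_eq[OF cone_direction(1)[OF c(1-4)], THEN iffD1] by blast
	have "ball (x + t *R n) r <= A"
	proof
		fix y assume "y : ball (x + t *R n) r"
		then have "y - x : ball (t *R n) r" by (simp add: dist_norm algebra_simps)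
		then have "y - x : ?W" using r(2) by blast
		from cone_direction(3)[OF c(1-4) this zero_less_one order_refl, of x]
		show "y : A" using c(5) by auto
	qed
	moreover have "dist (x + t *R n) x < rho" using t c(1) by (simp add: dist_norm)
	ultimately show ?thesis using r(1) by blast
qed

lemma fraction_less: "0 <= N ==> 0 < m ==> m / (2 * (N + 1)) * N < m" for N m :: real
proof -
	assume N: "0 <= N" and m: "0 < m"
	have "N / (2 * (N + 1)) < 1" using N by (auto simp: pos_divide_less_eq)
	then have "m * (N / (2 * (N + 1))) < m * 1" using m by (rule mult_strict_left_mono)
	then show ?thesis by simp
qed

text \<open>The vector \<open>n\<close> is the direction that the rigid motion makes vertical.
  Moving from a frontier point along \<open>n\<close> keeps the argument of \<open>g\<close> and
  raises the height from 0 to \<open>t\<close>, so the point enters \<open>A - frontier A\<close>,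
  which lies in the interior.\<close>

lemma C1_boundary_interior:
	assumes C: "C1_boundary A" and x: "x : closure A" and rho: "rho > 0"
	shows "\<exists>q r. r > 0 & ball q r <= A & dist q x < rho"
proof (cases "x : interior A")
	case True
	then obtain r where "r > 0" "ball x r <= A" by (auto simp: mem_interior)
	then show ?thesis using rho by (intro exI[of _ x] exI[of _ r]) auto
next
	case False
	then have xf: "x : frontier A" using x by (simp add: frontier_def)
	obtain U Q b and g :: "real^2 => real" where U: "open U" "x : U" and Q: "orthogonal_matrix Q"
		and f: "frontier A \<inter> U = {y\<in>U. (Q *v y + b) $ 3 - g (vector [(Q *v y + b) $ 1, (Q *v y + b) $ 2]) = 0}"
		and i: "(A - frontier A) \<inter> U = {y\<in>U. (Q *v y + b) $ 3 - g (vector [(Q *v y + b) $ 1, (Q *v y + b) $ 2]) > 0}"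
		using C[unfolded C1_boundary_def Let_def, rule_format, OF xf] by (elim exE conjE) (rule that)
	define n where "n = transpose Q *v axis 3 1"
	have Qn: "Q *v n = axis 3 1"
		unfolding n_def matrix_vector_mul_assoc using Q by (simp add: orthogonal_matrix_def)
	have h0: "(Q *v x + b) $ 3 - g (vector [(Q *v x + b) $ 1, (Q *v x + b) $ 2]) = 0" using f xf U(2) by blast
	have Qx: "Q *v (x + t *R n) = Q *v x + t *R axis 3 1" for t
		by (simp add: matrix_vector_right_distrib Qn matrix_vector_mult_scaleR)
	obtain s where s: "s > 0" "ball x s <= U" using open_contains_ball_eq[OF U(1)] U(2) by blast
	define t where "t = min s rho / (2 * (norm n + 1))"
	have t: "t > 0" using s rho by (simp add: t_def add_nonneg_pos)
	have tn: "t * norm n < min s rho"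
		unfolding t_def by (rule fraction_less) (use s rho in simp_all)
	let ?q = "x + t *R n"
	have qU: "?q : U" using s(2) tn t by (auto simp: dist_norm)
	have "(Q *v ?q + b) $ 3 - g (vector [(Q *v ?q + b) $ 1, (Q *v ?q + b) $ 2]) > 0"
		unfolding Qx using h0 t by (simp add: axis_def algebra_simps)
	then have "?q : A - frontier A" using i qU by blast
	then have "?q : interior A" using closure_subset[of A] by (auto simp: frontier_def)
	then obtain r where "r > 0" "ball ?q r <= A" by (auto simp: mem_interior)
	moreover have "dist ?q x < rho" using tn t by (simp add: dist_norm)
	ultimately show ?thesis by blast
qed

text \<open>The points of the frontier from which a fixed segment enters the open set \<open>B\<close> have infinitely many disjoint
	translates in a bounded region.\<close>

lemma condition_C_frontier_negligible:
	assumes B: "open B" "bounded B" and C: "condition_C B"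
	shows "negligible (frontier B)"
proof -
	\<comment> \<open>\<open>F q\<close> collects the frontier points from which
	  \<open>x + t *R q\<close> runs in \<open>B\<close> for all \<open>0 < t <= 1\<close>. Cutting
	  \<open>t\<close> below at \<open>1 / (m + 1)\<close> leaves compact segments, hence open
	  conditions, and makes \<open>F q\<close> a Borel set.\<close>
	define F where "F q = frontier B \<inter> (\<Inter>m. {x. \<forall>t\<in>{1 / real (Suc m)..1}. x + t *R q : B})" for q :: "real^3"
	have op: "open {x. \<forall>t\<in>{1 / real (Suc m)..1}. x + t *R q : B}" for m q
		unfolding open_contains_ball
	proof
		fix x assume "x : {x. \<forall>t\<in>{1 / real (Suc m)..1}. x + t *R q : B}"
		then have sub: "(%t. x + t *R q) ` {1 / real (Suc m)..1} <= B" by auto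
		have "compact ((%t. x + t *R q) ` {1 / real (Suc m)..1})"
			by (intro compact_continuous_image continuous_intros compact_Icc)
		from compact_subset_open_imp_ball_epsilon_subset[OF this B(1) sub]
		obtain e where e: "e > 0" "(\<Union>y\<in>(%t. x + t *R q) ` {1 / real (Suc m)..1}. ball y e) <= B" by blast
		show "\<exists>e>0. ball x e <= {x. \<forall>t\<in>{1 / real (Suc m)..1}. x + t *R q : B}"
		proof (intro exI[of _ e] conjI subsetI CollectI ballI)
			fix y t assume y: "y : ball x e" and t: "t : {1 / real (Suc m)..1}"
			have "y + t *R q : ball (x + t *R q) e" using y by (simp add: dist_norm)
			then show "y + t *R q : B" using e(2) t by blast
		qed (use e in auto)
	qed
	have Fmeas: "F q : sets lebesgue" for q
	proof -
		have "F q : sets borel" unfolding F_def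
			by (intro sets.Int sets.countable_INT) (auto intro!: borel_open op simp del: of_nat_Suc)
		then show ?thesis by simp
	qed
	have Fdef: "x : F q \<longleftrightarrow> x : frontier B & (\<forall>t. 0 < t & t <= 1 --> x + t *R q : B)" for x q
	proof -
		have m: "0 < 1 / real (Suc m)" for m by simp
		show ?thesis
		proof (intro iffI conjI allI impI)
			fix t :: real assume x: "x : F q" and t: "0 < t & t <= 1"
			obtain m where "1 / real (Suc m) < t" using reals_Archimedean[of t] t by (auto simp: inverse_eq_divide)
			then have "t : {1 / real (Suc m)..1}" using t by (simp del: of_nat_Suc)
			moreover have "\<forall>t\<in>{1 / real (Suc m)..1}. x + t *R q : B" using x unfolding F_def by blast
			ultimately show "x + t *R q : B" by blast
		next
			assume a: "x : frontier B & (\<forall>t. 0 < t & t <= 1 --> x + t *R q : B)"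
			show "x : F q" unfolding F_def
			proof (intro IntI INT_I CollectI ballI)
				fix k t assume "t : {1 / real (Suc k)..1}"
				then have "1 / real (Suc k) <= t" "t <= 1" by simp_all
				then have "0 < t" "t <= 1" using m[of k] less_le_trans by blast+
				then show "x + t *R q : B" using a by blast
			qed (use a in blast)
		next
			show "x : F q ==> x : frontier B" unfolding F_def by blast
		qed
	qed
	have null: "negligible (F q)" for q
	proof -
		define A where "A k = (%x. (1 / real (Suc k)) *R q + x) ` F q" for k :: nat
		have Fb: "bounded (F q)" using bounded_closure[OF B(2)] by (rule bounded_subset) (auto simp: F_def frontier_def)
		have Fl: "F q : lmeasurable" by (rule bounded_set_imp_lmeasurable[OF Fb Fmeas])
		have Al: "A k : lmeasurable" for k unfolding A_def by (rule measurable_translation[OF Fl])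
		have Am: "measure lebesgue (A k) = measure lebesgue (F q)" for k unfolding A_def by (rule measure_translation)
		have disj: "A k \<inter> A j = {}" if kj: "k < j" for k j
		proof (rule ccontr)
			assume "A k \<inter> A j ~= {}"
			then obtain x y where xy: "x : F q" "y : F q" "(1 / real (Suc k)) *R q + x = (1 / real (Suc j)) *R q + y"
				by (auto simp: A_def)
			define t where "t = 1 / real (Suc k) - 1 / real (Suc j)"
			have "1 / real (Suc j) < 1 / real (Suc k)" using kj by (intro divide_strict_left_mono) auto
			moreover have "1 / real (Suc k) <= 1" "0 < 1 / real (Suc j)" by simp_all
			ultimately have t: "0 < t" "t <= 1" unfolding t_def by linarith+
			\<comment> \<open>A common point of two translates would put \<open>y\<close> on the segment
			  issuing from \<open>x\<close>, hence into \<open>B\<close>, whereas frontier points of the open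
			  set \<open>B\<close> lie outside it.\<close>
			have "y = x + t *R q" using xy(3) by (simp add: t_def algebra_simps)
			then have "y : B" using xy(1) t Fdef by blast
			moreover have "y : frontier B" using xy(2) Fdef by blast
			ultimately show False using B(1) by (simp add: frontier_def interior_open)
		qed
		have "bounded B'" if "B' = (\<Union>k. A k)" for B'
		proof -
			obtain M where M: "!!x. x : F q ==> norm x <= M" using Fb by (auto simp: bounded_iff)
			have "norm y <= norm q + M" if "y : A k" for y k
			proof -
				obtain x where x: "x : F q" "y = (1 / real (Suc k)) *R q + x" using \<open>y : A k\<close> by (auto simp: A_def)
				have "norm ((1 / real (Suc k)) *R q) <= 1 * norm q" unfolding norm_scaleR by (intro mult_right_mono) auto
				then show ?thesis using x M[OF x(1)] norm_triangle_ineq[of "(1 / real (Suc k)) *R q" x] by simp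
			qed
			then show ?thesis unfolding that bounded_iff by auto
		qed
		then have Ub: "bounded (\<Union>k. A k)" by blast
		have "(\<Union>k. A k) : sets lebesgue" using Al by (intro sets.countable_UN) (auto simp: fmeasurable_def)
		then have Ul: "(\<Union>k. A k) : lmeasurable" by (rule bounded_set_imp_lmeasurable[OF Ub])
		have le: "real n * measure lebesgue (F q) <= measure lebesgue (\<Union>k. A k)" for n
		proof -
			have "real n * measure lebesgue (F q) = (\<Sum>k<n. measure lebesgue (A k))" by (simp add: Am)
			also have "... = measure lebesgue (\<Union>k<n. A k)"
			proof (rule measure_UNION'[symmetric])
				show "pairwise (%i j. disjnt (A i) (A j)) {..<n}"
					unfolding pairwise_def disjnt_def using disj by (metis Int_commute linorder_neqE_nat)
			qed (use Al in auto)
			also have "... <= measure lebesgue (\<Union>k. A k)"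
				by (rule measure_mono_fmeasurable[OF _ _ Ul]) (use Al in "auto simp: fmeasurable_def intro!: sets.finite_UN")
			finally show ?thesis .
		qed
		have "measure lebesgue (F q) <= 0"
		proof (rule ccontr)
			assume "\<not> ?thesis"
			then have p: "measure lebesgue (F q) > 0" by simp
			obtain n where "measure lebesgue (\<Union>k. A k) / measure lebesgue (F q) < real n" using reals_Archimedean2 by blast
			then show False using le[of n] p by (simp add: pos_divide_less_eq)
		qed
		then have "measure lebesgue (F q) = 0" using measure_nonneg[of lebesgue "F q"] by linarith
		then show ?thesis using Fl by (simp add: negligible_iff_measure)
	qed
	\<comment> \<open>The open cone of directions at any frontier point meets a fixed countable dense
	  set, so countably many of the null sets \<open>F q\<close> cover the frontier.\<close>
	obtain Q :: "(real^3) set" where Q: "countable Q" "!!X. open X ==> X ~= {} ==> \<exists>d\<in>Q. d : X"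
		using countable_dense_exists by blast
	have "frontier B <= (\<Union>q\<in>Q. F q)"
	proof
		fix x assume x: "x : frontier B"
		then obtain n h \<theta> where c: "norm n = 1" "h > 0" "0 < \<theta>" "\<theta> <= pi" "finite_cone x n h \<theta> - {x} <= B"
			using C by (auto simp: condition_C_def)
		let ?W = "{w::real^3. w ~= 0 & norm w < h & norm w * cos \<theta> < w \<bullet> n}"
		have "(h / 2) *R n : ?W" by (rule cone_direction(2)[OF c(1-4)]) (use c(2) in auto)
		then obtain q where q: "q : Q" "q : ?W" using Q(2)[OF cone_direction(1)[OF c(1-4)]] by blast
		have "x : F q"
			unfolding Fdef using x cone_direction(3)[OF c(1-4) q(2)] c(5) by blast
		then show "x : (\<Union>q\<in>Q. F q)" using q(1) by blast
	qed
	moreover have "negligible (\<Union>q\<in>Q. F q)"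
		by (rule negligible_countable_Union) (use Q(1) null in auto)
	ultimately show ?thesis using negligible_subset by blast
qed

text \<open>A pair of points and a crossing are chosen within \<open>eps / 4\<close> of the infimum.
  Moving the end point in \<open>D\<close> to the centre of a ball inside \<open>D\<close> costs
  another \<open>eps / 4\<close>, as the slowness there is \<open>1 / sqrt gm\<close>; the passage
  from mass to energy costs \<open>eps / 2\<close>.\<close>

lemma (in background) grad_energy_lower:
	assumes D: "D : sets lebesgue" "closure D <= R3_minus" "D ~= {}"
		and Dint: "!!x rho. x : closure D ==> rho > 0 ==> \<exists>q r. r > 0 & ball q r <= D & dist q x < rho"
		and B: "open B" "closure B <= R3_plus" "B ~= {}"
		and supp: "ess_support f <= closure B" and c1: "c1 > 0" "AL x. x : B --> c1 <= f x" and eps: "eps > 0"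
	shows "eventually (%tau. exp (- 2 * tau * (optical_set_distance gp gm D B + eps)) <= grad_energy_on D (v tau)) at_top"
proof -
	define l where "l = optical_set_distance gp gm D B"
	have "(INF (x, y)\<in>D \<times> B. optical_distance gp gm x y) < l + eps / 4" using eps by (simp add: l_def optical_set_distance_def)
	then obtain x y where xy: "x : D" "y : B" "optical_distance gp gm x y < l + eps / 4"
		using D(3) B(3) by (auto dest!: cInf_lessD[rotated])
	from xy(3) obtain z where z: "optical_length gp gm x y z < l + eps / 4"
		unfolding optical_distance_def by (auto dest!: cInf_lessD[rotated])
	have "x : closure D" using xy(1) closure_subset by blast
	moreover have "sqrt gm * (eps / 4) > 0" using gm eps by simp
	ultimately obtain q r where q: "r > 0" "ball q r <= D" "dist q x < sqrt gm * (eps / 4)" using Dint by blast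
	have "norm (interface_point z - q) <= norm (interface_point z - x) + norm (q - x)"
		using norm_triangle_ineq4[of "interface_point z - x" "q - x"] by simp
	then have "1 / sqrt gm * norm (interface_point z - q) <= 1 / sqrt gm * (norm (interface_point z - x) + sqrt gm * (eps / 4))"
		using q(3) gm by (intro mult_left_mono) (auto simp: dist_norm)
	then have ol: "optical_length gp gm q y z <= l + eps / 2"
		using z gm unfolding optical_length_alt by (simp add: distrib_left)
	obtain r2 where r2: "r2 > 0" "ball y r2 <= B" using open_contains_ball_eq[OF B(1)] xy(2) by blast
	have "AL x. x : ball y r2 --> c1 <= f x"
		using c1(2) by eventually_elim (use r2(2) in blast)
	then have gy: "good v y 0" by (rule good_start[OF r2(1) c1(1)])
	have y3: "y $ 3 > 0" using xy(2) B(2) closure_subset[of B] by (auto simp: R3_plus_def)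
	have "q : D" using q(1,2) by auto
	then have q3: "q $ 3 < 0" using D(2) closure_subset[of D] by (auto simp: R3_minus_def)
	have gq: "good v q (optical_length gp gm q y z)" by (rule good_optical_path[OF gy y3 q3])
	have fD: "AL x. x : D --> f x = 0"
		using emission_outside[OF supp]
	proof eventually_elim
		fix x assume a: "x \<notin> closure B --> f x = 0"
		show "x : D --> f x = 0"
		proof
			assume "x : D"
			then have "x : R3_minus" using D(2) closure_subset by blast
			then have "x \<notin> closure B" using B(2) by (auto simp: R3_minus_def R3_plus_def)
			then show "f x = 0" using a by blast
		qed
	qed
	have eps2: "eps / 2 > 0" using eps by simp
	show ?thesis
		using good_energy[OF gq D(1) q(1,2) fD eps2] eventually_ge_at_top[of 1] unfolding l_def[symmetric]
	proof eventually_elim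
		case (elim tau)
		have "tau * (optical_length gp gm q y z + eps / 2) <= tau * (l + eps)" using elim(2) ol by (intro mult_left_mono) auto
		then have "exp (- 2 * tau * (l + eps)) <= exp (- 2 * tau * (optical_length gp gm q y z + eps / 2))" by simp
		then show ?case using elim(1) by linarith
	qed
qed

subsection \<open>Weak derivatives in time\<close>

lemma flat_exp_borel [measurable]: "flat_exp P : BM"
proof -
	have "continuous_on UNIV (%x::real. flat_exp P (x \<bullet> 1 + 0))" using Ck_flat_exp[of 0 P "1::real" 0] by simp
	then show ?thesis by (intro borel_measurable_continuous_onI) simp
qed

lemma flat_exp_1_deriv: "(flat_exp 1 has_real_derivative flat_exp [:0, 0, 1:] s) (at s)"
	using flat_exp_deriv[of 1 s] by simp

text \<open>For \<open>s > 0\<close> this is the derivative of \<open>exp (- 1 / s)\<close>, which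
  rises from 0 to 1 on the half line; it is therefore a probability density.\<close>

lemma flat_exp_density:
	shows "0 <= flat_exp [:0, 0, 1:] s" and "s <= 0 ==> flat_exp [:0, 0, 1:] s = 0"
		and "integrable lborel (flat_exp [:0, 0, 1:])" and "(LINT s|lborel. flat_exp [:0, 0, 1:] s) = 1"
proof -
	show nn: "0 <= flat_exp [:0, 0, 1:] s" for s by (simp add: flat_exp_def)
	show z: "s <= 0 ==> flat_exp [:0, 0, 1:] s = 0" for s by (simp add: flat_exp_def)
	have "(\<integral>\<^sup>+s. ennreal (flat_exp [:0, 0, 1:] s) * indicator {0..} s \<partial>lborel) = 1 - flat_exp 1 0"
		by (rule nn_integral_FTC_atLeast[OF flat_exp_borel flat_exp_1_deriv nn flat_exp_tendsto_1[OF filterlim_ident]])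
	moreover have "(\<integral>\<^sup>+s. ennreal (flat_exp [:0, 0, 1:] s) * indicator {0..} s \<partial>lborel) = (\<integral>\<^sup>+s. ennreal (flat_exp [:0, 0, 1:] s) \<partial>lborel)"
		by (rule nn_integral_cong) (auto simp: indicator_def z)
	ultimately have "(\<integral>\<^sup>+s. ennreal (flat_exp [:0, 0, 1:] s) \<partial>lborel) = ennreal 1" by (simp add: flat_exp_bounds(4))
	then have "has_bochner_integral lborel (flat_exp [:0, 0, 1:]) 1"
		by (intro has_bochner_integral_nn_integral) (auto simp: nn)
	then show "integrable lborel (flat_exp [:0, 0, 1:])" "(LINT s|lborel. flat_exp [:0, 0, 1:] s) = 1"
		by (auto simp: has_bochner_integral_iff)
qed

text \<open>The shift by 1 keeps the support inside \<open>[1 / (n + 1), T - 1 / (n + 1)]\<close>,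
  hence compact in the open interval; as \<open>n\<close> grows the functions tend to 1 on
  it.\<close>

definition cutoff :: "real => nat => real => real" where
	"cutoff T n t = flat_exp 1 (real (Suc n) * t - 1) * flat_exp 1 (real (Suc n) * (T - t) - 1)"

lemma cutoff_test: "cutoff T n : test_functions {0<..<T}"
proof (rule test_functionsI)
	define k where "k = real (Suc n)"
	have k: "k > 0" by (simp add: k_def)
	show "Ck j (cutoff T n)" for j
	proof -
		have "Ck j (%t::real. flat_exp 1 (t \<bullet> k + (-1)) * flat_exp 1 (t \<bullet> (- k) + (k * T - 1)))"
			by (intro Ck_mult Ck_flat_exp)
		moreover have "cutoff T n = (%t::real. flat_exp 1 (t \<bullet> k + (-1)) * flat_exp 1 (t \<bullet> (- k) + (k * T - 1)))"
			unfolding fun_eq_iff cutoff_def k_def[symmetric] by (simp add: algebra_simps)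
		ultimately show ?thesis by simp
	qed
	have "{t. cutoff T n t ~= 0} <= {1 / k..T - 1 / k}"
	proof
		fix t assume "t : {t. cutoff T n t ~= 0}"
		then have "flat_exp 1 (k * t - 1) ~= 0" "flat_exp 1 (k * (T - t) - 1) ~= 0" by (auto simp: cutoff_def k_def)
		then have "1 < k * t" "1 < k * (T - t)"
			using flat_exp_bounds(4)[of "k * t - 1"] flat_exp_bounds(4)[of "k * (T - t) - 1"] by linarith+
		then have "1 / k < t" "1 / k < T - t" using k by (simp_all only: pos_divide_less_eq mult.commute)
		then show "t : {1 / k..T - 1 / k}" by simp
	qed
	then show "closure {t. cutoff T n t ~= 0} <= {1 / k..T - 1 / k}" by (rule closure_minimal) simp
	show "{1 / k..T - 1 / k} <= {0<..<T}"
	proof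
		fix t assume "t : {1 / k..T - 1 / k}"
		moreover have "0 < 1 / k" using k by simp
		ultimately have "0 < t" "t < T" unfolding atLeastAtMost_iff by linarith+
		then show "t : {0<..<T}" by simp
	qed
qed simp

lemma cutoff_bounds: "0 <= cutoff T n t" "cutoff T n t <= 1"
	unfolding cutoff_def by (auto intro!: mult_le_one simp: flat_exp_bounds)

lemma cutoff_borel [measurable]: "cutoff T n : BM"
	unfolding cutoff_def[abs_def] by measurable

lemma cutoff_deriv:
	"deriv (cutoff T n) t = real (Suc n) * flat_exp [:0, 0, 1:] (real (Suc n) * t - 1) * flat_exp 1 (real (Suc n) * (T - t) - 1)
			- real (Suc n) * flat_exp [:0, 0, 1:] (real (Suc n) * (T - t) - 1) * flat_exp 1 (real (Suc n) * t - 1)"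
proof (rule DERIV_imp_deriv)
	define k where "k = real (Suc n)"
	have 1: "((%t. flat_exp 1 (k * t - 1)) has_real_derivative flat_exp [:0, 0, 1:] (k * t - 1) * k) (at t)"
		by (rule DERIV_chain'[where g = "flat_exp 1", OF _ flat_exp_1_deriv]) (auto intro!: derivative_eq_intros)
	have 2: "((%t. flat_exp 1 (k * (T - t) - 1)) has_real_derivative flat_exp [:0, 0, 1:] (k * (T - t) - 1) * (- k)) (at t)"
		by (rule DERIV_chain'[where g = "flat_exp 1", OF _ flat_exp_1_deriv]) (auto intro!: derivative_eq_intros)
	have "cutoff T n = (%t. flat_exp 1 (k * t - 1) * flat_exp 1 (k * (T - t) - 1))" by (simp add: fun_eq_iff cutoff_def k_def)
	then show "(cutoff T n has_real_derivative real (Suc n) * flat_exp [:0, 0, 1:] (real (Suc n) * t - 1) * flat_exp 1 (real (Suc n) * (T - t) - 1)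
			- real (Suc n) * flat_exp [:0, 0, 1:] (real (Suc n) * (T - t) - 1) * flat_exp 1 (real (Suc n) * t - 1)) (at t)"
		unfolding k_def[symmetric] using DERIV_mult[OF 1 2] by (simp add: algebra_simps)
qed

lemma filterlim_affine:
	assumes "(d::real) > 0"
	shows "filterlim (%x. x * d - a) at_top at_top"
	unfolding filterlim_at_top
proof
	fix Z
	show "\<forall>\<^sub>F x in at_top. Z <= x * d - a"
		using eventually_ge_at_top[of "(Z + a) / d"]
	proof eventually_elim
		case (elim x)
		then have "Z + a <= x * d" using assms by (simp add: pos_divide_le_eq)
		then show ?case by linarith
	qed
qed

lemma filterlim_affine_sequentially:
	assumes "(d::real) > 0"
	shows "filterlim (%n. real (Suc n) * d - a) at_top sequentially"
proof -
	have "filterlim (%n. real (Suc n)) at_top sequentially"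
		by (rule filterlim_compose[OF filterlim_real_sequentially filterlim_Suc])
	with filterlim_affine[OF assms] show ?thesis by (rule filterlim_compose)
qed

text \<open>The substitution \<open>t = (1 + s) / (n + 1)\<close> turns the spike of the cutoff's
  derivative near 0 into a fixed probability density, and dominated convergence evaluates
  \<open>V\<close> at 0.\<close>

lemma endpoint_limit:
	fixes V :: "real => real"
	assumes T: "T > 0" and V: "continuous_on {0..T} V"
	defines "h \<equiv> %n t. indicator {0<..<T} t * (real (Suc n) * flat_exp [:0, 0, 1:] (real (Suc n) * t - 1) * flat_exp 1 (real (Suc n) * (T - t) - 1) * V t)"
	shows "integrable lborel (h n)" and "(%n. LINT t|lborel. h n t) ----> V 0"
proof -
	define Vi where "Vi t = indicator {0<..<T} t * V t" for t
	have Vi [measurable]: "Vi : BM"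
	proof -
		have "continuous_on {0<..<T} V" by (rule continuous_on_subset[OF V]) auto
		from borel_measurable_continuous_on_indicator[OF _ this] show ?thesis by (simp add: Vi_def[abs_def])
	qed
	have "bounded (V ` {0..T})" by (intro compact_imp_bounded compact_continuous_image V compact_Icc)
	then obtain M where "\<forall>y\<in>V ` {0..T}. norm y <= M" unfolding bounded_iff by blast
	then have M: "!!t. t : {0..T} ==> \<bar>V t\<bar> <= M" by simp
	have M0: "M >= 0" using M[of 0] T by simp
	have ViM: "\<bar>Vi t\<bar> <= M" for t using M[of t] M0 by (auto simp: Vi_def indicator_def)
	define g where "g n s = flat_exp [:0, 0, 1:] s * (flat_exp 1 (real (Suc n) * T - (s + 2)) * Vi ((1 + s) / real (Suc n)))" for n s
	have hg: "h n (1 / real (Suc n) + 1 / real (Suc n) * s) = real (Suc n) * g n s" for n s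
	proof -
		have e: "1 / real (Suc n) + 1 / real (Suc n) * s = (1 + s) / real (Suc n)" by (simp add: add_divide_distrib)
		have a: "real (Suc n) * ((1 + s) / real (Suc n)) - 1 = s" by simp
		have b: "real (Suc n) * (T - (1 + s) / real (Suc n)) - 1 = real (Suc n) * T - (s + 2)" using a by (simp only: right_diff_distrib)
		show ?thesis unfolding e h_def a b g_def Vi_def by (simp only: mult_ac)
	qed
	have gint: "integrable lborel (g n)" and gle: "\<bar>g n s\<bar> <= M * flat_exp [:0, 0, 1:] s" for n s
	proof -
		show le: "\<bar>g n s\<bar> <= M * flat_exp [:0, 0, 1:] s" for s
		proof -
			have "\<bar>flat_exp 1 (real (Suc n) * T - (s + 2)) * Vi ((1 + s) / real (Suc n))\<bar> <= 1 * M"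
				unfolding abs_mult using flat_exp_bounds(1,2) ViM by (intro mult_mono) auto
			then have "flat_exp [:0, 0, 1:] s * \<bar>flat_exp 1 (real (Suc n) * T - (s + 2)) * Vi ((1 + s) / real (Suc n))\<bar> <= flat_exp [:0, 0, 1:] s * M"
				by (intro mult_left_mono flat_exp_density(1)) simp
			then show ?thesis using flat_exp_density(1)[of s] by (simp add: g_def abs_mult mult.commute)
		qed
		have "integrable lborel (%s. M * flat_exp [:0, 0, 1:] s)" using flat_exp_density(3) by simp
		moreover have "g n : borel_measurable lborel" unfolding g_def[abs_def] by measurable
		ultimately show "integrable lborel (g n)" by (rule lint_bound) (use le flat_exp_density(1) M0 in "auto simp: abs_mult")
	qed
	have "integrable lborel (%s. h n (1 / real (Suc n) + 1 / real (Suc n) * s))" for n unfolding hg using gint by simp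
	then show "integrable lborel (h n)" for n by (subst (asm) lborel_integrable_real_affine_iff) auto
	have hint: "(LINT t|lborel. h n t) = (LINT s|lborel. g n s)" for n
	proof -
		have "(LINT t|lborel. h n t) = \<bar>1 / real (Suc n)\<bar> *R (LINT s|lborel. h n (1 / real (Suc n) + 1 / real (Suc n) * s))"
			by (rule lborel_integral_real_affine) simp
		then show ?thesis unfolding hg by simp
	qed
	have "(%n. LINT s|lborel. g n s) ----> (LINT s|lborel. flat_exp [:0, 0, 1:] s * V 0)"
	proof (rule lint_dom[where w = "%s. M * flat_exp [:0, 0, 1:] s"])
		show "integrable lborel (%s. M * flat_exp [:0, 0, 1:] s)" using flat_exp_density(3) by simp
		show "AE s in lborel. norm (g n s) <= M * flat_exp [:0, 0, 1:] s" for n using gle by simp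
		show "g n : borel_measurable lborel" for n using gint by simp
		show "AE s in lborel. (%n. g n s) ----> flat_exp [:0, 0, 1:] s * V 0"
		proof (rule AE_I2)
			fix s :: real
			show "(%n. g n s) ----> flat_exp [:0, 0, 1:] s * V 0"
			proof (cases "s > 0")
				case True
				have lim: "(%n. (1 + s) / real (Suc n)) ----> 0"
					using tendsto_mult_right[OF LIMSEQ_inverse_real_of_nat, of "1 + s"] by (simp add: inverse_eq_divide)
				have "eventually (%n. (1 + s) / real (Suc n) < T) sequentially" using order_tendstoD(2)[OF lim T] .
				then have ev: "eventually (%n. (1 + s) / real (Suc n) : {0<..<T}) sequentially"
					by eventually_elim (use True in auto)
				have "(V ---> V 0) (at 0 within {0..T})" using V T by (simp add: continuous_on_def)
				moreover have "filterlim (%n. (1 + s) / real (Suc n)) (at 0 within {0..T}) sequentially"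
					unfolding filterlim_at using lim ev by (auto elim!: eventually_mono)
				ultimately have "(%n. V ((1 + s) / real (Suc n))) ----> V 0" by (rule filterlim_compose)
				moreover have "eventually (%n. V ((1 + s) / real (Suc n)) = Vi ((1 + s) / real (Suc n))) sequentially"
					using ev by eventually_elim (simp add: Vi_def)
				ultimately have "(%n. Vi ((1 + s) / real (Suc n))) ----> V 0" by (rule Lim_transform_eventually)
				then have "(%n. g n s) ----> flat_exp [:0, 0, 1:] s * (1 * V 0)"
					unfolding g_def by (intro tendsto_mult tendsto_const flat_exp_tendsto_1 filterlim_affine_sequentially T)
				then show ?thesis by simp
			next
				case False
				then show ?thesis by (simp add: g_def flat_exp_density(2))
			qed
		qed
	qed simp
	then show "(%n. LINT t|lborel. h n t) ----> V 0" unfolding hint using flat_exp_density(4) by simp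
qed

lemma lebesgue_on_interval:
	fixes F :: "real => real"
	assumes "(%t. indicator {a<..<b} t * F t) : BM"
	shows "(LINT t|lebesgue_on {a<..<b}. F t) = (LINT t|lborel. indicator {a<..<b} t * F t)"
proof -
	have "(LINT t|lebesgue_on {a<..<b}. F t) = (LN t. indicator {a<..<b} t *R F t)"
		by (rule integral_restrict_space) simp
	also have "... = (LINT t|lborel. indicator {a<..<b} t *R F t)"
		by (rule integral_completion) (use assms in simp)
	finally show ?thesis by simp
qed

text \<open>The weak identity is tested with the cutoffs. Their derivatives act as an approximate
  identity at 0 minus one at \<open>T\<close>; the reflection \<open>V t = W (T - t)\<close> reduces
  the second to the first.\<close>

lemma weak_derivative_endpoints:
	fixes W G :: "real => real"
	assumes T: "T > 0" and W: "continuous_on {0..T} W" and G: "integrable (lebesgue_on {0<..<T}) G"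
		and weak: "!!psi. psi : test_functions {0<..<T} ==>
			(LINT t|lebesgue_on {0<..<T}. deriv psi t * W t) = - (LINT t|lebesgue_on {0<..<T}. psi t * G t)"
	shows "(LINT t|lebesgue_on {0<..<T}. G t) = W T - W 0"
proof -
	define h where "h = (%V n t. indicator {0<..<T} t * (real (Suc n) * flat_exp [:0, 0, 1:] (real (Suc n) * t - 1) * flat_exp 1 (real (Suc n) * (T - t) - 1) * V t))"
	define V where "V t = W (T - t)" for t
	have V: "continuous_on {0..T} V" unfolding V_def
		by (rule continuous_on_compose2[OF W]) (auto intro: continuous_intros)
	have e1: "integrable lborel (h W n)" "(%n. LINT t|lborel. h W n t) ----> W 0" for n
		unfolding h_def by (rule endpoint_limit[OF T W])+
	have e2: "integrable lborel (h V n)" "(%n. LINT t|lborel. h V n t) ----> V 0" for n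
		unfolding h_def by (rule endpoint_limit[OF T V])+
	have hV: "h V n (T + (- 1) * t) = indicator {0<..<T} t * (real (Suc n) * flat_exp [:0, 0, 1:] (real (Suc n) * (T - t) - 1) * flat_exp 1 (real (Suc n) * t - 1) * W t)" for n t
		unfolding h_def V_def by (cases "t : {0<..<T}") (auto simp: mult_ac)
	have split: "indicator {0<..<T} t * (deriv (cutoff T n) t * W t) = h W n t - h V n (T + (- 1) * t)" for n t
		unfolding hV unfolding h_def cutoff_deriv by (simp only: left_diff_distrib right_diff_distrib mult.assoc)
	have i2: "integrable lborel (%t. h V n (T + (- 1) * t))" for n by (rule lborel_integrable_real_affine[OF e2(1)]) simp
	have "(LINT t|lebesgue_on {0<..<T}. deriv (cutoff T n) t * W t) = (LINT t|lborel. h W n t) - (LINT t|lborel. h V n t)" for n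
	proof -
		have m: "(%t. h W n t - h V n (T + (- 1) * t)) : BM"
			using borel_measurable_integrable[OF e1(1)] borel_measurable_integrable[OF i2] by (intro borel_measurable_diff) auto
		have "(LINT t|lebesgue_on {0<..<T}. deriv (cutoff T n) t * W t) = (LINT t|lborel. h W n t - h V n (T + (- 1) * t))"
			unfolding split[symmetric] by (rule lebesgue_on_interval) (use m in "simp only: split")
		moreover have "... = (LINT t|lborel. h W n t) - (LINT t|lborel. h V n (T + (- 1) * t))"
			by (rule Bochner_Integration.integral_diff[OF e1(1) i2])
		moreover have "(LINT t|lborel. h V n (T + (- 1) * t)) = (LINT t|lborel. h V n t)"
			using lborel_integral_real_affine[of "-1" "h V n" T] by simp
		ultimately show ?thesis by simp
	qed
	then have "(%n. LINT t|lebesgue_on {0<..<T}. deriv (cutoff T n) t * W t) ----> W 0 - V 0"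
		using tendsto_diff[OF e1(2) e2(2)] by simp
	then have l1: "(%n. - (LINT t|lebesgue_on {0<..<T}. cutoff T n t * G t)) ----> W 0 - W T"
		unfolding weak[OF cutoff_test] by (simp add: V_def)
	have "(%n. LINT t|lebesgue_on {0<..<T}. cutoff T n t * G t) ----> (LINT t|lebesgue_on {0<..<T}. G t)"
	proof (rule lint_dom[where w = "%t. \<bar>G t\<bar>"])
		show "integrable (lebesgue_on {0<..<T}) (%t. \<bar>G t\<bar>)" using G by simp
		show mG: "G : borel_measurable (lebesgue_on {0<..<T})" using G by simp
		have "cutoff T n : borel_measurable (lebesgue_on {0<..<T})" for n
			by (intro measurable_restrict_space1 borel_imp_lebesgue_measurable cutoff_borel)
		then show "(%t. cutoff T n t * G t) : borel_measurable (lebesgue_on {0<..<T})" for n using mG by (intro borel_measurable_times)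
		show "AE t in lebesgue_on {0<..<T}. norm (cutoff T n t * G t) <= \<bar>G t\<bar>" for n
		proof (rule AE_I2)
			fix t
			have "\<bar>cutoff T n t\<bar> * \<bar>G t\<bar> <= 1 * \<bar>G t\<bar>" using cutoff_bounds[of T n t] by (intro mult_right_mono) auto
			then show "norm (cutoff T n t * G t) <= \<bar>G t\<bar>" by (simp add: abs_mult)
		qed
		show "AE t in lebesgue_on {0<..<T}. (%n. cutoff T n t * G t) ----> G t"
		proof (rule AE_I2)
			fix t assume "t : space (lebesgue_on {0<..<T})"
			then have t: "0 < t" "0 < T - t" by (auto simp: space_restrict_space)
			have "(%n. cutoff T n t * G t) ----> (1 * 1) * G t"
				unfolding cutoff_def by (intro tendsto_mult tendsto_const flat_exp_tendsto_1 filterlim_affine_sequentially t)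
			then show "(%n. cutoff T n t * G t) ----> G t" by simp
		qed
	qed
	then have "(%n. - (LINT t|lebesgue_on {0<..<T}. cutoff T n t * G t)) ----> - (LINT t|lebesgue_on {0<..<T}. G t)" by (rule tendsto_minus)
	from LIMSEQ_unique[OF this l1] show ?thesis by simp
qed

lemma Ck_exp: "Ck k (%t::real. exp (- (tau * t)))"
proof -
	have "Ck k (%t::real. exp (t \<bullet> (- tau) + 0))"
	proof (rule Ck_ridge[where F = "{exp}"])
		show "\<exists>h'\<in>{exp}. \<forall>s::real. (h has_real_derivative h' s) (at s)" if "h : {exp}" for h
			using that DERIV_exp by auto
	qed simp
	then show ?thesis by (simp add: mult.commute)
qed

lemma test_function_times_Ck:
	assumes "psi : test_functions S" "!!k. Ck k h"
	shows "(%t. psi t * h t) : test_functions S"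
proof (rule test_functionsI)
	show "Ck k (%t. psi t * h t)" for k using assms by (intro Ck_mult) (auto simp: test_functions_def)
	show "closure {t. psi t * h t ~= 0} <= closure {t. psi t ~= 0}" by (rule closure_mono) auto
qed (use assms(1) in "auto simp: test_functions_def")

lemma test_function_real_bounded:
	fixes psi :: "real => real"
	assumes "psi : test_functions S"
	shows "continuous_on UNIV psi" "continuous_on UNIV (deriv psi)" "psi field_differentiable (at t)"
		"\<exists>M. \<forall>t. \<bar>psi t\<bar> <= M" "\<exists>M. \<forall>t. \<bar>deriv psi t\<bar> <= M"
proof -
	have U: "psi : test_functions UNIV" using assms by (auto simp: test_functions_def)
	note p = test_function_props[OF U, of 1]
	show "continuous_on UNIV psi" using p by simp
	have "Ck 1 psi" using U by (auto simp: test_functions_def)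
	then have df: "psi differentiable (at t)" for t by simp
	then show "psi field_differentiable (at t)" by (simp add: field_differentiable_def real_differentiable_def)
	have "deriv psi t = pd psi t 1" for t
	proof -
		obtain d where d: "(psi has_real_derivative d) (at t)" using df[of t] by (auto simp: real_differentiable_def)
		then have "pd psi t = (%h. d * h)"
			using frechet_derivative_at[of psi "%h. d * h" t] by (simp add: has_field_derivative_def)
		then show ?thesis using DERIV_imp_deriv[OF d] by simp
	qed
	then have e: "deriv psi = (%t. pd psi t 1)" by auto
	show "continuous_on UNIV (deriv psi)" unfolding e using p by simp
	show "\<exists>M. \<forall>t. \<bar>psi t\<bar> <= M" "\<exists>M. \<forall>t. \<bar>deriv psi t\<bar> <= M" unfolding e using p by (auto simp: bounded_fun_def)
qed

lemma continuous_interval_integrable: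
	fixes V :: "real => real"
	assumes "continuous_on {a..b} V"
	shows "integrable (lebesgue_on {a<..<b}) V"
proof -
	have "integrable (lebesgue_on {a..b}) V" by (rule continuous_imp_integrable_real[OF assms])
	then have "set_integrable lebesgue {a..b} V" by (simp add: set_integrable_def integrable_restrict_space)
	then have "set_integrable lebesgue {a<..<b} V" by (rule set_integrable_subset) auto
	then show ?thesis by (simp add: set_integrable_def integrable_restrict_space)
qed

lemma integrable_bounded_continuous_mult:
	fixes G h :: "real => real"
	assumes G: "integrable (lebesgue_on S) G" and h: "continuous_on UNIV h" "!!t. t : S ==> \<bar>h t\<bar> <= M"
	shows "integrable (lebesgue_on S) (%t. h t * G t)"
proof (rule lint_bound)
	show "integrable (lebesgue_on S) (%t. M * G t)" using G by simp
	have "h : borel_measurable (lebesgue_on S)"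
		by (intro measurable_restrict_space1 continuous_imp_lebesgue_measurable h)
	then show "(%t. h t * G t) : borel_measurable (lebesgue_on S)" using G by (intro borel_measurable_times) auto
	show "AE t in lebesgue_on S. norm (h t * G t) <= norm (M * G t)"
	proof (rule AE_I2)
		fix t assume "t : space (lebesgue_on S)"
		then have "\<bar>h t\<bar> <= \<bar>M\<bar>" using h(2)[of t] by (auto simp: space_restrict_space)
		then have "\<bar>h t\<bar> * \<bar>G t\<bar> <= \<bar>M\<bar> * \<bar>G t\<bar>" by (rule mult_right_mono) simp
		then show "norm (h t * G t) <= norm (M * G t)" by (simp add: abs_mult)
	qed
qed

text \<open>Multiplying a test function by the exponential gives a test function again, so
  \<open>exp (- tau t) W\<close> has weak derivative \<open>exp (- tau t) (G - tau W)\<close>; the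
  end point formula is applied to it.\<close>

lemma laplace_weak_derivative:
	fixes W G :: "real => real"
	assumes T: "T > 0" and W: "continuous_on {0..T} W" and G: "integrable (lebesgue_on {0<..<T}) G" and tau: "tau >= 0"
		and weak: "!!psi. psi : test_functions {0<..<T} ==>
			(LINT t|lebesgue_on {0<..<T}. deriv psi t * W t) = - (LINT t|lebesgue_on {0<..<T}. psi t * G t)"
	shows "(LINT t|lebesgue_on {0<..<T}. exp (- tau * t) * G t)
		= exp (- tau * T) * W T - W 0 + tau * (LINT t|lebesgue_on {0<..<T}. exp (- tau * t) * W t)"
proof -
	let ?J = "lebesgue_on {0<..<T}"
	let ?e = "%t::real. exp (- tau * t)"
	have ce: "continuous_on UNIV ?e" by (intro continuous_intros)
	have e1: "\<bar>?e t\<bar> <= 1" if "t : {0<..<T}" for t using that tau by (simp add: mult_nonneg_nonneg)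
	have iW: "integrable ?J W" by (rule continuous_interval_integrable[OF W])
	have ieW: "integrable ?J (%t. ?e t * W t)" by (rule integrable_bounded_continuous_mult[OF iW ce e1])
	have ieG: "integrable ?J (%t. ?e t * G t)" by (rule integrable_bounded_continuous_mult[OF G ce e1])
	have "(LINT t|?J. ?e t * G t - tau * (?e t * W t)) = ?e T * W T - ?e 0 * W 0"
	proof (rule weak_derivative_endpoints[OF T])
		show "continuous_on {0..T} (%t. ?e t * W t)" by (intro continuous_intros W)
		show "integrable ?J (%t. ?e t * G t - tau * (?e t * W t))" using ieW ieG by (intro Bochner_Integration.integrable_diff integrable_mult_right)
		fix psi assume psi: "psi : test_functions {0<..<T}"
		have psie: "(%t. psi t * exp (- (tau * t))) : test_functions {0<..<T}" by (rule test_function_times_Ck[OF psi Ck_exp])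
		note b = test_function_real_bounded[OF psi]
		obtain M1 M2 where M: "!!t. \<bar>psi t\<bar> <= M1" "!!t. \<bar>deriv psi t\<bar> <= M2" using b(4,5) by blast
		have d: "deriv (%t. psi t * exp (- (tau * t))) t = deriv psi t * ?e t - tau * (psi t * ?e t)" for t
		proof (rule DERIV_imp_deriv)
			have "(psi has_real_derivative deriv psi t) (at t)" using b(3) field_differentiable_derivI by blast
			then show "((%t. psi t * exp (- (tau * t))) has_real_derivative deriv psi t * ?e t - tau * (psi t * ?e t)) (at t)"
				by (auto intro!: derivative_eq_intros simp: algebra_simps)
		qed
		have i1: "integrable ?J (%t. deriv psi t * (?e t * W t))" by (rule integrable_bounded_continuous_mult[OF ieW b(2) M(2)])
		have i2: "integrable ?J (%t. psi t * (?e t * W t))" by (rule integrable_bounded_continuous_mult[OF ieW b(1) M(1)])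
		have i3: "integrable ?J (%t. psi t * (?e t * G t))" by (rule integrable_bounded_continuous_mult[OF ieG b(1) M(1)])
		have "(LINT t|?J. deriv psi t * (?e t * W t)) - tau * (LINT t|?J. psi t * (?e t * W t))
				= (LINT t|?J. deriv psi t * (?e t * W t) - tau * (psi t * (?e t * W t)))"
			using i1 i2 by simp
		moreover have "... = (LINT t|?J. deriv (%t. psi t * exp (- (tau * t))) t * W t)"
			by (rule lint_cong) (simp only: d left_diff_distrib mult.assoc)
		moreover have "... = - (LINT t|?J. psi t * exp (- (tau * t)) * G t)" by (rule weak[OF psie])
		moreover have "(LINT t|?J. psi t * exp (- (tau * t)) * G t) = (LINT t|?J. psi t * (?e t * G t))"
			by (rule lint_cong) simp
		ultimately have *: "(LINT t|?J. deriv psi t * (?e t * W t)) = tau * (LINT t|?J. psi t * (?e t * W t)) - (LINT t|?J. psi t * (?e t * G t))" by linarith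
		have "(LINT t|?J. psi t * (?e t * G t - tau * (?e t * W t))) = (LINT t|?J. psi t * (?e t * G t) - tau * (psi t * (?e t * W t)))"
			by (rule lint_cong) (simp add: algebra_simps)
		moreover have "... = (LINT t|?J. psi t * (?e t * G t)) - tau * (LINT t|?J. psi t * (?e t * W t))" using i2 i3 by simp
		ultimately show "(LINT t|?J. deriv psi t * (?e t * W t)) = - (LINT t|?J. psi t * (?e t * G t - tau * (?e t * W t)))"
			using * by linarith
	qed
	moreover have "(LINT t|?J. ?e t * G t - tau * (?e t * W t)) = (LINT t|?J. ?e t * G t) - tau * (LINT t|?J. ?e t * W t)"
		using ieW ieG by simp
	ultimately show ?thesis by simp
qed

subsection \<open>Norms and functionals on \<open>H1\<close>\<close>

lemma H1_norm_bounds: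
	"0 <= H1_norm u" "L2_norm u <= H1_norm u" "L2_norm (grad u) <= H1_norm u" "H1_norm u <= L2_norm (grad u) + L2_norm u"
proof -
	show "0 <= H1_norm u" by (simp add: H1_norm_def)
	show "L2_norm u <= H1_norm u" unfolding H1_norm_def by (rule real_sqrt_sum_squares_ge1)
	show "L2_norm (grad u) <= H1_norm u" unfolding H1_norm_def by (rule real_sqrt_sum_squares_ge2)
	show "H1_norm u <= L2_norm (grad u) + L2_norm u" unfolding H1_norm_def
		using sqrt_sum_squares_le_sum[of "L2_norm u" "L2_norm (grad u)"] by (simp add: add.commute)
qed

lemma H1_norm_cmult: "u : H1 ==> H1_norm (%x. c * u x) = \<bar>c\<bar> * H1_norm u"
proof -
	assume u: "u : H1"
	have m: "grad (%x. c * u x) : LM" "(%x. c *R grad u x) : LM"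
		using H1_D(2)[OF H1_cmult[OF u]] L2_scaleR[OF H1_D(2)[OF u]] by (auto dest: L2_measurable)
	have g: "L2_norm (grad (%x. c * u x)) = \<bar>c\<bar> * L2_norm (grad u)"
		using L2_norm_cong[OF m grad_cmult[OF u]] by (simp add: L2_norm_scaleR)
	have l: "L2_norm (%x. c * u x) = \<bar>c\<bar> * L2_norm u" using L2_norm_scaleR[of c u] by simp
	have "H1_norm (%x. c * u x) = sqrt (c^2 * ((L2_norm u)^2 + (L2_norm (grad u))^2))"
		unfolding H1_norm_def g l by (simp add: power_mult_distrib distrib_left)
	then show ?thesis by (simp add: real_sqrt_mult H1_norm_def)
qed

lemma H1_norm_triangle_diff:
	assumes u: "u : H1" and w: "w : H1" and z: "z : H1"
	shows "H1_norm (%x. u x - w x) <= H1_norm (%x. u x - z x) + H1_norm (%x. w x - z x)"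
proof -
	let ?a = "%x. u x - z x" and ?b = "%x. w x - z x"
	have ab: "?a : H1" "?b : H1" using assms by (auto intro: H1_diff)
	have e: "(%x. u x - w x) = (%x. ?a x - ?b x)" by auto
	have "L2_norm (%x. ?a x - ?b x) <= L2_norm ?a + L2_norm ?b"
		by (rule L2_norm_triangle_diff[OF H1_D(1)[OF ab(1)] H1_D(1)[OF ab(2)]])
	moreover have "L2_norm (grad (%x. ?a x - ?b x)) <= L2_norm (grad ?a) + L2_norm (grad ?b)"
	proof -
		have "L2_norm (grad (%x. ?a x - ?b x)) = L2_norm (%x. grad ?a x - grad ?b x)"
			by (rule L2_norm_cong[OF _ _ grad_diff[OF ab]])
				(use H1_D(2)[OF H1_diff[OF ab]] L2_diff[OF H1_D(2)[OF ab(1)] H1_D(2)[OF ab(2)]] in "auto dest: L2_measurable")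
		then show ?thesis using L2_norm_triangle_diff[OF H1_D(2)[OF ab(1)] H1_D(2)[OF ab(2)]] by simp
	qed
	ultimately have "H1_norm (%x. ?a x - ?b x) <= sqrt ((L2_norm ?a + L2_norm ?b)^2 + (L2_norm (grad ?a) + L2_norm (grad ?b))^2)"
		unfolding H1_norm_def by (intro real_sqrt_le_mono add_mono power_mono) auto
	also have "... <= H1_norm ?a + H1_norm ?b" unfolding H1_norm_def by (rule real_sqrt_sum_squares_triangle_ineq)
	finally show ?thesis unfolding e .
qed

lemma H1_dual_linear: "F : H1_dual ==> phi : H1 ==> psi : H1 ==> F (%x. a * phi x + b * psi x) = a * F phi + b * F psi"
	by (auto simp: H1_dual_def)

lemma H1_dual_diff_arg: "F : H1_dual ==> phi : H1 ==> psi : H1 ==> F (%x. phi x - psi x) = F phi - F psi"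
	using H1_dual_linear[of F phi psi 1 "-1"] by simp

lemma H1_dual_bdd:
	assumes F: "F : H1_dual"
	shows "bdd_above ((%psi. \<bar>F psi\<bar>) ` {psi\<in>H1. H1_norm psi <= 1})"
proof -
	obtain K where K: "\<forall>psi\<in>H1. \<bar>F psi\<bar> <= K * H1_norm psi" using F unfolding H1_dual_def by blast
	show ?thesis
	proof (rule bdd_aboveI2)
		fix psi :: "'a => real" assume "psi : {psi\<in>H1. H1_norm psi <= 1}"
		then have psi: "psi : H1" "H1_norm psi <= 1" by auto
		have "K * H1_norm psi <= \<bar>K\<bar> * 1" using psi(2) H1_norm_bounds(1)[of psi] by (intro mult_mono) auto
		then show "\<bar>F psi\<bar> <= \<bar>K\<bar>" using bspec[OF K psi(1)] by simp
	qed
qed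

lemma H1_dual_bound:
	assumes F: "F : H1_dual" and phi: "phi : H1"
	shows "\<bar>F phi\<bar> <= H1_dual_norm F * H1_norm phi"
proof (cases "H1_norm phi = 0")
	case True
	obtain K where "\<forall>psi\<in>H1. \<bar>F psi\<bar> <= K * H1_norm psi" using F unfolding H1_dual_def by blast
	then have "\<bar>F phi\<bar> <= K * H1_norm phi" using phi by blast
	then show ?thesis using True by simp
next
	case False
	then have p: "H1_norm phi > 0" using H1_norm_bounds(1)[of phi] by simp
	let ?c = "1 / H1_norm phi"
	let ?psi = "%x. ?c * phi x"
	have "?psi : {psi\<in>H1. H1_norm psi <= 1}" using H1_norm_cmult[OF phi, of ?c] H1_cmult[OF phi, of ?c] p by simp
	then have "\<bar>F ?psi\<bar> <= H1_dual_norm F" unfolding H1_dual_norm_def by (rule cSUP_upper[OF _ H1_dual_bdd[OF F]])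
	moreover have "F ?psi = ?c * F phi" using H1_dual_linear[OF F phi phi, of ?c 0] by simp
	ultimately have "\<bar>F phi\<bar> / H1_norm phi <= H1_dual_norm F" using p by (simp add: abs_mult)
	then show ?thesis using p by (simp add: pos_divide_le_eq)
qed

lemma H1_dual_norm_nonneg:
	fixes F :: "('a::euclidean_space => real) => real"
	assumes F: "F : H1_dual"
	shows "0 <= H1_dual_norm F"
proof -
	have "H1_norm (%x::'a. 0 * 0) = \<bar>0\<bar> * H1_norm (%x::'a. 0)" by (rule H1_norm_cmult[OF H1_zero])
	then have "(%x::'a. 0) : {psi\<in>H1. H1_norm psi <= 1}" by (simp add: H1_zero)
	then have "\<bar>F (%x. 0)\<bar> <= H1_dual_norm F" unfolding H1_dual_norm_def by (rule cSUP_upper[OF _ H1_dual_bdd[OF F]])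
	then show ?thesis by simp
qed

lemma H1_dual_diff:
	assumes F: "F : H1_dual" and G: "G : H1_dual"
	shows "(%z. F z - G z) : H1_dual"
proof -
	have "\<bar>F phi - G phi\<bar> <= (H1_dual_norm F + H1_dual_norm G) * H1_norm phi" if "phi : H1" for phi
		using H1_dual_bound[OF F that] H1_dual_bound[OF G that] by (simp add: distrib_right)
	moreover have "F (%x. a * phi x + b * psi x) - G (%x. a * phi x + b * psi x) = a * (F phi - G phi) + b * (F psi - G psi)"
		if "phi : H1" "psi : H1" for a b phi psi
		using H1_dual_linear[OF F that] H1_dual_linear[OF G that] by (simp add: algebra_simps)
	ultimately show ?thesis unfolding H1_dual_def by blast
qed

subsection \<open>Bochner measurable functions\<close>

lemma simple_on_interval:
	assumes J: "J : sets lebesgue" and s: "finite (s ` J)" "!!y. {t\<in>J. s t = y} : sets lebesgue"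
	shows "simple_function (lebesgue_on J) s"
proof (rule simple_function_def[THEN iffD2], intro conjI ballI)
	show "finite (s ` space (lebesgue_on J))" using s(1) by (simp add: space_restrict_space)
	fix y
	have "s -` {y} \<inter> space (lebesgue_on J) = {t\<in>J. s t = y}" by (auto simp: space_restrict_space)
	then show "s -` {y} \<inter> space (lebesgue_on J) : sets (lebesgue_on J)"
		using s(2)[of y] J by (simp add: sets_restrict_space_iff)
qed

lemma borel_measurable_AE_limit:
	fixes G :: "nat => real => real"
	assumes J: "J : sets lebesgue" and G: "!!n. G n : borel_measurable (lebesgue_on J)"
		and lim: "AE t in lebesgue_on J. (%n. G n t) ----> L t"
	shows "L : borel_measurable (lebesgue_on J)"
proof -
	have JJ: "J \<inter> space lebesgue : sets lebesgue" using J by simp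
	have m: "(%t. indicator J t *R G n t) : LM" for n
		using G[of n] by (simp only: borel_measurable_restrict_space_iff[OF JJ])
	have "(%t. lim (%n. indicator J t *R G n t)) : LM" by (rule borel_measurable_lim_metric[OF m])
	moreover have "AL t. lim (%n. indicator J t *R G n t) = indicator J t *R L t"
		using lim unfolding AE_restrict_space_iff[OF JJ]
	proof eventually_elim
		fix t assume "t : J --> (%n. G n t) ----> L t"
		then show "lim (%n. indicator J t *R G n t) = indicator J t *R L t"
			by (cases "t : J") (auto intro: limI)
	qed
	ultimately have "(%t. indicator J t *R L t) : LM" by (rule borel_measurable_AE)
	then show ?thesis by (simp only: borel_measurable_restrict_space_iff[OF JJ])
qed

lemma borel_measurable_AE_on:
	fixes f g :: "real => real"
	assumes "J : sets lebesgue" "f : borel_measurable (lebesgue_on J)" "AE t in lebesgue_on J. f t = g t"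
	shows "g : borel_measurable (lebesgue_on J)"
	by (rule borel_measurable_AE_limit[OF assms(1), of "%n. f"]) (use assms in auto)

lemma strongly_measurable_functional:
	assumes sm: "strongly_measurable J X N F" and J: "J : sets lebesgue"
		and L: "!!a b. a : X ==> b : X ==> \<bar>Lam a - Lam b\<bar> <= K * N (%z. a z - b z)"
	shows "(%t. Lam (F t)) : borel_measurable (lebesgue_on J)"
proof -
	obtain s where s: "\<forall>n. finite (s n ` J) & s n ` J <= X & (\<forall>y. {t\<in>J. s n t = y} : sets lebesgue)"
		and lim: "AE t in lebesgue_on J. F t : X & (%n. N (%z. s n t z - F t z)) ----> 0"
		using sm unfolding strongly_measurable_def by blast
	show ?thesis
	proof (rule borel_measurable_AE_limit[OF J])
		show "(%t. Lam (s n t)) : borel_measurable (lebesgue_on J)" for n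
		proof -
			have "simple_function (lebesgue_on J) (s n)" by (rule simple_on_interval[OF J]) (use s in auto)
			from borel_measurable_simple_function[OF simple_function_compose1[OF this, of Lam]] show ?thesis .
		qed
		have "AE t in lebesgue_on J. t : J" by (rule AE_I2) (simp add: space_restrict_space)
		with lim show "AE t in lebesgue_on J. (%n. Lam (s n t)) ----> Lam (F t)"
		proof eventually_elim
			case (elim t)
			have "(%n. K * N (%z. s n t z - F t z)) ----> K * 0" using elim by (intro tendsto_mult tendsto_const) auto
			then have l: "(%n. K * N (%z. s n t z - F t z)) ----> 0" by simp
			have "(%n. Lam (s n t) - Lam (F t)) ----> 0"
			proof (rule Lim_null_comparison[OF always_eventually l], rule allI)
				fix n
				have "s n t : X" using s elim(2) by blast
				then show "norm (Lam (s n t) - Lam (F t)) <= K * N (%z. s n t z - F t z)" using L elim(1) by simp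
			qed
			then show ?case by (rule LIM_zero_cancel)
		qed
	qed
qed

lemma H1_finite_sum:
	assumes "finite Y" "Y <= H1"
	shows "(%x. \<Sum>y\<in>Y. c y * y x) : H1"
		and "Lam : H1_dual ==> Lam (%x. \<Sum>y\<in>Y. c y * y x) = (\<Sum>y\<in>Y. c y * Lam y)"
proof -
	have "(%x. \<Sum>y\<in>Y. c y * y x) : H1 & (Lam : H1_dual --> Lam (%x. \<Sum>y\<in>Y. c y * y x) = (\<Sum>y\<in>Y. c y * Lam y))"
		using assms
	proof (induction Y rule: finite_induct)
		case empty
		show ?case using H1_dual_linear[OF _ H1_zero H1_zero, of Lam 0 0] by (auto simp: H1_zero)
	next
		case (insert y Y)
		then have IH: "(%x. \<Sum>y\<in>Y. c y * y x) : H1" "Lam : H1_dual ==> Lam (%x. \<Sum>y\<in>Y. c y * y x) = (\<Sum>y\<in>Y. c y * Lam y)" and y: "y : H1" by auto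
		have e: "(%x. \<Sum>y\<in>insert y Y. c y * y x) = (%x. c y * y x + 1 * (\<Sum>y\<in>Y. c y * y x))" using insert.hyps by (simp add: fun_eq_iff)
		show ?case unfolding e using H1_lincomb(1)[OF y IH(1), of "c y" 1] H1_dual_linear[OF _ y IH(1), of Lam "c y" 1] IH(2) insert.hyps by auto
	qed
	then show "(%x. \<Sum>y\<in>Y. c y * y x) : H1"
		and "Lam : H1_dual ==> Lam (%x. \<Sum>y\<in>Y. c y * y x) = (\<Sum>y\<in>Y. c y * Lam y)" by auto
qed

lemma integral_simple_functional:
	fixes s :: "real => 'b" and Lam :: "'b => real" and g :: "real => real"
	assumes J: "J : sets lebesgue" and s: "finite (s ` J)" "!!y. {t\<in>J. s t = y} : sets lebesgue"
		and g: "integrable (lebesgue_on J) g"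
	shows "integrable (lebesgue_on J) (%t. g t * Lam (s t))"
		and "(LINT t|lebesgue_on J. g t * Lam (s t)) = (\<Sum>y\<in>s ` J. (LINT t|lebesgue_on J. g t * indicator {t\<in>J. s t = y} t) * Lam y)"
proof -
	let ?h = "%t. \<Sum>y\<in>s ` J. g t * indicator {t\<in>J. s t = y} t * Lam y"
	have i: "integrable (lebesgue_on J) (%t. g t * indicator {t\<in>J. s t = y} t * Lam y)" for y
	proof -
		have "{t\<in>J. s t = y} : sets (lebesgue_on J)" using s(2)[of y] J by (simp add: sets_restrict_space_iff)
		from integrable_real_mult_indicator[OF this g] show ?thesis by (rule integrable_mult_left)
	qed
	have e: "?h t = g t * Lam (s t)" if "t : space (lebesgue_on J)" for t
	proof -
		have t: "t : J" using that by (simp add: space_restrict_space)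
		have "?h t = (\<Sum>y\<in>s ` J. if y = s t then g t * Lam y else 0)" by (rule sum.cong[OF refl]) (use t in "auto simp: indicator_def")
		then show ?thesis using s(1) t by simp
	qed
	have ih: "integrable (lebesgue_on J) ?h" by (rule Bochner_Integration.integrable_sum) (rule i)
	show "integrable (lebesgue_on J) (%t. g t * Lam (s t))"
	proof -
		have "integrable (lebesgue_on J) ?h = integrable (lebesgue_on J) (%t. g t * Lam (s t))"
			by (rule Bochner_Integration.integrable_cong[OF refl]) (rule e)
		then show ?thesis using ih by blast
	qed
	have "(LINT t|lebesgue_on J. g t * Lam (s t)) = (LINT t|lebesgue_on J. ?h t)"
		by (rule lint_cong) (rule e[symmetric])
	moreover have "... = (\<Sum>y\<in>s ` J. LINT t|lebesgue_on J. g t * indicator {t\<in>J. s t = y} t * Lam y)"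
		by (rule Bochner_Integration.integral_sum) (rule i)
	moreover have "... = (\<Sum>y\<in>s ` J. (LINT t|lebesgue_on J. g t * indicator {t\<in>J. s t = y} t) * Lam y)" by simp
	ultimately show "(LINT t|lebesgue_on J. g t * Lam (s t)) = (\<Sum>y\<in>s ` J. (LINT t|lebesgue_on J. g t * indicator {t\<in>J. s t = y} t) * Lam y)"
		by (simp only:)
qed

lemma simple_pair_measurable:
	assumes J: "J : sets lebesgue" and s: "finite (s ` J)" "!!y. {t\<in>J. s t = y} : sets lebesgue"
		and r: "finite (r ` J)" "!!y. {t\<in>J. r t = y} : sets lebesgue"
	shows "(%t. h (s t) (r t) :: real) : borel_measurable (lebesgue_on J)"
proof -
	have "simple_function (lebesgue_on J) (%t. (s t, r t))" by (rule simple_function_Pair[OF simple_on_interval[OF J s] simple_on_interval[OF J r]])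
	from simple_function_compose1[OF this, of "%(a, b). h a b"] have "simple_function (lebesgue_on J) (%t. h (s t) (r t))" by simp
	then show ?thesis by (rule borel_measurable_simple_function)
qed

text \<open>One element \<open>w\<close> stands in for the \<open>H1\<close>-valued integral of
  \<open>e u\<close>, to accuracy \<open>eps\<close> for all bounded functionals at once. It is the
  integral of \<open>e\<close> times a simple approximant of \<open>u\<close>, restricted to the
  times at which the approximant is close to \<open>u\<close>.\<close>

lemma bochner_integral_approximation:
	assumes J: "J : sets lebesgue" "emeasure lebesgue J < \<infinity>" and sm: "strongly_measurable J H1 H1_norm u"
		and int: "integrable (lebesgue_on J) (%t. H1_norm (u t))"
		and e: "e : LM" "!!t. t : J ==> 0 <= e t & e t <= (1::real)" and eps: "eps > 0"
	shows "\<exists>w\<in>H1. \<forall>Lam\<in>H1_dual. \<forall>K\<ge>0. (\<forall>phi\<in>H1. \<bar>Lam phi\<bar> <= K * H1_norm phi) \<longrightarrow>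
		integrable (lebesgue_on J) (%t. e t * Lam (u t)) & \<bar>Lam w - (LINT t|lebesgue_on J. e t * Lam (u t))\<bar> <= K * eps"
proof -
	let ?M = "lebesgue_on J"
	obtain s where s: "\<forall>n. finite (s n ` J) & s n ` J <= H1 & (\<forall>y. {t\<in>J. s n t = y} : sets lebesgue)"
		and lim: "AE t in ?M. u t : H1 & (%n. H1_norm (%z. s n t z - u t z)) ----> 0"
		using sm unfolding strongly_measurable_def by blast
	have tJ: "AE t in ?M. t : J" by (rule AE_I2) (simp add: space_restrict_space)
	define d where "d n t = H1_norm (%z. s n t z - u t z)" for n t
	\<comment> \<open>The distance to \<open>u\<close> is measurable as an almost everywhere limit of
	  distances between two simple functions, which themselves take finitely many values.\<close>
	have dm: "d n : borel_measurable ?M" for n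
	proof (rule borel_measurable_AE_limit[OF J(1)])
		show "(%t. H1_norm (%z. s n t z - s m t z)) : borel_measurable ?M" for m
			by (rule simple_pair_measurable[OF J(1), of "s n" "s m" "%a b. H1_norm (%z. a z - b z)"]) (use s in auto)
		show "AE t in ?M. (%m. H1_norm (%z. s n t z - s m t z)) ----> d n t"
			using lim tJ
		proof eventually_elim
			case (elim t)
			have H: "s k t : H1" for k using s elim(2) by blast
			have "(%m. H1_norm (%z. s n t z - s m t z) - d n t) ----> 0"
			proof (rule Lim_null_comparison[OF always_eventually conjunct2[OF elim(1)]], rule allI)
				fix m
				have "H1_norm (%z. s n t z - s m t z) <= d n t + d m t"
					using H1_norm_triangle_diff[OF H[of n] H[of m] conjunct1[OF elim(1)]] by (simp add: d_def)
				moreover have "d n t <= H1_norm (%z. s n t z - s m t z) + H1_norm (%z. u t z - s m t z)"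
					using H1_norm_triangle_diff[OF H[of n] conjunct1[OF elim(1)] H[of m]] by (simp add: d_def)
				moreover have "H1_norm (%z. u t z - s m t z) = d m t"
					using H1_norm_cmult[OF H1_diff[OF H[of m] conjunct1[OF elim(1)]], of "-1"] by (simp add: d_def)
				ultimately have "\<bar>H1_norm (%z. s n t z - s m t z) - d n t\<bar> <= d m t" by linarith
				then show "norm (H1_norm (%z. s n t z - s m t z) - d n t) <= H1_norm (%z. s m t z - u t z)" by (simp add: d_def)
			qed
			then show ?case by (rule LIM_zero_cancel)
		qed
	qed
	\<comment> \<open>The approximants converge only pointwise in time. Dropping them where they are
	  farther than 1 from \<open>u\<close> makes the error dominated by
	  \<open>1 + H1_norm (u t)\<close>.\<close>
	define c where "c n t = (if d n t <= 1 then 1 else 0 :: real)" for n t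
	have cm: "c n : borel_measurable ?M" for n
	proof -
		have "{t : space ?M. d n t <= 1} : sets ?M" using dm[of n] by (rule borel_measurable_le) simp
		then show ?thesis unfolding c_def by (intro measurable_If) auto
	qed
	\<comment> \<open>\<open>b n t\<close> bounds the error at time \<open>t\<close>: the distance
	  where the approximant is kept, the norm of \<open>u t\<close> where it is replaced by 0.\<close>
	define b where "b n t = c n t * d n t + (1 - c n t) * H1_norm (u t)" for n t
	have um: "(%t. H1_norm (u t)) : borel_measurable ?M" using int by simp
	have bm: "b n : borel_measurable ?M" for n
		unfolding b_def using cm[of n] dm[of n] um by (intro borel_measurable_add borel_measurable_times borel_measurable_diff borel_measurable_const)
	have d0: "0 <= d n t" for n t unfolding d_def by (rule H1_norm_bounds(1))
	have ble: "\<bar>b n t\<bar> <= 1 + H1_norm (u t)" for n t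
		using d0[of n t] H1_norm_bounds(1)[of "u t"] by (auto simp: b_def c_def)
	have fin: "finite_measure ?M"
		by (rule finite_measureI) (use J in "auto simp: space_restrict_space emeasure_restrict_space")
	have idom: "integrable ?M (%t. 1 + H1_norm (u t))"
		using int finite_measure.integrable_const[OF fin, of "1::real"] by (intro Bochner_Integration.integrable_add)
	have bint: "integrable ?M (b n)" for n
	proof (rule lint_bound[OF idom bm], rule AE_I2)
		fix t
		show "norm (b n t) <= norm (1 + H1_norm (u t))" using ble[of n t] H1_norm_bounds(1)[of "u t"] by simp
	qed
	have "(%n. LINT t|?M. b n t) ----> (LINT t|?M. 0)"
	proof (rule lint_dom[OF _ bm idom])
		show "AE t in ?M. norm (b n t) <= 1 + H1_norm (u t)" for n using ble by simp
		show "AE t in ?M. (%n. b n t) ----> 0"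
			using lim
		proof eventually_elim
			case (elim t)
			then have l: "(%n. d n t) ----> 0" by (simp add: d_def)
			have "eventually (%n. d n t < 1) sequentially" by (rule order_tendstoD(2)[OF l zero_less_one])
			then have "eventually (%n. d n t = b n t) sequentially" by eventually_elim (simp add: b_def c_def)
			with l show ?case by (rule Lim_transform_eventually)
		qed
	qed simp
	then have "(%n. LINT t|?M. b n t) ----> 0" by simp
	then have "eventually (%n. (LINT t|?M. b n t) < eps) sequentially" by (rule order_tendstoD(2)) (rule eps)
	then obtain n where n: "(LINT t|?M. b n t) < eps" unfolding eventually_sequentially by blast
	have em: "e : borel_measurable ?M" by (rule measurable_restrict_space1[OF e(1)])
	have eAE: "AE t in ?M. 0 <= e t & e t <= 1" using tJ by eventually_elim (rule e(2))
	have i1: "integrable ?M (%t. 1::real)" by (rule finite_measure.integrable_const[OF fin])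
	have iec: "integrable ?M (%t. e t * c n t)"
	proof (rule lint_bound[OF i1])
		show "(%t. e t * c n t) : borel_measurable ?M" by (intro borel_measurable_times em cm)
		show "AE t in ?M. norm (e t * c n t) <= norm (1::real)" using eAE by eventually_elim (auto simp: c_def)
	qed
	define a where "a y = (LINT t|?M. (e t * c n t) * indicator {t\<in>J. s n t = y} t)" for y
	define w where "w = (%x. \<Sum>y\<in>s n ` J. a y * y x)"
	have wH: "w : H1" unfolding w_def by (rule H1_finite_sum(1)) (use s in auto)
	show ?thesis
	proof (intro bexI[OF _ wH] ballI allI impI)
		fix Lam :: "('a => real) => real" and K :: real
		assume L: "Lam : H1_dual" and K: "0 <= K" and LK: "\<forall>phi\<in>H1. \<bar>Lam phi\<bar> <= K * H1_norm phi"
		have L1: "Lam w = (\<Sum>y\<in>s n ` J. a y * Lam y)" unfolding w_def by (rule H1_finite_sum(2)[OF _ _ L]) (use s in auto)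
		have sn: "finite (s n ` J)" "!!y. {t\<in>J. s n t = y} : sets lebesgue" using s by auto
		note L2 = integral_simple_functional[OF J(1) sn iec, of Lam]
		have Lw: "Lam w = (LINT t|?M. e t * c n t * Lam (s n t))" unfolding L1 a_def L2(2) ..
		have Lm: "(%t. Lam (u t)) : borel_measurable ?M"
		proof (rule strongly_measurable_functional[OF sm J(1)])
			show "\<bar>Lam p - Lam q\<bar> <= K * H1_norm (%z. p z - q z)" if "p : H1" "q : H1" for p q
				using LK H1_diff[OF that] H1_dual_diff_arg[OF L that] by auto
		qed
		have iu: "integrable ?M (%t. e t * Lam (u t))"
		proof (rule lint_bound)
			show "integrable ?M (%t. K * H1_norm (u t))" using int by simp
			show "(%t. e t * Lam (u t)) : borel_measurable ?M" by (intro borel_measurable_times em Lm)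
			show "AE t in ?M. norm (e t * Lam (u t)) <= norm (K * H1_norm (u t))"
				using eAE lim
			proof eventually_elim
				case (elim t)
				have "\<bar>e t\<bar> * \<bar>Lam (u t)\<bar> <= 1 * (K * H1_norm (u t))" using elim LK by (intro mult_mono) auto
				then show ?case using K H1_norm_bounds(1)[of "u t"] by (simp add: abs_mult)
			qed
		qed
		have "\<bar>Lam w - (LINT t|?M. e t * Lam (u t))\<bar> = \<bar>LINT t|?M. e t * c n t * Lam (s n t) - e t * Lam (u t)\<bar>"
			unfolding Lw using L2(1) iu by simp
		moreover have "... <= (LINT t|?M. \<bar>e t * c n t * Lam (s n t) - e t * Lam (u t)\<bar>)" by (rule integral_abs_bound)
		moreover have "... <= (LINT t|?M. K * b n t)"
		proof (rule integral_mono_AE)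
			show "integrable ?M (%t. \<bar>e t * c n t * Lam (s n t) - e t * Lam (u t)\<bar>)" using L2(1) iu by (intro integrable_abs Bochner_Integration.integrable_diff)
			show "integrable ?M (%t. K * b n t)" using bint by simp
			show "AE t in ?M. \<bar>e t * c n t * Lam (s n t) - e t * Lam (u t)\<bar> <= K * b n t"
				using eAE lim tJ
			proof eventually_elim
				case (elim t)
				have H: "s n t : H1" "u t : H1" using s elim(2,3) by blast+
				have "\<bar>c n t * Lam (s n t) - Lam (u t)\<bar> <= K * b n t"
				proof (cases "d n t <= 1")
					case True
					then show ?thesis using LK H1_diff[OF H] H1_dual_diff_arg[OF L H] by (auto simp: b_def c_def d_def)
				next
					case False
					then show ?thesis using LK H(2) by (auto simp: b_def c_def)
				qed
				moreover have "\<bar>e t * c n t * Lam (s n t) - e t * Lam (u t)\<bar> = \<bar>e t\<bar> * \<bar>c n t * Lam (s n t) - Lam (u t)\<bar>"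
					unfolding abs_mult[symmetric] by (simp add: algebra_simps)
				moreover have "\<bar>e t\<bar> * \<bar>c n t * Lam (s n t) - Lam (u t)\<bar> <= 1 * \<bar>c n t * Lam (s n t) - Lam (u t)\<bar>"
					using elim(1) by (intro mult_right_mono) auto
				ultimately show ?case by simp
			qed
		qed
		moreover have "(LINT t|?M. K * b n t) <= K * eps" using n K by (simp add: mult_left_mono)
		ultimately show "integrable ?M (%t. e t * Lam (u t)) & \<bar>Lam w - (LINT t|?M. e t * Lam (u t))\<bar> <= K * eps"
			using iu by linarith
	qed
qed

subsection \<open>The Laplace transform of the wave\<close>

text \<open>The continuous representative \<open>U\<close> is used only through functionals that are
  Lipschitz for \<open>N\<close>, each of which makes it a continuous scalar function with the right
  value at 0. In use, \<open>Lam\<close> is pairing with, or evaluation at, a fixed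
  \<open>phi\<close>.\<close>

lemma functional_representative:
	assumes iv: "has_initial_value T X N F F0"
	obtains U where "!!t. t : {0..T} ==> U t : X"
		and "!!Lam K. T > 0 ==> (!!a b. a : X ==> b : X ==> \<bar>Lam a - Lam b\<bar> <= K * N (%z. a z - b z)) ==>
			continuous_on {0..T} (%t. Lam (U t)) & Lam (U 0) = Lam F0 & (AE t in lebesgue_on {0<..<T}. Lam (F t) = Lam (U t))"
proof -
	obtain U where U: "\<forall>t\<in>{0..T}. U t : X & ((%s. N (%z. U s z - U t z)) ---> 0) (at t within {0..T})"
		and ae: "AE t in lebesgue_on {0<..<T}. F t : X & N (%z. U t z - F t z) = 0"
		and i: "F0 : X" "N (%z. U 0 z - F0 z) = 0"
		using iv unfolding has_initial_value_def by blast
	show ?thesis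
	proof (rule that[of U])
		show "U t : X" if "t : {0..T}" for t using U that by blast
		fix Lam :: "('a => real) => real" and K
		assume T: "T > 0" and L: "!!a b. a : X ==> b : X ==> \<bar>Lam a - Lam b\<bar> <= K * N (%z. a z - b z)"
		have c: "continuous_on {0..T} (%t. Lam (U t))"
			unfolding continuous_on_def
		proof
			fix t assume t: "t : {0..T}"
			have "((%s. K * N (%z. U s z - U t z)) ---> K * 0) (at t within {0..T})" using U t by (intro tendsto_mult tendsto_const) blast
			then have l: "((%s. K * N (%z. U s z - U t z)) ---> 0) (at t within {0..T})" by simp
			have "eventually (%s. s : {0..T}) (at t within {0..T})" by (simp add: eventually_at_filter)
			then have "eventually (%s. norm (Lam (U s) - Lam (U t)) <= K * N (%z. U s z - U t z)) (at t within {0..T})"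
			proof eventually_elim
				case (elim s)
				then have "U s : X" "U t : X" using U t by blast+
				then show ?case using L by simp
			qed
			from Lim_null_comparison[OF this l]
			show "((%t. Lam (U t)) ---> Lam (U t)) (at t within {0..T})" by (rule LIM_zero_cancel)
		qed
		have "U 0 : X" using U T by simp
		then have "\<bar>Lam (U 0) - Lam F0\<bar> <= K * 0" using L[OF _ i(1)] i(2) by metis
		then have z: "Lam (U 0) = Lam F0" by simp
		have "AE t in lebesgue_on {0<..<T}. t : {0<..<T}" by (rule AE_I2) (simp add: space_restrict_space)
		with ae have "AE t in lebesgue_on {0<..<T}. Lam (F t) = Lam (U t)"
		proof eventually_elim
			case (elim t)
			then have "U t : X" using U by simp
			then have "\<bar>Lam (U t) - Lam (F t)\<bar> <= K * 0" using L elim(1) by metis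
			then show ?case by simp
		qed
		with c z show "continuous_on {0..T} (%t. Lam (U t)) & Lam (U 0) = Lam F0 & (AE t in lebesgue_on {0<..<T}. Lam (F t) = Lam (U t))"
			by blast
	qed
qed

lemma integral_mult_cong_AE_on:
	fixes F W h :: "real => real"
	assumes J: "J : sets lebesgue" and W: "W : borel_measurable (lebesgue_on J)" and ae: "AE t in lebesgue_on J. W t = F t"
		and h: "continuous_on UNIV h"
	shows "(LINT t|lebesgue_on J. h t * F t) = (LINT t|lebesgue_on J. h t * W t)"
proof (rule integral_cong_AE)
	have hm: "h : borel_measurable (lebesgue_on J)" by (intro measurable_restrict_space1 continuous_imp_lebesgue_measurable h)
	show "(%t. h t * W t) : borel_measurable (lebesgue_on J)" using hm W by (rule borel_measurable_times)
	show "(%t. h t * F t) : borel_measurable (lebesgue_on J)" using hm borel_measurable_AE_on[OF J W ae] by (rule borel_measurable_times)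
	show "AE t in lebesgue_on J. h t * F t = h t * W t" using ae by eventually_elim simp
qed

lemma L2_pairing_bound: "u : L2 ==> phi : L2 ==> \<bar>L2_pairing u phi\<bar> <= L2_norm u * L2_norm phi"
	unfolding L2_pairing_def by (rule L2_Cauchy_Schwarz_real)

lemma L2_pairing_lincomb:
	assumes "u : L2" "w : L2" "phi : L2"
	shows "L2_pairing (%x. a * u x + b * w x) phi = a * L2_pairing u phi + b * L2_pairing w phi"
proof -
	have i: "LI (%x. u x * phi x)" "LI (%x. w x * phi x)" using assms by (auto intro: L2_mult_integrable)
	have "L2_pairing (%x. a * u x + b * w x) phi = (LN x. a * (u x * phi x) + b * (w x * phi x))"
		unfolding L2_pairing_def by (rule lint_cong) (simp add: algebra_simps)
	then show ?thesis using i by (simp add: L2_pairing_def)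
qed

lemma L2_pairing_lipschitz:
	assumes "u : L2" "w : L2" "phi : L2"
	shows "\<bar>L2_pairing u phi - L2_pairing w phi\<bar> <= L2_norm phi * L2_norm (%x. u x - w x)"
	using L2_pairing_lincomb[OF assms, of 1 "-1"] L2_pairing_bound[OF L2_diff[OF assms(1,2)] assms(3)] by (simp add: mult.commute)

lemma L2_pairing_H1_dual:
	assumes "phi : L2"
	shows "(%w. L2_pairing w phi) : H1_dual" and "w : H1 ==> \<bar>L2_pairing w phi\<bar> <= L2_norm phi * H1_norm w"
proof -
	have b: "\<bar>L2_pairing w phi\<bar> <= L2_norm phi * H1_norm w" if "w : H1" for w
		using L2_pairing_bound[OF H1_D(1)[OF that] assms] mult_right_mono[OF H1_norm_bounds(2)[of w], of "L2_norm phi"]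
		by (simp add: mult.commute)
	show "w : H1 ==> \<bar>L2_pairing w phi\<bar> <= L2_norm phi * H1_norm w" by (rule b)
	show "(%w. L2_pairing w phi) : H1_dual"
		unfolding H1_dual_def using L2_pairing_lincomb[OF H1_D(1) H1_D(1) assms] b by blast
qed

lemma energy_form_H1_dual:
	assumes el: "elliptic sig c K" and phi: "phi : H1"
	shows "(%w. energy_form sig w phi) : H1_dual" and "w : H1 ==> \<bar>energy_form sig w phi\<bar> <= K * L2_norm (grad phi) * H1_norm w"
proof -
	have K: "K >= 0" using el by (simp add: elliptic_def)
	have b: "\<bar>energy_form sig w phi\<bar> <= K * L2_norm (grad phi) * H1_norm w" if "w : H1" for w
	proof -
		have "K * L2_norm (grad phi) * L2_norm (grad w) <= K * L2_norm (grad phi) * H1_norm w"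
			using K by (intro mult_left_mono H1_norm_bounds(3)) simp
		then show ?thesis using energy_form_bound[OF el that phi] by (simp add: mult_ac)
	qed
	show "w : H1 ==> \<bar>energy_form sig w phi\<bar> <= K * L2_norm (grad phi) * H1_norm w" by (rule b)
	show "(%w. energy_form sig w phi) : H1_dual"
		unfolding H1_dual_def using energy_form_lincomb_left[OF el phi] b by blast
qed

lemma tau_norm_bounds:
	assumes "tau >= 1"
	shows "H1_norm phi <= tau_norm tau phi" "L2_norm (grad phi) <= tau_norm tau phi" "tau * L2_norm phi <= tau_norm tau phi"
	using H1_norm_bounds(4)[of phi] mult_right_mono[OF assms, of "L2_norm phi"] assms by (auto simp: tau_norm_def)

lemma bochner_L2_norm_integrable:
	assumes J: "J : sets lebesgue" "emeasure lebesgue J < \<infinity>" and u: "bochner_L2 J H1 H1_norm u"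
	shows "integrable (lebesgue_on J) (%t. H1_norm (u t))"
proof -
	have i: "integrable (lebesgue_on J) (%t. (H1_norm (u t))^2)" using u by (simp add: bochner_L2_def)
	have fin: "finite_measure (lebesgue_on J)"
		by (rule finite_measureI) (use J in "auto simp: space_restrict_space emeasure_restrict_space")
	have i1: "integrable (lebesgue_on J) (%t. 1 + (H1_norm (u t))^2)"
		using i finite_measure.integrable_const[OF fin, of "1::real"] by (intro Bochner_Integration.integrable_add)
	have "(%t. sqrt ((H1_norm (u t))^2)) : borel_measurable (lebesgue_on J)"
		using borel_measurable_integrable[OF i]
		by (rule measurable_compose) (intro borel_measurable_continuous_onI continuous_intros)
	then have m: "(%t. H1_norm (u t)) : borel_measurable (lebesgue_on J)" by (simp add: H1_norm_bounds(1))
	have le: "norm (H1_norm (u t)) <= norm (1 + (H1_norm (u t))^2)" for t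
	proof -
		have "0 <= (H1_norm (u t) - 1)^2" by (rule zero_le_power2)
		then have "2 * H1_norm (u t) <= 1 + (H1_norm (u t))^2" by (simp add: power2_eq_square algebra_simps)
		then show ?thesis using H1_norm_bounds(1)[of "u t"] by simp
	qed
	show ?thesis by (rule lint_bound[OF i1 m]) (use le in simp)
qed

text \<open>The Laplace rule is applied to \<open>u\<close> with derivative \<open>u'\<close> and
  then to \<open>u'\<close> with derivative \<open>u''\<close>, which the equation replaces by minus
  the energy form. The values at time 0 contribute 0 and \<open>f\<close>. The values at time
  \<open>T\<close> carry the factor \<open>exp (- tau T)\<close> and form the remainder, so
  \<open>A\<close> consists of the norms of the two representatives at \<open>T\<close>.\<close>

lemma wave_identity:
	assumes T: "T > 0" and wave: "wave_solution \<gamma> f T u" and el: "elliptic \<gamma> c K" and f: "f : L2"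
	shows "\<exists>A\<ge>0. \<forall>tau\<ge>1. \<forall>phi\<in>H1. \<bar>(LINT t|lebesgue_on {0<..<T}. exp (- tau * t) * energy_form \<gamma> (u t) phi)
			+ tau^2 * (LINT t|lebesgue_on {0<..<T}. exp (- tau * t) * L2_pairing (u t) phi) - L2_pairing f phi\<bar> <= A * exp (- tau * T) * tau_norm tau phi"
proof -
	let ?J = "lebesgue_on {0<..<T}"
	have J: "{0<..<T} : sets lebesgue" "emeasure lebesgue {0<..<T} < \<infinity>" using T by auto
	obtain u' u'' where u: "bochner_L2 {0<..<T} H1 H1_norm u"
		and d1: "weak_time_derivative T L2 (%t. L2_pairing (u t)) (%t. L2_pairing (u' t))"
		and d2: "weak_time_derivative T H1 (%t. L2_pairing (u' t)) u''"
		and eq: "AE t in ?J. \<forall>phi\<in>H1. u'' t phi + energy_form \<gamma> (u t) phi = 0"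
		and iv1: "has_initial_value T L2 L2_norm u (%x. 0)"
		and iv2: "has_initial_value T H1_dual H1_dual_norm (%t. L2_pairing (u' t)) (L2_pairing f)"
		using wave unfolding wave_solution_def by (elim exE conjE) (rule that)
	note uint = bochner_L2_norm_integrable[OF J u]
	have sm: "strongly_measurable {0<..<T} H1 H1_norm u" using u by (simp add: bochner_L2_def)
	show ?thesis
	proof (rule functional_representative[OF iv1], goal_cases)
		case (1 U1)
		note U1 = 1(1) and r1 = 1(2)
		show ?thesis
		proof (rule functional_representative[OF iv2], goal_cases)
			case (1 U2)
			note U2 = 1(1) and r2 = 1(2)
			have UT: "U1 T : L2" "U2 T : H1_dual" using U1[of T] U2[of T] T by auto
			define A where "A = H1_dual_norm (U2 T) + L2_norm (U1 T)"
			have A: "A >= 0" unfolding A_def using H1_dual_norm_nonneg[OF UT(2)] by simp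
			show ?thesis
			proof (intro exI[of _ A] conjI A allI impI ballI)
				fix tau :: real and phi :: "real^3 => real" assume tau: "tau >= 1" and phi: "phi : H1"
				have tau0: "tau >= 0" using tau by simp
				note phiL = H1_D(1)[OF phi]
				have c1: "continuous_on {0..T} (%t. L2_pairing (U1 t) phi)" "L2_pairing (U1 0) phi = L2_pairing (%x. 0) phi"
					"AE t in ?J. L2_pairing (u t) phi = L2_pairing (U1 t) phi"
					using r1[of "%a. L2_pairing a phi", OF T L2_pairing_lipschitz[OF _ _ phiL]] by blast+
				have l2: "\<bar>a phi - b phi\<bar> <= H1_norm phi * H1_dual_norm (%z. a z - b z)" if "a : H1_dual" "b : H1_dual" for a b
					using H1_dual_bound[OF H1_dual_diff[OF that] phi] by (simp add: mult.commute)
				have c2: "continuous_on {0..T} (%t. U2 t phi)" "U2 0 phi = L2_pairing f phi" "AE t in ?J. L2_pairing (u' t) phi = U2 t phi"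
					using r2[of "%a. a phi", OF T l2] by blast+
				have i1: "integrable ?J (%t. L2_pairing (U1 t) phi)" by (rule continuous_interval_integrable[OF c1(1)])
				have i2: "integrable ?J (%t. U2 t phi)" by (rule continuous_interval_integrable[OF c2(1)])
				have a1: "AE t in ?J. L2_pairing (U1 t) phi = L2_pairing (u t) phi" using c1(3) by eventually_elim simp
				have a2: "AE t in ?J. U2 t phi = L2_pairing (u' t) phi" using c2(3) by eventually_elim simp
				have a3: "AE t in ?J. - energy_form \<gamma> (u t) phi = u'' t phi" using eq
				proof eventually_elim
					case (elim t)
					then have "u'' t phi + energy_form \<gamma> (u t) phi = 0" using phi by blast
					then show ?case by simp
				qed
				have iE: "integrable ?J (%t. energy_form \<gamma> (u t) phi)"
				proof -
					have "K * L2_norm (grad phi) >= 0" using el by (simp add: elliptic_def)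
					then have "integrable ?J (%t. 1 * energy_form \<gamma> (u t) phi)"
						using bochner_integral_approximation[OF J sm uint borel_measurable_const, of 1 1] energy_form_H1_dual[OF el phi] by fastforce
					then show ?thesis by simp
				qed
				have iE': "integrable ?J (%t. - energy_form \<gamma> (u t) phi)" using iE by simp
				note m1 = borel_measurable_integrable[OF i1]
				note m2 = borel_measurable_integrable[OF i2]
				note m3 = borel_measurable_integrable[OF iE']
				have w1: "(LINT t|?J. exp (- tau * t) * U2 t phi)
					= exp (- tau * T) * L2_pairing (U1 T) phi - L2_pairing (U1 0) phi + tau * (LINT t|?J. exp (- tau * t) * L2_pairing (U1 t) phi)"
				proof (rule laplace_weak_derivative[OF T c1(1) i2 tau0])
					fix psi assume psi: "psi : test_functions {0<..<T}"
					note b = test_function_real_bounded(1,2)[OF psi]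
					show "(LINT t|?J. deriv psi t * L2_pairing (U1 t) phi) = - (LINT t|?J. psi t * U2 t phi)"
						using d1[unfolded weak_time_derivative_def, rule_format, OF phiL psi]
						unfolding integral_mult_cong_AE_on[OF J(1) m1 a1 b(2)] integral_mult_cong_AE_on[OF J(1) m2 a2 b(1)] .
				qed
				have w2: "(LINT t|?J. exp (- tau * t) * - energy_form \<gamma> (u t) phi)
					= exp (- tau * T) * U2 T phi - U2 0 phi + tau * (LINT t|?J. exp (- tau * t) * U2 t phi)"
				proof (rule laplace_weak_derivative[OF T c2(1) iE' tau0])
					fix psi assume psi: "psi : test_functions {0<..<T}"
					note b = test_function_real_bounded(1,2)[OF psi]
					show "(LINT t|?J. deriv psi t * U2 t phi) = - (LINT t|?J. psi t * - energy_form \<gamma> (u t) phi)"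
						using d2[unfolded weak_time_derivative_def, rule_format, OF phi psi]
						unfolding integral_mult_cong_AE_on[OF J(1) m2 a2 b(2)] integral_mult_cong_AE_on[OF J(1) m3 a3 b(1)] .
				qed
				have e1: "(LINT t|?J. exp (- tau * t) * L2_pairing (u t) phi) = (LINT t|?J. exp (- tau * t) * L2_pairing (U1 t) phi)"
					by (rule integral_mult_cong_AE_on[OF J(1) m1 a1]) (intro continuous_intros)
				have e2: "(LINT t|?J. exp (- tau * t) * - energy_form \<gamma> (u t) phi) = - (LINT t|?J. exp (- tau * t) * energy_form \<gamma> (u t) phi)" by simp
				have z: "L2_pairing (%x. 0) phi = 0" by (simp add: L2_pairing_def)
				let ?E = "LINT t|?J. exp (- tau * t) * energy_form \<gamma> (u t) phi" and ?P = "LINT t|?J. exp (- tau * t) * L2_pairing (u t) phi"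
				have w2': "- ?E = exp (- tau * T) * U2 T phi - L2_pairing f phi + tau * (exp (- tau * T) * L2_pairing (U1 T) phi + tau * ?P)"
					using w2 unfolding e2 w1 c1(2) z c2(2) e1 by simp
				have "tau * (exp (- tau * T) * L2_pairing (U1 T) phi + tau * ?P) = exp (- tau * T) * (tau * L2_pairing (U1 T) phi) + tau^2 * ?P"
					by (simp add: power2_eq_square algebra_simps)
				then have "?E + tau^2 * ?P - L2_pairing f phi = - (exp (- tau * T) * U2 T phi + exp (- tau * T) * (tau * L2_pairing (U1 T) phi))"
					using w2' by linarith
				then have m: "\<bar>?E + tau^2 * ?P - L2_pairing f phi\<bar> = exp (- tau * T) * \<bar>U2 T phi + tau * L2_pairing (U1 T) phi\<bar>"
					by (simp only: abs_minus_cancel distrib_left[symmetric] abs_mult abs_exp_cancel)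
				have "\<bar>U2 T phi\<bar> <= H1_dual_norm (U2 T) * tau_norm tau phi"
					using H1_dual_bound[OF UT(2) phi] mult_left_mono[OF tau_norm_bounds(1)[OF tau, of phi] H1_dual_norm_nonneg[OF UT(2)]] by linarith
				moreover have "\<bar>tau * L2_pairing (U1 T) phi\<bar> <= L2_norm (U1 T) * tau_norm tau phi"
				proof -
					have "\<bar>tau * L2_pairing (U1 T) phi\<bar> <= tau * (L2_norm (U1 T) * L2_norm phi)"
						using tau0 L2_pairing_bound[OF UT(1) phiL] by (simp add: abs_mult mult_left_mono)
					moreover have "L2_norm (U1 T) * (tau * L2_norm phi) <= L2_norm (U1 T) * tau_norm tau phi"
						by (intro mult_left_mono tau_norm_bounds tau) simp
					ultimately show ?thesis by (simp add: mult_ac)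
				qed
				ultimately have "\<bar>U2 T phi + tau * L2_pairing (U1 T) phi\<bar> <= A * tau_norm tau phi" unfolding A_def distrib_right by linarith
				then have "exp (- tau * T) * \<bar>U2 T phi + tau * L2_pairing (U1 T) phi\<bar> <= exp (- tau * T) * (A * tau_norm tau phi)"
					by (rule mult_left_mono) simp
				then show "\<bar>?E + tau^2 * ?P - L2_pairing f phi\<bar> <= A * exp (- tau * T) * tau_norm tau phi"
					unfolding m by (simp add: mult_ac)
			qed
		qed
	qed
qed

lemma lebesgue_cong_lborel:
	fixes F G :: "'a::euclidean_space => real"
	assumes F: "F : BM" and ae: "AL x. F x = G x"
	shows "G : LM" "(LN x. G x) = (LINT x|lborel. F x)" "LI G \<longleftrightarrow> integrable lborel F"
proof -
	have Fm: "F : LM" by (rule borel_imp_lebesgue_measurable[OF F])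
	show Gm: "G : LM" by (rule borel_measurable_AE[OF Fm ae])
	have Fl: "F : borel_measurable lborel" using F by simp
	have "(LN x. F x) = (LN x. G x)" by (rule integral_cong_AE[OF Fm Gm ae])
	then show "(LN x. G x) = (LINT x|lborel. F x)" using integral_completion[OF Fl] by simp
	have "LI F \<longleftrightarrow> LI G" by (rule integrable_cong_AE[OF Fm Gm ae])
	then show "LI G \<longleftrightarrow> integrable lborel F" using integrable_completion[OF Fl] by simp
qed

text \<open>The indicator function integrates in time at fixed \<open>x\<close>, the weak
  formulation in space at fixed \<open>t\<close>; Fubini exchanges the two. Joint measurability
  supplies a Borel function \<open>g\<close> that agrees with \<open>u\<close> off a null set
  \<open>N\<close>, almost all of whose sections are null in either order.\<close>

lemma laplace_pairing:
	assumes jm: "(%(t, x). u t x) : borel_measurable (lebesgue_on ({0<..<T} \<times> UNIV))"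
		and sm: "strongly_measurable {0<..<T} H1 H1_norm u" and int: "integrable (lebesgue_on {0<..<T}) (%t. H1_norm (u t))"
		and f: "f : L2" and tau: "tau >= 0"
	shows "LI (%x. f x * laplace_transform T u tau x)"
		and "(LN x. f x * laplace_transform T u tau x) = (LINT t|lebesgue_on {0<..<T}. exp (- tau * t) * L2_pairing (u t) f)"
proof -
	let ?J = "{0<..<T} :: real set"
	let ?i = "%t. indicator ?J t :: real"
	let ?e = "%t. exp (- tau * t) :: real"
	obtain f' where f': "f' : BM" "AL x. f x = f' x" using lebesgue_ex_borel[OF L2_measurable[OF f]] by blast
	have "open (?J \<times> (UNIV :: (real^3) set))" by (intro open_Times) auto
	then have "(?J \<times> (UNIV :: (real^3) set)) \<inter> space lebesgue : sets lebesgue" by (simp add: borel_open)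
	from borel_measurable_restrict_space_iff[OF this, THEN iffD1, OF jm]
	have "(%p. indicator (?J \<times> UNIV) p *R (case p of (t, x) => u t x)) : LM" .
	then obtain g where g: "g : BM"
		and gu: "AL p. indicator (?J \<times> UNIV) p *R (case p of (t, x) => u t x) = g p" by (rule lebesgue_ex_borel)
	from gu have "AE p in (lborel \<Otimes>\<^sub>M lborel). indicator (?J \<times> UNIV) p *R (case p of (t, x) => u t x) = g p"
		by (simp only: AE_completion_iff lborel_prod)
	then have "AE p in (lborel \<Otimes>\<^sub>M lborel). fst p : ?J --> u (fst p) (snd p) = g p"
		by eventually_elim (auto simp: indicator_def)
	then obtain N where N: "{p : space (lborel \<Otimes>\<^sub>M lborel). \<not> (fst p : ?J --> u (fst p) (snd p) = g p)} <= N"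
		"emeasure (lborel \<Otimes>\<^sub>M lborel) N = 0" "N : sets (lborel \<Otimes>\<^sub>M (lborel :: (real^3) measure))" by (rule AE_E)
	have gN: "t : ?J ==> (t, x) \<notin> N ==> u t x = g (t, x)" for t x
	proof (rule ccontr)
		assume "t : ?J" "(t, x) \<notin> N" "u t x ~= g (t, x)"
		then have "(t, x) : {p : space (lborel \<Otimes>\<^sub>M lborel). \<not> (fst p : ?J --> u (fst p) (snd p) = g p)}"
			by (simp add: space_pair_measure)
		then show False using N(1) \<open>(t, x) \<notin> N\<close> by blast
	qed
	have "AE p in (lborel \<Otimes>\<^sub>M (lborel :: (real^3) measure)). p \<notin> N" using N(2,3) by (intro AE_not_in) (simp add: null_sets_def)
	then have tx: "AE t in lborel. AE x in lborel. (t, x) \<notin> N" by (rule lborel_pair.AE_pair)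
	have Nm: "{p : space (lborel \<Otimes>\<^sub>M lborel). (fst p, snd p) \<notin> N} : sets (lborel \<Otimes>\<^sub>M (lborel :: (real^3) measure))"
	proof -
		have "{p : space (lborel \<Otimes>\<^sub>M lborel). (fst p, snd p) \<notin> N} = space (lborel \<Otimes>\<^sub>M lborel) - N" by auto
		then show ?thesis using sets.compl_sets[OF N(3)] by (simp only:)
	qed
	have xt: "AE x in lborel. AE t in lborel. (t, x) \<notin> N" using lborel_pair.AE_commute[OF Nm] tx by blast
	define h where "h t x = ?i t * ?e t * (f' x * g (t, x))" for t x
	have gm [measurable]: "g : borel_measurable (lborel \<Otimes>\<^sub>M lborel)" using g by (simp add: lborel_prod)
	have fm [measurable]: "f' : borel_measurable lborel" using f'(1) by simp
	have hm: "case_prod h : borel_measurable (lborel \<Otimes>\<^sub>M lborel)" unfolding h_def[abs_def] by measurable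
	have H1: "AL t. t : ?J --> u t : H1"
		using sm unfolding strongly_measurable_def by (auto simp: AE_restrict_space_iff)
	have tx': "AL t. AL x. (t, x) \<notin> N" using tx by (simp only: AE_completion_iff)
	have xt': "AL x. AL t. (t, x) \<notin> N" using xt by (simp only: AE_completion_iff)
	have htm: "h t : BM" for t using measurable_Pair2[OF hm, of t] by (simp add: comp_def)
	have inner: "integrable lborel (h t) & (LINT x|lborel. norm (h t x)) <= ?i t * (L2_norm f * H1_norm (u t))
			& (LINT x|lborel. h t x) = ?i t * (?e t * L2_pairing (u t) f)"
		if t: "t : ?J --> u t : H1" and ae: "AL x. (t, x) \<notin> N" for t
	proof (cases "t : ?J")
		case False
		then have "h t = (%x. 0)" by (simp add: h_def fun_eq_iff)
		then show ?thesis using False by simp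
	next
		case True
		then have uH: "u t : L2" using t by (simp add: H1_D)
		have ae2: "AL x. h t x = ?e t * (u t x * f x)" using ae f'(2)
		proof eventually_elim
			case (elim x)
			then show ?case using gN[OF True elim(1)] True by (simp add: h_def)
		qed
		note c = lebesgue_cong_lborel[OF htm ae2]
		have i: "LI (%x. u t x * f x)" by (rule L2_mult_integrable[OF uH f])
		then have ih: "integrable lborel (h t)" using c(3) by simp
		have eq: "(LINT x|lborel. h t x) = ?e t * L2_pairing (u t) f" using c(2) by (simp add: L2_pairing_def)
		have ae3: "AL x. norm (h t x) = ?e t * (norm (u t x) * norm (f x))" using ae2 by eventually_elim (simp add: abs_mult)
		have hn: "(%x. norm (h t x)) : BM" using htm by measurable
		have "(LINT x|lborel. norm (h t x)) = ?e t * (LN x. norm (u t x) * norm (f x))"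
			using lebesgue_cong_lborel(2)[OF hn ae3] by simp
		also have "... <= 1 * (L2_norm (u t) * L2_norm f)"
		proof (intro mult_mono L2_abs_integral_le uH f)
			have "0 <= tau * t" using tau True by simp
			then show "?e t <= 1" by simp
		qed auto
		also have "... <= L2_norm f * H1_norm (u t)" using mult_left_mono[OF H1_norm_bounds(2)[of "u t"], of "L2_norm f"] by (simp add: mult.commute)
		finally show ?thesis using ih eq True by simp
	qed
	have AEt: "AL t. integrable lborel (h t) & (LINT x|lborel. norm (h t x)) <= ?i t * (L2_norm f * H1_norm (u t))
			& (LINT x|lborel. h t x) = ?i t * (?e t * L2_pairing (u t) f)"
		using H1 tx' by eventually_elim (rule inner)
	have intp: "integrable (lborel \<Otimes>\<^sub>M lborel) (case_prod h)"
	proof (rule lborel_pair.Fubini_integrable[OF hm])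
		have "AL t. integrable lborel (h t)" using AEt by eventually_elim blast
		then show "AE t in lborel. integrable lborel (%x. case_prod h (t, x))" by (simp add: AE_completion_iff)
		have m: "(%t. LINT x|lborel. norm (case_prod h (t, x))) : borel_measurable lborel"
		proof -
			have "(%p. norm (case_prod h p)) : borel_measurable (lborel \<Otimes>\<^sub>M lborel)" using hm by (rule measurable_compose[OF _ borel_measurable_norm])
			moreover have "(%p. norm (case_prod h p)) = case_prod (%t x. norm (h t x))" by (simp add: fun_eq_iff)
			ultimately have "case_prod (%t x. norm (h t x)) : borel_measurable (lborel \<Otimes>\<^sub>M lborel)" by (simp only:)
			from lborel.borel_measurable_lebesgue_integral[OF this] show ?thesis by simp
		qed
		have "LI (%t. LINT x|lborel. norm (case_prod h (t, x)))"
		proof (rule lint_bound)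
			have "LI (%t. ?i t *R (L2_norm f * H1_norm (u t)))"
				using int by (subst integrable_restrict_space[symmetric]) auto
			then show "LI (%t. ?i t * (L2_norm f * H1_norm (u t)))" by simp
			show "(%t. LINT x|lborel. norm (case_prod h (t, x))) : LM"
				using m by (intro borel_imp_lebesgue_measurable) simp
			show "AL t. norm (LINT x|lborel. norm (case_prod h (t, x))) <= norm (?i t * (L2_norm f * H1_norm (u t)))"
				using AEt
			proof eventually_elim
				case (elim t)
				have "0 <= (LINT x|lborel. norm (h t x))" by (rule integral_nonneg_AE) simp
				then have "norm (LINT x|lborel. norm (h t x)) = (LINT x|lborel. norm (h t x))" by simp
				also have "... <= ?i t * (L2_norm f * H1_norm (u t))" using elim by blast
				also have "... <= norm (?i t * (L2_norm f * H1_norm (u t)))" unfolding real_norm_def by (rule abs_ge_self)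
				finally show ?case by (simp only: split_conv)
			qed
		qed
		then show "integrable lborel (%t. LINT x|lborel. norm (case_prod h (t, x)))" using integrable_completion[OF m] by simp
	qed
	note fub = lborel_pair.Fubini_integral[OF intp]
	have snd: "integrable lborel (%x. LINT t|lborel. h t x)" using lborel_pair.integrable_snd[OF intp] by simp
	have fst: "integrable lborel (%t. LINT x|lborel. h t x)" using lborel_pair.integrable_fst[OF intp] by simp
	have hxm: "(%t. h t x) : BM" for x using measurable_Pair1[OF hm, of x] by (simp add: comp_def)
	have AEx: "AL x. (LINT t|lborel. h t x) = f x * laplace_transform T u tau x"
		using xt' f'(2)
	proof eventually_elim
		case (elim x)
		have "AL t. h t x = f' x * (?i t * (?e t * u t x))" using elim(1)
		proof eventually_elim
			case (elim t)
			then show ?case using gN[of t x] by (cases "t : ?J") (auto simp: h_def)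
		qed
		note c = lebesgue_cong_lborel[OF hxm this]
		have "laplace_transform T u tau x = (LN t. ?i t *R (?e t * u t x))"
			unfolding laplace_transform_def by (rule integral_restrict_space) simp
		then show ?case using c(2) elim(2) by simp
	qed
	have sb: "(%x. LINT t|lborel. h t x) : BM" using borel_measurable_integrable[OF snd] by simp
	note cx = lebesgue_cong_lborel[OF sb AEx]
	show "LI (%x. f x * laplace_transform T u tau x)" using cx(3) snd by simp
	have fb: "(%t. LINT x|lborel. h t x) : BM" using borel_measurable_integrable[OF fst] by simp
	have AEt2: "AL t. (LINT x|lborel. h t x) = ?i t * (?e t * L2_pairing (u t) f)" using AEt by eventually_elim blast
	note ct = lebesgue_cong_lborel[OF fb AEt2]
	have "(LINT t|lebesgue_on ?J. ?e t * L2_pairing (u t) f) = (LN t. ?i t *R (?e t * L2_pairing (u t) f))"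
		by (rule integral_restrict_space) simp
	then show "(LN x. f x * laplace_transform T u tau x) = (LINT t|lebesgue_on ?J. ?e t * L2_pairing (u t) f)"
		using cx(2) ct(2) fub by simp
qed

text \<open>The element \<open>w\<close> of the approximation lemma is compared with
  \<open>u\<close> under three functionals: the pairing with \<open>f\<close>, the pairing with
  \<open>phi\<close> and the energy form against \<open>phi\<close>. The last two carry the wave
  identity over to \<open>w\<close>.\<close>

lemma wave_approximation:
	assumes T: "T > 0" and wave: "wave_solution \<gamma> f T u" and el: "elliptic \<gamma> c K" and f: "f : L2"
	shows "\<exists>A\<ge>0. \<forall>tau\<ge>1. LI (%x. f x * laplace_transform T u tau x) \<and>
		(\<exists>w\<in>H1. \<bar>(LN x. f x * laplace_transform T u tau x) - (LN x. f x * w x)\<bar> <= exp (- tau * T) / tau \<and>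
			(\<forall>phi\<in>H1. \<bar>energy_form \<gamma> w phi + tau^2 * (LN x. w x * phi x) - (LN x. f x * phi x)\<bar> <= A * exp (- tau * T) * tau_norm tau phi))"
proof -
	let ?J = "lebesgue_on {0<..<T}"
	have J: "{0<..<T} : sets lebesgue" "emeasure lebesgue {0<..<T} < \<infinity>" using T by auto
	have u: "bochner_L2 {0<..<T} H1 H1_norm u" and jm: "(%(t, x). u t x) : borel_measurable (lebesgue_on ({0<..<T} \<times> UNIV))"
		using wave by (auto simp: wave_solution_def)
	note uint = bochner_L2_norm_integrable[OF J u]
	have sm: "strongly_measurable {0<..<T} H1 H1_norm u" using u by (simp add: bochner_L2_def)
	have K: "K >= 0" using el by (simp add: elliptic_def)
	obtain A where A: "A >= 0" "!!tau phi. tau >= 1 ==> phi : H1 ==> \<bar>(LINT t|?J. exp (- tau * t) * energy_form \<gamma> (u t) phi)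
			+ tau^2 * (LINT t|?J. exp (- tau * t) * L2_pairing (u t) phi) - L2_pairing f phi\<bar> <= A * exp (- tau * T) * tau_norm tau phi"
		using wave_identity[OF T wave el f] by blast
	show ?thesis
	proof (intro exI[of _ "A + K + 1"] conjI allI impI)
		show "0 <= A + K + 1" using A(1) K by simp
		fix tau :: real assume tau: "tau >= 1"
		then have tau0: "tau >= 0" "tau > 0" by auto
		note lp = laplace_pairing[OF jm sm uint f tau0(1)]
		show "LI (%x. f x * laplace_transform T u tau x)" by (rule lp(1))
		define q where "q = exp (- tau * T)"
		have q: "q > 0" by (simp add: q_def)
		\<comment> \<open>The bound \<open>tau * eps <= q\<close> serves the term with
		  \<open>tau^2\<close>, since \<open>tau^2 * (L2_norm phi * eps)\<close> is
		  \<open>tau * eps\<close> times \<open>tau * L2_norm phi\<close>. The divisor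
		  \<open>L2_norm f + 1\<close> makes the pairing with \<open>f\<close> accurate to
		  \<open>q / tau\<close>.\<close>
		define eps where "eps = q / tau / (L2_norm f + 1)"
		have nf: "L2_norm f + 1 >= 1" "L2_norm f + 1 > 0" using L2_norm_nonneg[of f] by linarith+
		have eps: "eps > 0" using q tau0 nf by (simp add: eps_def)
		have epsf: "L2_norm f * eps <= q / tau"
		proof -
			have "eps * (L2_norm f + 1) = q / tau" using nf(2) by (simp add: eps_def)
			then show ?thesis using eps by (simp add: algebra_simps)
		qed
		have epstau: "eps <= q / tau" unfolding eps_def using divide_left_mono[OF nf(1), of "q / tau"] q tau0 nf by simp
		have epsq: "eps <= q" "tau * eps <= q"
		proof -
			show "tau * eps <= q" using mult_left_mono[OF epstau tau0(1)] tau0 by simp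
			moreover have "1 * eps <= tau * eps" using tau eps by (intro mult_right_mono) auto
			ultimately show "eps <= q" by simp
		qed
		have em: "(%t. exp (- tau * t)) : LM"
			by (intro continuous_imp_lebesgue_measurable continuous_intros)
		have e1: "0 <= exp (- tau * t) & exp (- tau * t) <= 1" if "t : {0<..<T}" for t
			using that tau0 mult_nonneg_nonneg[of tau t] by simp
		obtain w where w: "w : H1" and wL: "!!Lam K. Lam : H1_dual ==> K >= 0 ==> (!!phi. phi : H1 ==> \<bar>Lam phi\<bar> <= K * H1_norm phi) ==>
				\<bar>Lam w - (LINT t|?J. exp (- tau * t) * Lam (u t))\<bar> <= K * eps"
			using bochner_integral_approximation[OF J sm uint em e1 eps] by blast
		show "\<exists>w\<in>H1. \<bar>(LN x. f x * laplace_transform T u tau x) - (LN x. f x * w x)\<bar> <= exp (- tau * T) / tau \<and>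
			(\<forall>phi\<in>H1. \<bar>energy_form \<gamma> w phi + tau^2 * (LN x. w x * phi x) - (LN x. f x * phi x)\<bar> <= (A + K + 1) * exp (- tau * T) * tau_norm tau phi)"
		proof (intro bexI[OF _ w] conjI ballI)
			have "\<bar>L2_pairing w f - (LINT t|?J. exp (- tau * t) * L2_pairing (u t) f)\<bar> <= L2_norm f * eps"
				by (rule wL[OF L2_pairing_H1_dual(1)[OF f] L2_norm_nonneg L2_pairing_H1_dual(2)[OF f]])
			moreover have "L2_pairing w f = (LN x. f x * w x)" by (simp add: L2_pairing_def mult.commute)
			ultimately show "\<bar>(LN x. f x * laplace_transform T u tau x) - (LN x. f x * w x)\<bar> <= exp (- tau * T) / tau"
				unfolding lp(2) q_def[symmetric] using epsf by linarith
			fix phi :: "real^3 => real" assume phi: "phi : H1"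
			note phiL = H1_D(1)[OF phi]
			let ?E = "LINT t|?J. exp (- tau * t) * energy_form \<gamma> (u t) phi" and ?P = "LINT t|?J. exp (- tau * t) * L2_pairing (u t) phi"
			have tn: "0 <= tau_norm tau phi" using tau_norm_bounds(2)[OF tau, of phi] L2_norm_nonneg[of "grad phi"] by linarith
			have K0: "0 <= K * L2_norm (grad phi)" using K by simp
			have "\<bar>energy_form \<gamma> w phi - ?E\<bar> <= K * L2_norm (grad phi) * eps"
				by (rule wL[OF energy_form_H1_dual(1)[OF el phi] K0 energy_form_H1_dual(2)[OF el phi]])
			moreover have "K * L2_norm (grad phi) * eps <= K * tau_norm tau phi * q"
				using K tn eps epsq(1) by (intro mult_mono tau_norm_bounds tau order_refl) auto
			ultimately have b1: "\<bar>energy_form \<gamma> w phi - ?E\<bar> <= K * q * tau_norm tau phi" by (simp add: mult_ac)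
			have "\<bar>L2_pairing w phi - ?P\<bar> <= L2_norm phi * eps"
				by (rule wL[OF L2_pairing_H1_dual(1)[OF phiL] L2_norm_nonneg L2_pairing_H1_dual(2)[OF phiL]])
			then have "tau^2 * \<bar>L2_pairing w phi - ?P\<bar> <= tau^2 * (L2_norm phi * eps)" by (rule mult_left_mono) simp
			moreover have "tau^2 * (L2_norm phi * eps) = (tau * eps) * (tau * L2_norm phi)" by (simp add: power2_eq_square mult_ac)
			moreover have "... <= q * tau_norm tau phi" using epsq(2) q tau0 by (intro mult_mono tau_norm_bounds tau) auto
			ultimately have b2: "\<bar>tau^2 * L2_pairing w phi - tau^2 * ?P\<bar> <= q * tau_norm tau phi"
				by (simp add: abs_mult right_diff_distrib[symmetric])
			have b3: "\<bar>?E + tau^2 * ?P - L2_pairing f phi\<bar> <= A * q * tau_norm tau phi" unfolding q_def by (rule A(2)[OF tau phi])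
			have "\<bar>energy_form \<gamma> w phi + tau^2 * L2_pairing w phi - L2_pairing f phi\<bar> <= A * q * tau_norm tau phi + K * q * tau_norm tau phi + q * tau_norm tau phi"
				using b1 b2 b3 by linarith
			then show "\<bar>energy_form \<gamma> w phi + tau^2 * (LN x. w x * phi x) - (LN x. f x * phi x)\<bar> <= (A + K + 1) * exp (- tau * T) * tau_norm tau phi"
				unfolding q_def[symmetric] by (simp add: L2_pairing_def distrib_right)
		qed
	qed
qed

subsection \<open>Asymptotics of the indicator function\<close>

lemma background_solution_minus:
	assumes pos: "gp > 0" "gm > 0" and v: "background_solution (gamma0 gp gm) f tau v"
	shows "background_solution (gamma0 gp gm) (%x. - f x) tau (%x. - v x)"
proof -
	have vH: "v : H1" and eq: "!!phi. phi : H1 ==> - energy_form (gamma0 gp gm) v phi - tau^2 * (LN x. v x * phi x) + (LN x. f x * phi x) = 0"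
		using v by (auto simp: background_solution_def)
	have "energy_form (gamma0 gp gm) (%x. - v x) phi = - energy_form (gamma0 gp gm) v phi" if "phi : H1" for phi
		using energy_form_lincomb_left[OF gamma0_elliptic[OF pos] that vH vH, of "-1" 0] by simp
	moreover have "(%x. - v x) : H1" using H1_cmult[OF vH, of "-1"] by simp
	ultimately show ?thesis unfolding background_solution_def using eq by fastforce
qed

lemma grad_energy_minus:
	assumes v: "v : H1" and D: "D : sets lebesgue"
	shows "grad_energy_on D (%x. - v x) = grad_energy_on D v"
proof -
	have v': "(%x. - v x) : H1" using H1_cmult[OF v, of "-1"] by simp
	show ?thesis
		unfolding grad_energy_on_def
	proof (rule integral_cong_AE)
		show "(%x. indicator D x * (norm (grad (%x. - v x) x))^2) : LM"
			"(%x. indicator D x * (norm (grad v x))^2) : LM"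
			using integrable_grad_energy[OF v' D] integrable_grad_energy[OF v D] by auto
		show "AL x. indicator D x * (norm (grad (%x. - v x) x))^2 = indicator D x * (norm (grad v x))^2"
		proof -
			have "AL x. grad (%x. - v x) x = - grad v x" using grad_cmult[OF v, of "-1"] by simp
			then show ?thesis by eventually_elim simp
		qed
	qed
qed

lemma emission_nonneg:
	assumes B: "open B" "bounded B" "condition_C B" and supp: "ess_support f <= closure B"
		and c1: "c1 > 0" "AL x. x : B --> c1 <= f x"
	shows "AL x. 0 <= f x"
proof -
	have "frontier B : null_sets lebesgue"
		using condition_C_frontier_negligible[OF B] by (simp add: negligible_iff_null_sets)
	then have "AL x. x \<notin> frontier B" by (rule AE_not_in)
	with emission_outside[OF supp] c1(2) show ?thesis
	proof eventually_elim
		case (elim x)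
		have "x : B" if "x : closure B" using elim(3) that B(1) by (simp add: frontier_def interior_open)
		then show ?case using elim(1,2) c1(1) by (cases "x : closure B") auto
	qed
qed

text \<open>If it is \<open>- f\<close> that is bounded below on \<open>B\<close>, then
  \<open>- f\<close> and \<open>- v\<close> take the roles of \<open>f\<close> and \<open>v\<close>;
  the gradient energy does not notice the sign.\<close>

lemma background_energy_lower:
	assumes pos: "gp > 0" "gm > 0" and D: "D : sets lebesgue" "closure D <= R3_minus" "D ~= {}"
		and Dint: "!!x rho. x : closure D ==> rho > 0 ==> \<exists>q r. r > 0 & ball q r <= D & dist q x < rho"
		and B: "open B" "bounded B" "condition_C B" "closure B <= R3_plus" "B ~= {}"
		and f: "f : L2" "emission_condition B f"
		and sol: "!!tau. tau >= 1 ==> background_solution (gamma0 gp gm) f tau (v tau)" and eps: "eps > 0"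
	shows "eventually (%tau. exp (- 2 * tau * (optical_set_distance gp gm D B + eps)) <= grad_energy_on D (v tau)) at_top"
proof -
	obtain c1 where c1: "c1 > 0" and supp: "ess_support f <= closure B"
		and cs: "(AL x. x : B --> f x >= c1) \<or> (AL x. x : B --> - f x >= c1)"
		using f(2) unfolding emission_condition_def by blast
	have vH: "v tau : H1" if "tau >= 1" for tau using sol[OF that] by (simp add: background_solution_def)
	from cs show ?thesis
	proof
		assume ae: "AL x. x : B --> f x >= c1"
		interpret background gp gm f v
			by unfold_locales (use pos f(1) sol emission_nonneg[OF B(1-3) supp c1 ae] in auto)
		show ?thesis by (rule grad_energy_lower[OF D Dint B(1,4,5) supp c1 ae eps])
	next
		assume ae: "AL x. x : B --> - f x >= c1"
		have supp': "ess_support (%x. - f x) <= closure B" using supp by (simp add: ess_support_def)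
		interpret background gp gm "%x. - f x" "%tau x. - v tau x"
			by unfold_locales (use pos f(1) background_solution_minus[OF pos sol] emission_nonneg[OF B(1-3) supp' c1 ae] in auto)
		have "eventually (%tau. exp (- 2 * tau * (optical_set_distance gp gm D B + eps)) <= grad_energy_on D (%x. - v tau x)) at_top"
			by (rule grad_energy_lower[OF D Dint B(1,4,5) supp' c1 ae eps])
		then show ?thesis
			using eventually_ge_at_top[of 1]
		proof eventually_elim
			case (elim tau)
			show ?case using elim(1) grad_energy_minus[OF vH[OF elim(2)] D(1)] by simp
		qed
	qed
qed

section \<open>From the rate of the energy to the limits of the indicator function\<close>

lemma exp_neg_le:
	assumes "tau > 0" "d > (0::real)"
	shows "exp (- tau * d) <= 1 / (tau * d)"
proof -
	have p: "tau * d > 0" using assms by simp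
	have "tau * d <= exp (tau * d)" using exp_ge_add_one_self[of "tau * d"] by linarith
	then have "1 / exp (tau * d) <= 1 / (tau * d)" using p by (intro divide_left_mono) auto
	then show ?thesis by (simp add: exp_minus inverse_eq_divide)
qed

lemma exponential_decay:
	fixes X I :: "real => real"
	assumes upper: "!!eps. eps > 0 ==> \<exists>C\<ge>0. \<forall>tau\<ge>1. X tau <= C * exp (- 2 * tau * (l - eps))"
		and C1: "C1 >= 0" and bound: "!!tau. tau >= 1 ==> \<bar>I tau\<bar> <= C1 * (X tau + exp (- tau * T) / tau)"
		and T: "T < 2 * l"
	shows "((%tau. exp (tau * T) * I tau) ---> 0) at_top"
proof -
	\<comment> \<open>The gap \<open>2 * l - T\<close> is \<open>2 * d\<close>. Losing
	  \<open>d / 2\<close> in the rate of \<open>X\<close> costs \<open>d\<close> of it, so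
	  \<open>exp (- tau d)\<close> remains after multiplication by \<open>exp (tau T)\<close>.\<close>
	define d where "d = (2 * l - T) / 2"
	have d: "d > 0" using T by (simp add: d_def)
	obtain C where C: "C >= 0" "!!tau. tau >= 1 ==> X tau <= C * exp (- 2 * tau * (l - d / 2))" using upper[of "d / 2"] d by auto
	have "eventually (%tau. norm (exp (tau * T) * I tau) <= (C1 * (C / d + 1)) / tau) at_top"
		using eventually_ge_at_top[of 1]
	proof eventually_elim
		case (elim tau)
		then have tau: "tau > 0" by simp
		have "exp (tau * T) * X tau <= exp (tau * T) * (C * exp (- 2 * tau * (l - d / 2)))" by (rule mult_left_mono[OF C(2)[OF elim]]) simp
		also have "... = C * exp (- tau * d)"
		proof -
			have "exp (tau * T) * exp (- 2 * tau * (l - d / 2)) = exp (- tau * d)"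
				unfolding exp_add[symmetric] by (rule arg_cong[where f = exp]) (simp add: d_def field_simps)
			then show ?thesis by (simp add: mult.left_commute)
		qed
		also have "... <= C * (1 / (tau * d))" by (rule mult_left_mono[OF exp_neg_le[OF tau d] C(1)])
		finally have a: "exp (tau * T) * X tau <= C / d / tau" by (simp add: field_simps)
		have b: "exp (tau * T) * (exp (- tau * T) / tau) = 1 / tau" by (simp add: exp_minus)
		have "norm (exp (tau * T) * I tau) = exp (tau * T) * \<bar>I tau\<bar>" by (simp add: abs_mult)
		also have "... <= exp (tau * T) * (C1 * (X tau + exp (- tau * T) / tau))" by (rule mult_left_mono[OF bound[OF elim]]) simp
		also have "... = C1 * (exp (tau * T) * X tau + 1 / tau)" unfolding b[symmetric] by (simp add: algebra_simps)
		also have "... <= C1 * (C / d / tau + 1 / tau)" using a C1 by (intro mult_left_mono) auto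
		also have "... = (C1 * (C / d + 1)) / tau" by (simp add: add_divide_distrib distrib_left)
		finally show ?case .
	qed
	moreover have "((%tau. (C1 * (C / d + 1)) / tau) ---> 0) at_top"
		by (rule real_tendsto_divide_at_top[OF tendsto_const filterlim_ident])
	ultimately show ?thesis by (rule Lim_null_comparison)
qed

lemma exponential_growth:
	fixes X J :: "real => real"
	assumes lower: "!!eps. eps > 0 ==> eventually (%tau. exp (- 2 * tau * (l + eps)) <= X tau) at_top"
		and C1: "C1 >= 0" and c: "c > 0" and low: "!!tau. tau >= 1 ==> c * X tau - C1 * (exp (- tau * T) / tau) <= J tau"
		and T: "2 * l < T"
	shows "filterlim (%tau. exp (tau * T) * J tau) at_top at_top"
proof -
	\<comment> \<open>Now the gap works in the other direction: with the loss \<open>d / 2\<close> in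
	  the rate, \<open>exp (tau T) X\<close> still grows at least like \<open>exp (tau d)\<close>,
	  whereas the error term stays bounded.\<close>
	define d where "d = (T - 2 * l) / 2"
	have d: "d > 0" using T by (simp add: d_def)
	have d2: "d / 2 > 0" using d by simp
	have "filterlim (%tau. tau * (c * d) - C1) at_top at_top" by (rule filterlim_affine) (use c d in simp)
	moreover have "eventually (%tau. tau * (c * d) - C1 <= exp (tau * T) * J tau) at_top"
		using eventually_ge_at_top[of 1] lower[OF d2]
	proof eventually_elim
		case (elim tau)
		have "tau * d <= exp (tau * d)" using exp_ge_add_one_self[of "tau * d"] by linarith
		also have "... = exp (tau * T) * exp (- 2 * tau * (l + d / 2))"
			unfolding exp_add[symmetric] by (rule arg_cong[where f = exp]) (simp add: d_def field_simps)
		also have "... <= exp (tau * T) * X tau" using elim(2) by (rule mult_left_mono) simp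
		finally have "c * (tau * d) <= c * (exp (tau * T) * X tau)" using c by (intro mult_left_mono) auto
		moreover have "exp (tau * T) * (c * X tau - C1 * (exp (- tau * T) / tau)) <= exp (tau * T) * J tau"
			by (rule mult_left_mono[OF low[OF elim(1)]]) simp
		moreover have "exp (tau * T) * (c * X tau - C1 * (exp (- tau * T) / tau)) = c * (exp (tau * T) * X tau) - C1 / tau"
			by (simp add: algebra_simps exp_minus)
		moreover have "C1 / tau <= C1 / 1" using C1 elim(1) by (intro divide_left_mono) auto
		ultimately have "c * (tau * d) - C1 <= exp (tau * T) * J tau" by linarith
		then show ?case by (simp only: mult.left_commute[of tau c d])
	qed
	ultimately show ?thesis by (rule filterlim_at_top_mono)
qed

lemma abs_add_less_of_bounds:
	fixes a b F L P S :: real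
	assumes "a - (P + 2 * S) <= L" "L <= b - (P - 2 * S)" "\<bar>a\<bar> < F" "\<bar>b\<bar> < F" "S <= F"
	shows "\<bar>L + P\<bar> < 4 * F"
proof -
	have "- F < a" "b < F" "0 < F" using assms(3,4) by auto
	then have "L + P < 4 * F" "- (L + P) < 4 * F" using assms(1,2,5) by auto
	then show ?thesis by (simp only: abs_less_iff)
qed

lemma logarithmic_rate:
	fixes X J :: "real => real"
	assumes upper: "!!eps. eps > 0 ==> \<exists>C\<ge>0. \<forall>tau\<ge>1. X tau <= C * exp (- 2 * tau * (l - eps))"
		and lower: "!!eps. eps > 0 ==> eventually (%tau. exp (- 2 * tau * (l + eps)) <= X tau) at_top"
		and C1: "C1 >= 0" and bound: "!!tau. tau >= 1 ==> \<bar>J tau\<bar> <= C1 * (X tau + exp (- tau * T) / tau)"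
		and c: "c > 0" and low: "!!tau. tau >= 1 ==> c * X tau - C1 * (exp (- tau * T) / tau) <= J tau"
		and T: "2 * l < T"
	shows "((%tau. 1 / tau * ln \<bar>J tau\<bar>) ---> - 2 * l) at_top"
proof (rule tendstoI)
	fix e :: real assume e: "e > 0"
	define d where "d = (T - 2 * l) / 2"
	\<comment> \<open>The bound \<open>2 * dlt <= d\<close> keeps \<open>exp (- tau T)\<close> below
	  the lower bound of \<open>X\<close> by the factor \<open>exp (- tau d)\<close>, so the error
	  cannot spoil it. The bound \<open>e / 4\<close> leaves room for the logarithms of the constants
	  in the final tolerance.\<close>
	define dlt where "dlt = min (e / 4) (d / 2)"
	have d: "d > 0" using T by (simp add: d_def)
	have dlt: "dlt > 0" "dlt <= e / 4" "2 * dlt <= d" using d e by (auto simp: dlt_def min_def)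
	obtain C where C: "C >= 0" "!!tau. tau >= 1 ==> X tau <= C * exp (- 2 * tau * (l - dlt))" using upper[OF dlt(1)] by blast
	define k1 where "k1 = c / 2"
	define k2 where "k2 = C1 * (C + 1) + 1"
	have k1: "k1 > 0" using c by (simp add: k1_def)
	have k2: "k2 > 0" using C1 C(1) by (simp add: k2_def add_nonneg_pos)
	show "eventually (%tau. dist (1 / tau * ln \<bar>J tau\<bar>) (- 2 * l) < e) at_top"
		using eventually_ge_at_top[of 1] lower[OF dlt(1)] eventually_gt_at_top[of "4 * \<bar>ln k1\<bar> / e"]
			eventually_gt_at_top[of "4 * \<bar>ln k2\<bar> / e"] eventually_ge_at_top[of "C1 / (k1 * d)"]
	proof eventually_elim
		case (elim tau)
		then have tau: "tau > 0" by simp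
		define q Y Z where "q = exp (- tau * T)" and "Y = exp (- 2 * tau * (l + dlt))" and "Z = exp (- 2 * tau * (l - dlt))"
		have pos: "q > 0" "Y > 0" "Z > 0" by (simp_all add: q_def Y_def Z_def)
		have "q / tau <= q / 1" using elim(1) pos by (intro divide_left_mono) auto
		then have qtau: "q / tau <= q" by simp
		have taudlt: "tau * dlt <= tau * (e / 4)" "tau * (2 * dlt) <= tau * d" using dlt tau by (auto intro: mult_left_mono)
		have taud: "tau * d = tau * T / 2 - tau * l" by (simp add: d_def field_simps)
		have taud0: "tau * d > 0" using tau d by simp
		have "tau * dlt > 0" using tau dlt by simp
		have "C1 * q <= k1 * Y"
		proof -
			have "q <= Y * exp (- tau * d)"
				unfolding q_def Y_def exp_add[symmetric] exp_le_cancel_iff using taudlt(2) taud by (simp add: algebra_simps)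
			also have "... <= Y * (1 / (tau * d))" by (rule mult_left_mono[OF exp_neg_le[OF tau d]]) (use pos in simp)
			finally have "C1 * q <= C1 * (Y * (1 / (tau * d)))" by (rule mult_left_mono[OF _ C1])
			also have "... = Y * (C1 / (tau * d))" by simp
			also have "... <= Y * k1"
			proof (rule mult_left_mono)
				have "C1 <= tau * (k1 * d)" using elim(5) k1 d by (simp add: pos_divide_le_eq)
				then show "C1 / (tau * d) <= k1" using taud0 by (simp add: pos_divide_le_eq mult_ac)
			qed (use pos in simp)
			finally show ?thesis by (simp add: mult.commute)
		qed
		moreover have "C1 * (q / tau) <= C1 * q" by (rule mult_left_mono[OF qtau C1])
		moreover have "c * Y <= c * X tau" using elim(2) c by (simp add: Y_def)
		moreover have "c * X tau - C1 * (q / tau) <= J tau" using low[OF elim(1)] by (simp add: q_def)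
		moreover have "c * Y = k1 * Y + k1 * Y" by (simp add: k1_def)
		ultimately have JL: "k1 * Y <= J tau" by linarith
		have kY: "k1 * Y > 0" using k1 pos by simp
		then have J0: "J tau > 0" using JL by linarith
		have "ln (k1 * Y) <= ln \<bar>J tau\<bar>" using JL kY by simp
		moreover have "ln (k1 * Y) = ln k1 - 2 * tau * (l + dlt)" using k1 pos by (simp add: ln_mult Y_def)
		ultimately have L1: "ln k1 - 2 * tau * (l + dlt) <= ln \<bar>J tau\<bar>" by simp
		have "q <= Z" unfolding q_def Z_def exp_le_cancel_iff using taud taud0 \<open>tau * dlt > 0\<close> by (simp add: algebra_simps)
		then have "X tau + q / tau <= (C + 1) * Z" using C(2)[OF elim(1)] qtau by (simp add: Z_def distrib_right)
		then have "C1 * (X tau + q / tau) <= C1 * ((C + 1) * Z)" by (rule mult_left_mono[OF _ C1])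
		moreover have "\<bar>J tau\<bar> <= C1 * (X tau + q / tau)" using bound[OF elim(1)] by (simp add: q_def)
		ultimately have "\<bar>J tau\<bar> <= k2 * Z" using pos by (simp add: k2_def algebra_simps)
		then have "ln \<bar>J tau\<bar> <= ln (k2 * Z)" using J0 by (intro ln_mono) auto
		moreover have "ln (k2 * Z) = ln k2 - 2 * tau * (l - dlt)" using k2 pos by (simp add: ln_mult Z_def)
		ultimately have L2: "ln \<bar>J tau\<bar> <= ln k2 - 2 * tau * (l - dlt)" by simp
		have l1: "\<bar>ln k1\<bar> < tau * (e / 4)" using elim(3) e by (simp add: pos_divide_less_eq mult_ac)
		have l2: "\<bar>ln k2\<bar> < tau * (e / 4)" using elim(4) e by (simp add: pos_divide_less_eq mult_ac)
		have "2 * tau * (l + dlt) = 2 * tau * l + 2 * (tau * dlt)" "2 * tau * (l - dlt) = 2 * tau * l - 2 * (tau * dlt)"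
			by (simp_all add: algebra_simps)
		then have "\<bar>ln \<bar>J tau\<bar> + 2 * tau * l\<bar> < 4 * (tau * (e / 4))"
			using abs_add_less_of_bounds[OF _ _ l1 l2 taudlt(1)] L1 L2 by (simp only:)
		then have "\<bar>ln \<bar>J tau\<bar> + 2 * tau * l\<bar> < tau * e" by simp
		moreover have "1 / tau * ln \<bar>J tau\<bar> - (- 2 * l) = (ln \<bar>J tau\<bar> + 2 * tau * l) / tau" using tau by (simp add: field_simps)
		ultimately show ?case unfolding dist_real_def using tau by (simp add: pos_divide_less_eq mult.commute)
	qed
qed

text \<open>\<open>perturbation_estimates\<close> is applied with the residual bound
  \<open>A exp (- tau T)\<close>, and its conclusion is transferred from \<open>w\<close> to the
  Laplace transform itself. All error terms are brought to the single form
  \<open>exp (- tau T) / tau\<close>.\<close>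

lemma indicator_bounds:
	assumes pos: "gp > 0" "gm > 0" and adm: "admissible_medium gp gm D \<gamma>" and D: "D <= R3_minus" "D : sets lebesgue"
		and f: "f : L2" and T: "T > 0" and wave: "wave_solution \<gamma> f T u"
		and sol: "!!tau. tau >= 1 ==> background_solution (gamma0 gp gm) f tau (v tau)"
	shows "\<exists>C\<ge>0. (\<forall>tau\<ge>1. \<bar>indicator_function f T u v tau\<bar> <= C * (grad_energy_on D (v tau) + exp (- tau * T) / tau)) \<and>
		(M_plus gm D \<gamma> --> (\<exists>k>0. \<forall>tau\<ge>1. k * grad_energy_on D (v tau) - C * (exp (- tau * T) / tau) <= - indicator_function f T u v tau)) \<and>
		(M_minus gm D \<gamma> --> (\<exists>k>0. \<forall>tau\<ge>1. k * grad_energy_on D (v tau) - C * (exp (- tau * T) / tau) <= indicator_function f T u v tau))"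
proof -
	obtain c K where el: "elliptic \<gamma> c K" using admissible_elliptic[OF adm] by blast
	obtain A where A: "A >= 0" "!!tau. tau >= 1 ==> LI (%x. f x * laplace_transform T u tau x)"
		and w: "!!tau. tau >= 1 ==> \<exists>w\<in>H1. \<bar>(LN x. f x * laplace_transform T u tau x) - (LN x. f x * w x)\<bar> <= exp (- tau * T) / tau \<and>
			(\<forall>phi\<in>H1. \<bar>energy_form \<gamma> w phi + tau^2 * (LN x. w x * phi x) - (LN x. f x * phi x)\<bar> <= A * exp (- tau * T) * tau_norm tau phi)"
		using wave_approximation[OF T wave el f] by blast
	show ?thesis
	proof (rule perturbation_estimates[OF pos adm D el f], goal_cases)
		case (1 C)
		note C = 1(1) and est = 1(2)
		\<comment> \<open>The term \<open>A^2 / T\<close> comes from the square of the residual bound, as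
		  \<open>q = exp (- tau T)\<close> is at most \<open>1 / (tau T)\<close> and so \<open>q^2\<close>
		  is at most \<open>q / (tau T)\<close>. The final 1 pays for the difference between
		  \<open>w\<close> and the Laplace transform.\<close>
		define C1 where "C1 = C * (1 + A + A^2 / T) + 1"
		have C1: "C1 >= 0" "C <= C1"
		proof -
			have "0 <= C * (A + A^2 / T)" using C A(1) T by (intro mult_nonneg_nonneg add_nonneg_nonneg divide_nonneg_pos) auto
			then show "C <= C1" by (simp add: C1_def algebra_simps)
			then show "C1 >= 0" using C by linarith
		qed
		have main: "\<exists>S. \<bar>indicator_function f T u v tau - S\<bar> <= exp (- tau * T) / tau \<and>
				\<bar>S\<bar> <= C * grad_energy_on D (v tau) + (C1 - 1) * (exp (- tau * T) / tau) \<and>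
				(\<forall>d>0. (AL x. x : D --> mat_le (mat d) (\<gamma> x - mat gm)) \<longrightarrow>
					gm * d / (gm + d) * grad_energy_on D (v tau) - (C1 - 1) * (exp (- tau * T) / tau) <= - S) \<and>
				(\<forall>d. (AL x. x : D --> mat_le (mat d) (mat gm - \<gamma> x)) \<longrightarrow>
					d * grad_energy_on D (v tau) - (C1 - 1) * (exp (- tau * T) / tau) <= S)"
			if tau: "tau >= 1" for tau
		proof -
			have tau0: "tau > 0" using tau by simp
			define q where "q = exp (- tau * T)"
			have q: "q > 0" by (simp add: q_def)
			obtain w where wH: "w : H1" and w1: "\<bar>(LN x. f x * laplace_transform T u tau x) - (LN x. f x * w x)\<bar> <= q / tau"
				and w2: "\<forall>phi\<in>H1. \<bar>energy_form \<gamma> w phi + tau^2 * (LN x. w x * phi x) - (LN x. f x * phi x)\<bar> <= A * q * tau_norm tau phi"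
				using w[OF tau] unfolding q_def by blast
			have Aq: "0 <= A * q" using A(1) q by simp
			note E = est[OF tau sol[OF tau] wH Aq bspec[OF w2]]
			have vH: "v tau : H1" using sol[OF tau] by (simp add: background_solution_def)
			have iv: "LI (%x. f x * v tau x)" by (rule L2_mult_integrable[OF f H1_D(1)[OF vH]])
			have iw: "LI (%x. f x * w x)" by (rule L2_mult_integrable[OF f H1_D(1)[OF wH]])
			have "indicator_function f T u v tau = (LN x. f x * laplace_transform T u tau x) - (LN x. f x * v tau x)"
				unfolding indicator_function_def right_diff_distrib by (rule Bochner_Integration.integral_diff[OF A(2)[OF tau] iv])
			moreover have "(LN x. f x * (w x - v tau x)) = (LN x. f x * w x) - (LN x. f x * v tau x)"
				unfolding right_diff_distrib by (rule Bochner_Integration.integral_diff[OF iw iv])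
			ultimately have d1: "\<bar>indicator_function f T u v tau - (LN x. f x * (w x - v tau x))\<bar> <= q / tau" using w1 by linarith
			have err: "C * (A * q / tau + (A * q)^2) + C * (q / tau) <= (C1 - 1) * (q / tau)"
			proof -
				have "q <= 1 / (tau * T)" unfolding q_def by (rule exp_neg_le[OF tau0 T])
				then have "A^2 * q * q <= A^2 * q * (1 / (tau * T))" using q by (intro mult_left_mono) auto
				moreover have "(A * q)^2 = A^2 * q * q" by (simp add: power2_eq_square)
				moreover have "A^2 * q * (1 / (tau * T)) = A^2 / T * (q / tau)" by simp
				ultimately have "A * q / tau + (A * q)^2 + q / tau <= (1 + A + A^2 / T) * (q / tau)"
					unfolding distrib_right mult_1 times_divide_eq_right[of A q tau] by linarith
				then have "C * (A * q / tau + (A * q)^2 + q / tau) <= C * ((1 + A + A^2 / T) * (q / tau))" using C by (intro mult_left_mono) auto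
				then show ?thesis unfolding C1_def distrib_left[of C "_ + _" "q / tau"] by (simp only: mult.assoc add_diff_cancel_right')
			qed
			have cq: "0 <= C * (q / tau)" using C q tau0 by simp
			show ?thesis
				unfolding q_def[symmetric]
			proof (intro exI[of _ "LN x. f x * (w x - v tau x)"] conjI allI impI d1)
				have "\<bar>LN x. f x * (w x - v tau x)\<bar> <= C * (grad_energy_on D (v tau) + A * q / tau + (A * q)^2)" using E by blast
				moreover have "C * (grad_energy_on D (v tau) + A * q / tau + (A * q)^2) = C * grad_energy_on D (v tau) + C * (A * q / tau + (A * q)^2)"
					by (simp only: distrib_left add.assoc)
				ultimately show "\<bar>LN x. f x * (w x - v tau x)\<bar> <= C * grad_energy_on D (v tau) + (C1 - 1) * (q / tau)"
					using err cq by linarith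
			next
				fix d :: real assume "0 < d" "AL x. x : D --> mat_le (mat d) (\<gamma> x - mat gm)"
				then have "gm * d / (gm + d) * grad_energy_on D (v tau) - C * (A * q / tau + (A * q)^2) <= - (LN x. f x * (w x - v tau x))"
					using E by blast
				then show "gm * d / (gm + d) * grad_energy_on D (v tau) - (C1 - 1) * (q / tau) <= - (LN x. f x * (w x - v tau x))"
					using err cq by linarith
			next
				fix d :: real assume "AL x. x : D --> mat_le (mat d) (mat gm - \<gamma> x)"
				then have "d * grad_energy_on D (v tau) - C * (A * q / tau + (A * q)^2) <= (LN x. f x * (w x - v tau x))"
					using E by blast
				then show "d * grad_energy_on D (v tau) - (C1 - 1) * (q / tau) <= (LN x. f x * (w x - v tau x))"
					using err cq by linarith
			qed
		qed
		have split: "C1 * q = (C1 - 1) * q + q" for q by (simp add: algebra_simps)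
		show ?thesis
		proof (rule exI[of _ C1], intro conjI C1(1) allI impI)
			fix tau :: real assume tau: "tau >= 1"
			have "C * grad_energy_on D (v tau) <= C1 * grad_energy_on D (v tau)" by (rule mult_right_mono[OF C1(2) grad_energy_nonneg])
			moreover obtain S where "\<bar>indicator_function f T u v tau - S\<bar> <= exp (- tau * T) / tau"
				"\<bar>S\<bar> <= C * grad_energy_on D (v tau) + (C1 - 1) * (exp (- tau * T) / tau)" using main[OF tau] by blast
			ultimately show "\<bar>indicator_function f T u v tau\<bar> <= C1 * (grad_energy_on D (v tau) + exp (- tau * T) / tau)"
				unfolding distrib_left split[of "exp (- tau * T) / tau"] by linarith
		next
			assume "M_plus gm D \<gamma>"
			then obtain d where d: "d > 0" "AL x. x : D --> mat_le (mat d) (\<gamma> x - mat gm)" unfolding M_plus_def by blast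
			show "\<exists>k>0. \<forall>tau\<ge>1. k * grad_energy_on D (v tau) - C1 * (exp (- tau * T) / tau) <= - indicator_function f T u v tau"
			proof (intro exI[of _ "gm * d / (gm + d)"] conjI allI impI)
				show "0 < gm * d / (gm + d)" using d(1) pos by simp
				fix tau :: real assume tau: "tau >= 1"
				obtain S where "\<bar>indicator_function f T u v tau - S\<bar> <= exp (- tau * T) / tau"
					"gm * d / (gm + d) * grad_energy_on D (v tau) - (C1 - 1) * (exp (- tau * T) / tau) <= - S" using main[OF tau] d by blast
				then show "gm * d / (gm + d) * grad_energy_on D (v tau) - C1 * (exp (- tau * T) / tau) <= - indicator_function f T u v tau"
					unfolding split[of "exp (- tau * T) / tau"] by linarith
			qed
		next
			assume "M_minus gm D \<gamma>"
			then obtain d where d: "d > 0" "AL x. x : D --> mat_le (mat d) (mat gm - \<gamma> x)" unfolding M_minus_def by blast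
			show "\<exists>k>0. \<forall>tau\<ge>1. k * grad_energy_on D (v tau) - C1 * (exp (- tau * T) / tau) <= indicator_function f T u v tau"
			proof (intro exI[of _ d] conjI allI impI d(1))
				fix tau :: real assume tau: "tau >= 1"
				obtain S where "\<bar>indicator_function f T u v tau - S\<bar> <= exp (- tau * T) / tau"
					"d * grad_energy_on D (v tau) - (C1 - 1) * (exp (- tau * T) / tau) <= S" using main[OF tau] d by blast
				then show "d * grad_energy_on D (v tau) - C1 * (exp (- tau * T) / tau) <= indicator_function f T u v tau"
					unfolding split[of "exp (- tau * T) / tau"] by linarith
			qed
		qed
	qed
qed

theorem theorem3p1:
  fixes \<gamma>p \<gamma>m T :: real
    and D B :: "(real^3) set"
    and \<gamma> :: "real^3 \<Rightarrow> real^3^3"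
    and f :: "real^3 \<Rightarrow> real"
    and u v :: "real \<Rightarrow> real^3 \<Rightarrow> real"
  assumes "\<gamma>p > 0" and "\<gamma>m > 0" and "\<gamma>p \<noteq> \<gamma>m"
    and "D \<noteq> {}" and "bounded D" and "D \<in> sets lebesgue"
    and "closure D \<subseteq> R3_minus" and "connected (R3_minus - D)"
    and "admissible_medium \<gamma>p \<gamma>m D \<gamma>"
    and "M_plus \<gamma>m D \<gamma> \<or> M_minus \<gamma>m D \<gamma>"
    and "B \<noteq> {}" and "bounded B" and "open B" and "closure B \<subseteq> R3_plus"
    and "f \<in> L2" and "emission_condition B f"
    and "T > 0" and "wave_solution \<gamma> f T u"
    and "\<And>\<tau>. \<tau> \<ge> 1 \<Longrightarrow> background_solution (gamma0 \<gamma>p \<gamma>m) f \<tau> (v \<tau>)"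
    and "(C1_boundary D \<and> condition_C B) \<or> (condition_C D \<and> condition_C B \<and> convex B)"
  defines "I \<equiv> indicator_function f T u v"
    and "l \<equiv> optical_set_distance \<gamma>p \<gamma>m D B"
  shows "(T < 2 * l \<longrightarrow> ((\<lambda>\<tau>. exp (\<tau> * T) * I \<tau>) \<longlongrightarrow> 0) at_top) \<and>
    (T > 2 * l \<longrightarrow>
       (M_plus \<gamma>m D \<gamma> \<longrightarrow> filterlim (\<lambda>\<tau>. exp (\<tau> * T) * I \<tau>) at_bot at_top) \<and>
       (M_minus \<gamma>m D \<gamma> \<longrightarrow> filterlim (\<lambda>\<tau>. exp (\<tau> * T) * I \<tau>) at_top at_top)) \<and>
    (T > 2 * l \<longrightarrow> ((\<lambda>\<tau>. 1 / \<tau> * ln \<bar>I \<tau>\<bar>) \<longlongrightarrow> - 2 * l) at_top)"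
proof -
	note pos = assms(1,2)
	have Dint: "\<exists>q r. r > 0 & ball q r <= D & dist q x < \<rho>" if "x : closure D" "\<rho> > 0" for x \<rho>
		using assms(20) C1_boundary_interior[OF _ that] condition_C_interior[OF _ that] by blast
	have cB: "condition_C B" using assms(20) by blast
	have supp: "ess_support f <= closure B" using assms(16) by (simp add: emission_condition_def)
	define X where "X \<tau> = grad_energy_on D (v \<tau>)" for \<tau>
	have upper: "\<exists>C\<ge>0. \<forall>\<tau>\<ge>1. X \<tau> <= C * exp (- 2 * \<tau> * (l - \<epsilon>))" if "\<epsilon> > 0" for \<epsilon>
	proof (rule grad_energy_upper[OF pos assms(6,7,4,5,12,14,11,15) supp that], goal_cases)
		case (1 C)
		then show ?thesis using assms(19) unfolding X_def l_def by blast
	qed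
	have lower: "eventually (%\<tau>. exp (- 2 * \<tau> * (l + \<epsilon>)) <= X \<tau>) at_top" if "\<epsilon> > 0" for \<epsilon>
		unfolding X_def l_def
		by (rule background_energy_lower[OF pos assms(6,7,4) Dint assms(13,12) cB assms(14,11,15,16) assms(19) that])
	have Dm: "D <= R3_minus" using assms(7) closure_subset by blast
	obtain C where C: "C >= 0" and bound: "!!\<tau>. \<tau> >= 1 ==> \<bar>I \<tau>\<bar> <= C * (X \<tau> + exp (- \<tau> * T) / \<tau>)"
		and plus: "M_plus \<gamma>m D \<gamma> ==> \<exists>k>0. \<forall>\<tau>\<ge>1. k * X \<tau> - C * (exp (- \<tau> * T) / \<tau>) <= - I \<tau>"
		and minus: "M_minus \<gamma>m D \<gamma> ==> \<exists>k>0. \<forall>\<tau>\<ge>1. k * X \<tau> - C * (exp (- \<tau> * T) / \<tau>) <= I \<tau>"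
		using indicator_bounds[OF pos assms(9) Dm assms(6,15,17,18,19)] unfolding I_def X_def by blast
	have bound': "\<bar>- I \<tau>\<bar> <= C * (X \<tau> + exp (- \<tau> * T) / \<tau>)" if "\<tau> >= 1" for \<tau> using bound[OF that] by simp
	show ?thesis
	proof (intro conjI impI)
		assume T: "T < 2 * l"
		show "((%\<tau>. exp (\<tau> * T) * I \<tau>) ---> 0) at_top" by (rule exponential_decay[OF upper C bound T])
	next
		assume T: "T > 2 * l" and "M_plus \<gamma>m D \<gamma>"
		then obtain k where k: "k > 0" "!!\<tau>. \<tau> >= 1 ==> k * X \<tau> - C * (exp (- \<tau> * T) / \<tau>) <= - I \<tau>" using plus by blast
		have "filterlim (%\<tau>. exp (\<tau> * T) * - I \<tau>) at_top at_top" by (rule exponential_growth[OF lower C k T])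
		then show "filterlim (%\<tau>. exp (\<tau> * T) * I \<tau>) at_bot at_top" by (simp add: filterlim_uminus_at_bot)
	next
		assume T: "T > 2 * l" and "M_minus \<gamma>m D \<gamma>"
		then obtain k where k: "k > 0" "!!\<tau>. \<tau> >= 1 ==> k * X \<tau> - C * (exp (- \<tau> * T) / \<tau>) <= I \<tau>" using minus by blast
		show "filterlim (%\<tau>. exp (\<tau> * T) * I \<tau>) at_top at_top" by (rule exponential_growth[OF lower C k T])
	next
		assume T: "T > 2 * l"
		from assms(10) show "((%\<tau>. 1 / \<tau> * ln \<bar>I \<tau>\<bar>) ---> - 2 * l) at_top"
		proof
			assume "M_plus \<gamma>m D \<gamma>"
			then obtain k where k: "k > 0" "!!\<tau>. \<tau> >= 1 ==> k * X \<tau> - C * (exp (- \<tau> * T) / \<tau>) <= - I \<tau>" using plus by blast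
			show ?thesis using logarithmic_rate[OF upper lower C bound' k T] by simp
		next
			assume "M_minus \<gamma>m D \<gamma>"
			then obtain k where k: "k > 0" "!!\<tau>. \<tau> >= 1 ==> k * X \<tau> - C * (exp (- \<tau> * T) / \<tau>) <= I \<tau>" using minus by blast
			show ?thesis by (rule logarithmic_rate[OF upper lower C bound k T])
		qed
	qed
qed

end
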